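(* Let $(R,\mathfrak{F},\Phi)$ be a bunched ring, let $X:=X(R,\mathfrak{F},\Phi)$ be the associated variety, let $\gamma_0\in\mathrm{rlv}(\Phi)$, and let $x\in X(\gamma_0)$ be a point of the corresponding stratum. (i) The point $x$ is factorial if and only if $Q$ maps $\mathrm{lin}(\gamma_0)\cap E$ onto $K$. (ii) The point $x$ is $\mathbb{Q}$-factorial if and only if $Q(\gamma_0)$ is of full dimension in $K_{\mathbb{Q}}$.
   Context: Conventions. $\mathbb{K}$ is an algebraically closed field of characteristic zero; a variety is an integral (separated, finite type) scheme over $\mathbb{K}$; points are closed points. A lattice is a finitely generated free abelian group $N$, and $N_{\mathbb{Q}}=N\otimes_{\mathbb{Z}}\mathbb{Q}$; lattice homomorphisms are extended to rational vector spaces under the same name. A cone is a convex polyhedral cone in $N_{\mathbb{Q}}$; $\sigma^\circ$ is its relative interior, $\mathrm{lin}(\sigma)$ its linear span, and $\sigma_0\preceq\sigma$ means that $\sigma_0$ is a face of $\sigma$ ($\sigma$ itself allowed). Bunched rings. Let $R$ be a finitely generated factorial $\mathbb{K}$-algebra with $R^*=\mathbb{K}^*$, faithfully graded by a lattice $K$ (i.e. the degrees $w$ with $R_w\neq 0$ generate $K$ as a lattice). Let $\mathfrak{F}=\{f_1,\dots,f_r\}\subset R$ be a system of homogeneous, pairwise nonassociated, nonzero prime elements generating $R$ as an algebra. Put $w_i:=\deg(f_i)$, $E:=\mathbb{Z}^r$ with canonical basis $e_1,\dots,e_r$, $\gamma:=\mathbb{Q}^r_{\ge 0}\subset E_{\mathbb{Q}}$,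 and let $Q\colon E\to K$ be the surjection with $Q(e_i)=w_i$. A face $\gamma_0\preceq\gamma$ is an $\mathfrak{F}$-face if $\prod_{e_i\in\gamma_0}f_i\notin\sqrt{\langle f_j;\ e_j\notin\gamma_0\rangle}$ (equivalently, there is $x\in\mathrm{Spec}(R)$ with $f_i(x)\ne0\Leftrightarrow e_i\in\gamma_0$). A projected $\mathfrak{F}$-face is the image $Q(\gamma_0)$ of an $\mathfrak{F}$-face. An $\mathfrak{F}$-bunch is a nonempty collection $\Phi$ of projected $\mathfrak{F}$-faces such that (1) a projected $\mathfrak{F}$-face $\tau$ belongs to $\Phi$ if and only if $\emptyset\neq\tau^\circ\cap\sigma^\circ\neq\sigma^\circ$ for every $\sigma\in\Phi$ with $\sigma\ne\tau$; (2) for each facet $\gamma_0\preceq\gamma$, the set $Q(\gamma_0\cap E)$ generates the lattice $K$, and there is $\tau\in\Phi$ with $Q(\gamma_0)^\circ\supset\tau^\circ$. A bunched ring is such a triple $(R,\mathfrak{F},\Phi)$. Associated variety. The set $\mathrm{rlv}(\Phi)$ of relevant faces consists of the $\mathfrak{F}$-faces $\gamma_0\preceq\gamma$ with $Q(\gamma_0)^\circ\supset\tau^\circ$ for some $\tau\in\Phi$; the covering collection $\mathrm{cov}(\Phi)$ is the set of (inclusion-)minimal elements of $\mathrm{rlv}(\Phi)$. Let $\overline{X}:=\mathrm{Spec}(R)$ with the action of the torus $T:=\mathrm{Spec}(\mathbb{K}[K])$ given by the grading. For $\gamma_0\preceq\gamma$ let $\overline{X}_{\gamma_0}:=\overline{X}_{f^u}$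 where $u\in\gamma_0^\circ\cap E$ and $f^u=f_1^{u_1}\cdots f_r^{u_r}$ (independent of $u$). Put $\widehat{X}:=\bigcup_{\gamma_0\in\mathrm{cov}(\Phi)}\overline{X}_{\gamma_0}$. There is a good quotient $p_X\colon\widehat{X}\to\widehat{X}/\!\!/T$ (affine, $T$-invariant, with $\mathcal{O}=(p_{X*}\mathcal{O}_{\widehat{X}})^T$), and $X(R,\mathfrak{F},\Phi):=\widehat{X}/\!\!/T$. Stratification. For $\gamma_0\in\mathrm{rlv}(\Phi)$ let $X_{\gamma_0}:=p_X(\overline{X}_{\gamma_0})$, an affine open subset of $X$ with $p_X^{-1}(X_{\gamma_0})=\overline{X}_{\gamma_0}$, and $X(\gamma_0):=X_{\gamma_0}\setminus\bigcup_{\gamma_0\prec\gamma_1\in\mathrm{rlv}(\Phi)}X_{\gamma_1}$. The variety $X$ is the disjoint union of the nonempty locally closed sets $X(\gamma_0)$, $\gamma_0\in\mathrm{rlv}(\Phi)$. Singularities. A point $x$ is factorial if its local ring is factorial. A point $y$ of a variety $Y$ is $\mathbb{Q}$-factorial if it is normal and, near $y$, every closed subset of codimension one is the set of zeroes of a regular function. *)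

theory Defs
  imports
    "HOL-Analysis.Abstract_Topology"
    "HOL-Algebra.QuotRing"
    "HOL-Algebra.Ring_Divisibility"
    "HOL-Computational_Algebra.Polynomial"
    "HOL-Library.Function_Algebras"
begin

section \<open>Algebra\<close>

text \<open>A subring of a type class ring as a HOL-Algebra record. Sets of functions into a field are
  covered as well, since function types carry the pointwise ring structure.\<close>

definition ring_on :: "'a::comm_ring_1 set \<Rightarrow> 'a ring" where
  "ring_on A = \<lparr>carrier = A, mult = (*), one = 1, zero = 0, add = (+)\<rparr>"

text \<open>A commutative algebra over the field \<open>'k\<close> is a ring \<open>'a\<close> together with its structure
  homomorphism \<open>\<iota>\<close>; \<open>alg_gen \<iota> G\<close> is the subalgebra generated by \<open>G\<close>.\<close>

definition structure_map :: "('k::field \<Rightarrow> 'a::comm_ring_1) \<Rightarrow> bool" where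
  "structure_map \<iota> \<longleftrightarrow>
     \<iota> 1 = 1 \<and> (\<forall>c d. \<iota> (c + d) = \<iota> c + \<iota> d) \<and> (\<forall>c d. \<iota> (c * d) = \<iota> c * \<iota> d)"

inductive_set alg_gen :: "('k::field \<Rightarrow> 'a::comm_ring_1) \<Rightarrow> 'a set \<Rightarrow> 'a set"
  for \<iota> :: "'k \<Rightarrow> 'a" and G :: "'a set" where
  const: "\<iota> c \<in> alg_gen \<iota> G"
| gen: "g \<in> G \<Longrightarrow> g \<in> alg_gen \<iota> G"
| add: "a \<in> alg_gen \<iota> G \<Longrightarrow> b \<in> alg_gen \<iota> G \<Longrightarrow> a + b \<in> alg_gen \<iota> G"
| mult: "a \<in> alg_gen \<iota> G \<Longrightarrow> b \<in> alg_gen \<iota> G \<Longrightarrow> a * b \<in> alg_gen \<iota> G"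

definition alg_homs :: "('k::field \<Rightarrow> 'a::comm_ring_1) \<Rightarrow> ('a \<Rightarrow> 'k) set" where
  "alg_homs \<iota> = {z. (\<forall>c. z (\<iota> c) = c) \<and> (\<forall>a b. z (a + b) = z a + z b) \<and> (\<forall>a b. z (a * b) = z a * z b)}"

definition radical :: "'a::comm_ring_1 set \<Rightarrow> 'a set" where
  "radical I = {a. \<exists>n. a ^ n \<in> I}"

text \<open>\<open>A\<close> is integrally closed in its field of fractions; the monic equation of degree \<open>n\<close> for
  a fraction \<open>a / b\<close> has been multiplied by \<open>b\<^sup>n\<close>.\<close>

definition integrally_closed :: "('a, 'b) ring_scheme \<Rightarrow> bool" where
  "integrally_closed A \<longleftrightarrow> domain A \<and>
     (\<forall>a\<in>carrier A. \<forall>b\<in>carrier A - {\<zero>\<^bsub>A\<^esub>}. \<forall>n::nat. \<forall>c\<in>{..<n} \<rightarrow> carrier A.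
        a [^]\<^bsub>A\<^esub> n \<oplus>\<^bsub>A\<^esub> (\<Oplus>\<^bsub>A\<^esub>i\<in>{..<n}. c i \<otimes>\<^bsub>A\<^esub> a [^]\<^bsub>A\<^esub> i \<otimes>\<^bsub>A\<^esub> b [^]\<^bsub>A\<^esub> (n - i)) = \<zero>\<^bsub>A\<^esub>
          \<longrightarrow> b divides\<^bsub>A\<^esub> a)"


section \<open>Varieties as spaces with functions\<close>

text \<open>Over an algebraically closed field, a variety is determined by its closed points, their
  Zariski topology, and the sheaf of regular functions, regarded as functions with values in the
  field. A regular function on \<open>U\<close> is a total function of which only the values on \<open>U\<close> matter.\<close>

record ('a, 'k) fspace =
  top_of :: "'a topology"
  reg :: "'a set \<Rightarrow> ('a \<Rightarrow> 'k) set"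

abbreviation points :: "('a, 'k, 'z) fspace_scheme \<Rightarrow> 'a set" where
  "points S \<equiv> topspace (top_of S)"

definition function_sheaf :: "('a, 'k::field) fspace \<Rightarrow> bool" where
  "function_sheaf S \<longleftrightarrow>
     (\<forall>U. openin (top_of S) U \<longrightarrow>
        (\<forall>c. (\<lambda>_. c) \<in> reg S U) \<and>
        (\<forall>f\<in>reg S U. \<forall>g\<in>reg S U. f + g \<in> reg S U \<and> f * g \<in> reg S U) \<and>
        (\<forall>f\<in>reg S U. \<forall>g. (\<forall>x\<in>U. g x = f x) \<longrightarrow> g \<in> reg S U) \<and>
        (\<forall>V f. openin (top_of S) V \<longrightarrow> V \<subseteq> U \<longrightarrow> f \<in> reg S U \<longrightarrow> f \<in> reg S V) \<and>
        (\<forall>f. (\<forall>x\<in>U. \<exists>V. openin (top_of S) V \<and> x \<in> V \<and> V \<subseteq> U \<and> f \<in> reg S V) \<longrightarrow> f \<in> reg S U))"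

definition open_subspace :: "('a, 'k) fspace \<Rightarrow> 'a set \<Rightarrow> ('a, 'k) fspace" where
  "open_subspace S U = \<lparr>top_of = subtopology (top_of S) U, reg = reg S\<rparr>"

definition fs_morphism :: "('a, 'k) fspace \<Rightarrow> ('b, 'k) fspace \<Rightarrow> ('a \<Rightarrow> 'b) \<Rightarrow> bool" where
  "fs_morphism S S' \<phi> \<longleftrightarrow> continuous_map (top_of S) (top_of S') \<phi> \<and>
     (\<forall>V h. openin (top_of S') V \<longrightarrow> h \<in> reg S' V \<longrightarrow> h \<circ> \<phi> \<in> reg S {x \<in> points S. \<phi> x \<in> V})"

definition fs_isomorphic :: "('a, 'k) fspace \<Rightarrow> ('b, 'k) fspace \<Rightarrow> bool" where
  "fs_isomorphic S S' \<longleftrightarrow> (\<exists>\<phi> \<psi>. fs_morphism S S' \<phi> \<and> fs_morphism S' S \<psi> \<and>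
     (\<forall>x\<in>points S. \<psi> (\<phi> x) = x) \<and> (\<forall>y\<in>points S'. \<phi> (\<psi> y) = y))"

text \<open>The Zariski topology defined by an algebra \<open>A\<close> of functions on a set \<open>Y\<close>; regular functions
  are locally quotients of elements of \<open>A\<close>.\<close>

definition zariski_open :: "'a set \<Rightarrow> ('a \<Rightarrow> 'k::field) set \<Rightarrow> 'a set \<Rightarrow> bool" where
  "zariski_open Y A U \<longleftrightarrow> (\<exists>F\<subseteq>A. U = {y \<in> Y. \<exists>f\<in>F. f y \<noteq> 0})"

definition zariski_space :: "'a set \<Rightarrow> ('a \<Rightarrow> 'k::field) set \<Rightarrow> ('a, 'k) fspace" where
  "zariski_space Y A =
     \<lparr>top_of = topology (zariski_open Y A),
      reg = (\<lambda>U. {h. \<forall>x\<in>U. \<exists>V a b. zariski_open Y A V \<and> x \<in> V \<and> V \<subseteq> U \<and> a \<in> A \<and> b \<in> A \<and>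
                     (\<forall>y\<in>V. b y \<noteq> 0 \<and> h y = a y / b y)})\<rparr>"

lemma istopology_zariski_open:
  assumes mult: "\<And>f g. f \<in> A \<Longrightarrow> g \<in> A \<Longrightarrow> \<exists>h\<in>A. \<forall>y\<in>Y. h y = f y * g y"
  shows "istopology (zariski_open Y A)"
  unfolding istopology_def
proof (intro conjI allI impI)
  fix U V assume "zariski_open Y A U" "zariski_open Y A V"
  then obtain F G where FA: "F \<subseteq> A" and U: "U = {y \<in> Y. \<exists>f\<in>F. f y \<noteq> 0}"
    and GA: "G \<subseteq> A" and V: "V = {y \<in> Y. \<exists>f\<in>G. f y \<noteq> 0}"
    unfolding zariski_open_def by blast
  define H where "H = {h \<in> A. \<exists>f\<in>F. \<exists>g\<in>G. \<forall>y\<in>Y. h y = f y * g y}"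
  have "U \<inter> V = {y \<in> Y. \<exists>h\<in>H. h y \<noteq> 0}"
  proof (intro equalityI subsetI)
    fix y assume "y \<in> U \<inter> V"
    then obtain f g where y: "y \<in> Y" "f \<in> F" "g \<in> G" "f y \<noteq> 0" "g y \<noteq> 0"
      unfolding U V by blast
    obtain h where h: "h \<in> A" "\<forall>y\<in>Y. h y = f y * g y"
      using mult[of f g] y FA GA by blast
    have "h \<in> H" unfolding H_def using h y by blast
    moreover have "h y \<noteq> 0" using h y by simp
    ultimately show "y \<in> {y \<in> Y. \<exists>h\<in>H. h y \<noteq> 0}" using y by blast
  next
    fix y assume "y \<in> {y \<in> Y. \<exists>h\<in>H. h y \<noteq> 0}"
    then obtain h f g where y: "y \<in> Y" "h y \<noteq> 0" "f \<in> F" "g \<in> G" "h y = f y * g y"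
      unfolding H_def by blast
    then have "f y \<noteq> 0" "g y \<noteq> 0" by auto
    with y show "y \<in> U \<inter> V" unfolding U V by blast
  qed
  moreover have "H \<subseteq> A" unfolding H_def by blast
  ultimately show "zariski_open Y A (U \<inter> V)" unfolding zariski_open_def by blast
next
  fix \<U> assume *: "\<forall>U\<in>\<U>. zariski_open Y A U"
  define H where "H = {f \<in> A. \<exists>U\<in>\<U>. {y \<in> Y. f y \<noteq> 0} \<subseteq> U}"
  have "\<Union>\<U> \<subseteq> {y \<in> Y. \<exists>h\<in>H. h y \<noteq> 0}"
  proof
    fix y assume "y \<in> \<Union>\<U>"
    then obtain U where U: "U \<in> \<U>" "y \<in> U" by blast
    with * obtain F where F: "F \<subseteq> A" "U = {y \<in> Y. \<exists>f\<in>F. f y \<noteq> 0}"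
      unfolding zariski_open_def by blast
    with U obtain f where f: "y \<in> Y" "f \<in> F" "f y \<noteq> 0" by blast
    have "{y \<in> Y. f y \<noteq> 0} \<subseteq> U" unfolding F(2) using f by blast
    with f F(1) U have "f \<in> H" unfolding H_def by blast
    with f show "y \<in> {y \<in> Y. \<exists>h\<in>H. h y \<noteq> 0}" by blast
  qed
  moreover have "{y \<in> Y. \<exists>h\<in>H. h y \<noteq> 0} \<subseteq> \<Union>\<U>" unfolding H_def by blast
  ultimately have "\<Union>\<U> = {y \<in> Y. \<exists>h\<in>H. h y \<noteq> 0}" by (rule equalityI)
  moreover have "H \<subseteq> A" unfolding H_def by blast
  ultimately show "zariski_open Y A (\<Union>\<U>)" unfolding zariski_open_def by blast
qed

text \<open>The points of affine \<open>n\<close>-space are the sequences vanishing from index \<open>n\<close> on.\<close>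

definition affine_space :: "nat \<Rightarrow> (nat \<Rightarrow> 'k::field) set" where
  "affine_space n = {a. \<forall>i\<ge>n. a i = 0}"

definition poly_funs :: "nat \<Rightarrow> ((nat \<Rightarrow> 'k::field) \<Rightarrow> 'k) set" where
  "poly_funs n = alg_gen (\<lambda>c _. c) ((\<lambda>i a. a i) ` {..<n})"

definition fs_affine :: "('a, 'k::field) fspace \<Rightarrow> bool" where
  "fs_affine S \<longleftrightarrow> (\<exists>n. \<exists>I\<subseteq>poly_funs n.
     fs_isomorphic S (zariski_space {a \<in> affine_space n. \<forall>f\<in>I. f a = 0} (poly_funs n)))"

text \<open>Irreducible subspaces of a topological space; not to be confused with irreducible ring
  elements.\<close>

definition irreducible_subspace :: "'a topology \<Rightarrow> 'a set \<Rightarrow> bool" where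
  "irreducible_subspace \<tau> Z \<longleftrightarrow> Z \<subseteq> topspace \<tau> \<and> Z \<noteq> {} \<and>
     (\<forall>A B. closedin \<tau> A \<longrightarrow> closedin \<tau> B \<longrightarrow> Z \<subseteq> A \<union> B \<longrightarrow> Z \<subseteq> A \<or> Z \<subseteq> B)"

text \<open>The diagonal is closed in the product variety: the basic open subsets of \<open>X \<times> X\<close> are the
  nonvanishing loci in \<open>U \<times> V\<close> of finite sums \<open>\<Sum> f(x) g(y)\<close> with \<open>f\<close>, \<open>g\<close> regular on \<open>U\<close>, \<open>V\<close>,
  and each pair of distinct points must lie in such a set that does not meet the diagonal.\<close>

definition separated :: "('a, 'k::field) fspace \<Rightarrow> bool" where
  "separated S \<longleftrightarrow> (\<forall>x\<in>points S. \<forall>y\<in>points S. x \<noteq> y \<longrightarrow>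
     (\<exists>U V F. openin (top_of S) U \<and> openin (top_of S) V \<and> x \<in> U \<and> y \<in> V \<and>
        finite F \<and> F \<subseteq> reg S U \<times> reg S V \<and>
        (\<Sum>(f, g)\<in>F. f x * g y) \<noteq> 0 \<and> (\<forall>z\<in>U \<inter> V. (\<Sum>(f, g)\<in>F. f z * g z) = 0)))"

definition variety :: "('a, 'k::field) fspace \<Rightarrow> bool" where
  "variety S \<longleftrightarrow> function_sheaf S \<and> irreducible_subspace (top_of S) (points S) \<and> separated S \<and>
     (\<exists>\<U>. finite \<U> \<and> \<Union>\<U> = points S \<and>
        (\<forall>U\<in>\<U>. openin (top_of S) U \<and> fs_affine (open_subspace S U)))"


section \<open>Factorial and Q-factorial points\<close>

definition regular_near :: "('a, 'k::field) fspace \<Rightarrow> 'a \<Rightarrow> ('a \<Rightarrow> 'k) set" where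
  "regular_near S x = {f. \<exists>U. openin (top_of S) U \<and> x \<in> U \<and> f \<in> reg S U}"

definition zero_near :: "('a, 'k::field) fspace \<Rightarrow> 'a \<Rightarrow> ('a \<Rightarrow> 'k) set" where
  "zero_near S x =
     {f \<in> regular_near S x. \<exists>U. openin (top_of S) U \<and> x \<in> U \<and> (\<forall>y\<in>U. f y = 0)}"

definition local_ring :: "('a, 'k::field) fspace \<Rightarrow> 'a \<Rightarrow> ('a \<Rightarrow> 'k) set ring" where
  "local_ring S x = ring_on (regular_near S x) Quot zero_near S x"

definition factorial_point :: "('a, 'k::field) fspace \<Rightarrow> 'a \<Rightarrow> bool" where
  "factorial_point S x \<longleftrightarrow> factorial_domain (local_ring S x)"

definition normal_point :: "('a, 'k::field) fspace \<Rightarrow> 'a \<Rightarrow> bool" where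
  "normal_point S x \<longleftrightarrow> integrally_closed (local_ring S x)"

definition irreducible_closed :: "('a, 'k) fspace \<Rightarrow> 'a set \<Rightarrow> bool" where
  "irreducible_closed S Z \<longleftrightarrow> closedin (top_of S) Z \<and> irreducible_subspace (top_of S) Z"

text \<open>All irreducible components have codimension one. The whole space is assumed to be
  irreducible.\<close>

definition codim_one :: "('a, 'k) fspace \<Rightarrow> 'a set \<Rightarrow> bool" where
  "codim_one S A \<longleftrightarrow> closedin (top_of S) A \<and>
     (\<forall>Z. irreducible_closed S Z \<and> Z \<subseteq> A \<and>
          (\<forall>Z'. irreducible_closed S Z' \<and> Z \<subseteq> Z' \<and> Z' \<subseteq> A \<longrightarrow> Z' = Z) \<longrightarrow>
        Z \<noteq> points S \<and> \<not> (\<exists>Z'. irreducible_closed S Z' \<and> Z \<subset> Z' \<and> Z' \<subset> points S))"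

definition qfactorial_point :: "('a, 'k::field) fspace \<Rightarrow> 'a \<Rightarrow> bool" where
  "qfactorial_point S x \<longleftrightarrow> normal_point S x \<and>
     (\<forall>A. codim_one S A \<longrightarrow>
        (\<exists>U. openin (top_of S) U \<and> x \<in> U \<and> (\<exists>g\<in>reg S U. A \<inter> U = {y \<in> U. g y = 0})))"


section \<open>Lattices and cones\<close>

text \<open>A lattice is given inside its rational vector space: \<open>L\<close> is the group of integral combinations
  of a finite basis of the space \<open>'v\<close> with scalar multiplication \<open>s\<close>, so that \<open>'v\<close> is \<open>L\<close>
  tensored with the rationals.\<close>

definition int_span :: "(rat \<Rightarrow> 'v \<Rightarrow> 'v) \<Rightarrow> 'v set \<Rightarrow> 'v::ab_group_add set" where
  "int_span s S = {\<Sum>x\<in>F. s (of_int (c x)) x | F c. finite F \<and> F \<subseteq> S}"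

definition lattice_in :: "(rat \<Rightarrow> 'v \<Rightarrow> 'v) \<Rightarrow> 'v::ab_group_add set \<Rightarrow> bool" where
  "lattice_in s L \<longleftrightarrow> vector_space s \<and>
     (\<exists>B. finite B \<and> \<not> module.dependent s B \<and> module.span s B = UNIV \<and> L = int_span s B)"

definition face :: "(rat \<Rightarrow> 'v \<Rightarrow> 'v) \<Rightarrow> 'v::ab_group_add set \<Rightarrow> 'v set \<Rightarrow> bool" where
  "face s \<tau> \<sigma> \<longleftrightarrow>
     (\<exists>u. Vector_Spaces.linear s (*) u \<and> (\<forall>x\<in>\<sigma>. 0 \<le> u x) \<and> \<tau> = {x \<in> \<sigma>. u x = 0})"

definition facet :: "(rat \<Rightarrow> 'v \<Rightarrow> 'v) \<Rightarrow> 'v::ab_group_add set \<Rightarrow> 'v set \<Rightarrow> bool" where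
  "facet s \<tau> \<sigma> \<longleftrightarrow> face s \<tau> \<sigma> \<and> vector_space.dim s \<tau> + 1 = vector_space.dim s \<sigma>"

text \<open>The interior of a convex cone in its linear span.\<close>

definition relint :: "(rat \<Rightarrow> 'v \<Rightarrow> 'v) \<Rightarrow> 'v::ab_group_add set \<Rightarrow> 'v set" where
  "relint s \<sigma> = {x \<in> \<sigma>. \<forall>v\<in>module.span s \<sigma>. \<exists>\<epsilon>>0. \<forall>t\<in>{0..\<epsilon>}. x + s t v \<in> \<sigma>}"


section \<open>Bunched rings\<close>

text \<open>The data of a bunched ring. The ring \<open>R\<close> is the type \<open>'r\<close>, with structure map \<open>emb\<close>; the
  grading lattice \<open>K\<close> is the subset \<open>lat\<close> of the rational vector space \<open>'v\<close>; \<open>hcomp w\<close> is the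
  homogeneous component of degree \<open>w\<close>, only used for \<open>w\<close> in \<open>lat\<close>; the generators are
  \<open>gen 0, \<dots>, gen (num - 1)\<close>.\<close>

record ('k, 'r, 'v) bunch_data =
  emb :: "'k \<Rightarrow> 'r"
  scl :: "rat \<Rightarrow> 'v \<Rightarrow> 'v"
  lat :: "'v set"
  hcomp :: "'v \<Rightarrow> 'r set"
  num :: nat
  gen :: "nat \<Rightarrow> 'r"
  bunch :: "'v set set"

definition graded_algebra :: "('k::field, 'r::idom, 'v::ab_group_add) bunch_data \<Rightarrow> bool" where
  "graded_algebra B \<longleftrightarrow> structure_map (emb B) \<and> lattice_in (scl B) (lat B) \<and>
     (\<forall>w\<in>lat B. 0 \<in> hcomp B w \<and>
        (\<forall>a\<in>hcomp B w. \<forall>b\<in>hcomp B w. a + b \<in> hcomp B w) \<and>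
        (\<forall>c. \<forall>a\<in>hcomp B w. emb B c * a \<in> hcomp B w)) \<and>
     (\<forall>a. \<exists>!c. finite {w. c w \<noteq> 0} \<and> {w. c w \<noteq> 0} \<subseteq> lat B \<and> (\<forall>w\<in>lat B. c w \<in> hcomp B w) \<and>
        a = (\<Sum>w | c w \<noteq> 0. c w)) \<and>
     1 \<in> hcomp B 0 \<and>
     (\<forall>v\<in>lat B. \<forall>w\<in>lat B. \<forall>a\<in>hcomp B v. \<forall>b\<in>hcomp B w. a * b \<in> hcomp B (v + w))"

definition faithfully_graded :: "('k::field, 'r::idom, 'v::ab_group_add) bunch_data \<Rightarrow> bool" where
  "faithfully_graded B \<longleftrightarrow>
     graded_algebra B \<and> int_span (scl B) {w \<in> lat B. hcomp B w \<noteq> {0}} = lat B"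

definition deg :: "('k, 'r, 'v) bunch_data \<Rightarrow> 'r \<Rightarrow> 'v" where
  "deg B a = (THE w. w \<in> lat B \<and> a \<in> hcomp B w)"

text \<open>The vector space \<open>E\<^sub>\<rat>\<close> and the lattice \<open>E\<close> are realized in the space of all sequences of
  rationals.\<close>

definition qscale :: "rat \<Rightarrow> (nat \<Rightarrow> rat) \<Rightarrow> nat \<Rightarrow> rat" where
  "qscale c v = (\<lambda>i. c * v i)"

definition basis_vec :: "nat \<Rightarrow> nat \<Rightarrow> rat" where
  "basis_vec i = (\<lambda>j. if j = i then 1 else 0)"

definition lat_E :: "('k, 'r, 'v) bunch_data \<Rightarrow> (nat \<Rightarrow> rat) set" where
  "lat_E B = {v. (\<forall>i. v i \<in> \<int>) \<and> (\<forall>i\<ge>num B. v i = 0)}"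

definition orthant :: "('k, 'r, 'v) bunch_data \<Rightarrow> (nat \<Rightarrow> rat) set" where
  "orthant B = {v. (\<forall>i. 0 \<le> v i) \<and> (\<forall>i\<ge>num B. v i = 0)}"

definition Qmap :: "('k, 'r, 'v::ab_group_add) bunch_data \<Rightarrow> (nat \<Rightarrow> rat) \<Rightarrow> 'v" where
  "Qmap B v = (\<Sum>i<num B. scl B (v i) (deg B (gen B i)))"

definition F_face :: "('k, 'r::idom, 'v) bunch_data \<Rightarrow> (nat \<Rightarrow> rat) set \<Rightarrow> bool" where
  "F_face B \<gamma>0 \<longleftrightarrow> face qscale \<gamma>0 (orthant B) \<and>
     (\<Prod>i | i < num B \<and> basis_vec i \<in> \<gamma>0. gen B i)
       \<notin> radical (Idl\<^bsub>ring_on UNIV\<^esub> {gen B j | j. j < num B \<and> basis_vec j \<notin> \<gamma>0})"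

definition projected_F_faces :: "('k, 'r::idom, 'v::ab_group_add) bunch_data \<Rightarrow> 'v set set" where
  "projected_F_faces B = {Qmap B ` \<gamma>0 | \<gamma>0. F_face B \<gamma>0}"

definition F_bunch :: "('k, 'r::idom, 'v::ab_group_add) bunch_data \<Rightarrow> bool" where
  "F_bunch B \<longleftrightarrow> bunch B \<noteq> {} \<and> bunch B \<subseteq> projected_F_faces B \<and>
     (\<forall>\<tau>\<in>projected_F_faces B. \<tau> \<in> bunch B \<longleftrightarrow>
        (\<forall>\<sigma>\<in>bunch B. \<sigma> \<noteq> \<tau> \<longrightarrow>
           {} \<noteq> relint (scl B) \<tau> \<inter> relint (scl B) \<sigma> \<and>
           relint (scl B) \<tau> \<inter> relint (scl B) \<sigma> \<noteq> relint (scl B) \<sigma>)) \<and>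
     (\<forall>\<gamma>0. facet qscale \<gamma>0 (orthant B) \<longrightarrow>
        int_span (scl B) (Qmap B ` (\<gamma>0 \<inter> lat_E B)) = lat B \<and>
        (\<exists>\<tau>\<in>bunch B. relint (scl B) \<tau> \<subseteq> relint (scl B) (Qmap B ` \<gamma>0)))"

definition bunched_ring :: "('k::field, 'r::idom, 'v::ab_group_add) bunch_data \<Rightarrow> bool" where
  "bunched_ring B \<longleftrightarrow> faithfully_graded B \<and>
     (\<exists>G. finite G \<and> alg_gen (emb B) G = UNIV) \<and>
     factorial_domain (ring_on (UNIV :: 'r set)) \<and>
     {a. a dvd 1} = emb B ` (UNIV - {0}) \<and>
     (\<forall>i<num B. prime_elem (gen B i) \<and> (\<exists>w\<in>lat B. gen B i \<in> hcomp B w)) \<and>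
     (\<forall>i<num B. \<forall>j<num B. i \<noteq> j \<longrightarrow> \<not> (gen B i dvd gen B j \<and> gen B j dvd gen B i)) \<and>
     alg_gen (emb B) (gen B ` {..<num B}) = UNIV \<and>
     F_bunch B"

definition rlv :: "('k, 'r::idom, 'v::ab_group_add) bunch_data \<Rightarrow> (nat \<Rightarrow> rat) set set" where
  "rlv B = {\<gamma>0. F_face B \<gamma>0 \<and>
     (\<exists>\<tau>\<in>bunch B. relint (scl B) \<tau> \<subseteq> relint (scl B) (Qmap B ` \<gamma>0))}"

definition cov :: "('k, 'r::idom, 'v::ab_group_add) bunch_data \<Rightarrow> (nat \<Rightarrow> rat) set set" where
  "cov B = {\<gamma>0 \<in> rlv B. \<not> (\<exists>\<gamma>1\<in>rlv B. \<gamma>1 \<subset> \<gamma>0)}"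


section \<open>The associated variety\<close>

text \<open>The closed points of \<open>Spec R\<close> are the algebra homomorphisms from \<open>R\<close> to the ground field, and
  those of the torus \<open>Spec \<bbbK>[K]\<close> are the multiplicative characters of \<open>K\<close>. A character \<open>\<chi>\<close> acts
  by multiplying the values of homogeneous elements of degree \<open>w\<close> by \<open>\<chi> w\<close>.\<close>

definition Xbar :: "('k::field, 'r::idom, 'v) bunch_data \<Rightarrow> ('r \<Rightarrow> 'k, 'k) fspace" where
  "Xbar B = zariski_space (alg_homs (emb B)) (range (\<lambda>a z. z a))"

definition torus :: "('k::field, 'r, 'v::ab_group_add) bunch_data \<Rightarrow> ('v \<Rightarrow> 'k) set" where
  "torus B = {\<chi>. \<chi> 0 = 1 \<and> (\<forall>v\<in>lat B. \<forall>w\<in>lat B. \<chi> (v + w) = \<chi> v * \<chi> w)}"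

definition torus_act ::
  "('k::field, 'r::idom, 'v) bunch_data \<Rightarrow> ('v \<Rightarrow> 'k) \<Rightarrow> ('r \<Rightarrow> 'k) \<Rightarrow> 'r \<Rightarrow> 'k" where
  "torus_act B \<chi> z =
     (THE z'. z' \<in> alg_homs (emb B) \<and> (\<forall>w\<in>lat B. \<forall>a\<in>hcomp B w. z' a = \<chi> w * z a))"

definition monomial :: "('k, 'r::idom, 'v) bunch_data \<Rightarrow> (nat \<Rightarrow> rat) \<Rightarrow> 'r" where
  "monomial B u = (\<Prod>i<num B. gen B i ^ nat \<lfloor>u i\<rfloor>)"

text \<open>The locus where \<open>monomial B u\<close> does not vanish, which is the same for all lattice points
  \<open>u\<close> in the relative interior of \<open>\<gamma>0\<close>.\<close>

definition Xbar_loc ::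
  "('k::field, 'r::idom, 'v) bunch_data \<Rightarrow> (nat \<Rightarrow> rat) set \<Rightarrow> ('r \<Rightarrow> 'k) set" where
  "Xbar_loc B \<gamma>0 = {z \<in> alg_homs (emb B). \<exists>u\<in>relint qscale \<gamma>0 \<inter> lat_E B. z (monomial B u) \<noteq> 0}"

definition Xhat_points :: "('k::field, 'r::idom, 'v::ab_group_add) bunch_data \<Rightarrow> ('r \<Rightarrow> 'k) set" where
  "Xhat_points B = (\<Union>\<gamma>0\<in>cov B. Xbar_loc B \<gamma>0)"

definition Xhat :: "('k::field, 'r::idom, 'v::ab_group_add) bunch_data \<Rightarrow> ('r \<Rightarrow> 'k, 'k) fspace" where
  "Xhat B = open_subspace (Xbar B) (Xhat_points B)"

definition affine_morphism :: "('a, 'k::field) fspace \<Rightarrow> ('b, 'k) fspace \<Rightarrow> ('a \<Rightarrow> 'b) \<Rightarrow> bool" where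
  "affine_morphism S S' \<phi> \<longleftrightarrow> fs_morphism S S' \<phi> \<and>
     (\<forall>U. openin (top_of S') U \<longrightarrow> fs_affine (open_subspace S' U) \<longrightarrow>
        fs_affine (open_subspace S {x \<in> points S. \<phi> x \<in> U}))"

text \<open>\<open>p\<close> is a good quotient of \<open>Xhat B\<close> by the torus. The last two conditions say that pulling back
  identifies the regular functions on \<open>U\<close> with the invariant regular functions on the preimage of
  \<open>U\<close>. Since a good quotient is unique up to isomorphism, such an \<open>X\<close> is the variety associated
  with the bunched ring.\<close>

definition good_quotient ::
  "('k::field, 'r::idom, 'v::ab_group_add) bunch_data \<Rightarrow> ('x, 'k) fspace \<Rightarrow> (('r \<Rightarrow> 'k) \<Rightarrow> 'x) \<Rightarrow> bool"
  where
  "good_quotient B X p \<longleftrightarrow> variety X \<and> affine_morphism (Xhat B) X p \<and>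
     (\<forall>\<chi>\<in>torus B. \<forall>z\<in>Xhat_points B. p (torus_act B \<chi> z) = p z) \<and>
     (\<forall>U. openin (top_of X) U \<longrightarrow>
        (let W = {z \<in> Xhat_points B. p z \<in> U} in
          (\<forall>g. g \<in> reg (Xhat B) W \<and> (\<forall>\<chi>\<in>torus B. \<forall>z\<in>W. g (torus_act B \<chi> z) = g z)
               \<longleftrightarrow> (\<exists>h\<in>reg X U. \<forall>z\<in>W. g z = h (p z))) \<and>
          (\<forall>h1\<in>reg X U. \<forall>h2\<in>reg X U.
               (\<forall>z\<in>W. h1 (p z) = h2 (p z)) \<longrightarrow> (\<forall>x\<in>U. h1 x = h2 x))))"

definition X_loc ::
  "('k::field, 'r::idom, 'v) bunch_data \<Rightarrow> (('r \<Rightarrow> 'k) \<Rightarrow> 'x) \<Rightarrow> (nat \<Rightarrow> rat) set \<Rightarrow> 'x set" where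
  "X_loc B p \<gamma>0 = p ` Xbar_loc B \<gamma>0"

definition stratum ::
  "('k::field, 'r::idom, 'v::ab_group_add) bunch_data \<Rightarrow> (('r \<Rightarrow> 'k) \<Rightarrow> 'x) \<Rightarrow>
     (nat \<Rightarrow> rat) set \<Rightarrow> 'x set" where
  "stratum B p \<gamma>0 = X_loc B p \<gamma>0 -
     (\<Union>\<gamma>1\<in>{\<gamma>1 \<in> rlv B. face qscale \<gamma>0 \<gamma>1 \<and> \<gamma>0 \<noteq> \<gamma>1}. X_loc B p \<gamma>1)"

end

theory Submission
  imports Defs "HOL-Computational_Algebra.Fraction_Field"
begin

text \<open>Let \<open>z\<close> be a point of the closed orbit over \<open>x\<close>, so that \<open>J = {i. z (f i) \<noteq> 0}\<close> is the index set
  of \<open>\<gamma>0\<close>. By the good quotient property the local ring at \<open>x\<close> consists of the fractions \<open>a / b\<close> of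
  homogeneous elements of equal degree with \<open>z b \<noteq> 0\<close>; since \<open>R\<close> is factorial, it is normal. A
  homogeneous element that does not vanish at \<open>z\<close> has its degree in \<open>Q (lin \<gamma>0 \<inter> E)\<close>, the group
  generated by the degrees of the \<open>f i\<close> with \<open>i \<in> J\<close>, and every element of this group is the degree
  of a Laurent monomial in these \<open>f i\<close>, a unit at \<open>z\<close>. If a multiple of the degree of a homogeneous
  prime \<open>q\<close> lies in this group, then correcting a power of \<open>q\<close> by such a unit yields an equation for the
  divisor of \<open>q\<close> near \<open>x\<close>; if the degree itself does, this equation is a prime element.
  Conversely, for \<open>i \<notin> J\<close> the zeros of \<open>f i\<close> form a prime divisor through \<open>x\<close>. As \<open>K\<close> is generated
  by the degrees of all \<open>f j\<close> with \<open>j \<noteq> i\<close>, for every degree there are fractions that are units along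
  this divisor, and therefore any local equation of it has the form \<open>f i ^ m * h / b\<close> with \<open>h\<close>, \<open>b\<close>
  not vanishing at \<open>z\<close>. Hence \<open>m\<close> times the degree of \<open>f i\<close> lies in the group, with \<open>m = 1\<close> if the
  equation is a prime element.\<close>

section \<open>The Nullstellensatz\<close>

text \<open>The definition of a good quotient speaks only of regular functions, so the geometry of
  \<open>p\<close> is recovered from them: fibres are nonempty by taking invariant parts, and the
  images of the loci of relevant faces are open and saturated because invariants separate the closed
  invariant sets involved. Both need the Nullstellensatz on affine charts; density arguments need it
  for R. Invariants are homogeneous fractions for two reasons: over a factorial ring a regular
  function on an open set is a single reduced fraction, and its denominator is homogeneous because
  the open set is invariant. The closed orbit is found combinatorially: \<open>z\<close> has the
  fewest nonvanishing generators in its fibre, and a one-parameter degeneration would leave fewer if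
  their index set were not relevant. In the converse direction \<open>h\<close> does not vanish at
  \<open>z\<close>, since a prime through \<open>z\<close> dividing it would divide the numerators
  of all fractions of one degree, which the facet condition excludes. That a prime equation
  generates the whole ideal of the divisor is a height one argument with such fractions.\<close>

definition coeffs_in :: "'a::comm_ring_1 set \<Rightarrow> 'a poly set" where
  "coeffs_in C = {F. \<forall>i. coeff F i \<in> C}"

text \<open>Subalgebras are sets inside one fixed ring type, so that the induction over generators
  can pass from \<open>C\<close> to C[g] without changing types.\<close>

locale subalgebra =
  fixes \<iota> :: "'k::field \<Rightarrow> 'a::comm_ring_1" and C :: "'a set"
  assumes str: "structure_map \<iota>"
    and const_mem [simp]: "\<And>c. \<iota> c \<in> C"
    and add_mem: "\<And>a b. a \<in> C \<Longrightarrow> b \<in> C \<Longrightarrow> a + b \<in> C"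
    and mult_mem: "\<And>a b. a \<in> C \<Longrightarrow> b \<in> C \<Longrightarrow> a * b \<in> C"
begin

lemma str1 [simp]: "\<iota> 1 = 1" and str_add: "\<iota> (c + d) = \<iota> c + \<iota> d"
  and str_mult: "\<iota> (c * d) = \<iota> c * \<iota> d"
  using str unfolding structure_map_def by auto

lemma str0 [simp]: "\<iota> 0 = 0"
  using str_add[of 0 0] by simp

lemma str_neg: "\<iota> (- c) = - \<iota> c"
  using str_add[of c "- c"] by (simp add: eq_neg_iff_add_eq_0 add.commute)

lemma zero_mem [simp]: "0 \<in> C" and one_mem [simp]: "1 \<in> C"
  using const_mem[of 0] const_mem[of 1] by auto

lemma neg_mem: "a \<in> C \<Longrightarrow> - a \<in> C"
  using mult_mem[OF const_mem[of "- 1"], of a] by (simp add: str_neg del: const_mem)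

lemma diff_mem: "a \<in> C \<Longrightarrow> b \<in> C \<Longrightarrow> a - b \<in> C"
  using add_mem[of a "- b"] neg_mem[of b] by simp

lemma sum_mem: "(\<And>i. i \<in> I \<Longrightarrow> f i \<in> C) \<Longrightarrow> sum f I \<in> C"
  by (induction I rule: infinite_finite_induct) (auto intro: add_mem)

lemma power_mem: "a \<in> C \<Longrightarrow> a ^ n \<in> C"
  by (induction n) (auto intro: mult_mem)

lemma coeffs_in_add: "F \<in> coeffs_in C \<Longrightarrow> G \<in> coeffs_in C \<Longrightarrow> F + G \<in> coeffs_in C"
  and coeffs_in_diff: "F \<in> coeffs_in C \<Longrightarrow> G \<in> coeffs_in C \<Longrightarrow> F - G \<in> coeffs_in C"
  and coeffs_in_smult: "c \<in> C \<Longrightarrow> F \<in> coeffs_in C \<Longrightarrow> smult c F \<in> coeffs_in C"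
  and coeffs_in_mult: "F \<in> coeffs_in C \<Longrightarrow> G \<in> coeffs_in C \<Longrightarrow> F * G \<in> coeffs_in C"
  and coeffs_in_monom: "c \<in> C \<Longrightarrow> monom c n \<in> coeffs_in C"
  and coeffs_in_0: "0 \<in> coeffs_in C"
  and coeffs_in_coeff: "F \<in> coeffs_in C \<Longrightarrow> coeff F i \<in> C"
  unfolding coeffs_in_def
  by (auto intro: add_mem diff_mem mult_mem sum_mem simp: coeff_mult)

text \<open>\<open>C\<close> is not a field, so each cancellation of a leading term costs one factor
  \<open>lead_coeff G\<close>. The degree bound on the quotient serves the minimality argument in
  \<open>extension_algebraic\<close>.\<close>

lemma pseudo_division:
  assumes "G \<in> coeffs_in C" "G \<noteq> 0" "H \<in> coeffs_in C"
  shows "\<exists>m Q r. Q \<in> coeffs_in C \<and> r \<in> coeffs_in C \<and> smult (lead_coeff G ^ m) H = G * Q + r \<and>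
    (r = 0 \<or> degree r < degree G) \<and> degree Q \<le> degree H - degree G"
  using assms(3)
\<comment> \<open>The measure separates the zero polynomial from the nonzero constants, all of which
  have degree 0.\<close>
proof (induction "if H = 0 then 0 else Suc (degree H)" arbitrary: H rule: less_induct)
  case less
  show ?case
  proof (cases "H = 0 \<or> degree H < degree G")
    case True
    then show ?thesis using less.prems coeffs_in_0
      by (intro exI[of _ 0] exI[of _ H]) auto
  next
    case False
    define c where "c = lead_coeff G"
    define M where "M = monom (lead_coeff H) (degree H - degree G)"
    define H' where "H' = smult c H - G * M"
    have cC: "c \<in> C" unfolding c_def using coeffs_in_coeff assms by blast
    have MC: "M \<in> coeffs_in C" unfolding M_def using coeffs_in_monom coeffs_in_coeff less.prems by blast
    have H'C: "H' \<in> coeffs_in C"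
      unfolding H'_def
    by (intro coeffs_in_diff coeffs_in_mult coeffs_in_smult cC MC less.prems assms(1))
    have dM: "degree M \<le> degree H - degree G" unfolding M_def by (rule degree_monom_le)
    have "degree (G * M) \<le> degree H"
      using degree_mult_le[of G M] dM False by linarith
    then have d1: "degree H' \<le> degree H"
      unfolding H'_def using degree_diff_le degree_smult_le by (meson order_trans)
    have "coeff (M * G) (degree H) = c * lead_coeff H"
      unfolding M_def using False by (simp add: coeff_monom_mult c_def)
    then have "coeff (G * M) (degree H) = c * lead_coeff H"
      by (subst mult.commute)
    then have c0: "coeff H' (degree H) = 0" unfolding H'_def by simp
    then have "H' = 0 \<or> degree H' < degree H"
      using d1 by (metis le_neq_implies_less leading_coeff_0_iff)
    then have "(if H' = 0 then 0 else Suc (degree H')) < (if H = 0 then 0 else Suc (degree H))"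
      using False by auto
    from less.hyps[OF this H'C] obtain m Q r where IH: "Q \<in> coeffs_in C" "r \<in> coeffs_in C"
      "smult (c ^ m) H' = G * Q + r" "r = 0 \<or> degree r < degree G" "degree Q \<le> degree H' - degree G"
      unfolding c_def by blast
    define Q' where "Q' = Q + smult (c ^ m) M"
    have "smult (c ^ m) (smult c H) = smult (c ^ m) H' + smult (c ^ m) (G * M)"
      unfolding H'_def by (simp add: smult_diff_right)
    then have "smult (c ^ Suc m) H = G * Q' + r"
      unfolding Q'_def IH(3) by (simp add: algebra_simps)
    moreover have "Q' \<in> coeffs_in C"
      unfolding Q'_def by (intro coeffs_in_add coeffs_in_smult IH(1) MC power_mem cC)
    moreover have "degree Q' \<le> degree H - degree G"
      unfolding Q'_def
    proof (rule degree_add_le)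
      show "degree Q \<le> degree H - degree G" using IH(5) d1 by linarith
      show "degree (smult (c ^ m) M) \<le> degree H - degree G"
        using dM degree_smult_le order_trans by blast
    qed
    ultimately show ?thesis using IH(2,4) unfolding c_def by blast
  qed
qed

definition hom_on :: "('a \<Rightarrow> 'k) \<Rightarrow> bool" where
  "hom_on \<phi> \<longleftrightarrow> (\<forall>c. \<phi> (\<iota> c) = c) \<and> (\<forall>a\<in>C. \<forall>b\<in>C. \<phi> (a + b) = \<phi> a + \<phi> b) \<and>
     (\<forall>a\<in>C. \<forall>b\<in>C. \<phi> (a * b) = \<phi> a * \<phi> b)"

text \<open>\<open>P\<close> may exceed \<open>C\<close>: only its trace on \<open>C\<close>
  matters, so one fixed \<open>P\<close> serves all intermediate subalgebras. The equivalence
  contains both primality and closure under multiplication by \<open>C\<close>.\<close>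

definition prime_on :: "'a set \<Rightarrow> bool" where
  "prime_on P \<longleftrightarrow> 0 \<in> P \<and> 1 \<notin> P \<and> (\<forall>a\<in>C \<inter> P. \<forall>b\<in>C \<inter> P. a + b \<in> P) \<and>
     (\<forall>a\<in>C. \<forall>b\<in>C. a * b \<in> P \<longleftrightarrow> a \<in> P \<or> b \<in> P)"

context
  fixes \<phi> assumes hom: "hom_on \<phi>"
begin

lemma hom_const [simp]: "\<phi> (\<iota> c) = c" and hom_add: "a \<in> C \<Longrightarrow> b \<in> C \<Longrightarrow> \<phi> (a + b) = \<phi> a + \<phi> b"
  and hom_mult: "a \<in> C \<Longrightarrow> b \<in> C \<Longrightarrow> \<phi> (a * b) = \<phi> a * \<phi> b"
  using hom unfolding hom_on_def by auto

lemma hom_0 [simp]: "\<phi> 0 = 0" and hom_1 [simp]: "\<phi> 1 = 1"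
  using hom_const[of 0] hom_const[of 1] by auto

lemma hom_sum: "(\<And>i. i \<in> I \<Longrightarrow> f i \<in> C) \<Longrightarrow> \<phi> (sum f I) = (\<Sum>i\<in>I. \<phi> (f i))"
  by (induction I rule: infinite_finite_induct) (auto simp: hom_add sum_mem)

lemma hom_power: "a \<in> C \<Longrightarrow> \<phi> (a ^ n) = \<phi> a ^ n"
  by (induction n) (auto simp: hom_mult power_mem)

lemma map_poly_hom_add:
  "F \<in> coeffs_in C \<Longrightarrow> G \<in> coeffs_in C \<Longrightarrow> map_poly \<phi> (F + G) = map_poly \<phi> F + map_poly \<phi> G"
  by (rule poly_eqI) (simp add: coeff_map_poly hom_add coeffs_in_coeff)

lemma map_poly_hom_mult:
  "F \<in> coeffs_in C \<Longrightarrow> G \<in> coeffs_in C \<Longrightarrow> map_poly \<phi> (F * G) = map_poly \<phi> F * map_poly \<phi> G"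
  by (rule poly_eqI)
    (simp add: coeff_map_poly coeff_mult hom_sum hom_mult coeffs_in_coeff mult_mem)

lemma map_poly_hom_smult:
  "c \<in> C \<Longrightarrow> F \<in> coeffs_in C \<Longrightarrow> map_poly \<phi> (smult c F) = smult (\<phi> c) (map_poly \<phi> F)"
  by (rule poly_eqI) (simp add: coeff_map_poly hom_mult coeffs_in_coeff)

end

context
  fixes P assumes pr: "prime_on P"
begin

lemma prime_mult_iff: "a \<in> C \<Longrightarrow> b \<in> C \<Longrightarrow> a * b \<in> P \<longleftrightarrow> a \<in> P \<or> b \<in> P"
  and prime_add: "a \<in> C \<Longrightarrow> b \<in> C \<Longrightarrow> a \<in> P \<Longrightarrow> b \<in> P \<Longrightarrow> a + b \<in> P"
  and prime_0 [simp]: "0 \<in> P" and prime_1 [simp]: "1 \<notin> P"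
  using pr unfolding prime_on_def by auto

lemma prime_neg: "a \<in> C \<Longrightarrow> a \<in> P \<Longrightarrow> - a \<in> P"
  using prime_mult_iff[of "- 1" a] by (simp add: neg_mem)

lemma prime_diff: "a \<in> C \<Longrightarrow> b \<in> C \<Longrightarrow> a \<in> P \<Longrightarrow> b \<in> P \<Longrightarrow> a - b \<in> P"
  using prime_add[of a "- b"] prime_neg[of b] neg_mem[of b] by simp

lemma prime_diff_iff: "a \<in> C \<Longrightarrow> b \<in> C \<Longrightarrow> a - b \<in> P \<Longrightarrow> a \<in> P \<longleftrightarrow> b \<in> P"
  using prime_add[of "a - b" b] prime_diff[of a "a - b"] diff_mem[of a b] by auto

lemma prime_sum: "(\<And>i. i \<in> I \<Longrightarrow> f i \<in> C \<and> f i \<in> P) \<Longrightarrow> sum f I \<in> P"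
  by (induction I rule: infinite_finite_induct) (auto intro: prime_add sum_mem)

lemma prime_power: "a \<in> C \<Longrightarrow> a ^ n \<in> P \<Longrightarrow> a \<in> P"
  by (induction n) (auto simp: prime_mult_iff power_mem)

end

lemma subalgebra_adjoin:
  "subalgebra \<iota> ((\<lambda>F. poly F g) ` coeffs_in C)"
proof
  fix c show "\<iota> c \<in> (\<lambda>F. poly F g) ` coeffs_in C"
    by (rule image_eqI[of _ _ "monom (\<iota> c) 0"]) (auto simp: poly_monom coeffs_in_monom)
next
  fix a b assume "a \<in> (\<lambda>F. poly F g) ` coeffs_in C" "b \<in> (\<lambda>F. poly F g) ` coeffs_in C"
  then obtain F G where FG: "F \<in> coeffs_in C" "G \<in> coeffs_in C" "a = poly F g" "b = poly G g"
    by auto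
  show "a + b \<in> (\<lambda>F. poly F g) ` coeffs_in C"
    by (rule image_eqI[of _ _ "F + G"]) (auto simp: FG coeffs_in_add)
  show "a * b \<in> (\<lambda>F. poly F g) ` coeffs_in C"
    by (rule image_eqI[of _ _ "F * G"]) (auto simp: FG coeffs_in_mult)
qed (rule str)

lemma adjoin_superset: "C \<subseteq> (\<lambda>F. poly F g) ` coeffs_in C"
proof
  fix c assume "c \<in> C"
  then show "c \<in> (\<lambda>F. poly F g) ` coeffs_in C"
    by (intro image_eqI[of _ _ "monom c 0"]) (auto simp: poly_monom coeffs_in_monom)
qed

lemma adjoin_gen: "g \<in> (\<lambda>F. poly F g) ` coeffs_in C"
  by (rule image_eqI[of _ _ "monom 1 1"]) (auto simp: poly_monom coeffs_in_monom)

end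

lemma subalgebra_alg_gen: "structure_map \<iota> \<Longrightarrow> subalgebra \<iota> (alg_gen \<iota> G)"
  by standard (auto intro: alg_gen.intros)

lemma alg_gen_least: "subalgebra \<iota> C \<Longrightarrow> G \<subseteq> C \<Longrightarrow> alg_gen \<iota> G \<subseteq> C"
proof
  fix x assume C: "subalgebra \<iota> C" "G \<subseteq> C" and "x \<in> alg_gen \<iota> G"
  from this(3) show "x \<in> C"
    by induction (use C in \<open>auto simp: subalgebra_def\<close>)
qed

text \<open>Reduces an induction over a finite generating set to the adjunction of a single
  element.\<close>

lemma alg_gen_insert:
  assumes "structure_map \<iota>"
  shows "alg_gen \<iota> (insert g G) = (\<lambda>F. poly F g) ` coeffs_in (alg_gen \<iota> G)" (is "?L = ?R")
proof
  interpret C: subalgebra \<iota> "alg_gen \<iota> G" by (rule subalgebra_alg_gen[OF assms])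
  have "insert g G \<subseteq> ?R"
    using C.adjoin_superset[of g] C.adjoin_gen[of g] alg_gen.gen[of _ G \<iota>] by blast
  then show "?L \<subseteq> ?R" by (rule alg_gen_least[OF C.subalgebra_adjoin])
  interpret L: subalgebra \<iota> ?L by (rule subalgebra_alg_gen[OF assms])
  have sub: "alg_gen \<iota> G \<subseteq> ?L"
    by (rule alg_gen_least[OF L.subalgebra_axioms]) (auto intro: alg_gen.gen)
  show "?R \<subseteq> ?L"
  proof safe
    fix F assume F: "F \<in> coeffs_in (alg_gen \<iota> G)"
    have "coeff F i \<in> ?L" for i using F sub unfolding coeffs_in_def by auto
    then show "poly F g \<in> ?L"
      unfolding poly_altdef by (intro L.sum_mem L.mult_mem L.power_mem) (auto intro: alg_gen.gen)
  qed
qed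

section \<open>Extending homomorphisms by one generator\<close>

lemma poly_drop_lead:
  fixes H :: "'a::comm_ring_1 poly"
  defines "H1 \<equiv> H - monom (lead_coeff H) (degree H)"
  shows "H1 = 0 \<or> degree H1 < degree H"
proof -
  have "degree H1 \<le> degree H"
    unfolding H1_def by (simp add: degree_diff_le degree_monom_le)
  moreover have "coeff H1 (degree H) = 0" unfolding H1_def by simp
  ultimately show ?thesis by (metis le_neq_implies_less leading_coeff_0_iff)
qed

locale adjoin = subalgebra \<iota> C for \<iota> :: "'k::{alg_closed_field, field_char_0} \<Rightarrow> 'a::comm_ring_1" and C +
  fixes g :: 'a and P :: "'a set"
  assumes prime': "subalgebra.prime_on ((\<lambda>F. poly F g) ` coeffs_in C) P"
begin

abbreviation "C' \<equiv> (\<lambda>F. poly F g) ` coeffs_in C"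

sublocale C': subalgebra \<iota> C' by (rule subalgebra_adjoin)

lemma C'I: "c \<in> C \<Longrightarrow> c \<in> C'" and poly_C': "F \<in> coeffs_in C \<Longrightarrow> poly F g \<in> C'"
  using adjoin_superset[of g] by auto

lemma prime_C: "prime_on P"
  unfolding prime_on_def
  using C'.prime_0[OF prime'] C'.prime_1[OF prime']
  by (auto intro!: C'.prime_add[OF prime'] C'I simp: C'.prime_mult_iff[OF prime' C'I C'I])

text \<open>Sending \<open>g\<close> to \<open>t\<close> is well defined because two representations
  of an element of C[g] differ by a polynomial with root \<open>g\<close>; as 0 lies in
  \<open>P\<close>, the assumption \<open>kill\<close> applies to the difference.\<close>

lemma hom_extend:
  assumes hom: "hom_on \<phi>"
    and kill: "\<And>H. H \<in> coeffs_in C \<Longrightarrow> poly H g \<in> P \<Longrightarrow> poly (map_poly \<phi> H) t = 0"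
  obtains \<phi>' where "C'.hom_on \<phi>'" "\<And>H. H \<in> coeffs_in C \<Longrightarrow> \<phi>' (poly H g) = poly (map_poly \<phi> H) t"
proof -
  define \<phi>' where "\<phi>' x = poly (map_poly \<phi> (SOME H. H \<in> coeffs_in C \<and> x = poly H g)) t" for x
  have eq: "\<phi>' (poly H g) = poly (map_poly \<phi> H) t" if H: "H \<in> coeffs_in C" for H
  proof -
    define K where "K = (SOME K. K \<in> coeffs_in C \<and> poly H g = poly K g)"
    have K: "K \<in> coeffs_in C" "poly H g = poly K g"
      using someI[of "\<lambda>K. K \<in> coeffs_in C \<and> poly H g = poly K g" H] H unfolding K_def by auto
    have D: "H - K \<in> coeffs_in C" using H K coeffs_in_diff by auto
    have "poly (map_poly \<phi> (H - K)) t = 0"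
      using K D prime_0[OF prime_C] by (intro kill) auto
    moreover have "map_poly \<phi> H = map_poly \<phi> (H - K) + map_poly \<phi> K"
      using map_poly_hom_add[OF hom D K(1)] by simp
    ultimately show ?thesis unfolding \<phi>'_def K_def[symmetric] by simp
  qed
  have "C'.hom_on \<phi>'"
    unfolding C'.hom_on_def
  proof (intro conjI allI ballI)
    fix c show "\<phi>' (\<iota> c) = c"
      using eq[of "monom (\<iota> c) 0"] hom
      by (simp add: poly_monom coeffs_in_monom map_poly_monom hom_const)
  next
    fix a b assume "a \<in> C'" "b \<in> C'"
    then obtain F G where FG: "F \<in> coeffs_in C" "G \<in> coeffs_in C" "a = poly F g" "b = poly G g"
      by auto
    show "\<phi>' (a + b) = \<phi>' a + \<phi>' b"
      using eq[of "F + G"] eq[of F] eq[of G] FG by (simp add: coeffs_in_add map_poly_hom_add[OF hom])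
    show "\<phi>' (a * b) = \<phi>' a * \<phi>' b"
      using eq[of "F * G"] eq[of F] eq[of G] FG by (simp add: coeffs_in_mult map_poly_hom_mult[OF hom])
  qed
  with eq that show thesis by blast
qed

text \<open>Without a relation for \<open>g\<close> modulo \<open>P\<close>, every value
  \<open>t\<close> is allowed. As \<open>b\<close> take a coefficient of \<open>a\<close> outside
  \<open>P\<close>; if it survives under \<open>\<phi>\<close>, the image polynomial is nonzero and,
  the field being infinite, has a nonroot \<open>t\<close>.\<close>

lemma extension_transcendental:
  assumes trans: "\<And>H i. H \<in> coeffs_in C \<Longrightarrow> poly H g \<in> P \<Longrightarrow> coeff H i \<in> P"
    and a: "a \<in> C'" "a \<notin> P"
  shows "\<exists>b\<in>C - P. \<forall>\<phi>. hom_on \<phi> \<and> (\<forall>c\<in>C \<inter> P. \<phi> c = 0) \<and> \<phi> b \<noteq> 0 \<longrightarrow>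
    (\<exists>\<phi>'. C'.hom_on \<phi>' \<and> (\<forall>c\<in>C' \<inter> P. \<phi>' c = 0) \<and> \<phi>' a \<noteq> 0)"
proof -
  obtain A where A: "A \<in> coeffs_in C" "a = poly A g" using a by auto
  have "\<exists>i. coeff A i \<notin> P"
  proof (rule ccontr)
    assume "\<nexists>i. coeff A i \<notin> P"
    then have "a \<in> P" unfolding A(2) poly_altdef
      using A(1) C'.prime_mult_iff[OF prime'] C'I coeffs_in_coeff C'.power_mem adjoin_gen
      by (intro C'.prime_sum[OF prime']) (auto intro!: C'.mult_mem)
    with a show False by simp
  qed
  then obtain i where i: "coeff A i \<notin> P" by auto
  show ?thesis
  proof (intro bexI[of _ "coeff A i"] allI impI, elim conjE)
    fix \<phi> assume hom: "hom_on \<phi>" and z: "\<forall>c\<in>C \<inter> P. \<phi> c = 0" and nz: "\<phi> (coeff A i) \<noteq> 0"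
    have "coeff (map_poly \<phi> A) i \<noteq> 0" using nz hom by (simp add: coeff_map_poly hom_0)
    then have "map_poly \<phi> A \<noteq> 0" by auto
    then have "finite {t. poly (map_poly \<phi> A) t = 0}" by (rule poly_roots_finite)
    then obtain t where t: "poly (map_poly \<phi> A) t \<noteq> 0"
      using infinite_UNIV_char_0[where 'a='k] by (metis (mono_tags, lifting) UNIV_I ex_new_if_finite mem_Collect_eq)
    have kill: "poly (map_poly \<phi> H) t = 0" if "H \<in> coeffs_in C" "poly H g \<in> P" for H
    proof -
      have "map_poly \<phi> H = 0"
        by (rule poly_eqI) (use trans[OF that] z hom coeffs_in_coeff[OF that(1)] in \<open>auto simp: coeff_map_poly hom_0\<close>)
      then show ?thesis by simp
    qed
    obtain \<phi>' where \<phi>': "C'.hom_on \<phi>'" "\<And>H. H \<in> coeffs_in C \<Longrightarrow> \<phi>' (poly H g) = poly (map_poly \<phi> H) t"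
      using hom_extend[OF hom kill] by blast
    then show "\<exists>\<phi>'. C'.hom_on \<phi>' \<and> (\<forall>c\<in>C' \<inter> P. \<phi>' c = 0) \<and> \<phi>' a \<noteq> 0"
      using kill t A by (intro exI[of _ \<phi>']) auto
  qed (use i A coeffs_in_coeff in auto)
qed

text \<open>Here the value of \<open>g\<close> must be a root of the image of a minimal relation
  \<open>F\<close>. The element \<open>b\<close> is \<open>c * g0\<close>: with
  \<open>\<phi> c \<noteq> 0\<close> the image of \<open>F\<close> keeps its degree and has a root,
  and \<open>g0\<close> is, modulo \<open>P\<close>, a multiple of \<open>a\<close>, so that
  \<open>\<phi> g0 \<noteq> 0\<close> keeps \<open>a\<close> alive.\<close>

lemma extension_algebraic:
  assumes alg: "F0 \<in> coeffs_in C" "poly F0 g \<in> P" "coeff F0 i0 \<notin> P"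
    and a: "a \<in> C'" "a \<notin> P"
  shows "\<exists>b\<in>C - P. \<forall>\<phi>. hom_on \<phi> \<and> (\<forall>c\<in>C \<inter> P. \<phi> c = 0) \<and> \<phi> b \<noteq> 0 \<longrightarrow>
    (\<exists>\<phi>'. C'.hom_on \<phi>' \<and> (\<forall>c\<in>C' \<inter> P. \<phi>' c = 0) \<and> \<phi>' a \<noteq> 0)"
proof -
  \<comment> \<open>Relations for \<open>g\<close> modulo \<open>P\<close>, apart from those with
    all coefficients in \<open>P\<close>, which hold trivially.\<close>
  define rel where "rel F \<longleftrightarrow> F \<in> coeffs_in C \<and> poly F g \<in> P \<and> (\<exists>i. coeff F i \<notin> P)" for F
  have "rel F0" unfolding rel_def using alg by auto
  then obtain F where F: "rel F" and min: "\<And>H. rel H \<Longrightarrow> degree F \<le> degree H"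
    using ex_has_least_nat[of rel F0 degree] by blast
  have FC: "F \<in> coeffs_in C" and Fg: "poly F g \<in> P" using F unfolding rel_def by auto
  have F0: "F \<noteq> 0" using F prime_0[OF prime_C] unfolding rel_def by auto
  note pC = prime_mult_iff[OF prime_C] and pC' = C'.prime_mult_iff[OF prime']
    and dC' = C'.prime_diff_iff[OF prime']
  have gC: "g \<in> C'" by (rule adjoin_gen)
  note memC = coeffs_in_coeff coeffs_in_mult coeffs_in_smult coeffs_in_diff coeffs_in_monom power_mem
  have drop: "H - monom (lead_coeff H) (degree H) \<in> coeffs_in C \<and>
      (poly (H - monom (lead_coeff H) (degree H)) g \<in> P \<longleftrightarrow> poly H g \<in> P)"
    if H: "H \<in> coeffs_in C" "lead_coeff H \<in> P" for H
  proof -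
    let ?H1 = "H - monom (lead_coeff H) (degree H)"
    have 1: "?H1 \<in> coeffs_in C" using H memC by blast
    have "poly H g - poly ?H1 g = lead_coeff H * g ^ degree H" by (simp add: poly_monom)
    also have "\<dots> \<in> P" using H pC'[of "lead_coeff H" "g ^ degree H"] C'I memC(1) C'.power_mem gC by auto
    finally show ?thesis using dC'[OF poly_C'[OF H(1)] poly_C'[OF 1]] 1 by auto
  qed
  define c where "c = lead_coeff F"
  have cC: "c \<in> C" unfolding c_def using FC memC by auto
  have cP: "c \<notin> P"
  proof
    assume c: "c \<in> P"
    let ?H1 = "F - monom (lead_coeff F) (degree F)"
    obtain i where i: "coeff F i \<notin> P" using F unfolding rel_def by auto
    have "coeff ?H1 i \<notin> P" using i c by (cases "i = degree F") (auto simp: c_def)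
    then have r: "rel ?H1"
      using drop[OF FC] c Fg unfolding rel_def c_def by blast
    have "?H1 \<noteq> 0" using \<open>coeff ?H1 i \<notin> P\<close> prime_0[OF prime_C] by (metis coeff_0)
    then show False using min[OF r] poly_drop_lead[of F] by auto
  qed
  have dF: "degree F \<noteq> 0"
  proof
    assume "degree F = 0"
    then have "poly F g = c" unfolding c_def by (auto elim: degree_eq_zeroE)
    then show False using Fg cP by simp
  qed
  \<comment> \<open>The Euclidean algorithm against \<open>F\<close>: modulo \<open>P\<close>, each
    nonzero element of C[g] has a nonzero multiple in \<open>C\<close>. Constants are their own
    multiple; otherwise one drops a leading term lying in \<open>P\<close>, divides \<open>H\<close>
    by \<open>F\<close>, or divides \<open>F\<close> by \<open>H\<close>, and continues with a
    polynomial of smaller degree.\<close>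
  have key: "\<exists>U\<in>coeffs_in C. \<exists>g0\<in>C - P. poly U g * poly H g - g0 \<in> P"
    if "H \<in> coeffs_in C" "poly H g \<notin> P" for H
    using that
  proof (induction "degree H" arbitrary: H rule: less_induct)
    case less
    define h where "h = lead_coeff H"
    have hC: "h \<in> C" unfolding h_def using less.prems memC by auto
    have H0: "H \<noteq> 0" using less.prems prime_0[OF prime_C] by auto
    consider "h \<in> P" | "h \<notin> P" "degree H = 0" | "h \<notin> P" "degree F \<le> degree H"
      | "h \<notin> P" "0 < degree H" "degree H < degree F" by linarith
    then show ?case
    proof cases
      case 1
      let ?H1 = "H - monom (lead_coeff H) (degree H)"
      have H1: "?H1 \<in> coeffs_in C" "poly ?H1 g \<notin> P" using drop less.prems 1 unfolding h_def by auto
      then have "?H1 \<noteq> 0" using prime_0[OF prime_C] by force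
      then have "degree ?H1 < degree H" using poly_drop_lead[of H] by auto
      from less.hyps[OF this H1] obtain U g0 where U: "U \<in> coeffs_in C" "g0 \<in> C - P"
        "poly U g * poly ?H1 g - g0 \<in> P" by blast
      have "poly U g * (poly H g - poly ?H1 g) = (poly U g * g ^ degree H) * h"
        by (simp add: poly_monom h_def)
      also have "\<dots> \<in> P" using 1 hC U pC'[of "poly U g * g ^ degree H" h] C'I
        by (auto intro: C'.mult_mem C'.power_mem gC poly_C')
      finally have "poly U g * (poly H g - poly ?H1 g) + (poly U g * poly ?H1 g - g0) \<in> P"
        using U H1 less.prems C'I
        by (intro C'.prime_add[OF prime'])
           (auto intro!: C'.mult_mem C'.diff_mem poly_C' simp del: poly_diff)
      then have "poly U g * poly H g - g0 \<in> P" by (simp add: algebra_simps)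
      then show ?thesis using U by blast
    next
      case 2
      then have "poly H g = h" unfolding h_def by (auto elim: degree_eq_zeroE)
      then show ?thesis using 2 hC prime_0[OF prime_C]
        by (intro bexI[of _ "monom 1 0"] bexI[of _ h]) (use coeffs_in_monom[OF one_mem, of 0] in auto)
    next
      case 3
      obtain m Q r where Q: "Q \<in> coeffs_in C" "r \<in> coeffs_in C" "smult (c ^ m) H = F * Q + r"
        "r = 0 \<or> degree r < degree F"
        using pseudo_division[OF FC F0 less.prems(1)] unfolding c_def by blast
      have e: "c ^ m * poly H g = poly F g * poly Q g + poly r g"
        using arg_cong[OF Q(3), of "\<lambda>p. poly p g"] by simp
      have cm: "c ^ m \<in> C" "c ^ m \<notin> P" using cC cP prime_power[OF prime_C] power_mem by auto
      have FQ: "poly F g * poly Q g \<in> P" using pC' Fg FC Q poly_C' by auto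
      have rn: "poly r g \<notin> P"
      proof
        assume "poly r g \<in> P"
        then have "c ^ m * poly H g \<in> P"
          unfolding e using FQ FC Q by (intro C'.prime_add[OF prime']) (auto intro!: C'.mult_mem poly_C')
        then show False using pC'[OF C'I[OF cm(1)] poly_C'[OF less.prems(1)]] cm less.prems by auto
      qed
      then have "r \<noteq> 0" using prime_0[OF prime_C] by auto
      then have "degree r < degree H" using Q(4) 3 by auto
      from less.hyps[OF this Q(2) rn] obtain U g0 where U: "U \<in> coeffs_in C" "g0 \<in> C - P"
        "poly U g * poly r g - g0 \<in> P" by blast
      have "poly (smult (c ^ m) U) g * poly H g - g0 = poly U g * (c ^ m * poly H g) - g0" by simp
      also have "\<dots> = poly U g * (poly F g * poly Q g) + (poly U g * poly r g - g0)"
        unfolding e by (simp add: algebra_simps)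
      also have "\<dots> \<in> P"
        using U FQ FC Q C'I pC'[of "poly U g" "poly F g * poly Q g"]
        by (intro C'.prime_add[OF prime']) (auto intro!: C'.mult_mem C'.diff_mem poly_C')
      finally show ?thesis using U cm memC(3) by blast
    next
      case 4
      obtain m Q r where Q: "Q \<in> coeffs_in C" "r \<in> coeffs_in C" "smult (h ^ m) F = H * Q + r"
        "r = 0 \<or> degree r < degree H" "degree Q \<le> degree F - degree H"
        using pseudo_division[OF less.prems(1) H0 FC] unfolding h_def by blast
      have hm: "h ^ m \<in> C" "h ^ m \<notin> P" using hC 4 prime_power[OF prime_C] power_mem by auto
      have e: "h ^ m * poly F g = poly H g * poly Q g + poly r g"
        using arg_cong[OF Q(3), of "\<lambda>p. poly p g"] by simp
      have hF: "h ^ m * poly F g \<in> P" using pC' hm FC Fg C'I poly_C' by auto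
      \<comment> \<open>Otherwise \<open>H * Q\<close> would vanish at \<open>g\<close> modulo
        \<open>P\<close>, hence \<open>Q\<close> would. Both \<open>Q\<close> and \<open>r\<close>
        have smaller degree than \<open>F\<close>, so by minimality their coefficients lie in
        \<open>P\<close>, and then so does the leading coefficient of
        \<open>smult (h ^ m) F\<close>.\<close>
      have rn: "poly r g \<notin> P"
      proof
        assume rP: "poly r g \<in> P"
        have "poly H g * poly Q g = h ^ m * poly F g - poly r g" using e by simp
        also have "\<dots> \<in> P" using hF rP hm FC Q C'I
          by (intro C'.prime_diff[OF prime']) (auto intro!: C'.mult_mem poly_C')
        finally have QP: "poly Q g \<in> P" using pC' less.prems Q poly_C' by auto
        have rc: "coeff r i \<in> P" for i
        proof (rule ccontr)
          assume "coeff r i \<notin> P"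
          then have "rel r" "r \<noteq> 0" using Q rP prime_0[OF prime_C] unfolding rel_def by auto
          then show False using min[of r] Q(4) 4 by auto
        qed
        have Qc: "coeff Q i \<in> P" for i
        proof (rule ccontr)
          assume "coeff Q i \<notin> P"
          then have "rel Q" using Q QP unfolding rel_def by auto
          then show False using min[of Q] Q(5) 4 by auto
        qed
        have "coeff (H * Q + r) (degree F) \<in> P"
          unfolding coeff_add coeff_mult using less.prems(1) Q rc Qc memC(1)
          by (intro prime_add[OF prime_C] prime_sum[OF prime_C] conjI)
             (auto intro!: sum_mem mult_mem simp: pC)
        then have "h ^ m * c \<in> P" unfolding Q(3)[symmetric] by (simp add: c_def)
        then show False using pC hm cC cP by auto
      qed
      then have "r \<noteq> 0" using prime_0[OF prime_C] by auto
      then have "degree r < degree H" using Q(4) by auto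
      from less.hyps[OF this Q(2) rn] obtain U g0 where U: "U \<in> coeffs_in C" "g0 \<in> C - P"
        "poly U g * poly r g - g0 \<in> P" by blast
      have UQ: "smult (- 1) (U * Q) \<in> coeffs_in C" by (intro coeffs_in_smult coeffs_in_mult neg_mem one_mem U Q)
      have "poly (smult (- 1) (U * Q)) g * poly H g - g0
          = (poly U g * poly r g - g0) - poly U g * (h ^ m * poly F g)"
        unfolding e by (simp add: algebra_simps)
      also have "\<dots> \<in> P"
      proof -
        have 1: "h ^ m * poly F g \<in> C'" by (intro C'.mult_mem C'I[OF hm(1)] poly_C' FC)
        have 2: "poly U g * (h ^ m * poly F g) \<in> P" using pC'[OF poly_C'[OF U(1)] 1] hF by simp
        have "g0 \<in> C'" using U(2) C'I by blast
        then show ?thesis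
          by (intro C'.prime_diff[OF prime' _ _ U(3) 2] C'.diff_mem C'.mult_mem poly_C' U(1) Q(2) 1)
      qed
      finally show ?thesis using U UQ by blast
    qed
  qed
  obtain A where A: "A \<in> coeffs_in C" "a = poly A g" using a by auto
  obtain U g0 where U: "U \<in> coeffs_in C" "g0 \<in> C" "g0 \<notin> P" "poly U g * a - g0 \<in> P"
    using key[OF A(1)] A a by blast
  show ?thesis
  proof (intro bexI[of _ "c * g0"] allI impI, elim conjE)
    fix \<phi> assume hom: "hom_on \<phi>" and z: "\<forall>c\<in>C \<inter> P. \<phi> c = 0" and nz: "\<phi> (c * g0) \<noteq> 0"
    have nzc: "\<phi> c \<noteq> 0" "\<phi> g0 \<noteq> 0" using nz hom_mult[OF hom cC U(2)] by auto
    have "degree (map_poly \<phi> F) = degree F"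
      using nzc unfolding c_def by (intro map_poly_degree_eq) auto
    then have "degree (map_poly \<phi> F) > 0" using dF by simp
    then obtain t where t: "poly (map_poly \<phi> F) t = 0"
      using alg_closed_imp_poly_has_root by blast
    \<comment> \<open>Dividing by \<open>F\<close> leaves a remainder that is a relation of smaller
      degree; its coefficients lie in \<open>P\<close> and are killed by
      \<open>\<phi>\<close>.\<close>
    have kill: "poly (map_poly \<phi> H) t = 0" if H: "H \<in> coeffs_in C" "poly H g \<in> P" for H
    proof -
      obtain m Q r where Q: "Q \<in> coeffs_in C" "r \<in> coeffs_in C" "smult (c ^ m) H = F * Q + r"
        "r = 0 \<or> degree r < degree F"
        using pseudo_division[OF FC F0 H(1)] unfolding c_def by blast
      have cm: "c ^ m \<in> C" using cC power_mem by auto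
      have "poly r g = c ^ m * poly H g - poly F g * poly Q g"
        using arg_cong[OF Q(3), of "\<lambda>p. poly p g"] by (simp add: algebra_simps)
      also have "\<dots> \<in> P" using H Q FC Fg cm C'I poly_C'
        by (intro C'.prime_diff[OF prime']) (auto intro!: C'.mult_mem simp: pC')
      finally have rP: "poly r g \<in> P" .
      have rc: "coeff r i \<in> P" for i
      proof (rule ccontr)
        assume "coeff r i \<notin> P"
        then have "rel r" "r \<noteq> 0" using Q rP prime_0[OF prime_C] unfolding rel_def by auto
        then show False using min[of r] Q(4) by auto
      qed
      have mr: "map_poly \<phi> r = 0"
        by (rule poly_eqI) (use rc z hom coeffs_in_coeff[OF Q(2)] in \<open>auto simp: coeff_map_poly hom_0\<close>)
      then have "smult (\<phi> (c ^ m)) (map_poly \<phi> H) = map_poly \<phi> F * map_poly \<phi> Q"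
        using arg_cong[OF Q(3), of "map_poly \<phi>"] mr
        by (simp add: map_poly_hom_smult[OF hom cm H(1)] map_poly_hom_mult[OF hom FC Q(1)]
            map_poly_hom_add[OF hom coeffs_in_mult[OF FC Q(1)] Q(2)])
      from arg_cong[OF this, of "\<lambda>p. poly p t"] have "\<phi> (c ^ m) * poly (map_poly \<phi> H) t = 0"
        using t by simp
      then show ?thesis using nzc hom_power[OF hom cC] by simp
    qed
    obtain \<phi>' where \<phi>': "C'.hom_on \<phi>'" "\<And>H. H \<in> coeffs_in C \<Longrightarrow> \<phi>' (poly H g) = poly (map_poly \<phi> H) t"
      using hom_extend[OF hom kill] by blast
    have z': "\<phi>' c = 0" if "c \<in> C' \<inter> P" for c
      using that kill \<phi>'(2) by auto
    have d1: "poly U g * a - g0 \<in> C'"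
      using U a C'I by (auto intro!: C'.diff_mem C'.mult_mem poly_C')
    have "poly U g * a = (poly U g * a - g0) + g0" by simp
    then have "\<phi>' (poly U g * a) = \<phi>' (poly U g * a - g0) + \<phi>' g0"
      using C'.hom_add[OF \<phi>'(1) d1 C'I[OF U(2)]] by simp
    also have "\<dots> = \<phi> g0" using z' d1 U \<phi>'(2)[of "monom g0 0"] hom
      by (simp add: coeffs_in_monom poly_monom map_poly_monom hom_0)
    finally have "\<phi>' (poly U g) * \<phi>' a \<noteq> 0"
      using C'.hom_mult[OF \<phi>'(1)] U a poly_C' nzc by auto
    then have "\<phi>' a \<noteq> 0" by auto
    then show "\<exists>\<phi>'. C'.hom_on \<phi>' \<and> (\<forall>c\<in>C' \<inter> P. \<phi>' c = 0) \<and> \<phi>' a \<noteq> 0"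
      using \<phi>'(1) z' by blast
  qed (use U cC cP pC mult_mem in auto)
qed

end

text \<open>The induction over the generators needs the element \<open>a\<close>: in each step it is
  replaced by an element \<open>b\<close> of the smaller algebra whose survival guarantees that of
  \<open>a\<close>. Without generators the algebra is the ground field, on which \<open>P\<close> is
  zero.\<close>

theorem nullstellensatz_prime:
  fixes \<iota> :: "'k::{alg_closed_field, field_char_0} \<Rightarrow> 'a::comm_ring_1"
  assumes str: "structure_map \<iota>" and "finite G"
    and "subalgebra.prime_on (alg_gen \<iota> G) P" "a \<in> alg_gen \<iota> G" "a \<notin> P"
  shows "\<exists>\<phi>. subalgebra.hom_on \<iota> (alg_gen \<iota> G) \<phi> \<and> (\<forall>c\<in>alg_gen \<iota> G \<inter> P. \<phi> c = 0) \<and> \<phi> a \<noteq> 0"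
  using assms(2-)
proof (induction G arbitrary: a)
  case empty
  interpret C: subalgebra \<iota> "alg_gen \<iota> {}" by (rule subalgebra_alg_gen[OF str])
  have im: "\<exists>c. x = \<iota> c" if "x \<in> alg_gen \<iota> {}" for x
    using that by induction (auto simp: C.str_add[symmetric] C.str_mult[symmetric])
  have nP: "c = 0" if "\<iota> c \<in> P" for c
  proof (rule ccontr)
    assume "c \<noteq> 0"
    then have "\<iota> (inverse c) * \<iota> c = 1" by (simp add: C.str_mult[symmetric])
    moreover have "\<iota> (inverse c) * \<iota> c \<in> P" using that C.prime_mult_iff[OF empty.prems(1)] by auto
    ultimately show False using C.prime_1[OF empty.prems(1)] by simp
  qed
  have inj: "c = d" if "\<iota> c = \<iota> d" for c d
  proof -
    have "\<iota> (c - d) = 0" using that C.str_add[of c "- d"] C.str_neg[of d] by simp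
    then show ?thesis using nP[of "c - d"] C.prime_0[OF empty.prems(1)] by simp
  qed
  define \<phi> where "\<phi> = inv_into UNIV \<iota>"
  have \<phi>: "\<phi> (\<iota> c) = c" for c unfolding \<phi>_def using inj by (intro inv_f_f injI)
  have "C.hom_on \<phi>"
    unfolding C.hom_on_def
  proof (intro conjI allI ballI)
    fix a b assume "a \<in> alg_gen \<iota> {}" "b \<in> alg_gen \<iota> {}"
    then obtain c d where "a = \<iota> c" "b = \<iota> d" using im by blast
    then show "\<phi> (a + b) = \<phi> a + \<phi> b" "\<phi> (a * b) = \<phi> a * \<phi> b"
      by (simp_all add: C.str_add[symmetric] C.str_mult[symmetric] \<phi>)
  qed (rule \<phi>)
  moreover have "\<forall>c\<in>alg_gen \<iota> {} \<inter> P. \<phi> c = 0" using im nP \<phi> by fastforce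
  moreover have "\<phi> a \<noteq> 0" using im[OF empty.prems(2)] empty.prems(3) \<phi> C.prime_0[OF empty.prems(1)] by force
  ultimately show ?case by blast
next
  case (insert g G)
  interpret C: subalgebra \<iota> "alg_gen \<iota> G" by (rule subalgebra_alg_gen[OF str])
  interpret A: adjoin \<iota> "alg_gen \<iota> G" g P
    by standard (use insert.prems(1) in \<open>simp add: alg_gen_insert[OF str]\<close>)
  have a: "a \<in> A.C'" using insert.prems by (simp add: alg_gen_insert[OF str])
  have "\<exists>b\<in>alg_gen \<iota> G - P. \<forall>\<phi>. C.hom_on \<phi> \<and> (\<forall>c\<in>alg_gen \<iota> G \<inter> P. \<phi> c = 0) \<and> \<phi> b \<noteq> 0 \<longrightarrow>
    (\<exists>\<phi>'. A.C'.hom_on \<phi>' \<and> (\<forall>c\<in>A.C' \<inter> P. \<phi>' c = 0) \<and> \<phi>' a \<noteq> 0)"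
    using A.extension_transcendental[OF _ a insert.prems(3)] A.extension_algebraic[OF _ _ _ a insert.prems(3)]
    by blast
  then obtain b where b: "b \<in> alg_gen \<iota> G" "b \<notin> P" and
    ext: "\<And>\<phi>. C.hom_on \<phi> \<Longrightarrow> (\<forall>c\<in>alg_gen \<iota> G \<inter> P. \<phi> c = 0) \<Longrightarrow> \<phi> b \<noteq> 0 \<Longrightarrow>
      \<exists>\<phi>'. A.C'.hom_on \<phi>' \<and> (\<forall>c\<in>A.C' \<inter> P. \<phi>' c = 0) \<and> \<phi>' a \<noteq> 0" by blast
  from insert.IH[OF A.prime_C b] ext show ?case by (simp add: alg_gen_insert[OF str]) blast
qed

section \<open>Common zeros of ideals\<close>

context subalgebra begin

definition ideal_on :: "'a set \<Rightarrow> bool" where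
  "ideal_on I \<longleftrightarrow> I \<subseteq> C \<and> 0 \<in> I \<and> (\<forall>a\<in>I. \<forall>b\<in>I. a + b \<in> I) \<and> (\<forall>c\<in>C. \<forall>a\<in>I. c * a \<in> I)"

text \<open>A maximal proper ideal above \<open>I\<close>, from Zorn's lemma, is prime: together
  with any element outside it, it generates the unit ideal.\<close>

lemma prime_on_above_ideal:
  assumes I: "ideal_on I" "1 \<notin> I"
  shows "\<exists>P. I \<subseteq> P \<and> P \<subseteq> C \<and> prime_on P"
proof -
  define \<A> where "\<A> = {M. ideal_on M \<and> I \<subseteq> M \<and> 1 \<notin> M}"
  have "\<exists>M\<in>\<A>. \<forall>N\<in>\<A>. M \<subseteq> N \<longrightarrow> N = M"
  proof (rule subset_Zorn_nonempty)
    show "\<A> \<noteq> {}" using I unfolding \<A>_def by auto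
  next
    fix \<C> assume ne: "\<C> \<noteq> {}" and ch: "subset.chain \<A> \<C>"
    have cA: "\<C> \<subseteq> \<A>" and tot: "\<And>M N. M \<in> \<C> \<Longrightarrow> N \<in> \<C> \<Longrightarrow> M \<subseteq> N \<or> N \<subseteq> M"
      using ch unfolding subset_chain_def by auto
    have id: "ideal_on M" if "M \<in> \<C>" for M using that cA unfolding \<A>_def by auto
    have "ideal_on (\<Union>\<C>)"
      unfolding ideal_on_def
    proof (intro conjI ballI)
      show "\<Union>\<C> \<subseteq> C" using id unfolding ideal_on_def by blast
      show "0 \<in> \<Union>\<C>" using ne id unfolding ideal_on_def by blast
    next
      fix a b assume "a \<in> \<Union>\<C>" "b \<in> \<Union>\<C>"
      then obtain M N where "M \<in> \<C>" "N \<in> \<C>" "a \<in> M" "b \<in> N" by auto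
      then obtain L where "L \<in> \<C>" "a \<in> L" "b \<in> L" using tot[of M N] by auto
      then show "a + b \<in> \<Union>\<C>" using id[of L] unfolding ideal_on_def by blast
    next
      fix c a assume "c \<in> C" "a \<in> \<Union>\<C>"
      then show "c * a \<in> \<Union>\<C>" using id unfolding ideal_on_def by blast
    qed
    moreover have "I \<subseteq> \<Union>\<C>" "1 \<notin> \<Union>\<C>" using ne cA unfolding \<A>_def by auto
    ultimately show "\<Union>\<C> \<in> \<A>" unfolding \<A>_def by auto
  qed
  then obtain M where MA: "M \<in> \<A>" and maxA: "\<forall>N\<in>\<A>. M \<subseteq> N \<longrightarrow> N = M" by (elim bexE)
  have M: "ideal_on M" "I \<subseteq> M" "1 \<notin> M" using MA unfolding \<A>_def by auto
  have max: "N = M" if "ideal_on N" "M \<subseteq> N" "1 \<notin> N" for N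
    using maxA that M(2) unfolding \<A>_def by simp
  have MC: "M \<subseteq> C" and M0: "0 \<in> M" and Madd: "\<And>a b. a \<in> M \<Longrightarrow> b \<in> M \<Longrightarrow> a + b \<in> M"
    and Mmult: "\<And>c a. c \<in> C \<Longrightarrow> a \<in> M \<Longrightarrow> c * a \<in> M"
    using M(1) unfolding ideal_on_def by auto
  have unit: "\<exists>m\<in>M. \<exists>c\<in>C. m + c * a = 1" if a: "a \<in> C" "a \<notin> M" for a
  proof (rule ccontr)
    assume *: "\<not> ?thesis"
    define N where "N = {m + c * a | m c. m \<in> M \<and> c \<in> C}"
    have "ideal_on N"
      unfolding ideal_on_def
    proof (intro conjI ballI)
      show "N \<subseteq> C" unfolding N_def using MC a by (auto intro!: add_mem mult_mem)
      show "0 \<in> N" unfolding N_def using M0 by (auto intro!: exI[of _ 0])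
    next
      fix x y assume "x \<in> N" "y \<in> N"
      then obtain m c m' c' where *: "m \<in> M" "c \<in> C" "m' \<in> M" "c' \<in> C" "x = m + c * a" "y = m' + c' * a"
        unfolding N_def by auto
      then have "x + y = (m + m') + (c + c') * a" by (simp add: algebra_simps)
      with * show "x + y \<in> N" unfolding N_def using Madd add_mem by blast
    next
      fix d x assume d: "d \<in> C" and "x \<in> N"
      then obtain m c where *: "m \<in> M" "c \<in> C" "x = m + c * a" unfolding N_def by auto
      then have "d * x = d * m + (d * c) * a" by (simp add: algebra_simps)
      with * d show "d * x \<in> N" unfolding N_def using Mmult mult_mem by blast
    qed
    moreover have "M \<subseteq> N"
    proof
      fix m assume "m \<in> M"
      then show "m \<in> N" unfolding N_def by (intro CollectI exI[of _ m] exI[of _ 0]) auto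
    qed
    moreover have "1 \<notin> N" using * unfolding N_def by auto
    ultimately have "N = M" by (rule max)
    moreover have "a \<in> N" unfolding N_def using M0 by (intro CollectI exI[of _ 0] exI[of _ 1]) auto
    ultimately show False using a by simp
  qed
  have "prime_on M"
    unfolding prime_on_def
  proof (intro conjI ballI)
    show "0 \<in> M" "1 \<notin> M" by fact+
    show "a + b \<in> M" if "a \<in> C \<inter> M" "b \<in> C \<inter> M" for a b using that Madd by auto
    fix a b assume ab: "a \<in> C" "b \<in> C"
    show "a * b \<in> M \<longleftrightarrow> a \<in> M \<or> b \<in> M"
    proof
      assume m: "a * b \<in> M"
      show "a \<in> M \<or> b \<in> M"
      proof (rule ccontr)
        assume "\<not> (a \<in> M \<or> b \<in> M)"
        then obtain m c where mc: "m \<in> M" "c \<in> C" "m + c * a = 1" and "b \<notin> M" using unit[OF ab(1)] by auto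
        have "b = (m + c * a) * b" using mc by simp
        also have "\<dots> = b * m + c * (a * b)" by (simp add: algebra_simps)
        also have "\<dots> \<in> M" by (intro Madd Mmult ab mc m)
        finally show False using \<open>b \<notin> M\<close> by simp
      qed
    next
      assume "a \<in> M \<or> b \<in> M"
      then show "a * b \<in> M" using Mmult[OF ab(1), of b] Mmult[OF ab(2), of a] by (auto simp: mult.commute)
    qed
  qed
  with M MC show ?thesis by blast
qed

end

theorem nullstellensatz_ideal:
  fixes \<iota> :: "'k::{alg_closed_field, field_char_0} \<Rightarrow> 'a::comm_ring_1"
  assumes str: "structure_map \<iota>" and G: "finite G"
    and I: "subalgebra.ideal_on (alg_gen \<iota> G) I" "1 \<notin> I"
  shows "\<exists>\<phi>. subalgebra.hom_on \<iota> (alg_gen \<iota> G) \<phi> \<and> (\<forall>c\<in>I. \<phi> c = 0)"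
proof -
  interpret C: subalgebra \<iota> "alg_gen \<iota> G" by (rule subalgebra_alg_gen[OF str])
  obtain P where P: "I \<subseteq> P" "P \<subseteq> alg_gen \<iota> G" "C.prime_on P"
    using C.prime_on_above_ideal[OF I] by blast
  from nullstellensatz_prime[OF str G P(3) C.one_mem C.prime_1[OF P(3)]] P(1,2)
  show ?thesis by blast
qed

lemma alg_homs_on_UNIV:
  assumes "structure_map \<iota>" "alg_gen \<iota> G = UNIV"
  shows "subalgebra.hom_on \<iota> (alg_gen \<iota> G) \<phi> \<longleftrightarrow> \<phi> \<in> alg_homs \<iota>"
proof -
  interpret C: subalgebra \<iota> "alg_gen \<iota> G" by (rule subalgebra_alg_gen[OF assms(1)])
  show ?thesis using C.hom_on_def[of \<phi>] by (simp add: alg_homs_def assms(2))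
qed

text \<open>The multiples of \<open>q\<close> form a prime ideal. This is how divisibility by
  \<open>q\<close> is read off from points throughout.\<close>

theorem nullstellensatz_prime_elem:
  fixes \<iota> :: "'k::{alg_closed_field, field_char_0} \<Rightarrow> 'a::idom"
  assumes str: "structure_map \<iota>" and G: "finite G" "alg_gen \<iota> G = UNIV"
    and q: "prime_elem q" "\<not> q dvd a"
  shows "\<exists>z\<in>alg_homs \<iota>. z q = 0 \<and> z a \<noteq> 0"
proof -
  interpret C: subalgebra \<iota> "alg_gen \<iota> G" by (rule subalgebra_alg_gen[OF str])
  have "C.prime_on {b. q dvd b}"
    unfolding C.prime_on_def using q prime_elem_dvd_mult_iff[OF q(1)] by (auto simp: prime_elem_def)
  from nullstellensatz_prime[OF str G(1) this, of a] q(2) show ?thesis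
    unfolding alg_homs_on_UNIV[OF str G(2)] by (simp add: G(2)) (metis dvd_refl)
qed

theorem nullstellensatz_nonzero:
  fixes \<iota> :: "'k::{alg_closed_field, field_char_0} \<Rightarrow> 'a::idom"
  assumes str: "structure_map \<iota>" and G: "finite G" "alg_gen \<iota> G = UNIV"
    and "a \<noteq> 0"
  shows "\<exists>z\<in>alg_homs \<iota>. z a \<noteq> 0"
proof -
  interpret C: subalgebra \<iota> "alg_gen \<iota> G" by (rule subalgebra_alg_gen[OF str])
  have "C.prime_on {0}"
    unfolding C.prime_on_def by auto
  from nullstellensatz_prime[OF str G(1) this, of a] assms(4) show ?thesis
    unfolding alg_homs_on_UNIV[OF str G(2)] by (auto simp: G(2))
qed

lemma structure_map_const: "structure_map (\<lambda>c::'k::field. \<lambda>_. c)"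
  unfolding structure_map_def by (auto simp: fun_eq_iff)

interpretation poly_funs: subalgebra "\<lambda>c _. c" "poly_funs n"
  unfolding poly_funs_def by (rule subalgebra_alg_gen[OF structure_map_const])

text \<open>The point is the tuple of the images of the coordinate functions.\<close>

lemma hom_poly_funs:
  assumes "poly_funs.hom_on n \<phi>"
  shows "\<exists>a\<in>affine_space n. \<forall>f\<in>poly_funs n. \<phi> f = f a"
proof
  define a where "a i = (if i < n then \<phi> (\<lambda>b. b i) else 0)" for i
  show "a \<in> affine_space n" unfolding a_def affine_space_def by auto
  show "\<forall>f\<in>poly_funs n. \<phi> f = f a"
  proof
    fix f :: "(nat \<Rightarrow> 'a) \<Rightarrow> 'a" assume "f \<in> poly_funs n"
    then have "f \<in> poly_funs n \<and> \<phi> f = f a"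
      unfolding poly_funs_def
    proof induction
      case (const c)
      then show ?case using poly_funs.hom_const[OF assms] by (auto intro: alg_gen.const)
    next
      case (gen g)
      then show ?case by (auto simp: a_def intro: alg_gen.gen)
    next
      case (add f g)
      then have "\<phi> (f + g) = \<phi> f + \<phi> g" using poly_funs.hom_add[OF assms, of f g]
        unfolding poly_funs_def by blast
      with add show ?case by (metis alg_gen.add plus_fun_apply)
    next
      case (mult f g)
      then have "\<phi> (f * g) = \<phi> f * \<phi> g" using poly_funs.hom_mult[OF assms, of f g]
        unfolding poly_funs_def by blast
      with mult show ?case by (metis alg_gen.mult times_fun_apply)
    qed
    then show "\<phi> f = f a" by simp
  qed
qed

theorem weak_nullstellensatz:
  fixes I :: "((nat \<Rightarrow> 'k::{alg_closed_field, field_char_0}) \<Rightarrow> 'k) set"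
  assumes "poly_funs.ideal_on n I" and "\<And>a. a \<in> affine_space n \<Longrightarrow> \<exists>f\<in>I. f a \<noteq> 0"
  shows "1 \<in> I"
proof (rule ccontr)
  assume 1: "1 \<notin> I"
  have IC: "I \<subseteq> poly_funs n" using assms(1) unfolding poly_funs.ideal_on_def by auto
  obtain \<phi> where \<phi>: "poly_funs.hom_on n \<phi>" "\<forall>f\<in>I. \<phi> f = 0"
    using nullstellensatz_ideal[OF structure_map_const _ assms(1)[unfolded poly_funs_def] 1]
    unfolding poly_funs_def by auto
  obtain a where a: "a \<in> affine_space n" "\<forall>f\<in>poly_funs n. \<phi> f = f a" using hom_poly_funs[OF \<phi>(1)] by auto
  then show False using assms(2)[OF a(1)] \<phi>(2) IC by (metis subsetD)
qed

section \<open>Cones\<close>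

text \<open>The generators form a family indexed by \<open>J\<close>, since different
  \<open>f i\<close> may have the same degree.\<close>

definition cone_of :: "(rat \<Rightarrow> 'v \<Rightarrow> 'v) \<Rightarrow> ('i \<Rightarrow> 'v) \<Rightarrow> 'i set \<Rightarrow> 'v::ab_group_add set" where
  "cone_of s w J = {\<Sum>i\<in>J. s (c i) (w i) | c. \<forall>i\<in>J. 0 \<le> c i}"

lemma linear_functionalI:
  fixes s :: "rat \<Rightarrow> 'v::ab_group_add \<Rightarrow> 'v" and u :: "'v \<Rightarrow> rat"
  assumes "vector_space s" "\<And>x y. u (x + y) = u x + u y" "\<And>c x. u (s c x) = c * u x"
  shows "Vector_Spaces.linear s (*) u"
proof -
  have "vector_space ((*) :: rat \<Rightarrow> rat \<Rightarrow> rat)" by standard (auto simp: algebra_simps)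
  with assms show ?thesis by (simp add: Vector_Spaces.linear_iff)
qed

lemma linear_functional_exists:
  fixes s :: "rat \<Rightarrow> 'v::ab_group_add \<Rightarrow> 'v"
  assumes "vector_space s" "v \<noteq> 0"
  shows "\<exists>u. Vector_Spaces.linear s (*) u \<and> u v = (1::rat)"
proof -
  interpret V: vector_space s by fact
  interpret Q: vector_space "(*) :: rat \<Rightarrow> rat \<Rightarrow> rat"
    by standard (auto simp: algebra_simps)
  interpret VP: vector_space_pair s "(*) :: rat \<Rightarrow> rat \<Rightarrow> rat" ..
  have "\<not> V.dependent {v}" using assms(2) by simp
  from VP.linear_independent_extend[OF this, of "\<lambda>_. 1"] show ?thesis by auto
qed

text \<open>Induction over the generators. A functional found for \<open>J\<close> may be negative
  on the new generator \<open>w k\<close>; then everything is projected along \<open>w k\<close>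
  onto its kernel, where the hypothesis is used once more for \<open>J\<close>, and the composite
  functional vanishes on \<open>w k\<close>.\<close>

theorem farkas:
  fixes s :: "rat \<Rightarrow> 'v::ab_group_add \<Rightarrow> 'v" and w :: "'i \<Rightarrow> 'v"
  assumes vs: "vector_space s" and J: "finite J" and v: "v \<notin> cone_of s w J"
  shows "\<exists>u. Vector_Spaces.linear s (*) u \<and> (\<forall>i\<in>J. 0 \<le> u (w i)) \<and> u v < (0::rat)"
  using J v
proof (induction J arbitrary: v w)
  case empty
  interpret V: vector_space s by fact
  have "v \<noteq> 0" using empty unfolding cone_of_def by auto
  then have "- v \<noteq> 0" by simp
  from linear_functional_exists[OF vs this] obtain u
    where u: "Vector_Spaces.linear s (*) u" "u (- v) = (1::rat)" by auto
  interpret u: Vector_Spaces.linear s "(*)" u by (rule u)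
  have "u v = - 1" using u(2) u.neg[of v] by simp
  then show ?case using u by auto
next
  case (insert k J)
  interpret V: vector_space s by fact
  have "v \<notin> cone_of s w J"
  proof
    assume "v \<in> cone_of s w J"
    then obtain c where c: "v = (\<Sum>i\<in>J. s (c i) (w i))" "\<forall>i\<in>J. 0 \<le> c i" unfolding cone_of_def by auto
    define c' where "c' = c(k := 0)"
    have "(\<Sum>i\<in>J. s (c i) (w i)) = (\<Sum>i\<in>J. s (c' i) (w i))"
      using insert.hyps unfolding c'_def by (intro sum.cong) auto
    then have "v = (\<Sum>i\<in>insert k J. s (c' i) (w i))"
      using c insert.hyps unfolding c'_def by simp
    moreover have "\<forall>i\<in>insert k J. 0 \<le> c' i" using c unfolding c'_def by auto
    ultimately show False using insert.prems unfolding cone_of_def by blast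
  qed
  from insert.IH[OF this] obtain u where u: "Vector_Spaces.linear s (*) u"
    "\<forall>i\<in>J. 0 \<le> u (w i)" "u v < (0::rat)" by auto
  interpret u: Vector_Spaces.linear s "(*)" u by (rule u)
  show ?case
  proof (cases "0 \<le> u (w k)")
    case True
    then show ?thesis using u by auto
  next
    case False
    define pr where "pr x = x - s (u x / u (w k)) (w k)" for x
    have "pr v \<notin> cone_of s (\<lambda>i. pr (w i)) J"
    proof
      assume "pr v \<in> cone_of s (\<lambda>i. pr (w i)) J"
      then obtain c where c: "pr v = (\<Sum>i\<in>J. s (c i) (pr (w i)))" "\<forall>i\<in>J. 0 \<le> c i"
        unfolding cone_of_def by auto
      \<comment> \<open>The coefficient of \<open>w k\<close> when the relation between the
        projections is lifted. It is nonnegative because \<open>u\<close> is negative on both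
        \<open>v\<close> and \<open>w k\<close> and nonnegative on the other generators.\<close>
      define d where "d = u v / u (w k) - (\<Sum>i\<in>J. c i * (u (w i) / u (w k)))"
      have "(\<Sum>i\<in>J. s (c i) (pr (w i))) = (\<Sum>i\<in>J. s (c i) (w i)) - s (\<Sum>i\<in>J. c i * (u (w i) / u (w k))) (w k)"
        unfolding pr_def by (simp add: V.scale_right_diff_distrib sum_subtractf V.scale_sum_left)
      with c(1) have "pr v = (\<Sum>i\<in>J. s (c i) (w i)) - s (\<Sum>i\<in>J. c i * (u (w i) / u (w k))) (w k)"
        by simp
      then have "v = (\<Sum>i\<in>J. s (c i) (w i)) + s d (w k)"
        unfolding pr_def d_def by (simp add: V.scale_left_diff_distrib algebra_simps)
      moreover have "d \<ge> 0"
      proof -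
        have "u v / u (w k) \<ge> 0" using u(3) False by (simp add: divide_nonpos_neg)
        moreover have "(\<Sum>i\<in>J. c i * (u (w i) / u (w k))) \<le> 0"
          using c(2) u(2) False
          by (intro sum_nonpos mult_nonneg_nonpos) (auto simp: divide_nonneg_neg)
        ultimately show ?thesis unfolding d_def by linarith
      qed
      moreover have "(\<Sum>i\<in>J. s (c i) (w i)) = (\<Sum>i\<in>J. s ((c(k := d)) i) (w i))"
        using insert.hyps by (intro sum.cong) auto
      ultimately have "v = (\<Sum>i\<in>insert k J. s ((c(k := d)) i) (w i))" "\<forall>i\<in>insert k J. 0 \<le> (c(k := d)) i"
        using insert.hyps c(2) by (simp_all add: add.commute)
      then show False using insert.prems unfolding cone_of_def by blast
    qed
    from insert.IH[OF this] obtain u' where u': "Vector_Spaces.linear s (*) u'"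
      "\<forall>i\<in>J. 0 \<le> u' (pr (w i))" "u' (pr v) < (0::rat)" by auto
    interpret u': Vector_Spaces.linear s "(*)" u' by (rule u')
    have "pr (x + y) = pr x + pr y" for x y
      unfolding pr_def by (simp add: u.add V.scale_left_distrib add_divide_distrib)
    moreover have "pr (s c x) = s c (pr x)" for c x
      unfolding pr_def by (simp add: u.scale V.scale_right_diff_distrib)
    ultimately have "Vector_Spaces.linear s (*) (\<lambda>x. u' (pr x))"
      by (intro linear_functionalI[OF vs]) (simp_all add: u'.add u'.scale)
    moreover have "pr (w k) = 0" unfolding pr_def using False by simp
    ultimately show ?thesis using u'(2,3) u'.zero by (intro exI[of _ "\<lambda>x. u' (pr x)"]) auto
  qed
qed

context
  fixes s :: "rat \<Rightarrow> 'v::ab_group_add \<Rightarrow> 'v"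
  assumes vs: "vector_space s"
begin

interpretation V: vector_space s by (rule vs)

lemma cone_of_sum_mem: "(\<And>i. i \<in> J \<Longrightarrow> 0 \<le> c i) \<Longrightarrow> (\<Sum>i\<in>J. s (c i) (w i)) \<in> cone_of s w J"
  unfolding cone_of_def by blast

text \<open>Moving a little from a relatively interior point against the sum \<open>q\<close> of all
  generators stays in the cone, so adding the step back makes all coefficients positive. Conversely,
  positive coefficients absorb a small multiple of any vector of the span.\<close>

lemma relint_cone_of:
  assumes "finite J"
  shows "relint s (cone_of s w J) = {\<Sum>i\<in>J. s (c i) (w i) | c. \<forall>i\<in>J. 0 < c i}" (is "?L = ?R")
proof (intro equalityI subsetI)
  fix x assume x: "x \<in> ?L"
  define q where "q = (\<Sum>i\<in>J. s 1 (w i))"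
  have "q \<in> cone_of s w J" unfolding q_def by (intro cone_of_sum_mem) auto
  then have "- q \<in> V.span (cone_of s w J)" by (intro V.span_neg V.span_base)
  with x obtain \<epsilon> where \<epsilon>: "\<epsilon> > 0" "\<forall>t\<in>{0..\<epsilon>}. x + s t (- q) \<in> cone_of s w J"
    unfolding relint_def by blast
  then have "x + s \<epsilon> (- q) \<in> cone_of s w J" by auto
  then obtain c where c: "x + s \<epsilon> (- q) = (\<Sum>i\<in>J. s (c i) (w i))" "\<forall>i\<in>J. 0 \<le> c i"
    unfolding cone_of_def by auto
  have "x = (\<Sum>i\<in>J. s (c i) (w i)) + s \<epsilon> q" using c(1) by (simp add: V.scale_minus_right algebra_simps)
  also have "\<dots> = (\<Sum>i\<in>J. s (c i + \<epsilon>) (w i))"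
    unfolding q_def by (simp add: V.scale_sum_right V.scale_left_distrib sum.distrib)
  finally show "x \<in> ?R" using c(2) \<epsilon>(1) by (auto intro!: exI[of _ "\<lambda>i. c i + \<epsilon>"] simp: add_nonneg_pos)
next
  fix x assume "x \<in> ?R"
  then obtain c where c: "x = (\<Sum>i\<in>J. s (c i) (w i))" "\<forall>i\<in>J. 0 < c i" by auto
  have "\<exists>\<epsilon>>0. \<forall>t\<in>{0..\<epsilon>}. x + s t v \<in> cone_of s w J" if v: "v \<in> V.span (cone_of s w J)" for v
  proof -
    have "cone_of s w J \<subseteq> V.span (w ` J)"
      unfolding cone_of_def by (auto intro!: V.span_sum V.span_scale intro: V.span_base)
    then have "v \<in> V.span (w ` J)" using v V.span_minimal[OF _ V.subspace_span] by blast
    then have "\<exists>d. v = (\<Sum>i\<in>J. s (d i) (w i))"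
    proof (induction rule: V.span_induct_alt)
      case base
      show ?case by (auto intro!: exI[of _ "\<lambda>_. 0"])
    next
      case (step a x y)
      then obtain d i where d: "y = (\<Sum>i\<in>J. s (d i) (w i))" "i \<in> J" "x = w i" by auto
      have "(\<Sum>j\<in>J. s ((d(i := d i + a)) j) (w j)) = (\<Sum>j\<in>J. s (if j = i then a else 0) (w j) + s (d j) (w j))"
        by (intro sum.cong) (auto simp: V.scale_left_distrib)
      also have "\<dots> = (\<Sum>j\<in>J. (if j = i then s a (w i) else 0) + s (d j) (w j))"
        by (intro sum.cong) auto
      also have "\<dots> = s a x + y" using d assms by (simp add: sum.distrib)
      finally show ?case by metis
    qed
    then obtain d where d: "v = (\<Sum>i\<in>J. s (d i) (w i))" by auto
    obtain \<epsilon> where \<epsilon>: "\<epsilon> > 0" "\<And>i. i \<in> J \<Longrightarrow> \<epsilon> * \<bar>d i\<bar> \<le> c i"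
    proof -
      define \<epsilon> where "\<epsilon> = Min (insert 1 ((\<lambda>i. c i / (\<bar>d i\<bar> + 1)) ` J))"
      have "\<epsilon> > 0" unfolding \<epsilon>_def using assms c(2) by (subst Min_gr_iff) (auto intro!: divide_pos_pos)
      moreover have "\<epsilon> * \<bar>d i\<bar> \<le> c i" if "i \<in> J" for i
      proof -
        have "\<epsilon> \<le> c i / (\<bar>d i\<bar> + 1)" unfolding \<epsilon>_def using assms that by (intro Min_le) auto
        then have "\<epsilon> * (\<bar>d i\<bar> + 1) \<le> c i" by (simp add: pos_le_divide_eq)
        then show ?thesis using \<open>\<epsilon> > 0\<close> by (simp add: algebra_simps)
      qed
      ultimately show thesis using that by blast
    qed
    have "x + s t v \<in> cone_of s w J" if t: "t \<in> {0..\<epsilon>}" for t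
    proof -
      have "x + s t v = (\<Sum>i\<in>J. s (c i + t * d i) (w i))"
        unfolding c(1) d by (simp add: V.scale_sum_right V.scale_left_distrib sum.distrib)
      moreover have "0 \<le> c i + t * d i" if "i \<in> J" for i
      proof -
        have "\<bar>t * d i\<bar> \<le> \<epsilon> * \<bar>d i\<bar>" using t by (simp add: abs_mult mult_right_mono)
        then show ?thesis using \<epsilon>(2)[OF that] by linarith
      qed
      ultimately show ?thesis using cone_of_sum_mem[of J "\<lambda>i. c i + t * d i"] by simp
    qed
    then show ?thesis using \<epsilon>(1) by blast
  qed
  moreover have "x \<in> cone_of s w J" unfolding c(1) using c(2) by (intro cone_of_sum_mem) (simp add: less_imp_le)
  ultimately show "x \<in> ?L" unfolding relint_def by auto
qed

lemma relint_cone_of_nonempty: "finite J \<Longrightarrow> relint s (cone_of s w J) \<noteq> {}"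
  by (subst relint_cone_of) (auto intro!: exI[of _ "\<lambda>_. 1"])

text \<open>The assumption \<open>nosep\<close> says that no proper face of the cone over
  \<open>J\<close> contains all \<open>w i\<close> with \<open>i\<close> in \<open>J0\<close>. By
  Farkas each \<open>w j\<close> then occurs in a nonnegative expression for a multiple of
  \<open>q\<close>, the sum over \<open>J0\<close>. Summing over \<open>j\<close> writes
  \<open>s b' q\<close> with positive coefficients on all of \<open>J\<close>, and a small multiple
  of this is exchanged inside \<open>x\<close>.\<close>

lemma relint_cone_of_mono:
  assumes J: "finite J" "J0 \<subseteq> J"
    and nosep: "\<And>u. Vector_Spaces.linear s (*) u \<Longrightarrow> (\<forall>i\<in>J. 0 \<le> u (w i)) \<Longrightarrow> (\<forall>i\<in>J0. u (w i) = 0) \<Longrightarrow>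
      (\<forall>i\<in>J. u (w i) = (0::rat))"
  shows "relint s (cone_of s w J0) \<subseteq> relint s (cone_of s w J)"
proof
  have J0: "finite J0" using J finite_subset by auto
  define q where "q = (\<Sum>i\<in>J0. w i)"
  \<comment> \<open>\<open>None\<close> indexes the additional generator \<open>- q\<close>.\<close>
  define W where "W i = (case i of None \<Rightarrow> - q | Some i \<Rightarrow> w i)" for i
  have "\<exists>b a. b \<ge> 0 \<and> (\<forall>i\<in>J. 0 \<le> a i) \<and> s b q = w j + (\<Sum>i\<in>J. s (a i) (w i))" if j: "j \<in> J" for j
  proof -
    have "- w j \<in> cone_of s W (insert None (Some ` J))"
    proof (rule ccontr)
      assume "\<not> ?thesis"
      from farkas[OF vs _ this] J obtain u where u: "Vector_Spaces.linear s (*) u"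
        "\<forall>i\<in>insert None (Some ` J). 0 \<le> u (W i)" "u (- w j) < (0::rat)" by auto
      interpret u: Vector_Spaces.linear s "(*)" u by (rule u)
      have pos: "\<forall>i\<in>J. 0 \<le> u (w i)" using u(2) unfolding W_def by auto
      have "u q \<le> 0" using u(2) unfolding W_def by (auto simp: u.neg)
      then have "(\<Sum>i\<in>J0. u (w i)) \<le> 0" unfolding q_def by (simp add: u.sum)
      moreover have nn: "\<forall>i\<in>J0. 0 \<le> u (w i)" using pos J by auto
      ultimately have "(\<Sum>i\<in>J0. u (w i)) = 0" using sum_nonneg[of J0 "\<lambda>i. u (w i)"] by force
      then have "\<forall>i\<in>J0. u (w i) = 0" using nn J0 by (simp add: sum_nonneg_eq_0_iff)
      from nosep[OF u(1) pos this] j u(3) show False by (simp add: u.neg)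
    qed
    then obtain c where c: "- w j = (\<Sum>i\<in>insert None (Some ` J). s (c i) (W i))"
      "\<forall>i\<in>insert None (Some ` J). 0 \<le> c i" unfolding cone_of_def by auto
    have "- w j = - s (c None) q + (\<Sum>i\<in>J. s (c (Some i)) (w i))"
      using c(1) J unfolding W_def by (simp add: sum.reindex V.scale_minus_right)
    then have "s (c None) q = w j + (\<Sum>i\<in>J. s (c (Some i)) (w i))" by (simp add: algebra_simps)
    then show ?thesis using c(2) by (intro exI[of _ "c None"] exI[of _ "\<lambda>i. c (Some i)"]) auto
  qed
  then obtain b a where ba: "\<And>j. j \<in> J \<Longrightarrow> b j \<ge> 0" "\<And>j i. j \<in> J \<Longrightarrow> i \<in> J \<Longrightarrow> 0 \<le> a j i"
    "\<And>j. j \<in> J \<Longrightarrow> s (b j) q = w j + (\<Sum>i\<in>J. s (a j i) (w i))" by metis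
  define b' where "b' = (\<Sum>j\<in>J. b j)"
  define e where "e i = 1 + (\<Sum>j\<in>J. a j i)" for i
  have b': "b' \<ge> 0" unfolding b'_def using ba(1) by (intro sum_nonneg)
  have e: "e i > 0" if "i \<in> J" for i
    unfolding e_def using ba(2) that by (intro add_pos_nonneg sum_nonneg) auto
  have "s b' q = (\<Sum>j\<in>J. w j + (\<Sum>i\<in>J. s (a j i) (w i)))"
    unfolding b'_def V.scale_sum_left by (intro sum.cong) (auto simp: ba(3))
  also have "\<dots> = (\<Sum>i\<in>J. s (e i) (w i))"
    unfolding e_def V.scale_left_distrib sum.distrib V.scale_sum_left
    by (subst (2) sum.swap) simp
  finally have b'q: "s b' q = (\<Sum>i\<in>J. s (e i) (w i))" .
  fix x assume "x \<in> relint s (cone_of s w J0)"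
  then obtain c where c: "x = (\<Sum>i\<in>J0. s (c i) (w i))" "\<forall>i\<in>J0. 0 < c i"
    unfolding relint_cone_of[OF J0] by auto
  obtain \<delta> where \<delta>: "\<delta> > 0" "\<And>i. i \<in> J0 \<Longrightarrow> \<delta> * b' \<le> c i"
  proof -
    define m where "m = Min (insert 1 (c ` J0))"
    have m: "m > 0" unfolding m_def using J0 c(2) by (subst Min_gr_iff) auto
    have "m / (b' + 1) > 0" using m b' by (intro divide_pos_pos) auto
    moreover have "m / (b' + 1) * b' \<le> c i" if "i \<in> J0" for i
    proof -
      have "m / (b' + 1) * b' \<le> m" using m b' by (simp add: field_simps)
      also have "m \<le> c i" unfolding m_def using J0 that by (intro Min_le) auto
      finally show ?thesis .
    qed
    ultimately show thesis using that by blast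
  qed
  \<comment> \<open>The part \<open>\<delta> * b'\<close> of each coefficient over \<open>J0\<close>
    is traded for \<open>\<delta> * e i\<close> over all of \<open>J\<close>.\<close>
  define f where "f i = \<delta> * e i + (if i \<in> J0 then c i - \<delta> * b' else 0)" for i
  have "(\<Sum>i\<in>J. s (f i) (w i)) = s \<delta> (s b' q) + (\<Sum>i\<in>J. s (if i \<in> J0 then c i - \<delta> * b' else 0) (w i))"
    unfolding f_def b'q by (simp add: V.scale_left_distrib sum.distrib V.scale_sum_right)
  also have "(\<Sum>i\<in>J. s (if i \<in> J0 then c i - \<delta> * b' else 0) (w i)) = (\<Sum>i\<in>J0. s (c i - \<delta> * b') (w i))"
    using J by (intro sum.mono_neutral_cong_right) auto
  also have "\<dots> = x - s (\<delta> * b') q"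
    unfolding c(1) q_def by (simp add: V.scale_left_diff_distrib sum_subtractf V.scale_sum_right)
  finally have "x = (\<Sum>i\<in>J. s (f i) (w i))" by simp
  moreover have "\<forall>i\<in>J. f i > 0"
    unfolding f_def using \<delta> e by (auto intro!: add_pos_nonneg)
  ultimately show "x \<in> relint s (cone_of s w J)" unfolding relint_cone_of[OF J(1)] by auto
qed

end

lemma common_denominator:
  fixes c :: "'i \<Rightarrow> rat"
  assumes "finite J"
  shows "\<exists>N::nat. N > 0 \<and> (\<forall>i\<in>J. of_nat N * c i \<in> \<int>)"
  using assms
proof induction
  case empty
  show ?case by (intro exI[of _ 1]) auto
next
  case (insert j J)
  then obtain N :: nat where N: "N > 0" "\<forall>i\<in>J. of_nat N * c i \<in> \<int>" by auto
  obtain a b where ab: "c j = Rat.Fract a b" "b > 0" using Rat_cases by metis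
  define M where "M = N * nat b"
  have e: "(of_nat M :: rat) = of_nat N * of_int b" unfolding M_def using ab by simp
  have "of_nat M * c j = of_nat N * of_int a"
    using ab unfolding e by (simp add: Fract_of_int_quotient)
  then have 1: "of_nat M * c j \<in> \<int>" by (simp del: of_nat_mult)
  have "of_nat M * c i \<in> \<int>" if "i \<in> J" for i
  proof -
    have "(of_nat N * c i) * of_int b \<in> \<int>" 
      using Ints_mult[OF _ Ints_of_int[of b], of "of_nat N * c i"] N(2) that by simp
    then show ?thesis by (simp add: e mult_ac)
  qed
  then show ?case using 1 N ab unfolding M_def by (intro exI[of _ "N * nat b"]) auto
qed

section \<open>Coordinate faces of the orthant\<close>

lemma vector_space_qscale: "vector_space qscale"
  by standard (auto simp: qscale_def fun_eq_iff algebra_simps)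

text \<open>By \<open>face_orthant_iff\<close> these are all faces of the orthant, so that from here
  on faces are handled through their index sets.\<close>

definition coord_face :: "('k, 'r, 'v) bunch_data \<Rightarrow> nat set \<Rightarrow> (nat \<Rightarrow> rat) set" where
  "coord_face B J = {v \<in> orthant B. \<forall>i. v i \<noteq> 0 \<longrightarrow> i \<in> J}"

lemma vec_eq_sum_basis:
  assumes "finite J" "\<And>i. v i \<noteq> 0 \<Longrightarrow> i \<in> J"
  shows "v = (\<Sum>i\<in>J. qscale (v i) (basis_vec i))"
proof
  fix j
  have "(\<Sum>i\<in>J. qscale (v i) (basis_vec i)) j = (\<Sum>i\<in>J. qscale (v i) (basis_vec i) j)"
    using assms(1) by induction auto
  also have "\<dots> = (\<Sum>i\<in>J. if i = j then v j else 0)"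
    by (intro sum.cong) (auto simp: qscale_def basis_vec_def)
  also have "\<dots> = v j" using assms by auto
  finally show "v j = (\<Sum>i\<in>J. qscale (v i) (basis_vec i)) j" by simp
qed

lemma coord_face_eq_cone:
  assumes "J \<subseteq> {..<num B}"
  shows "coord_face B J = cone_of qscale basis_vec J"
proof -
  interpret Q: vector_space qscale by (rule vector_space_qscale)
  have fin: "finite J" using assms finite_subset by auto
  show ?thesis
  proof (intro equalityI subsetI)
    fix v assume v: "v \<in> coord_face B J"
    then have "v = (\<Sum>i\<in>J. qscale (v i) (basis_vec i))"
      by (intro vec_eq_sum_basis fin) (auto simp: coord_face_def)
    then show "v \<in> cone_of qscale basis_vec J" using v
      unfolding cone_of_def coord_face_def orthant_def by (auto intro!: exI[of _ v])
  next
    fix v assume "v \<in> cone_of qscale basis_vec J"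
    then obtain c where c: "v = (\<Sum>i\<in>J. qscale (c i) (basis_vec i))" "\<forall>i\<in>J. 0 \<le> c i"
      unfolding cone_of_def by auto
    define c' where "c' i = (if i \<in> J then c i else 0)" for i
    have "c' = (\<Sum>i\<in>J. qscale (c' i) (basis_vec i))"
      by (intro vec_eq_sum_basis fin) (auto simp: c'_def split: if_splits)
    also have "\<dots> = v" unfolding c(1) c'_def by (intro sum.cong) auto
    finally have "v = c'" ..
    then show "v \<in> coord_face B J"
      using c(2) assms unfolding coord_face_def orthant_def c'_def by (auto split: if_splits)
  qed
qed

lemma relint_coord_face:
  assumes "J \<subseteq> {..<num B}"
  shows "relint qscale (coord_face B J) = {v \<in> coord_face B J. \<forall>i\<in>J. 0 < v i}"
proof -
  interpret Q: vector_space qscale by (rule vector_space_qscale)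
  have fin: "finite J" using assms finite_subset by auto
  have eq: "(\<Sum>i\<in>J. qscale (c i) (basis_vec i)) j = (if j \<in> J then c j else 0)" for c j
  proof -
    have "(\<lambda>j. if j \<in> J then c j else 0) = (\<Sum>i\<in>J. qscale ((\<lambda>j. if j \<in> J then c j else 0) i) (basis_vec i))"
      by (intro vec_eq_sum_basis fin) (auto split: if_splits)
    also have "\<dots> = (\<Sum>i\<in>J. qscale (c i) (basis_vec i))" by (intro sum.cong) auto
    finally show ?thesis by (simp add: fun_eq_iff)
  qed
  show ?thesis
  proof (intro equalityI subsetI)
    fix v assume v: "v \<in> relint qscale (coord_face B J)"
    then have 1: "v \<in> coord_face B J" unfolding relint_def by auto
    from v obtain c where "v = (\<Sum>i\<in>J. qscale (c i) (basis_vec i))" "\<forall>i\<in>J. 0 < c i"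
      unfolding coord_face_eq_cone[OF assms] relint_cone_of[OF vector_space_qscale fin] by auto
    then show "v \<in> {v \<in> coord_face B J. \<forall>i\<in>J. 0 < v i}" using 1 eq by auto
  next
    fix v assume v: "v \<in> {v \<in> coord_face B J. \<forall>i\<in>J. 0 < v i}"
    then have "v = (\<Sum>i\<in>J. qscale (v i) (basis_vec i))"
      by (intro vec_eq_sum_basis fin) (auto simp: coord_face_def)
    with v show "v \<in> relint qscale (coord_face B J)"
      unfolding coord_face_eq_cone[OF assms] relint_cone_of[OF vector_space_qscale fin] by auto
  qed
qed

lemma basis_vec_mem_coord_face:
  "i < num B \<Longrightarrow> basis_vec i \<in> coord_face B J \<longleftrightarrow> i \<in> J"
  unfolding coord_face_def orthant_def basis_vec_def by auto

text \<open>A functional that is nonnegative on the orthant vanishes on one of its vectors exactly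
  if it vanishes on every basis vector that occurs there. Conversely, the sum of the coordinates
  outside \<open>J\<close> cuts out the face of \<open>J\<close>.\<close>

lemma face_orthant_iff:
  "face qscale \<gamma> (orthant B) \<longleftrightarrow> (\<exists>J\<subseteq>{..<num B}. \<gamma> = coord_face B J)"
proof
  assume "face qscale \<gamma> (orthant B)"
  then obtain u where u: "Vector_Spaces.linear qscale (*) u" "\<forall>x\<in>orthant B. 0 \<le> u x"
    "\<gamma> = {x \<in> orthant B. u x = 0}" unfolding face_def by auto
  interpret u: Vector_Spaces.linear qscale "(*)" u by (rule u)
  define J where "J = {i. i < num B \<and> u (basis_vec i) = 0}"
  have nn: "u (basis_vec i) \<ge> 0" if "i < num B" for i
    using u(2) that unfolding orthant_def basis_vec_def by auto
  have ux: "u x = (\<Sum>i<num B. x i * u (basis_vec i))" if "x \<in> orthant B" for x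
  proof -
    have "x = (\<Sum>i<num B. qscale (x i) (basis_vec i))"
      using that by (intro vec_eq_sum_basis) (auto simp: orthant_def not_less[symmetric])
    then have "u x = u (\<Sum>i<num B. qscale (x i) (basis_vec i))" by simp
    then show ?thesis by (simp add: u.sum u.scale)
  qed
  have "u x = 0 \<longleftrightarrow> (\<forall>i. x i \<noteq> 0 \<longrightarrow> i \<in> J)" if x: "x \<in> orthant B" for x
  proof -
    have "u x = 0 \<longleftrightarrow> (\<forall>i<num B. x i * u (basis_vec i) = 0)"
      unfolding ux[OF x] using x nn
      by (subst sum_nonneg_eq_0_iff) (auto simp: orthant_def)
    also have "\<dots> \<longleftrightarrow> (\<forall>i. x i \<noteq> 0 \<longrightarrow> i \<in> J)"
      using x unfolding J_def orthant_def by (auto simp: not_less[symmetric])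
    finally show ?thesis .
  qed
  then have "\<gamma> = coord_face B J" unfolding u(3) coord_face_def by auto
  then show "\<exists>J\<subseteq>{..<num B}. \<gamma> = coord_face B J" unfolding J_def by (auto intro!: exI[of _ J] simp: J_def)
next
  assume "\<exists>J\<subseteq>{..<num B}. \<gamma> = coord_face B J"
  then obtain J where J: "J \<subseteq> {..<num B}" "\<gamma> = coord_face B J" by auto
  define u where "u x = (\<Sum>i\<in>{..<num B} - J. x i)" for x :: "nat \<Rightarrow> rat"
  have "Vector_Spaces.linear qscale (*) u"
    by (rule linear_functionalI[OF vector_space_qscale])
      (simp_all add: u_def qscale_def sum.distrib sum_distrib_left)
  moreover have "\<forall>x\<in>orthant B. 0 \<le> u x" unfolding u_def orthant_def by (auto intro: sum_nonneg)
  moreover have "\<gamma> = {x \<in> orthant B. u x = 0}"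
  proof -
    have "u x = 0 \<longleftrightarrow> (\<forall>i. x i \<noteq> 0 \<longrightarrow> i \<in> J)" if "x \<in> orthant B" for x
      unfolding u_def using that
      by (subst sum_nonneg_eq_0_iff) (auto simp: orthant_def not_less[symmetric])
    then show ?thesis unfolding J coord_face_def by auto
  qed
  ultimately show "face qscale \<gamma> (orthant B)" unfolding face_def by blast
qed

lemma coord_face_mono_iff:
  assumes "J \<subseteq> {..<num B}"
  shows "coord_face B J \<subseteq> coord_face B J' \<longleftrightarrow> J \<subseteq> J'"
proof
  assume "coord_face B J \<subseteq> coord_face B J'"
  then show "J \<subseteq> J'" using assms basis_vec_mem_coord_face by (metis lessThan_iff subsetD subsetI)
qed (auto simp: coord_face_def)

lemma dim_coord_face:
  assumes "J \<subseteq> {..<num B}"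
  shows "vector_space.dim qscale (coord_face B J) = card J"
proof -
  interpret Q: vector_space qscale by (rule vector_space_qscale)
  have fin: "finite J" using assms finite_subset by auto
  have inj: "inj basis_vec" by (rule injI) (metis basis_vec_def zero_neq_one)
  have "\<not> Q.dependent (basis_vec ` J)"
  proof (subst Q.independent_explicit_finite_subsets, intro allI impI ballI)
    fix S u b assume S: "S \<subseteq> basis_vec ` J" "finite S" "(\<Sum>v\<in>S. qscale (u v) v) = 0" "b \<in> S"
    then obtain j where j: "b = basis_vec j" by auto
    have "(\<Sum>v\<in>S. qscale (u v) v) j = (\<Sum>v\<in>S. qscale (u v) v j)"
      using S(2) by induction auto
    also have "\<dots> = (\<Sum>v\<in>S. if v = b then u b else 0)"
    proof (intro sum.cong refl)
      fix v assume "v \<in> S"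
      then obtain i where i: "v = basis_vec i" using S(1) by auto
      show "qscale (u v) v j = (if v = b then u b else 0)"
      proof (cases "i = j")
        case False
        then have "v \<noteq> b" unfolding i j using inj by (simp add: inj_eq)
        then show ?thesis using False unfolding i qscale_def basis_vec_def by simp
      qed (simp add: i j qscale_def basis_vec_def)
    qed
    also have "\<dots> = u b" using S by simp
    finally show "u b = 0" using S(3) by simp
  qed
  moreover have "Q.span (basis_vec ` J) = Q.span (coord_face B J)"
  proof
    show "Q.span (basis_vec ` J) \<subseteq> Q.span (coord_face B J)"
      using assms basis_vec_mem_coord_face by (intro Q.span_mono) auto
    have "coord_face B J \<subseteq> Q.span (basis_vec ` J)"
      unfolding coord_face_eq_cone[OF assms] cone_of_def
      by (auto intro!: Q.span_sum Q.span_scale intro: Q.span_base)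
    then show "Q.span (coord_face B J) \<subseteq> Q.span (basis_vec ` J)"
      by (rule Q.span_minimal[OF _ Q.subspace_span])
  qed
  ultimately have "Q.dim (coord_face B J) = card (basis_vec ` J)" by (metis Q.dim_eq_card)
  also have "\<dots> = card J" using inj by (intro card_image inj_on_subset[OF inj]) simp
  finally show ?thesis .
qed

lemma orthant_eq_coord_face: "orthant B = coord_face B {..<num B}"
  unfolding coord_face_def orthant_def by (auto simp: not_less[symmetric])

lemma facet_orthant:
  assumes "k < num B"
  shows "facet qscale (coord_face B ({..<num B} - {k})) (orthant B)"
proof -
  have "face qscale (coord_face B ({..<num B} - {k})) (orthant B)"
    unfolding face_orthant_iff by (rule exI[of _ "{..<num B} - {k}"]) simp
  moreover have "vector_space.dim qscale (coord_face B ({..<num B} - {k})) + 1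
      = vector_space.dim qscale (orthant B)"
    using assms by (simp add: orthant_eq_coord_face dim_coord_face)
  ultimately show ?thesis unfolding facet_def by (rule conjI)
qed

section \<open>Factorial domains\<close>

lemma comm_monoid_cancel_mult_of: "domain R \<Longrightarrow> comm_monoid_cancel (mult_of R)"
proof -
  assume "domain R"
  then interpret domain R .
  show ?thesis by (rule mult_of.comm_monoid_cancel_axioms)
qed

lemma (in comm_monoid) Units_iff_divides_one:
  "a \<in> carrier G \<Longrightarrow> a \<in> Units G \<longleftrightarrow> a divides \<one>"
  using unit_divides divides_unit Units_one_closed one_closed by blast

definition prime_product :: "('a, 'b) ring_scheme \<Rightarrow> 'a \<Rightarrow> bool" where
  "prime_product R a \<longleftrightarrow> (\<exists>ps. set ps \<subseteq> carrier (mult_of R) \<and> (\<forall>p\<in>set ps. Divisibility.prime (mult_of R) p) \<and>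
     foldr (\<otimes>\<^bsub>R\<^esub>) ps \<one>\<^bsub>R\<^esub> \<sim>\<^bsub>mult_of R\<^esub> a)"

text \<open>Factorizations into primes are unique up to associates, so their existence is all that
  has to be checked. An irreducible element is associated to the first factor of its prime
  factorization, hence prime, and the primeness condition yields uniqueness.\<close>

lemma factorial_domain_iff_prime_product:
  "factorial_domain R \<longleftrightarrow> domain R \<and> (\<forall>a\<in>carrier (mult_of R). prime_product R a)"
proof (intro iffI conjI ballI; (elim conjE)?)
  assume "factorial_domain R"
  then interpret factorial_domain R .
  show "domain R" by (rule domain_axioms)
  fix a assume a: "a \<in> carrier (mult_of R)"
  from factorial_monoid.wfactors_exist[OF factorial_monoid_axioms this]
  obtain fs where fs: "set fs \<subseteq> carrier (mult_of R)" "wfactors (mult_of R) fs a" by auto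
  have "Divisibility.prime (mult_of R) p" if "p \<in> set fs" for p
  proof -
    have "Divisibility.irreducible (mult_of R) p" using fs(2) that unfolding wfactors_def by blast
    then show ?thesis
      using primeness_condition_monoid.irreducible_prime[OF factorial_monoid.primeness_condition[OF factorial_monoid_axioms]]
        fs(1) that by (meson subsetD)
  qed
  moreover have "foldr (\<otimes>\<^bsub>R\<^esub>) fs \<one>\<^bsub>R\<^esub> \<sim>\<^bsub>mult_of R\<^esub> a"
    using fs(2) unfolding wfactors_def by (simp add: mult_of_def)
  ultimately show "prime_product R a" unfolding prime_product_def using fs(1) by blast
next
  assume "domain R" and pp: "\<forall>a\<in>carrier (mult_of R). prime_product R a"
  interpret M: comm_monoid_cancel "mult_of R" by (rule comm_monoid_cancel_mult_of) fact
  have wf: "\<exists>fs. set fs \<subseteq> carrier (mult_of R) \<and> wfactors (mult_of R) fs a \<and> (\<forall>p\<in>set fs. Divisibility.prime (mult_of R) p)"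
    if a: "a \<in> carrier (mult_of R)" for a
  proof -
    obtain ps where ps: "set ps \<subseteq> carrier (mult_of R)" "\<forall>p\<in>set ps. Divisibility.prime (mult_of R) p"
      "foldr (\<otimes>\<^bsub>R\<^esub>) ps \<one>\<^bsub>R\<^esub> \<sim>\<^bsub>mult_of R\<^esub> a"
      using pp a unfolding prime_product_def by blast
    have "Divisibility.irreducible (mult_of R) p" if "p \<in> set ps" for p
      using M.prime_irreducible ps that by auto
    then have "wfactors (mult_of R) ps a" unfolding wfactors_def using ps(3) by (simp add: mult_of_def)
    then show ?thesis using ps by blast
  qed
  have "primeness_condition_monoid (mult_of R)"
  proof (intro primeness_condition_monoid.intro primeness_condition_monoid_axioms.intro)
    show "comm_monoid_cancel (mult_of R)" by (rule M.comm_monoid_cancel_axioms)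
    fix a assume a: "a \<in> carrier (mult_of R)" "Divisibility.irreducible (mult_of R) a"
    then obtain ps where ps: "set ps \<subseteq> carrier (mult_of R)" "wfactors (mult_of R) ps a"
      "\<forall>p\<in>set ps. Divisibility.prime (mult_of R) p" using wf by blast
    have nu: "a \<notin> Units (mult_of R)" using a(2) unfolding Divisibility.irreducible_def by simp
    show "Divisibility.prime (mult_of R) a"
    proof (cases ps)
      case Nil
      then have "\<one>\<^bsub>mult_of R\<^esub> \<sim>\<^bsub>mult_of R\<^esub> a" using ps(2) unfolding wfactors_def by simp
      then have "a \<in> Units (mult_of R)" using M.Units_one_closed M.Units_cong a(1) by blast
      then show ?thesis using nu by simp
    next
      case (Cons p qs)
      have carr: "p \<in> carrier (mult_of R)" "set qs \<subseteq> carrier (mult_of R)" using ps(1) Cons by auto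
      define m where "m = foldr (\<otimes>\<^bsub>mult_of R\<^esub>) qs \<one>\<^bsub>mult_of R\<^esub>"
      have m: "m \<in> carrier (mult_of R)" unfolding m_def using M.multlist_closed[OF carr(2)] .
      have as: "p \<otimes>\<^bsub>mult_of R\<^esub> m \<sim>\<^bsub>mult_of R\<^esub> a"
        using ps(2) Cons unfolding wfactors_def m_def by simp
      have "p divides\<^bsub>mult_of R\<^esub> p \<otimes>\<^bsub>mult_of R\<^esub> m" 
        by (rule M.divides_prod_r[OF M.divides_refl[OF carr(1)] carr(1) m])
      then have pd: "p divides\<^bsub>mult_of R\<^esub> a" using M.divides_cong_r as carr m a(1) M.m_closed by blast
      have "p \<notin> Units (mult_of R)" using ps(3) Cons unfolding Divisibility.prime_def by auto
      then have "p \<sim>\<^bsub>mult_of R\<^esub> a"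
        using pd a(2) carr(1) unfolding Divisibility.irreducible_def properfactor_def associated_def by blast
      moreover have "Divisibility.prime (mult_of R) p" using ps(3) Cons by simp
      ultimately show ?thesis using M.prime_cong carr(1) a(1) by blast
    qed
  qed
  then interpret PC: primeness_condition_monoid "mult_of R" .
  have "factorial_monoid (mult_of R)"
  proof (rule M.factorial_monoidI)
    fix a assume "a \<in> carrier (mult_of R)"
    then show "\<exists>fs. set fs \<subseteq> carrier (mult_of R) \<and> wfactors (mult_of R) fs a" using wf by blast
  next
    fix a fs fs'
    assume "a \<in> carrier (mult_of R)" "set fs \<subseteq> carrier (mult_of R)" "set fs' \<subseteq> carrier (mult_of R)"
      "wfactors (mult_of R) fs a" "wfactors (mult_of R) fs' a"
    then show "essentially_equal (mult_of R) fs fs'" using PC.wfactors_unique by blast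
  qed
  then show "factorial_domain R" unfolding factorial_domain_def using \<open>domain R\<close> by blast
qed

lemma factorial_domain_iso:
  assumes "factorial_domain R" "domain S" and h: "h \<in> ring_iso R S"
  shows "factorial_domain S"
proof -
  interpret R: factorial_domain R by fact
  interpret S: domain S by fact
  have hom: "h \<in> ring_hom R S" and bij: "bij_betw h (carrier R) (carrier S)"
    using h unfolding ring_iso_def by auto
  have h0: "h \<zero>\<^bsub>R\<^esub> = \<zero>\<^bsub>S\<^esub>" using ring_hom_zero[OF hom R.ring_axioms S.ring_axioms] .
  have h1: "h \<one>\<^bsub>R\<^esub> = \<one>\<^bsub>S\<^esub>" using hom by (rule ring_hom_one)
  have hm: "h (a \<otimes>\<^bsub>R\<^esub> b) = h a \<otimes>\<^bsub>S\<^esub> h b" if "a \<in> carrier R" "b \<in> carrier R" for a b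
    using hom that by (rule ring_hom_mult)
  let ?M = "mult_of R" and ?N = "mult_of S"
  have bij': "bij_betw h (carrier ?M) (carrier ?N)"
    using bij h0 unfolding bij_betw_def
    by (auto simp: inj_on_def)
  have memN: "h a \<in> carrier ?N" if "a \<in> carrier ?M" for a using bij' that bij_betwE by blast
  have inj: "h a = h b \<longleftrightarrow> a = b" if "a \<in> carrier ?M" "b \<in> carrier ?M" for a b
    using bij' that unfolding bij_betw_def inj_on_def by blast
  have preim: "\<exists>a\<in>carrier ?M. b = h a" if "b \<in> carrier ?N" for b
    using bij' that unfolding bij_betw_def by blast
  have hM: "h (a \<otimes>\<^bsub>?M\<^esub> b) = h a \<otimes>\<^bsub>?N\<^esub> h b" if "a \<in> carrier ?M" "b \<in> carrier ?M" for a b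
    using hm that by simp
  have cl: "a \<otimes>\<^bsub>?M\<^esub> b \<in> carrier ?M" if "a \<in> carrier ?M" "b \<in> carrier ?M" for a b
    using that R.integral by auto
  have dv: "h a divides\<^bsub>?N\<^esub> h b \<longleftrightarrow> a divides\<^bsub>?M\<^esub> b" if ab: "a \<in> carrier ?M" "b \<in> carrier ?M" for a b
  proof
    assume "h a divides\<^bsub>?N\<^esub> h b"
    then obtain c where c: "c \<in> carrier ?N" "h b = h a \<otimes>\<^bsub>?N\<^esub> c" unfolding factor_def by blast
    then obtain c' where c': "c' \<in> carrier ?M" "c = h c'" using preim by blast
    then have "h b = h (a \<otimes>\<^bsub>?M\<^esub> c')" using c hM[OF ab(1) c'(1)] by simp
    then have "b = a \<otimes>\<^bsub>?M\<^esub> c'" using inj[OF ab(2) cl[OF ab(1) c'(1)]] by simp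
    then show "a divides\<^bsub>?M\<^esub> b" using c'(1) unfolding factor_def by blast
  next
    assume "a divides\<^bsub>?M\<^esub> b"
    then obtain c where "c \<in> carrier ?M" "b = a \<otimes>\<^bsub>?M\<^esub> c" unfolding factor_def by blast
    then show "h a divides\<^bsub>?N\<^esub> h b" unfolding factor_def using hM[OF ab(1)] memN by blast
  qed
  have one: "\<one>\<^bsub>?M\<^esub> \<in> carrier ?M" by simp
  have un: "h a \<in> Units ?N \<longleftrightarrow> a \<in> Units ?M" if a: "a \<in> carrier ?M" for a
  proof -
    have "a \<in> Units ?M \<longleftrightarrow> a divides\<^bsub>?M\<^esub> \<one>\<^bsub>?M\<^esub>"
      using a by (intro comm_monoid.Units_iff_divides_one comm_monoid_cancel.axioms
          comm_monoid_cancel_mult_of R.domain_axioms)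
    moreover have "h a \<in> Units ?N \<longleftrightarrow> h a divides\<^bsub>?N\<^esub> \<one>\<^bsub>?N\<^esub>"
      using memN[OF a] by (intro comm_monoid.Units_iff_divides_one comm_monoid_cancel.axioms
          comm_monoid_cancel_mult_of S.domain_axioms)
    moreover have "h \<one>\<^bsub>?M\<^esub> = \<one>\<^bsub>?N\<^esub>" using h1 by simp
    ultimately show ?thesis using dv[OF a one] by simp
  qed
  have pr: "Divisibility.prime ?N (h p)" if p: "p \<in> carrier ?M" "Divisibility.prime ?M p" for p
    unfolding Divisibility.prime_def
  proof (intro conjI ballI impI)
    show "h p \<notin> Units ?N" using un p unfolding Divisibility.prime_def by blast
    fix x y assume xy: "x \<in> carrier ?N" "y \<in> carrier ?N" "h p divides\<^bsub>?N\<^esub> x \<otimes>\<^bsub>?N\<^esub> y"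
    then obtain a b where ab: "a \<in> carrier ?M" "b \<in> carrier ?M" "x = h a" "y = h b" using preim by blast
    have "p divides\<^bsub>?M\<^esub> a \<otimes>\<^bsub>?M\<^esub> b" using xy(3) dv[OF p(1) cl[OF ab(1,2)]] hM[OF ab(1,2)] ab by simp
    then have "p divides\<^bsub>?M\<^esub> a \<or> p divides\<^bsub>?M\<^esub> b" using p(2) ab unfolding Divisibility.prime_def by blast
    then show "h p divides\<^bsub>?N\<^esub> x \<or> h p divides\<^bsub>?N\<^esub> y" using dv p(1) ab by blast
  qed
  have "prime_product S b" if b: "b \<in> carrier ?N" for b
  proof -
    obtain a where a: "a \<in> carrier ?M" "b = h a" using preim[OF b] by blast
    have "factorial_domain R" by fact
    then have "prime_product R a" using a unfolding factorial_domain_iff_prime_product by blast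
    then obtain ps where ps: "set ps \<subseteq> carrier ?M" "\<forall>p\<in>set ps. Divisibility.prime ?M p"
      "foldr (\<otimes>\<^bsub>R\<^esub>) ps \<one>\<^bsub>R\<^esub> \<sim>\<^bsub>?M\<^esub> a" unfolding prime_product_def by blast
    have fold: "foldr (\<otimes>\<^bsub>R\<^esub>) ps \<one>\<^bsub>R\<^esub> \<in> carrier ?M \<and>
        h (foldr (\<otimes>\<^bsub>R\<^esub>) ps \<one>\<^bsub>R\<^esub>) = foldr (\<otimes>\<^bsub>S\<^esub>) (map h ps) \<one>\<^bsub>S\<^esub>"
      using ps(1)
    proof (induction ps)
      case Nil
      then show ?case using h1 by simp
    next
      case (Cons p ps)
      then show ?case using cl[of p "foldr (\<otimes>\<^bsub>R\<^esub>) ps \<one>\<^bsub>R\<^esub>"] hM[of p "foldr (\<otimes>\<^bsub>R\<^esub>) ps \<one>\<^bsub>R\<^esub>"]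
        by simp
    qed
    have "foldr (\<otimes>\<^bsub>S\<^esub>) (map h ps) \<one>\<^bsub>S\<^esub> \<sim>\<^bsub>?N\<^esub> b"
      using ps(3) fold dv a unfolding associated_def by metis
    moreover have "set (map h ps) \<subseteq> carrier ?N" "\<forall>p\<in>set (map h ps). Divisibility.prime ?N p"
      using ps(1,2) memN pr by auto
    ultimately show ?thesis unfolding prime_product_def by blast
  qed
  then show ?thesis unfolding factorial_domain_iff_prime_product using assms(2) by blast
qed

section \<open>Graded factorial rings\<close>

lemma ring_on_simps [simp]: "carrier (ring_on A) = A" "mult (ring_on A) = (*)"
  "one (ring_on A) = 1" "zero (ring_on A) = 0" "add (ring_on A) = (+)"
  by (simp_all add: ring_on_def)

text \<open>Brings the factoriality of HOL-Algebra into the language of \<open>prime_elem\<close>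
  and \<open>dvd\<close>; later factorization arguments in R go through this rule.\<close>

lemma prime_factor_induct [consumes 2, case_names unit prime]:
  fixes a :: "'r::idom"
  assumes fd: "factorial_domain (ring_on (UNIV :: 'r set))" and a: "a \<noteq> 0"
    and unit: "\<And>u. u dvd 1 \<Longrightarrow> Q u"
    and prime: "\<And>q b. prime_elem q \<Longrightarrow> b \<noteq> 0 \<Longrightarrow> Q b \<Longrightarrow> Q (q * b)"
  shows "Q a"
proof -
  let ?M = "mult_of (ring_on (UNIV :: 'r set))"
  have dv: "x divides\<^bsub>?M\<^esub> y \<longleftrightarrow> x dvd y" if "y \<noteq> 0" for x y
    using that unfolding factor_def dvd_def by (auto simp: mult_of_def)
  have un: "x \<in> Units ?M \<longleftrightarrow> x dvd 1" for x
    unfolding Units_def dvd_def by (auto simp: mult_of_def mult.commute) 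
  have pr: "prime_elem q" if "Divisibility.prime ?M q" "q \<noteq> 0" for q
  proof (rule prime_elemI)
    show "q \<noteq> 0" by fact
    show "\<not> q dvd 1" using that un unfolding Divisibility.prime_def by auto
    fix x y assume xy: "q dvd x * y"
    show "q dvd x \<or> q dvd y"
    proof (cases "x = 0 \<or> y = 0")
      case False
      then have "q divides\<^bsub>?M\<^esub> (x \<otimes>\<^bsub>?M\<^esub> y)" using xy dv by (simp add: mult_of_def)
      then have "q divides\<^bsub>?M\<^esub> x \<or> q divides\<^bsub>?M\<^esub> y"
        using that(1) False unfolding Divisibility.prime_def by (auto simp: mult_of_def)
      then show ?thesis using dv False by auto
    qed auto
  qed
  have "a \<in> carrier ?M" using a by (simp add: mult_of_def)
  then have "prime_product (ring_on UNIV) a"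
    using fd unfolding factorial_domain_iff_prime_product by blast
  then obtain ps where ps: "set ps \<subseteq> carrier ?M" "\<forall>p\<in>set ps. Divisibility.prime ?M p"
    "foldr (*) ps 1 \<sim>\<^bsub>?M\<^esub> a" unfolding prime_product_def by auto
  have Qu: "Q (v * b)" if "v dvd 1" "b \<noteq> 0" "Q b" "\<And>u. u dvd 1 \<Longrightarrow> Q (u * b)" for v b
    using that by blast
  \<comment> \<open>The claim carries a unit \<open>u\<close>, because \<open>a\<close> agrees with
    the product of primes only up to a unit.\<close>
  have fold: "foldr (*) ps 1 \<noteq> 0 \<and> (\<forall>u. u dvd 1 \<longrightarrow> Q (u * foldr (*) ps 1))"
    using ps(1,2)
  proof (induction ps)
    case Nil
    then show ?case using unit by simp
  next
    case (Cons p ps)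
    then have p: "prime_elem p" using pr by (auto simp: mult_of_def)
    have IH: "foldr (*) ps 1 \<noteq> 0" "\<And>u. u dvd 1 \<Longrightarrow> Q (u * foldr (*) ps 1)" using Cons by auto
    have "Q (u * (p * foldr (*) ps 1))" if u: "u dvd 1" for u
    proof -
      have "u * foldr (*) ps 1 \<noteq> 0" using u IH(1) by auto
      then have "Q (p * (u * foldr (*) ps 1))" using prime[OF p] IH(2)[OF u] by blast
      then show ?thesis by (simp add: mult_ac)
    qed
    then show ?case using IH(1) p by (auto simp: prime_elem_def)
  qed
  have "foldr (*) ps 1 dvd a" "a dvd foldr (*) ps 1"
    using ps(3) dv a fold unfolding associated_def by auto
  then obtain c d where cd: "a = foldr (*) ps 1 * c" "foldr (*) ps 1 = a * d" unfolding dvd_def by blast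
  then have "a * (d * c) = a * 1" by (simp add: mult_ac)
  then have "d * c = 1" using a by (simp only: mult_cancel_left) simp
  then have "c dvd 1" by (metis dvd_triv_right)
  then show ?thesis using fold cd(1) by (simp add: mult.commute)
qed

locale bunched =
  fixes B :: "('k::{alg_closed_field, field_char_0}, 'r::idom, 'v::ab_group_add) bunch_data"
  assumes bunched: "bunched_ring B"
begin

abbreviation "\<iota> \<equiv> emb B"
abbreviation "s \<equiv> scl B"
abbreviation "L \<equiv> lat B"
abbreviation "H \<equiv> hcomp B"
abbreviation "f \<equiv> gen B"
abbreviation "r \<equiv> num B"
abbreviation "w i \<equiv> deg B (f i)"

lemma graded: "graded_algebra B" and faithful: "int_span s {w \<in> L. H w \<noteq> {0}} = L"
  and ufd: "factorial_domain (ring_on (UNIV :: 'r set))"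
  and gen_prime: "i < r \<Longrightarrow> prime_elem (f i)"
  and gen_homog: "i < r \<Longrightarrow> \<exists>d\<in>L. f i \<in> H d"
  and gen_nonassoc: "i < r \<Longrightarrow> j < r \<Longrightarrow> i \<noteq> j \<Longrightarrow> \<not> (f i dvd f j \<and> f j dvd f i)"
  and gen_generate: "alg_gen \<iota> (f ` {..<r}) = UNIV"
  and bunch_F: "F_bunch B"
  using bunched unfolding bunched_ring_def faithfully_graded_def by auto

lemma str: "structure_map \<iota>" and latt: "lattice_in s L"
  and H0 [simp]: "d \<in> L \<Longrightarrow> 0 \<in> H d" and H_add: "d \<in> L \<Longrightarrow> a \<in> H d \<Longrightarrow> b \<in> H d \<Longrightarrow> a + b \<in> H d"
  and H_emb: "d \<in> L \<Longrightarrow> a \<in> H d \<Longrightarrow> \<iota> c * a \<in> H d"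
  and H_1: "1 \<in> H 0"
  and H_mult: "d \<in> L \<Longrightarrow> e \<in> L \<Longrightarrow> a \<in> H d \<Longrightarrow> b \<in> H e \<Longrightarrow> a * b \<in> H (d + e)"
  and H_decomp: "\<exists>!c. finite {d. c d \<noteq> 0} \<and> {d. c d \<noteq> 0} \<subseteq> L \<and> (\<forall>d\<in>L. c d \<in> H d) \<and>
        a = (\<Sum>d | c d \<noteq> 0. c d)"
  using graded unfolding graded_algebra_def by auto

sublocale V: vector_space s
  using latt unfolding lattice_in_def by blast

sublocale R: subalgebra \<iota> UNIV
  by standard (auto simp: str)

lemma scale_of_int_mem_lat: "d \<in> L \<Longrightarrow> s (of_int n) d \<in> L"
  and lat_add: "d \<in> L \<Longrightarrow> e \<in> L \<Longrightarrow> d + e \<in> L"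
  and lat_0 [simp]: "0 \<in> L"
proof -
  obtain Bs where Bs: "finite Bs" "L = int_span s Bs" using latt unfolding lattice_in_def by blast
  have L: "L = {\<Sum>x\<in>Bs. s (of_int (c x)) x | c. True}"
  proof (intro equalityI subsetI)
    fix d assume "d \<in> L"
    then obtain F c where F: "finite F" "F \<subseteq> Bs" "d = (\<Sum>x\<in>F. s (of_int (c x)) x)"
      unfolding Bs int_span_def by blast
    have "(\<Sum>x\<in>Bs. s (of_int (if x \<in> F then c x else 0)) x) = d"
      unfolding F(3) using F Bs(1) by (intro sum.mono_neutral_cong_right) auto
    from this[symmetric] show "d \<in> {\<Sum>x\<in>Bs. s (of_int (c x)) x | c. True}"
      by (intro CollectI exI[of _ "\<lambda>x. if x \<in> F then c x else 0"] conjI TrueI)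
  next
    fix d assume "d \<in> {\<Sum>x\<in>Bs. s (of_int (c x)) x | c. True}"
    then obtain c where "d = (\<Sum>x\<in>Bs. s (of_int (c x)) x)" by auto
    then show "d \<in> L" unfolding Bs(2) int_span_def
      by (intro CollectI exI[of _ Bs] exI[of _ c]) (simp add: Bs(1))
  qed
  show "s (of_int n) d \<in> L" if d: "d \<in> L"
  proof -
    obtain c where c: "d = (\<Sum>x\<in>Bs. s (of_int (c x)) x)" using d unfolding L by blast
    have "s (of_int n) d = (\<Sum>x\<in>Bs. s (of_int (n * c x)) x)"
      unfolding c by (simp add: V.scale_sum_right)
    then show ?thesis unfolding L by (intro CollectI exI[of _ "\<lambda>x. n * c x"] conjI TrueI)
  qed
  show "d + e \<in> L" if de: "d \<in> L" "e \<in> L"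
  proof -
    obtain c c' where c: "d = (\<Sum>x\<in>Bs. s (of_int (c x)) x)" "e = (\<Sum>x\<in>Bs. s (of_int (c' x)) x)"
      using de unfolding L by blast
    have "d + e = (\<Sum>x\<in>Bs. s (of_int (c x + c' x)) x)"
      unfolding c by (simp add: V.scale_left_distrib sum.distrib)
    then show ?thesis unfolding L by (intro CollectI exI[of _ "\<lambda>x. c x + c' x"] conjI TrueI)
  qed
  show "0 \<in> L" unfolding L by (intro CollectI exI[of _ "\<lambda>_. 0"]) simp
qed

lemma lat_neg: "d \<in> L \<Longrightarrow> - d \<in> L"
  using scale_of_int_mem_lat[of d "-1"] by simp

lemma lat_sum: "(\<And>i. i \<in> I \<Longrightarrow> g i \<in> L) \<Longrightarrow> sum g I \<in> L"
  by (induction I rule: infinite_finite_induct) (auto intro: lat_add)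

lemma lat_scale_of_nat: "d \<in> L \<Longrightarrow> s (of_nat n) d \<in> L"
  using scale_of_int_mem_lat[of d "int n"] by simp

text \<open>It suffices to clear the denominators on a finite basis. This turns rational functionals
  into integral exponents for characters.\<close>

lemma integral_functional:
  assumes u: "Vector_Spaces.linear s (*) u"
  shows "\<exists>N::nat. N > 0 \<and> (\<forall>d\<in>L. of_nat N * u d \<in> \<int>)"
proof -
  interpret u: Vector_Spaces.linear s "(*)" u by (rule u)
  obtain Bs where Bs: "finite Bs" "L = int_span s Bs" using latt unfolding lattice_in_def by blast
  obtain N :: nat where N: "N > 0" "\<forall>b\<in>Bs. of_nat N * u b \<in> \<int>" using common_denominator[OF Bs(1)] by blast
  have "of_nat N * u d \<in> \<int>" if "d \<in> L" for d
  proof -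
    obtain F c where F: "finite F" "F \<subseteq> Bs" "d = (\<Sum>x\<in>F. s (of_int (c x)) x)"
      using \<open>d \<in> L\<close> unfolding Bs int_span_def by blast
    have "of_nat N * u d = (\<Sum>x\<in>F. of_int (c x) * (of_nat N * u x))"
      unfolding F(3) u.sum u.scale sum_distrib_left by (intro sum.cong refl) (rule mult.left_commute)
    also have "\<dots> \<in> \<int>"
    proof (rule Ints_sum)
      fix x assume "x \<in> F"
      then have "of_nat N * u x \<in> \<int>" using N F by blast
      then show "of_int (c x) * (of_nat N * u x) \<in> \<int>" by (rule Ints_mult[OF Ints_of_int])
    qed
    finally show ?thesis .
  qed
  with N show ?thesis by blast
qed

section \<open>Homogeneous components and homogeneous factors\<close>

definition cmp :: "'r \<Rightarrow> 'v \<Rightarrow> 'r" where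
  "cmp a = (THE c. finite {d. c d \<noteq> 0} \<and> {d. c d \<noteq> 0} \<subseteq> L \<and> (\<forall>d\<in>L. c d \<in> H d) \<and>
        a = (\<Sum>d | c d \<noteq> 0. c d))"

definition supp :: "'r \<Rightarrow> 'v set" where "supp a = {d. cmp a d \<noteq> 0}"

lemma cmp_props: "finite (supp a)" "supp a \<subseteq> L" "d \<in> L \<Longrightarrow> cmp a d \<in> H d" "a = (\<Sum>d\<in>supp a. cmp a d)"
  using theI'[OF H_decomp[of a]] unfolding cmp_def[symmetric] supp_def by auto

lemma supp_lat: "d \<in> supp a \<Longrightarrow> d \<in> L" and cmp_mem: "d \<in> supp a \<Longrightarrow> cmp a d \<in> H d"
  using cmp_props(2)[of a] cmp_props(3)[of d a] by auto

lemma cmp_unique: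
  assumes "finite I" "I \<subseteq> L" "\<And>d. d \<in> I \<Longrightarrow> c d \<in> H d" "\<And>d. d \<notin> I \<Longrightarrow> c d = 0" "a = (\<Sum>d\<in>I. c d)"
  shows "cmp a = c"
  unfolding cmp_def
proof (rule the1_equality[OF H_decomp], intro conjI ballI)
  have sub: "{d. c d \<noteq> 0} \<subseteq> I" using assms(4) by blast
  show "finite {d. c d \<noteq> 0}" "{d. c d \<noteq> 0} \<subseteq> L" using sub assms(1,2) finite_subset by blast+
  show "c d \<in> H d" if "d \<in> L" for d using assms(3,4)[of d] that by (cases "d \<in> I") auto
  show "a = (\<Sum>d | c d \<noteq> 0. c d)"
    unfolding assms(5) using assms(1) sub by (intro sum.mono_neutral_right) auto
qed

lemma cmp_outside: "d \<notin> supp a \<Longrightarrow> cmp a d = 0" unfolding supp_def by simp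

lemma sum_cmp: "finite I \<Longrightarrow> supp a \<subseteq> I \<Longrightarrow> (\<Sum>d\<in>I. cmp a d) = a"
  using cmp_props(4)[of a] by (subst sum.mono_neutral_right[of I "supp a"]) (auto simp: cmp_outside)

lemma cmp_add: "cmp (a + b) d = cmp a d + cmp b d"
proof -
  have "cmp (a + b) = (\<lambda>d. cmp a d + cmp b d)"
  proof (rule cmp_unique[of "supp a \<union> supp b"])
    show "finite (supp a \<union> supp b)" "supp a \<union> supp b \<subseteq> L" using cmp_props(1,2) by auto
    show "cmp a d + cmp b d \<in> H d" if "d \<in> supp a \<union> supp b" for d
    proof -
      have "d \<in> L" using that supp_lat by auto
      then show ?thesis by (intro H_add cmp_props(3))
    qed
    show "a + b = (\<Sum>d\<in>supp a \<union> supp b. cmp a d + cmp b d)"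
      using cmp_props(1) by (simp add: sum.distrib sum_cmp)
  qed (auto simp: cmp_outside)
  then show ?thesis by simp
qed

lemma cmp_homog:
  assumes "d \<in> L" "a \<in> H d"
  shows "cmp a e = (if e = d then a else 0)"
proof -
  have "cmp a = (\<lambda>e. if e = d then a else 0)"
    by (rule cmp_unique[of "{d}"]) (use assms in auto)
  then show ?thesis by simp
qed

lemma cmp_0 [simp]: "cmp 0 d = 0"
  using cmp_homog[of 0 0] by simp

lemma cmp_sum: "cmp (sum g I) d = (\<Sum>i\<in>I. cmp (g i) d)"
  by (induction I rule: infinite_finite_induct) (auto simp: cmp_add)

lemma H_unique: "d \<in> L \<Longrightarrow> e \<in> L \<Longrightarrow> a \<in> H d \<Longrightarrow> a \<in> H e \<Longrightarrow> a \<noteq> 0 \<Longrightarrow> d = e"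
  using cmp_homog[of d a d] cmp_homog[of e a d] by (auto split: if_splits)

lemma H_cmp_iff: "d \<in> L \<Longrightarrow> a \<in> H d \<longleftrightarrow> cmp a d = a"
  using cmp_homog[of d a d] cmp_props(3)[of d a] by auto

lemma H_neg: "d \<in> L \<Longrightarrow> a \<in> H d \<Longrightarrow> - a \<in> H d"
  using H_emb[of d a "- 1"] by (simp add: R.str_neg)

lemma H_diff: "d \<in> L \<Longrightarrow> a \<in> H d \<Longrightarrow> b \<in> H d \<Longrightarrow> a - b \<in> H d"
  using H_add[of d a "- b"] H_neg[of d b] by simp

lemma cmp_diff: "cmp (a - b) d = cmp a d - cmp b d"
  using cmp_add[of "a - b" b d] by (simp add: algebra_simps)

lemma H_power: "d \<in> L \<Longrightarrow> a \<in> H d \<Longrightarrow> a ^ n \<in> H (s (of_nat n) d)"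
proof (induction n)
  case (Suc n)
  then show ?case using H_mult[of d "s (of_nat n) d" a "a ^ n"] lat_scale_of_nat
    by (simp add: V.scale_left_distrib)
qed (simp add: H_1)

lemma H_emb_0: "\<iota> c \<in> H 0"
  using H_emb[of 0 1 c] H_1 by simp

lemma cmp_mult: "cmp (a * b) d = (\<Sum>x\<in>supp a. \<Sum>y\<in>supp b. if d = x + y then cmp a x * cmp b y else 0)"
proof -
  have "a * b = (\<Sum>x\<in>supp a. \<Sum>y\<in>supp b. cmp a x * cmp b y)"
    by (subst (1) cmp_props(4)[of a], subst (1) cmp_props(4)[of b]) (rule sum_product)
  then have "cmp (a * b) d = (\<Sum>x\<in>supp a. \<Sum>y\<in>supp b. cmp (cmp a x * cmp b y) d)"
    by (simp only: cmp_sum)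
  also have "\<dots> = (\<Sum>x\<in>supp a. \<Sum>y\<in>supp b. if d = x + y then cmp a x * cmp b y else 0)"
  proof (intro sum.cong refl)
    fix x y assume "x \<in> supp a" "y \<in> supp b"
    then have xy: "x \<in> L" "y \<in> L" using cmp_props(2) by auto
    show "cmp (cmp a x * cmp b y) d = (if d = x + y then cmp a x * cmp b y else 0)"
      by (rule cmp_homog[OF lat_add[OF xy] H_mult[OF xy cmp_props(3)[OF xy(1)] cmp_props(3)[OF xy(2)]]])
  qed
  finally show ?thesis .
qed

lemma supp_mult: "d \<in> supp (a * b) \<Longrightarrow> \<exists>x\<in>supp a. \<exists>y\<in>supp b. d = x + y"
proof (rule ccontr)
  assume d: "d \<in> supp (a * b)" and no: "\<not> (\<exists>x\<in>supp a. \<exists>y\<in>supp b. d = x + y)"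
  have "cmp (a * b) d = 0" unfolding cmp_mult by (intro sum.neutral ballI) (use no in auto)
  then show False using d unfolding supp_def by simp
qed

lemma supp_add: "supp (a + b) \<subseteq> supp a \<union> supp b"
  unfolding supp_def by (auto simp: cmp_add)

lemma supp_nonempty: "a \<noteq> 0 \<Longrightarrow> supp a \<noteq> {}"
  using cmp_props(4)[of a] by auto

lemma supp_sum_cmp:
  assumes "I \<subseteq> supp a"
  shows "supp (\<Sum>d\<in>I. cmp a d) = I"
proof -
  have "cmp (\<Sum>d\<in>I. cmp a d) e = (if e \<in> I then cmp a e else 0)" for e
  proof -
    have fin: "finite I" using assms cmp_props(1) finite_subset by blast
    have "cmp (\<Sum>d\<in>I. cmp a d) e = (\<Sum>d\<in>I. if e = d then cmp a d else 0)"
      unfolding cmp_sum using assms by (intro sum.cong refl cmp_homog supp_lat[of _ a] cmp_mem) auto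
    also have "\<dots> = (if e \<in> I then cmp a e else 0)" using fin by simp
    finally show ?thesis .
  qed
  then show ?thesis using assms unfolding supp_def by auto
qed

text \<open>The parts of \<open>a\<close> and \<open>b\<close> of highest weight under
  \<open>u\<close> have a nonzero product, R being a domain, and no other products reach that
  weight. So it survives in \<open>a * b\<close>, which has only the degree
  \<open>d\<close>.\<close>

lemma extreme_weights:
  assumes u: "Vector_Spaces.linear s (*) u" and d: "d \<in> L" "a * b \<in> H d" "a * b \<noteq> 0"
  shows "\<exists>x\<in>supp a. \<exists>y\<in>supp b. (\<forall>x'\<in>supp a. u x' \<le> u x) \<and> (\<forall>y'\<in>supp b. u y' \<le> u y) \<and>
    u d = u x + (u y :: rat)"
proof -
  interpret u: Vector_Spaces.linear s "(*)" u by (rule u)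
  have top: "\<exists>x\<in>supp a. \<forall>x'\<in>supp a. u x' \<le> u x" if "a \<noteq> 0" for a
  proof -
    have fin: "finite (u ` supp a)" "u ` supp a \<noteq> {}" using cmp_props(1) supp_nonempty[OF that] by auto
    obtain x where "x \<in> supp a" "u x = Max (u ` supp a)" using Max_in[OF fin] by auto
    then show ?thesis using Max_ge[OF fin(1)] by (intro bexI[of _ x]) auto
  qed
  obtain x y where x: "x \<in> supp a" "\<forall>x'\<in>supp a. u x' \<le> u x" and y: "y \<in> supp b" "\<forall>y'\<in>supp b. u y' \<le> u y"
    using top[of a] top[of b] d(3) by auto
  have split: "\<exists>a1 a2. a = a1 + a2 \<and> a1 \<noteq> 0 \<and> (\<forall>e\<in>supp a1. u e = u x) \<and> (\<forall>e\<in>supp a2. u e < u x)"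
    if x: "x \<in> supp a" "\<forall>x'\<in>supp a. u x' \<le> u x" for a x
  proof -
    define I where "I = {e \<in> supp a. u e = u x}"
    have I: "I \<subseteq> supp a" "supp a - I \<subseteq> supp a" unfolding I_def by auto
    have "a = (\<Sum>d\<in>I. cmp a d) + (\<Sum>d\<in>supp a - I. cmp a d)"
      using sum.subset_diff[OF I(1) cmp_props(1), of "cmp a"] cmp_props(4)[of a] by (simp add: add.commute)
    moreover have "(\<Sum>d\<in>I. cmp a d) \<noteq> 0"
      using supp_sum_cmp[OF I(1)] x(1) by (auto simp: I_def supp_def)
    moreover have "\<forall>e\<in>supp (\<Sum>d\<in>I. cmp a d). u e = u x" unfolding supp_sum_cmp[OF I(1)] by (simp add: I_def)
    moreover have "\<forall>e\<in>supp (\<Sum>d\<in>supp a - I. cmp a d). u e < u x"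
      unfolding supp_sum_cmp[OF I(2)] using x(2) by (auto simp: I_def less_le)
    ultimately show ?thesis by blast
  qed
  obtain a1 a2 where a: "a = a1 + a2" "a1 \<noteq> 0" "\<forall>e\<in>supp a1. u e = u x" "\<forall>e\<in>supp a2. u e < u x"
    using split[OF x] by blast
  obtain b1 b2 where b: "b = b1 + b2" "b1 \<noteq> 0" "\<forall>e\<in>supp b1. u e = u y" "\<forall>e\<in>supp b2. u e < u y"
    using split[OF y] by blast
  define rest where "rest = a1 * b2 + (a2 * b1 + a2 * b2)"
  have ab: "a * b = a1 * b1 + rest" unfolding a(1) b(1) rest_def by (simp add: algebra_simps)
  have lt: "u e < u x + u y" if "e \<in> supp rest" for e
  proof -
    have "e \<in> supp (a1 * b2) \<or> e \<in> supp (a2 * b1) \<or> e \<in> supp (a2 * b2)"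
      using that supp_add unfolding rest_def by blast
    then show ?thesis
    proof (elim disjE)
      assume "e \<in> supp (a1 * b2)"
      from supp_mult[OF this] a b show ?thesis by (auto simp: u.add)
    next
      assume "e \<in> supp (a2 * b1)"
      from supp_mult[OF this] a b show ?thesis by (auto simp: u.add)
    next
      assume "e \<in> supp (a2 * b2)"
      then obtain x' y' where "x' \<in> supp a2" "y' \<in> supp b2" "e = x' + y'" using supp_mult by blast
      moreover have "u x' < u x" "u y' < u y" using calculation a(4) b(4) by auto
      ultimately show ?thesis by (simp add: u.add add_strict_mono)
    qed
  qed
  have "a1 * b1 \<noteq> 0" using a b by simp
  then obtain e where e: "e \<in> supp (a1 * b1)" using supp_nonempty by blast
  from supp_mult[OF e] a b have ue: "u e = u x + u y" by (auto simp: u.add)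
  have "e \<notin> supp rest" using lt ue by force
  then have "cmp (a * b) e \<noteq> 0" using e unfolding ab cmp_add supp_def by simp
  then have "e = d" using cmp_homog[OF d(1,2), of e] by (simp split: if_splits)
  then show ?thesis using x y ue by blast
qed

text \<open>The highest and the lowest weights of the factors add up to those of the product, which
  coincide. A functional with different values on two degrees of \<open>a\<close> would keep them
  apart.\<close>

lemma factor_homog:
  assumes d: "d \<in> L" "a * b \<in> H d" "a * b \<noteq> 0"
  shows "\<exists>e\<in>L. a \<in> H e"
proof -
  have a0: "a \<noteq> 0" using d by auto
  have eq: "x = y" if xy: "x \<in> supp a" "y \<in> supp a" for x y
  proof (rule ccontr)
    assume "x \<noteq> y"
    then have "x - y \<noteq> 0" by simp
    then obtain u
      where u: "Vector_Spaces.linear s (*) u" "u (x - y) = (1::rat)"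
      using linear_functional_exists[OF V.vector_space_axioms] by metis
    interpret u: Vector_Spaces.linear s "(*)" u by (rule u)
    have u': "Vector_Spaces.linear s (*) (\<lambda>x. - u x)"
      by (rule linear_functionalI[OF V.vector_space_axioms]) (simp_all add: u.add u.scale)
    obtain x1 y1 where 1: "x1 \<in> supp a" "y1 \<in> supp b" "\<forall>x'\<in>supp a. u x' \<le> u x1"
      "\<forall>y'\<in>supp b. u y' \<le> u y1" "u d = u x1 + u y1"
      using extreme_weights[OF u(1) d] by blast
    obtain x2 y2 where 2: "x2 \<in> supp a" "y2 \<in> supp b" "\<forall>x'\<in>supp a. - u x' \<le> - u x2"
      "\<forall>y'\<in>supp b. - u y' \<le> - u y2" "- u d = - u x2 + - u y2"
      using extreme_weights[OF u' d] by blast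
    have "u x1 \<ge> u x" "u x2 \<le> u y" "u y1 \<ge> u y2" using 1 2 xy by auto
    moreover have "u x = u y + 1" using u(2) by (simp add: u.diff)
    moreover have "u y1 \<ge> u y2" "u x1 \<ge> u x2" using 1 2 by auto
    moreover have "u x \<le> u x1" "u x2 \<le> u x" "u x2 \<le> u y" using 1 2 xy by auto
    ultimately show False using 1(5) 2(5) by linarith
  qed
  obtain e where e: "e \<in> supp a" using supp_nonempty[OF a0] by blast
  then have "supp a = {e}" using eq by blast
  then have "a = cmp a e" using cmp_props(4)[of a] by simp
  then have "a \<in> H e" using cmp_mem[OF e] by simp
  then show ?thesis using supp_lat[OF e] by blast
qed

lemma dvd_homog:
  assumes "a dvd b" "d \<in> L" "b \<in> H d" "b \<noteq> 0"
  shows "\<exists>e\<in>L. a \<in> H e"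
  using assms factor_homog unfolding dvd_def by blast

lemma gen_deg: "i < r \<Longrightarrow> w i \<in> L \<and> f i \<in> H (w i)"
proof -
  assume i: "i < r"
  obtain d where d: "d \<in> L" "f i \<in> H d" using gen_homog[OF i] by blast
  have "f i \<noteq> 0" using gen_prime[OF i] by (simp add: prime_elem_def)
  have "w i = d" unfolding deg_def
    by (rule the_equality) (use d H_unique \<open>f i \<noteq> 0\<close> in auto)
  then show ?thesis using d by simp
qed

lemma gen_nonzero: "i < r \<Longrightarrow> f i \<noteq> 0"
  using gen_prime by (auto simp: prime_elem_def)

end

lemma cring_ring_on:
  fixes A :: "'a::comm_ring_1 set"
  assumes "0 \<in> A" "1 \<in> A" "\<And>a b. a \<in> A \<Longrightarrow> b \<in> A \<Longrightarrow> a + b \<in> A"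
    "\<And>a. a \<in> A \<Longrightarrow> - a \<in> A" "\<And>a b. a \<in> A \<Longrightarrow> b \<in> A \<Longrightarrow> a * b \<in> A"
  shows "cring (ring_on A)"
proof (rule cringI)
  show "abelian_group (ring_on A)"
  proof (rule abelian_groupI)
    fix x assume "x \<in> carrier (ring_on A)"
    then show "\<exists>y\<in>carrier (ring_on A). y \<oplus>\<^bsub>ring_on A\<^esub> x = \<zero>\<^bsub>ring_on A\<^esub>"
      using assms(4) by (intro bexI[of _ "- x"]) auto
  qed (use assms in \<open>auto simp: algebra_simps\<close>)
  show "Group.comm_monoid (ring_on A)"
    by (rule comm_monoidI) (use assms in \<open>auto simp: algebra_simps\<close>)
qed (use assms in \<open>auto simp: algebra_simps\<close>)

context bunched
begin

section \<open>Factorization in R\<close>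

lemma prime_list:
  assumes "a \<noteq> (0::'r)"
  shows "\<exists>u qs. u dvd 1 \<and> (\<forall>q\<in>set qs. prime_elem q) \<and> a = u * prod_list qs"
  using ufd assms
proof (induction a rule: prime_factor_induct)
  case (unit u)
  then show ?case by (intro exI[of _ u] exI[of _ "[]"]) auto
next
  case (prime q b)
  then obtain u qs where "u dvd 1" "\<forall>q\<in>set qs. prime_elem q" "b = u * prod_list qs" by blast
  with prime(1) show ?case by (intro exI[of _ u] exI[of _ "q # qs"]) (auto simp: mult_ac)
qed

lemma prime_elem_assoc:
  fixes p q :: 'r
  assumes "prime_elem p" "prime_elem q" "p dvd q"
  shows "q dvd p"
proof -
  obtain c where c: "q = p * c" using assms(3) by (rule dvdE)
  have "\<not> p dvd 1" "q \<noteq> 0" "\<not> q dvd 1" using assms by (auto simp: prime_elem_def)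
  have "q dvd p \<or> q dvd c" using assms(2) c by (metis dvd_refl prime_elem_dvd_multD)
  moreover have "\<not> q dvd c"
  proof
    assume "q dvd c"
    then obtain e where e: "c = q * e" by (rule dvdE)
    have "q * (p * e) = p * c" unfolding e by (simp only: mult_ac)
    also have "\<dots> = q * 1" using c by simp
    finally have "q * (p * e) = q * 1" .
    then have "p * e = 1" using \<open>q \<noteq> 0\<close> by (simp only: mult_cancel_left) simp
    then show False using \<open>\<not> p dvd 1\<close> by (metis dvd_triv_left)
  qed
  ultimately show ?thesis by blast
qed

lemma prime_dvd_prod:
  fixes q :: 'r
  assumes q: "prime_elem q"
  shows "q dvd prod g I \<Longrightarrow> \<exists>i\<in>I. q dvd g i"
proof (induction I rule: infinite_finite_induct)
  case (insert i I)
  then show ?case using prime_elem_dvd_mult_iff[OF q] by auto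
qed (use q in \<open>auto simp: prime_elem_def\<close>)

text \<open>Going through the prime factors of \<open>b\<close>, each is cancelled if it divides the
  numerator and kept in the denominator otherwise.\<close>

lemma coprime_fraction:
  fixes a b :: 'r
  assumes "b \<noteq> 0"
  shows "\<exists>g a' b'. a = g * a' \<and> b = g * b' \<and> g \<noteq> 0 \<and> \<not> (\<exists>q. prime_elem q \<and> q dvd a' \<and> q dvd b')"
  using ufd assms
proof (induction b arbitrary: a rule: prime_factor_induct)
  case (unit u)
  have "\<not> q dvd u" if "prime_elem q" for q using that unit dvd_trans by (auto simp: prime_elem_def)
  then show ?case by (intro exI[of _ 1] exI[of _ a] exI[of _ u]) auto
next
  case (prime q b)
  show ?case
  proof (cases "q dvd a")
    case True
    then obtain a1 where a1: "a = q * a1" by (rule dvdE)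
    obtain g a' b' where "a1 = g * a'" "b = g * b'" "g \<noteq> 0"
      "\<not> (\<exists>q. prime_elem q \<and> q dvd a' \<and> q dvd b')" using prime.IH[of a1] by blast
    then show ?thesis using a1 prime.hyps
      by (intro exI[of _ "q * g"] exI[of _ a'] exI[of _ b']) (auto simp: mult_ac prime_elem_def)
  next
    case False
    obtain g a' b' where g: "a = g * a'" "b = g * b'" "g \<noteq> 0"
      "\<not> (\<exists>q. prime_elem q \<and> q dvd a' \<and> q dvd b')" using prime.IH[of a] by blast
    have "\<not> (p dvd a' \<and> p dvd q * b')" if p: "prime_elem p" for p
    proof
      assume *: "p dvd a' \<and> p dvd q * b'"
      then have "p dvd q" using g(4) p by (auto simp: prime_elem_dvd_mult_iff)
      then have "q dvd p" using prime_elem_assoc p prime.hyps(1) by blast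
      with * have "q dvd a'" by (blast intro: dvd_trans)
      then have "q dvd a" unfolding g(1) by (rule dvd_mult)
      then show False using False by simp
    qed
    then show ?thesis using g
      by (intro exI[of _ g] exI[of _ a'] exI[of _ "q * b'"]) (auto simp: mult_ac)
  qed
qed

lemma coprime_dvd:
  fixes a b d :: 'r
  assumes "b \<noteq> 0" "\<not> (\<exists>q. prime_elem q \<and> q dvd a \<and> q dvd b)" "b dvd a * d"
  shows "b dvd d"
  using ufd assms
proof (induction b arbitrary: d rule: prime_factor_induct)
  case (unit u)
  then show ?case using dvd_trans[OF unit(1) one_dvd] by simp
next
  case (prime q b)
  have "\<not> q dvd a" using prime.hyps(1) prime.prems(1) by auto
  moreover have "q dvd a * d" using dvd_mult_left[OF prime.prems(2)] .
  ultimately have "q dvd d" using prime_elem_dvd_multD[OF prime.hyps(1)] by blast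
  then obtain d1 where d1: "d = q * d1" by (rule dvdE)
  have q0: "q \<noteq> 0" using prime.hyps(1) by (simp add: prime_elem_def)
  have "q * b dvd q * (a * d1)" using prime.prems(2) unfolding d1 by (simp add: mult_ac)
  then have 1: "b dvd a * d1" using q0 by simp
  have 2: "\<not> (\<exists>p. prime_elem p \<and> p dvd a \<and> p dvd b)" using prime.prems(1) by (auto intro: dvd_mult)
  have "b dvd d1" by (rule prime.IH[OF 2 1])
  then show ?case unfolding d1 by simp
qed

section \<open>Points of Spec R and vanishing\<close>

abbreviation "Z \<equiv> alg_homs \<iota>"

context
  fixes z assumes z: "z \<in> Z"
begin

lemma pt_emb [simp]: "z (\<iota> c) = c" and pt_add [simp]: "z (a + b) = z a + z b"
  and pt_mult [simp]: "z (a * b) = z a * z b"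
  using z unfolding alg_homs_def by auto

lemma pt_0 [simp]: "z 0 = 0" and pt_1 [simp]: "z 1 = 1"
  using pt_emb[of 0] pt_emb[of 1] by auto

lemma pt_neg [simp]: "z (- a) = - z a"
  using pt_add[of a "- a"] by (simp add: eq_neg_iff_add_eq_0 add.commute)

lemma pt_diff [simp]: "z (a - b) = z a - z b"
  using pt_add[of a "- b"] by simp

lemma pt_power [simp]: "z (a ^ n) = z a ^ n"
  by (induction n) auto

lemma pt_sum: "z (sum g I) = (\<Sum>i\<in>I. z (g i))"
  by (induction I rule: infinite_finite_induct) auto

lemma pt_prod: "z (prod g I) = (\<Prod>i\<in>I. z (g i))"
  by (induction I rule: infinite_finite_induct) auto

lemma pt_unit: "a dvd 1 \<Longrightarrow> z a \<noteq> 0"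
  by (elim dvdE) (metis mult_zero_left pt_1 pt_mult zero_neq_one)

lemma pt_prod_list: "z (prod_list qs) = prod_list (map z qs)"
  by (induction qs) auto

lemma pt_dvd: "a dvd b \<Longrightarrow> z a = 0 \<Longrightarrow> z b = 0"
  unfolding dvd_def by auto

end

lemma exists_pt_nonzero: "a \<noteq> 0 \<Longrightarrow> \<exists>z\<in>Z. z a \<noteq> 0"
  using nullstellensatz_nonzero[OF str _ gen_generate] by simp

text \<open>Principal open sets are dense because R is a domain: a nonzero \<open>a * b\<close> does
  not vanish at some point.\<close>

lemma vanish_open:
  assumes "b \<noteq> 0" "\<And>z. z \<in> Z \<Longrightarrow> z b \<noteq> 0 \<Longrightarrow> z a = 0"
  shows "a = 0"
proof (rule ccontr)
  assume "a \<noteq> 0"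
  then have "a * b \<noteq> 0" using assms(1) by simp
  then obtain z where "z \<in> Z" "z (a * b) \<noteq> 0" using exists_pt_nonzero by blast
  then show False using assms(2)[of z] by auto
qed

lemma exists_pt_on_prime:
  assumes "prime_elem q" "\<not> q dvd a"
  shows "\<exists>z\<in>Z. z q = 0 \<and> z a \<noteq> 0"
  using nullstellensatz_prime_elem[OF str _ gen_generate assms] by simp

text \<open>The same density inside the zero set of \<open>q\<close>: if \<open>q\<close> divides
  neither \<open>a\<close> nor \<open>b\<close>, then it does not divide \<open>a * b\<close>, which
  is therefore nonzero at some zero of \<open>q\<close>.\<close>

lemma vanish_on_prime:
  assumes "prime_elem q" "\<not> q dvd b" "\<And>z. z \<in> Z \<Longrightarrow> z q = 0 \<Longrightarrow> z b \<noteq> 0 \<Longrightarrow> z a = 0"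
  shows "q dvd a"
proof (rule ccontr)
  assume "\<not> q dvd a"
  then have "\<not> q dvd a * b" using assms(1,2) by (simp add: prime_elem_dvd_mult_iff)
  then obtain z where "z \<in> Z" "z q = 0" "z (a * b) \<noteq> 0" using exists_pt_on_prime assms(1) by blast
  then show False using assms(3)[of z] by auto
qed

abbreviation "evals \<equiv> range (\<lambda>a z. z a) :: (('r \<Rightarrow> 'k) \<Rightarrow> 'k) set"

lemma openin_Xbar: "openin (top_of (Xbar B)) U \<longleftrightarrow> (\<exists>F. U = {z \<in> Z. \<exists>a\<in>F. z a \<noteq> 0})"
proof -
  have "istopology (zariski_open Z evals)"
  proof (rule istopology_zariski_open)
    fix g h assume "g \<in> evals" "h \<in> evals"
    then obtain a b where "g = (\<lambda>z. z a)" "h = (\<lambda>z. z b)" by auto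
    then show "\<exists>e\<in>evals. \<forall>y\<in>Z. e y = g y * h y"
      by (intro bexI[of _ "\<lambda>z. z (a * b)"]) auto
  qed
  then have "openin (top_of (Xbar B)) U \<longleftrightarrow> zariski_open Z evals U"
    unfolding Xbar_def zariski_space_def by (simp add: topology_inverse')
  also have "\<dots> \<longleftrightarrow> (\<exists>F. U = {z \<in> Z. \<exists>a\<in>F. z a \<noteq> 0})"
  proof
    assume "zariski_open Z evals U"
    then obtain G where G: "G \<subseteq> evals" "U = {z \<in> Z. \<exists>g\<in>G. g z \<noteq> 0}" unfolding zariski_open_def by blast
    have "U = {z \<in> Z. \<exists>a\<in>{a. (\<lambda>z. z a) \<in> G}. z a \<noteq> 0}" unfolding G(2) using G(1) by auto
    then show "\<exists>F. U = {z \<in> Z. \<exists>a\<in>F. z a \<noteq> 0}" by blast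
  next
    assume "\<exists>F. U = {z \<in> Z. \<exists>a\<in>F. z a \<noteq> 0}"
    then obtain F where "U = {z \<in> Z. \<exists>a\<in>F. z a \<noteq> 0}" by blast
    then show "zariski_open Z evals U"
      unfolding zariski_open_def by (intro exI[of _ "(\<lambda>a z. z a) ` F"]) auto
  qed
  finally show ?thesis .
qed

lemma reg_Xbar: "h \<in> reg (Xbar B) U \<longleftrightarrow> (\<forall>z\<in>U. \<exists>V a b. openin (top_of (Xbar B)) V \<and> z \<in> V \<and> V \<subseteq> U \<and>
  (\<forall>y\<in>V. y b \<noteq> 0 \<and> h y = y a / y b))"
proof -
  have o: "openin (top_of (Xbar B)) V \<longleftrightarrow> zariski_open Z evals V" for V
  proof
    assume "openin (top_of (Xbar B)) V"
    then obtain F where "V = {z \<in> Z. \<exists>a\<in>F. z a \<noteq> 0}" unfolding openin_Xbar by blast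
    then show "zariski_open Z evals V"
      unfolding zariski_open_def by (intro exI[of _ "(\<lambda>a z. z a) ` F"]) auto
  next
    assume "zariski_open Z evals V"
    then obtain G where G: "G \<subseteq> evals" "V = {z \<in> Z. \<exists>g\<in>G. g z \<noteq> 0}" unfolding zariski_open_def by blast
    have "V = {z \<in> Z. \<exists>a\<in>{a. (\<lambda>z. z a) \<in> G}. z a \<noteq> 0}" unfolding G(2) using G(1) by auto
    then show "openin (top_of (Xbar B)) V" unfolding openin_Xbar by blast
  qed
  show ?thesis unfolding o unfolding Xbar_def zariski_space_def by simp
qed

section \<open>The torus action\<close>

lemma torus_mult: "\<chi> \<in> torus B \<Longrightarrow> d \<in> L \<Longrightarrow> e \<in> L \<Longrightarrow> \<chi> (d + e) = \<chi> d * \<chi> e"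
  and torus_0 [simp]: "\<chi> \<in> torus B \<Longrightarrow> \<chi> 0 = 1"
  unfolding torus_def by auto

lemma torus_nonzero: "\<chi> \<in> torus B \<Longrightarrow> d \<in> L \<Longrightarrow> \<chi> d \<noteq> 0"
  using torus_mult[of \<chi> d "- d"] lat_neg[of d] by auto

lemma torus_prod: "\<chi> \<in> torus B \<Longrightarrow> \<chi>' \<in> torus B \<Longrightarrow> (\<lambda>d. \<chi> d * \<chi>' d) \<in> torus B"
  unfolding torus_def by auto

lemma torus_one: "(\<lambda>d. 1) \<in> torus B"
  unfolding torus_def by auto

text \<open>Scaling the component of degree \<open>d\<close> by \<open>\<kappa> d\<close> only has
  to be multiplicative where \<open>z\<close> does not vanish. This covers both the torus action,
  where \<open>\<kappa>\<close> is a character, and the degeneration in \<open>limit_point\<close>,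
  where it is the indicator of the zero set of a functional.\<close>

lemma multiplicative_extension:
  fixes z :: "'r \<Rightarrow> 'k" and \<kappa> :: "'v \<Rightarrow> 'k"
  assumes z: "z \<in> Z" and k0: "\<kappa> 0 = 1"
    and km: "\<And>d e a b. d \<in> L \<Longrightarrow> e \<in> L \<Longrightarrow> a \<in> H d \<Longrightarrow> b \<in> H e \<Longrightarrow> z (a * b) \<noteq> 0 \<Longrightarrow> \<kappa> (d + e) = \<kappa> d * \<kappa> e"
  shows "(\<lambda>a. \<Sum>d\<in>supp a. \<kappa> d * z (cmp a d)) \<in> Z"
proof -
  define z' where "z' a = (\<Sum>d\<in>supp a. \<kappa> d * z (cmp a d))" for a
  have z'_eq: "z' a = (\<Sum>d\<in>I. \<kappa> d * z (cmp a d))" if "finite I" "supp a \<subseteq> I" for I a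
    unfolding z'_def using that cmp_outside z
    by (intro sum.mono_neutral_left) auto
  have hom: "z' a = \<kappa> d * z a" if d: "d \<in> L" "a \<in> H d" for d a
  proof -
    have "supp a \<subseteq> {d}" unfolding supp_def using cmp_homog[OF d] by auto
    then have "z' a = (\<Sum>d\<in>{d}. \<kappa> d * z (cmp a d))" by (intro z'_eq) auto
    then show ?thesis using cmp_homog[OF d, of d] by simp
  qed
  have add: "z' (a + b) = z' a + z' b" for a b
  proof -
    let ?I = "supp a \<union> supp b"
    have "finite ?I" using cmp_props(1) by auto
    then have "z' (a + b) = (\<Sum>d\<in>?I. \<kappa> d * z (cmp (a + b) d))" "z' a = (\<Sum>d\<in>?I. \<kappa> d * z (cmp a d))"
      "z' b = (\<Sum>d\<in>?I. \<kappa> d * z (cmp b d))"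
      using supp_add by (auto intro!: z'_eq)
    then show ?thesis using z by (simp add: cmp_add sum.distrib algebra_simps)
  qed
  have z'0: "z' 0 = 0" using hom[of 0 0] z by simp
  have z'sum: "z' (sum g I) = (\<Sum>i\<in>I. z' (g i))" for g and I :: "'v set"
    by (induction I rule: infinite_finite_induct) (auto simp: add z'0)
  have mult: "z' (a * b) = z' a * z' b" for a b
  proof -
    have "a * b = (\<Sum>x\<in>supp a. \<Sum>y\<in>supp b. cmp a x * cmp b y)"
      by (subst (1) cmp_props(4)[of a], subst (1) cmp_props(4)[of b]) (rule sum_product)
    then have "z' (a * b) = (\<Sum>x\<in>supp a. \<Sum>y\<in>supp b. z' (cmp a x * cmp b y))"
      by (simp only: z'sum)
    also have "\<dots> = (\<Sum>x\<in>supp a. \<Sum>y\<in>supp b. (\<kappa> x * z (cmp a x)) * (\<kappa> y * z (cmp b y)))"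
    proof (intro sum.cong refl)
      fix x y assume xy: "x \<in> supp a" "y \<in> supp b"
      then have L: "x \<in> L" "y \<in> L" using supp_lat by auto
      have "z' (cmp a x * cmp b y) = \<kappa> (x + y) * z (cmp a x * cmp b y)"
        by (rule hom[OF lat_add[OF L] H_mult[OF L cmp_mem[OF xy(1)] cmp_mem[OF xy(2)]]])
      then show "z' (cmp a x * cmp b y) = (\<kappa> x * z (cmp a x)) * (\<kappa> y * z (cmp b y))"
        using km[OF L cmp_mem[OF xy(1)] cmp_mem[OF xy(2)]] z
        by (cases "z (cmp a x * cmp b y) = 0") auto
    qed
    also have "\<dots> = z' a * z' b" unfolding z'_def by (rule sum_product[symmetric])
    finally show ?thesis .
  qed
  have "z' (\<iota> c) = c" for c
    using hom[OF lat_0 H_emb_0[of c]] k0 z by simp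
  then have "z' \<in> Z" unfolding alg_homs_def using add mult by auto
  then show ?thesis unfolding z'_def .
qed

abbreviation "act \<equiv> torus_act B"

text \<open>A point is determined by its values on homogeneous elements, so the description in
  \<open>torus_act_def\<close> has exactly one solution, namely the sum in
  \<open>act_eq\<close>.\<close>

lemma act:
  assumes "\<chi> \<in> torus B" "z \<in> Z"
  shows act_mem: "act \<chi> z \<in> Z" and act_homog: "d \<in> L \<Longrightarrow> a \<in> H d \<Longrightarrow> act \<chi> z a = \<chi> d * z a"
    and act_eq: "act \<chi> z a = (\<Sum>d\<in>supp a. \<chi> d * z (cmp a d))"
proof -
  define z' where "z' a = (\<Sum>d\<in>supp a. \<chi> d * z (cmp a d))" for a
  have z': "z' \<in> Z"
    unfolding z'_def using assms torus_mult by (intro multiplicative_extension) auto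
  have hom: "z' a = \<chi> d * z a" if d: "d \<in> L" "a \<in> H d" for d a
  proof (cases "a = 0")
    case False
    have "supp a = {d}" unfolding supp_def using cmp_homog[OF d] False by auto
    then show ?thesis unfolding z'_def using cmp_homog[OF d, of d] by simp
  qed (use z' assms in simp)
  have uniq: "y = z'" if y: "y \<in> Z" "\<forall>d\<in>L. \<forall>a\<in>H d. y a = \<chi> d * z a" for y
  proof
    fix a
    have "y a = y (\<Sum>d\<in>supp a. cmp a d)" using cmp_props(4)[of a] by simp
    also have "\<dots> = (\<Sum>d\<in>supp a. \<chi> d * z (cmp a d))"
      unfolding pt_sum[OF y(1)] using y(2) supp_lat cmp_mem by (intro sum.cong refl) blast
    finally show "y a = z' a" unfolding z'_def .
  qed
  have "act \<chi> z = z'" unfolding torus_act_def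
  proof (rule the_equality)
    show "z' \<in> Z \<and> (\<forall>d\<in>L. \<forall>a\<in>H d. z' a = \<chi> d * z a)" using z' hom by simp
    fix y assume "y \<in> Z \<and> (\<forall>d\<in>L. \<forall>a\<in>H d. y a = \<chi> d * z a)"
    then show "y = z'" by (elim conjE) (rule uniq)
  qed
  then show "act \<chi> z \<in> Z" "d \<in> L \<Longrightarrow> a \<in> H d \<Longrightarrow> act \<chi> z a = \<chi> d * z a"
    "act \<chi> z a = (\<Sum>d\<in>supp a. \<chi> d * z (cmp a d))"
    using z' hom by (simp_all add: z'_def)
qed

lemma act_eq_on:
  assumes "\<chi> \<in> torus B" "z \<in> Z" "finite I" "supp a \<subseteq> I"
  shows "act \<chi> z a = (\<Sum>d\<in>I. \<chi> d * z (cmp a d))"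
  unfolding act_eq[OF assms(1,2)] using assms cmp_outside by (intro sum.mono_neutral_left) auto

lemma separating_character:
  assumes "d \<in> L" "e \<in> L" "d \<noteq> e"
  shows "\<exists>\<chi>\<in>torus B. \<chi> d \<noteq> \<chi> e"
proof -
  have "d - e \<noteq> 0" using assms by simp
  then obtain u where u: "Vector_Spaces.linear s (*) u" "u (d - e) = (1::rat)"
    using linear_functional_exists[OF V.vector_space_axioms] by metis
  interpret u: Vector_Spaces.linear s "(*)" u by (rule u)
  obtain N :: nat where N: "N > 0" "\<forall>d\<in>L. of_nat N * u d \<in> \<int>" using integral_functional[OF u(1)] by blast
  define l where "l x = \<lfloor>of_nat N * u x\<rfloor>" for x
  have l: "of_int (l x) = of_nat N * u x" if "x \<in> L" for x
    using N(2) that unfolding l_def by (auto elim: Ints_cases)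
  have l_add: "l (x + y) = l x + l y" if "x \<in> L" "y \<in> L" for x y
  proof -
    have "(of_int (l (x + y)) :: rat) = of_int (l x + l y)"
      using that l lat_add by (simp add: u.add algebra_simps)
    then show ?thesis by (simp only: of_int_eq_iff)
  qed
  have l0: "l 0 = 0" unfolding l_def by (simp add: u.zero)
  have lde: "l d \<noteq> l e"
  proof
    assume "l d = l e"
    then have "of_nat N * u d = of_nat N * u e" using l[OF assms(1)] l[OF assms(2)] by metis
    then show False using N(1) u(2) by (auto simp: u.diff)
  qed
  \<comment> \<open>Powers of 2 with different exponents differ in characteristic zero, so this
    character separates whatever \<open>l\<close> separates.\<close>
  define \<chi> :: "'v \<Rightarrow> 'k" where "\<chi> x = 2 powi (l x)" for x
  have t: "\<chi> \<in> torus B"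
    unfolding torus_def \<chi>_def using l_add l0 by (auto simp: power_int_add)
  have ne1: "(2::'k) powi n \<noteq> 1" if "n > 0" for n :: int
  proof
    assume "(2::'k) powi n = 1"
    then have "(2::'k) ^ nat n = 1" using that by (simp add: power_int_def)
    then have "of_nat (2 ^ nat n) = (of_nat 1 :: 'k)" by simp
    then have "(2::nat) ^ nat n = 1" by (simp only: of_nat_eq_iff)
    then show False using that by simp
  qed
  have "\<chi> d \<noteq> \<chi> e"
  proof
    assume eq: "\<chi> d = \<chi> e"
    have *: "(2::'k) powi (l d - l e) = 1" "(2::'k) powi (l e - l d) = 1"
      using eq unfolding \<chi>_def by (simp_all add: power_int_diff)
    show False using * ne1[of "l d - l e"] ne1[of "l e - l d"] lde by (cases "l d > l e") auto
  qed
  with t show ?thesis by blast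
qed

text \<open>Artin's argument: the relation twisted by a character \<open>\<psi>\<close> with
  \<open>\<psi> d \<noteq> \<psi> e\<close>, minus \<open>\<psi> e\<close> times the relation
  itself, no longer involves \<open>e\<close>.\<close>

theorem characters_independent:
  assumes "finite I" "I \<subseteq> L" "\<And>\<chi>. \<chi> \<in> torus B \<Longrightarrow> (\<Sum>d\<in>I. \<chi> d * c d) = 0"
  shows "\<forall>d\<in>I. c d = 0"
  using assms
proof (induction I arbitrary: c)
  case (insert e I)
  have step: "c d = 0" if d: "d \<in> I" for d
  proof -
    have "d \<in> L" "e \<in> L" "d \<noteq> e" using d insert by auto
    then obtain \<psi> where \<psi>: "\<psi> \<in> torus B" "\<psi> d \<noteq> \<psi> e" using separating_character by blast
    have "\<forall>d\<in>I. (\<psi> d - \<psi> e) * c d = 0"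
    proof (rule insert.IH)
      show "I \<subseteq> L" using insert by auto
      fix \<chi> assume \<chi>: "\<chi> \<in> torus B"
      have "(\<Sum>d\<in>insert e I. (\<chi> d * \<psi> d) * c d) - \<psi> e * (\<Sum>d\<in>insert e I. \<chi> d * c d) = 0"
        using insert.prems(2)[OF torus_prod[OF \<chi> \<psi>(1)]] insert.prems(2)[OF \<chi>] by simp
      then show "(\<Sum>d\<in>I. \<chi> d * ((\<psi> d - \<psi> e) * c d)) = 0"
        using insert.hyps by (simp add: algebra_simps sum_distrib_left sum_subtractf)
    qed
    then show ?thesis using d \<psi>(2) by auto
  qed
  have "(\<Sum>d\<in>insert e I. 1 * c d) = 0" using insert.prems(2)[OF torus_one] .
  then have "c e = 0" using insert.hyps step by simp
  then show ?case using step by auto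
qed simp

text \<open>Along the orbit of \<open>z\<close>, the value of \<open>a\<close> is a combination of
  the values \<open>\<chi> d\<close> with coefficients \<open>z (cmp a d)\<close>, and these are
  independent as functions of \<open>\<chi>\<close>.\<close>

lemma orbit_vanish:
  assumes "z \<in> Z" "\<And>\<chi>. \<chi> \<in> torus B \<Longrightarrow> act \<chi> z a = 0"
  shows "z (cmp a d) = 0"
proof (cases "d \<in> supp a")
  case True
  have "\<forall>d\<in>supp a. z (cmp a d) = 0"
    using assms(2) act_eq[OF _ assms(1)] cmp_props(1,2)
    by (intro characters_independent) auto
  then show ?thesis using True by blast
qed (use assms cmp_outside in simp)

end

section \<open>Relevant faces\<close>

context bunched
begin

lemma Qmap_eq_sum: "J \<subseteq> {..<r} \<Longrightarrow> (\<And>i. v i \<noteq> 0 \<Longrightarrow> i \<in> J) \<Longrightarrow> Qmap B v = (\<Sum>i\<in>J. s (v i) (w i))"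
  unfolding Qmap_def by (rule sum.mono_neutral_right) auto

lemma Qmap_coord_face:
  assumes J: "J \<subseteq> {..<r}"
  shows "Qmap B ` coord_face B J = cone_of s w J"
proof (intro equalityI subsetI)
  fix x assume "x \<in> Qmap B ` coord_face B J"
  then obtain v where v: "v \<in> coord_face B J" "x = Qmap B v" by blast
  then have "x = (\<Sum>i\<in>J. s (v i) (w i))" using Qmap_eq_sum[OF J, of v] unfolding coord_face_def by auto
  then show "x \<in> cone_of s w J" using v(1) unfolding cone_of_def coord_face_def orthant_def by auto
next
  fix x assume "x \<in> cone_of s w J"
  then obtain c where c: "x = (\<Sum>i\<in>J. s (c i) (w i))" "\<forall>i\<in>J. 0 \<le> c i" unfolding cone_of_def by auto
  define v where "v i = (if i \<in> J then c i else 0)" for i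
  have "Qmap B v = (\<Sum>i\<in>J. s (v i) (w i))" by (rule Qmap_eq_sum[OF J]) (auto simp: v_def split: if_splits)
  also have "\<dots> = x" unfolding c(1) v_def by (intro sum.cong) auto
  finally have "x = Qmap B v" ..
  moreover have "v \<in> coord_face B J" using c(2) J unfolding coord_face_def orthant_def v_def by (auto split: if_splits)
  ultimately show "x \<in> Qmap B ` coord_face B J" by (rule image_eqI)
qed

definition relevant :: "nat set \<Rightarrow> bool" where
  "relevant J \<longleftrightarrow> J \<subseteq> {..<r} \<and> coord_face B J \<in> rlv B"

text \<open>Relevance without the condition to be an F-face, which the facets in the second bunch
  axiom may fail.\<close>

definition ample :: "nat set \<Rightarrow> bool" where
  "ample J \<longleftrightarrow> J \<subseteq> {..<r} \<and> (\<exists>\<tau>\<in>bunch B. relint s \<tau> \<subseteq> relint s (cone_of s w J))"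

lemma relevant_iff: "relevant J \<longleftrightarrow> F_face B (coord_face B J) \<and> ample J"
proof (cases "J \<subseteq> {..<r}")
  case True
  then show ?thesis by (simp add: relevant_def ample_def rlv_def Qmap_coord_face[OF True])
qed (simp add: relevant_def ample_def)

lemma relevant_sub: "relevant J \<Longrightarrow> J \<subseteq> {..<r}" and relevant_finite: "relevant J \<Longrightarrow> finite J"
  unfolding relevant_def using finite_subset by auto

lemma rlv_eq: "\<gamma> \<in> rlv B \<longleftrightarrow> (\<exists>J. relevant J \<and> \<gamma> = coord_face B J)"
proof
  assume g: "\<gamma> \<in> rlv B"
  then have "face qscale \<gamma> (orthant B)" unfolding rlv_def F_face_def by blast
  then obtain J where "J \<subseteq> {..<r}" "\<gamma> = coord_face B J" unfolding face_orthant_iff by blast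
  with g show "\<exists>J. relevant J \<and> \<gamma> = coord_face B J" unfolding relevant_def by blast
qed (auto simp: relevant_def)

lemma bunch_cone: "\<tau> \<in> bunch B \<Longrightarrow> \<exists>J\<subseteq>{..<r}. \<tau> = cone_of s w J"
proof -
  assume "\<tau> \<in> bunch B"
  then have "\<tau> \<in> projected_F_faces B" using bunch_F unfolding F_bunch_def by blast
  then obtain \<gamma> where \<gamma>: "F_face B \<gamma>" "\<tau> = Qmap B ` \<gamma>" unfolding projected_F_faces_def by blast
  then obtain J where "J \<subseteq> {..<r}" "\<gamma> = coord_face B J" unfolding F_face_def face_orthant_iff by blast
  with \<gamma> Qmap_coord_face show ?thesis by blast
qed

lemma bunch_meet:
  assumes "\<tau> \<in> bunch B" "\<sigma> \<in> bunch B"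
  shows "relint s \<tau> \<inter> relint s \<sigma> \<noteq> {}"
proof (cases "\<tau> = \<sigma>")
  case True
  obtain J where J: "J \<subseteq> {..<r}" "\<tau> = cone_of s w J" using bunch_cone[OF assms(1)] by blast
  have "finite J" using J(1) finite_subset by blast
  then show ?thesis using relint_cone_of_nonempty[OF V.vector_space_axioms] J True by simp
next
  case False
  have F: "bunch B \<subseteq> projected_F_faces B" "\<forall>\<tau>\<in>projected_F_faces B. \<tau> \<in> bunch B \<longleftrightarrow>
        (\<forall>\<sigma>\<in>bunch B. \<sigma> \<noteq> \<tau> \<longrightarrow> {} \<noteq> relint s \<tau> \<inter> relint s \<sigma> \<and> relint s \<tau> \<inter> relint s \<sigma> \<noteq> relint s \<sigma>)"
    using bunch_F unfolding F_bunch_def by blast+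
  then show ?thesis using assms False by (metis subsetD)
qed

lemma facet_props:
  assumes "k < r"
  shows "ample ({..<r} - {k})" "int_span s (Qmap B ` (coord_face B ({..<r} - {k}) \<inter> lat_E B)) = L"
proof -
  have F: "\<forall>\<gamma>0. facet qscale \<gamma>0 (orthant B) \<longrightarrow>
        int_span (scl B) (Qmap B ` (\<gamma>0 \<inter> lat_E B)) = lat B \<and>
        (\<exists>\<tau>\<in>bunch B. relint (scl B) \<tau> \<subseteq> relint (scl B) (Qmap B ` \<gamma>0))"
    using bunch_F unfolding F_bunch_def by blast
  have sub: "{..<r} - {k} \<subseteq> {..<r}" by blast
  show "int_span s (Qmap B ` (coord_face B ({..<r} - {k}) \<inter> lat_E B)) = L"
    using F facet_orthant[OF assms] by blast
  show "ample ({..<r} - {k})"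
    unfolding ample_def Qmap_coord_face[OF sub, symmetric] using F facet_orthant[OF assms] by blast
qed

text \<open>The relative interiors of any two members of the bunch meet, hence so do those of the
  two cones. After clearing denominators a common point becomes a common degree of two monomials,
  one involving exactly the \<open>f i\<close> with \<open>i\<close> in \<open>J\<close>, the other
  those with \<open>i\<close> in \<open>J'\<close>.\<close>

lemma ample_meet:
  assumes "ample J" "ample J'"
  shows "\<exists>(n::nat \<Rightarrow> nat) n'. (\<forall>i\<in>J. 0 < n i) \<and> (\<forall>i\<in>J'. 0 < n' i) \<and>
    (\<Sum>i\<in>J. s (of_nat (n i)) (w i)) = (\<Sum>i\<in>J'. s (of_nat (n' i)) (w i))"
proof -
  have fin: "finite J" "finite J'" using assms finite_subset unfolding ample_def by auto
  obtain \<tau> \<tau>' where t: "\<tau> \<in> bunch B" "\<tau>' \<in> bunch B" "relint s \<tau> \<subseteq> relint s (cone_of s w J)"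
    "relint s \<tau>' \<subseteq> relint s (cone_of s w J')" using assms unfolding ample_def by blast
  obtain x where "x \<in> relint s \<tau>" "x \<in> relint s \<tau>'" using bunch_meet[OF t(1,2)] by blast
  then have "x \<in> relint s (cone_of s w J)" "x \<in> relint s (cone_of s w J')" using t by blast+
  then obtain c c' where c: "x = (\<Sum>i\<in>J. s (c i) (w i))" "\<forall>i\<in>J. 0 < c i"
    "x = (\<Sum>i\<in>J'. s (c' i) (w i))" "\<forall>i\<in>J'. 0 < c' i"
    unfolding relint_cone_of[OF V.vector_space_axioms fin(1)] relint_cone_of[OF V.vector_space_axioms fin(2)]
    by blast
  obtain N N' :: nat where N: "N > 0" "\<forall>i\<in>J. of_nat N * c i \<in> \<int>" "N' > 0" "\<forall>i\<in>J'. of_nat N' * c' i \<in> \<int>"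
    using common_denominator[OF fin(1)] common_denominator[OF fin(2)] by metis
  \<comment> \<open>Both sums are to represent the same multiple \<open>N * N'\<close> of
    \<open>x\<close>, so each side is also scaled by the denominator of the other.\<close>
  define n where "n i = nat \<lfloor>of_nat N' * (of_nat N * c i)\<rfloor>" for i
  define n' where "n' i = nat \<lfloor>of_nat N * (of_nat N' * c' i)\<rfloor>" for i
  have nn: "of_nat (n i) = of_nat N' * (of_nat N * c i)" "0 < n i" if "i \<in> J" for i
  proof -
    obtain m where m: "of_nat N * c i = of_int m" using N(2) \<open>i \<in> J\<close> by (auto elim: Ints_cases)
    have pos: "of_nat N * c i > 0" using N(1) c(2) \<open>i \<in> J\<close> by simp
    then have "m > 0" unfolding m by simp
    have e: "of_nat N' * (of_nat N * c i) = of_int (int N' * m)" unfolding m by simp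
    show "of_nat (n i) = of_nat N' * (of_nat N * c i)" "0 < n i"
      unfolding n_def e floor_of_int using \<open>m > 0\<close> N(3) by simp_all
  qed
  have nn': "of_nat (n' i) = of_nat N * (of_nat N' * c' i)" "0 < n' i" if "i \<in> J'" for i
  proof -
    obtain m where m: "of_nat N' * c' i = of_int m" using N(4) \<open>i \<in> J'\<close> by (auto elim: Ints_cases)
    have pos: "of_nat N' * c' i > 0" using N(3) c(4) \<open>i \<in> J'\<close> by simp
    then have "m > 0" unfolding m by simp
    have e: "of_nat N * (of_nat N' * c' i) = of_int (int N * m)" unfolding m by simp
    show "of_nat (n' i) = of_nat N * (of_nat N' * c' i)" "0 < n' i"
      unfolding n'_def e floor_of_int using \<open>m > 0\<close> N(1) by simp_all
  qed
  have "(\<Sum>i\<in>J. s (of_nat (n i)) (w i)) = s (of_nat N' * of_nat N) x"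
    unfolding c(1) V.scale_sum_right by (intro sum.cong) (auto simp: nn mult.assoc)
  moreover have "(\<Sum>i\<in>J'. s (of_nat (n' i)) (w i)) = s (of_nat N' * of_nat N) x"
    unfolding c(3) V.scale_sum_right by (intro sum.cong) (auto simp: nn' mult_ac)
  ultimately show ?thesis using nn(2) nn'(2) by (intro exI[of _ n] exI[of _ n']) auto
qed

lemma facet_generate:
  assumes k: "k < r" and d: "d \<in> L"
  shows "\<exists>c::nat \<Rightarrow> int. c k = 0 \<and> d = (\<Sum>i<r. s (of_int (c i)) (w i))"
proof -
  let ?G = "Qmap B ` (coord_face B ({..<r} - {k}) \<inter> lat_E B)"
  have g: "\<exists>c::nat \<Rightarrow> int. c k = 0 \<and> x = (\<Sum>i<r. s (of_int (c i)) (w i))" if "x \<in> ?G" for x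
  proof -
    obtain v where v: "x = Qmap B v" "v \<in> coord_face B ({..<r} - {k})" "v \<in> lat_E B" using \<open>x \<in> ?G\<close> by blast
    have e: "of_int \<lfloor>v i\<rfloor> = v i" for i
    proof -
      have "v i \<in> \<int>" using v(3) unfolding lat_E_def by blast
      then show ?thesis by (rule Ints_cases) simp
    qed
    have "v k = 0" using v(2) unfolding coord_face_def by auto
    then show ?thesis unfolding v(1) Qmap_def by (intro exI[of _ "\<lambda>i. \<lfloor>v i\<rfloor>"]) (simp add: e)
  qed
  obtain F m where F: "d = (\<Sum>x\<in>F. s (of_int (m x)) x)" "finite F" "F \<subseteq> ?G"
    using d facet_props(2)[OF k] unfolding int_span_def by blast
  have "\<forall>x\<in>F. \<exists>c::nat \<Rightarrow> int. c k = 0 \<and> x = (\<Sum>i<r. s (of_int (c i)) (w i))" using g F(3) by blast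
  then obtain c where c: "\<forall>x\<in>F. c x k = (0::int) \<and> x = (\<Sum>i<r. s (of_int (c x i)) (w i))"
    using bchoice[of F "\<lambda>x c. c k = (0::int) \<and> x = (\<Sum>i<r. s (of_int (c i)) (w i))"] by blast
  have "d = (\<Sum>x\<in>F. s (of_int (m x)) (\<Sum>i<r. s (of_int (c x i)) (w i)))"
    unfolding F(1) using c by (intro sum.cong) auto
  also have "\<dots> = (\<Sum>i<r. s (of_int (\<Sum>x\<in>F. m x * c x i)) (w i))"
    by (simp add: V.scale_sum_right V.scale_sum_left) (rule sum.swap)
  finally show ?thesis using c by (intro exI[of _ "\<lambda>i. \<Sum>x\<in>F. m x * c x i"]) simp
qed

text \<open>The facet condition alone gives integral exponents without \<open>f k\<close>, but of
  any sign. They are corrected by a multiple of \<open>p\<close>, which has degree 0, does not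
  involve \<open>k\<close> and is positive on all other indices outside \<open>J\<close>; it
  compares a degree over \<open>J\<close> with the same degree written over the facet.\<close>

lemma key_exponents:
  assumes J: "relevant J" and k: "k < r" "k \<notin> J" and d: "d \<in> L"
  shows "\<exists>v::nat \<Rightarrow> int. v k = 0 \<and> (\<forall>i<r. i \<notin> J \<longrightarrow> 0 \<le> v i) \<and> d = (\<Sum>i<r. s (of_int (v i)) (w i))"
proof -
  have aJ: "ample J" using J relevant_iff by blast
  have sub: "J \<subseteq> {..<r}" using relevant_sub[OF J] .
  obtain n n' where n: "\<forall>i\<in>J. 0 < n i" "\<forall>i\<in>{..<r} - {k}. 0 < n' i"
    "(\<Sum>i\<in>J. s (of_nat (n i)) (w i)) = (\<Sum>i\<in>{..<r} - {k}. s (of_nat (n' i)) (w i))"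
    using ample_meet[OF aJ facet_props(1)[OF k(1)]] by blast
  obtain c :: "nat \<Rightarrow> int" where c: "c k = 0" "d = (\<Sum>i<r. s (of_int (c i)) (w i))"
    using facet_generate[OF k(1) d] by blast
  \<comment> \<open>Large enough to outweigh every negative \<open>c i\<close>.\<close>
  define m where "m = (\<Sum>i<r. \<bar>c i\<bar>)"
  define p where "p i = (if i = k then 0 else int (n' i)) - (if i \<in> J then int (n i) else 0)" for i
  define v where "v i = c i + m * p i" for i
  have "(\<Sum>i<r. s (of_int (p i)) (w i))
      = (\<Sum>i<r. s (if i = k then 0 else of_nat (n' i)) (w i)) - (\<Sum>i<r. s (if i \<in> J then of_nat (n i) else 0) (w i))"
    unfolding p_def sum_subtractf[symmetric] V.scale_left_diff_distrib[symmetric]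
    by (intro sum.cong refl arg_cong2[where f = s]) auto
  also have "(\<Sum>i<r. s (if i = k then 0 else of_nat (n' i)) (w i)) = (\<Sum>i\<in>{..<r} - {k}. s (of_nat (n' i)) (w i))"
    by (intro sum.mono_neutral_cong_right) auto
  also have "(\<Sum>i<r. s (if i \<in> J then of_nat (n i) else 0) (w i)) = (\<Sum>i\<in>J. s (of_nat (n i)) (w i))"
    using sub by (intro sum.mono_neutral_cong_right) auto
  finally have p0: "(\<Sum>i<r. s (of_int (p i)) (w i)) = 0" using n(3) by simp
  have "(\<Sum>i<r. s (of_int (v i)) (w i)) = d + s (of_int m) (\<Sum>i<r. s (of_int (p i)) (w i))"
    unfolding v_def c(2) by (simp add: V.scale_left_distrib sum.distrib V.scale_sum_right)
  then have "d = (\<Sum>i<r. s (of_int (v i)) (w i))" using p0 by simp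
  moreover have "v k = 0" unfolding v_def p_def using c(1) k(2) by simp
  moreover have "0 \<le> v i" if i: "i < r" "i \<notin> J" for i
  proof (cases "i = k")
    case False
    have "\<bar>c i\<bar> \<le> m" unfolding m_def using i(1) by (intro member_le_sum) auto
    moreover have "p i \<ge> 1" unfolding p_def using n(2) i False by (auto simp: Suc_le_eq)
    moreover have "m \<ge> 0" unfolding m_def by (intro sum_nonneg) auto
    ultimately have "m * p i \<ge> m * 1" "\<bar>c i\<bar> \<le> m" by (auto intro: mult_left_mono simp del: mult_1_right)
    then show ?thesis unfolding v_def by linarith
  qed (use \<open>v k = 0\<close> in simp)
  ultimately show ?thesis by blast
qed

lemma H_prod_gen:
  assumes "I \<subseteq> {..<r}"
  shows "(\<Sum>i\<in>I. s (of_nat (n i)) (w i)) \<in> L" "(\<Prod>i\<in>I. f i ^ n i) \<in> H (\<Sum>i\<in>I. s (of_nat (n i)) (w i))"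
proof -
  have "finite I" using assms finite_subset by blast
  then have "(\<Sum>i\<in>I. s (of_nat (n i)) (w i)) \<in> L \<and> (\<Prod>i\<in>I. f i ^ n i) \<in> H (\<Sum>i\<in>I. s (of_nat (n i)) (w i))"
    using assms
  proof (induction I)
    case empty
    then show ?case by (simp add: H_1)
  next
    case (insert i I)
    have i: "w i \<in> L" "f i \<in> H (w i)" using gen_deg[of i] insert by auto
    show ?case using insert i lat_scale_of_nat[OF i(1), of "n i"] H_power[OF i, of "n i"]
      by (auto intro: lat_add H_mult)
  qed
  then show "(\<Sum>i\<in>I. s (of_nat (n i)) (w i)) \<in> L" "(\<Prod>i\<in>I. f i ^ n i) \<in> H (\<Sum>i\<in>I. s (of_nat (n i)) (w i))"
    by blast+
qed

text \<open>Splitting the exponents into positive and negative parts gives a fraction of degree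
  \<open>d\<close> that is a unit along the divisor of \<open>f k\<close>: its denominator is
  invertible where the \<open>f i\<close> over \<open>J\<close> are, and its numerator is free of
  \<open>f k\<close>.\<close>

lemma key_fraction:
  assumes J: "relevant J" and k: "k < r" "k \<notin> J" and d: "d \<in> L"
  shows "\<exists>e n m. e \<in> L \<and> (\<Prod>i\<in>{..<r} - {k}. f i ^ n i) \<in> H (d + e) \<and> (\<Prod>i\<in>J. f i ^ m i) \<in> H e"
proof -
  obtain v :: "nat \<Rightarrow> int" where v: "v k = 0" "\<forall>i<r. i \<notin> J \<longrightarrow> 0 \<le> v i" "d = (\<Sum>i<r. s (of_int (v i)) (w i))"
    using key_exponents[OF assms] by blast
  define n where "n i = nat (v i)" for i
  define m where "m i = nat (- v i)" for i
  define e where "e = (\<Sum>i\<in>J. s (of_nat (m i)) (w i))"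
  have sub: "J \<subseteq> {..<r}" using relevant_sub[OF J] .
  have e: "e \<in> L" "(\<Prod>i\<in>J. f i ^ m i) \<in> H e" unfolding e_def by (rule H_prod_gen[OF sub])+
  have e': "e = (\<Sum>i<r. s (of_nat (m i)) (w i))"
    unfolding e_def using sub v(2) by (intro sum.mono_neutral_left) (auto simp: m_def)
  have "(\<Sum>i\<in>{..<r} - {k}. s (of_nat (n i)) (w i)) = (\<Sum>i<r. s (of_nat (n i)) (w i))"
    using v(1) by (intro sum.mono_neutral_left) (auto simp: n_def)
  also have "\<dots> = (\<Sum>i<r. s (of_int (v i)) (w i) + s (of_nat (m i)) (w i))"
    unfolding V.scale_left_distrib[symmetric]
    by (intro sum.cong refl arg_cong2[where f = s]) (auto simp: n_def m_def)
  also have "\<dots> = d + e" unfolding sum.distrib v(3) e' ..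
  finally have "(\<Prod>i\<in>{..<r} - {k}. f i ^ n i) \<in> H (d + e)"
    using H_prod_gen(2)[of "{..<r} - {k}" n] by auto
  then show ?thesis using e by blast
qed

lemma prime_dvd_gen_prod:
  assumes "prime_elem q" "q dvd (\<Prod>i\<in>I. f i ^ n i)" "I \<subseteq> {..<r}"
  shows "\<exists>i\<in>I. q dvd f i \<and> f i dvd q"
proof -
  obtain i where i: "i \<in> I" "q dvd f i ^ n i" using prime_dvd_prod[OF assms(1,2)] by blast
  then have "q dvd f i" using prime_elem_dvd_power[OF assms(1)] by blast
  then show ?thesis using i prime_elem_assoc assms(1,3) gen_prime by blast
qed

lemma gen_not_dvd_prod:
  assumes "k < r" "I \<subseteq> {..<r} - {k}"
  shows "\<not> f k dvd (\<Prod>i\<in>I. f i ^ n i)"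
proof
  assume "f k dvd (\<Prod>i\<in>I. f i ^ n i)"
  then obtain i where "i \<in> I" "f k dvd f i \<and> f i dvd f k"
    using prime_dvd_gen_prod[OF gen_prime[OF assms(1)]] assms(2) by blast
  then show False using gen_nonassoc assms by blast
qed

text \<open>For the index set of a face \<open>\<gamma>0\<close> this is the image of the lattice
  points of its linear span; see \<open>Qmap_span_coord_face\<close>.\<close>

definition weights :: "nat set \<Rightarrow> 'v set" where
  "weights J = {\<Sum>i\<in>J. s (of_int (c i)) (w i) | c. True}"

lemma weights_add: "d \<in> weights J \<Longrightarrow> e \<in> weights J \<Longrightarrow> d + e \<in> weights J"
proof -
  assume "d \<in> weights J" "e \<in> weights J"
  then obtain c c' where "d = (\<Sum>i\<in>J. s (of_int (c i)) (w i))" "e = (\<Sum>i\<in>J. s (of_int (c' i)) (w i))"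
    unfolding weights_def by blast
  then have "d + e = (\<Sum>i\<in>J. s (of_int (c i + c' i)) (w i))" by (simp add: V.scale_left_distrib sum.distrib)
  then show ?thesis unfolding weights_def by (intro CollectI exI[of _ "\<lambda>i. c i + c' i"]) simp
qed

lemma weights_scale: "d \<in> weights J \<Longrightarrow> s (of_int n) d \<in> weights J"
proof -
  assume "d \<in> weights J"
  then obtain c where "d = (\<Sum>i\<in>J. s (of_int (c i)) (w i))" unfolding weights_def by blast
  then have "s (of_int n) d = (\<Sum>i\<in>J. s (of_int (n * c i)) (w i))" by (simp add: V.scale_sum_right)
  then show ?thesis unfolding weights_def by (intro CollectI exI[of _ "\<lambda>i. n * c i"]) simp
qed

lemma weights_neg: "d \<in> weights J \<Longrightarrow> - d \<in> weights J"
  using weights_scale[of d J "-1"] by simp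

lemma weights_diff: "d \<in> weights J \<Longrightarrow> e \<in> weights J \<Longrightarrow> d - e \<in> weights J"
  using weights_add[of d J "- e"] weights_neg[of e J] by simp

lemma weights_0: "0 \<in> weights J"
  unfolding weights_def by (intro CollectI exI[of _ "\<lambda>_. 0"]) simp

lemma weights_gen: "i \<in> J \<Longrightarrow> finite J \<Longrightarrow> w i \<in> weights J"
proof -
  assume i: "i \<in> J" "finite J"
  have "(\<Sum>j\<in>J. s (of_int (if j = i then 1 else 0)) (w j)) = (\<Sum>j\<in>J. if j = i then w i else 0)"
    by (intro sum.cong) auto
  also have "\<dots> = w i" using i by simp
  finally have "w i = (\<Sum>j\<in>J. s (of_int (if j = i then 1 else 0)) (w j))" ..
  then show ?thesis unfolding weights_def
    by (intro CollectI exI[of _ "\<lambda>j. if j = i then 1 else 0"]) simp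
qed

lemma weights_sub_lat: "J \<subseteq> {..<r} \<Longrightarrow> weights J \<subseteq> L"
  unfolding weights_def using gen_deg by (auto intro!: lat_sum scale_of_int_mem_lat)

section \<open>Degrees of functions not vanishing at a point\<close>

definition nzset :: "('r \<Rightarrow> 'k) \<Rightarrow> nat set" where "nzset z = {i. i < r \<and> z (f i) \<noteq> 0}"

lemma nzset_sub: "nzset z \<subseteq> {..<r}" and nzset_finite [simp]: "finite (nzset z)"
  unfolding nzset_def by auto

text \<open>R is generated by the \<open>f i\<close>, and those with \<open>z (f i) = 0\<close>
  contribute only products that vanish at \<open>z\<close>. The exponents are kept nonnegative for
  the sake of \<open>limit_point\<close>, where a functional has to be nonnegative on these
  degrees.\<close>

lemma nonvanishing_degree:
  assumes z: "z \<in> Z" and ne: "z (cmp a d) \<noteq> 0"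
  shows "\<exists>n::nat \<Rightarrow> nat. d = (\<Sum>i\<in>nzset z. s (of_nat (n i)) (w i))"
proof -
  define P where "P d \<longleftrightarrow> (\<exists>n::nat \<Rightarrow> nat. d = (\<Sum>i\<in>nzset z. s (of_nat (n i)) (w i)))" for d
  have P0: "P 0" unfolding P_def by (intro exI[of _ "\<lambda>_. 0"]) simp
  have Padd: "P (d + e)" if de: "P d" "P e" for d e
  proof -
    obtain n n' :: "nat \<Rightarrow> nat" where "d = (\<Sum>i\<in>nzset z. s (of_nat (n i)) (w i))"
      "e = (\<Sum>i\<in>nzset z. s (of_nat (n' i)) (w i))" using de unfolding P_def by blast
    then have "d + e = (\<Sum>i\<in>nzset z. s (of_nat (n i + n' i)) (w i))"
      by (simp add: V.scale_left_distrib sum.distrib)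
    then show ?thesis unfolding P_def by (rule exI[of _ "\<lambda>i. n i + n' i"])
  qed
  have "a \<in> alg_gen \<iota> (f ` {..<r})" using gen_generate by simp
  then have "\<forall>d. z (cmp a d) \<noteq> 0 \<longrightarrow> P d"
  proof induction
    case (const c)
    show ?case using cmp_homog[OF lat_0 H_emb_0[of c]] P0 z by simp
  next
    case (gen g)
    then obtain i where i: "i < r" "g = f i" by auto
    have "P (w i)" if "z (f i) \<noteq> 0"
    proof -
      have "i \<in> nzset z" using i that unfolding nzset_def by simp
      have "(\<Sum>j\<in>nzset z. s (of_nat (if j = i then 1 else 0)) (w j)) = (\<Sum>j\<in>nzset z. if j = i then w i else 0)"
        by (intro sum.cong) auto
      also have "\<dots> = w i" using \<open>i \<in> nzset z\<close> by simp
      finally have "w i = (\<Sum>j\<in>nzset z. s (of_nat (if j = i then 1 else 0)) (w j))" ..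
      then show ?thesis unfolding P_def by (intro exI[of _ "\<lambda>j. if j = i then 1 else 0"]) simp
    qed
    then show ?case unfolding i(2) using cmp_homog[of "w i" "f i"] gen_deg[OF i(1)] z by auto
  next
    case (add a b)
    show ?case
    proof (intro allI impI)
      fix d assume "z (cmp (a + b) d) \<noteq> 0"
      then have "z (cmp a d) \<noteq> 0 \<or> z (cmp b d) \<noteq> 0" using z by (auto simp: cmp_add)
      then show "P d" using add.IH by blast
    qed
  next
    case (mult a b)
    show ?case
    proof (intro allI impI)
      fix d assume "z (cmp (a * b) d) \<noteq> 0"
      then have "(\<Sum>x\<in>supp a. \<Sum>y\<in>supp b. z (if d = x + y then cmp a x * cmp b y else 0)) \<noteq> 0"
        unfolding cmp_mult by (simp only: pt_sum[OF z]) simp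
      then obtain x where "(\<Sum>y\<in>supp b. z (if d = x + y then cmp a x * cmp b y else 0)) \<noteq> 0"
        using sum.not_neutral_contains_not_neutral by blast
      then obtain y where y: "z (if d = x + y then cmp a x * cmp b y else 0) \<noteq> 0"
        using sum.not_neutral_contains_not_neutral by blast
      then have "d = x + y" "z (cmp a x) \<noteq> 0" "z (cmp b y) \<noteq> 0" using z by (auto split: if_splits)
      then show "P d" using mult.IH Padd by simp
    qed
  qed
  then show ?thesis using ne unfolding P_def by blast
qed

lemma nonvanishing_weight:
  assumes z: "z \<in> Z" and "d \<in> L" "a \<in> H d" "z a \<noteq> 0"
  shows "d \<in> weights (nzset z)"
proof -
  have "z (cmp a d) \<noteq> 0" using cmp_homog[OF assms(2,3)] assms(4) by simp
  then obtain n :: "nat \<Rightarrow> nat" where "d = (\<Sum>i\<in>nzset z. s (of_nat (n i)) (w i))"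
    using nonvanishing_degree[OF z] by blast
  then have "d = (\<Sum>i\<in>nzset z. s (of_int (int (n i))) (w i))" by simp
  then show ?thesis unfolding weights_def by (intro CollectI exI[of _ "\<lambda>i. int (n i)"]) simp
qed

lemma monomial_fraction:
  assumes J: "J \<subseteq> {..<r}" and d: "d \<in> weights J"
  shows "\<exists>e n m. e \<in> L \<and> (\<Prod>i\<in>J. f i ^ n i) \<in> H (d + e) \<and> (\<Prod>i\<in>J. f i ^ m i) \<in> H e"
proof -
  obtain c :: "nat \<Rightarrow> int" where c: "d = (\<Sum>i\<in>J. s (of_int (c i)) (w i))" using d unfolding weights_def by blast
  define e where "e = (\<Sum>i\<in>J. s (of_nat (nat (- c i))) (w i))"
  have "d + e = (\<Sum>i\<in>J. s (of_nat (nat (c i))) (w i))"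
    unfolding c e_def sum.distrib[symmetric] V.scale_left_distrib[symmetric]
    by (intro sum.cong refl arg_cong2[where f = s]) auto
  then show ?thesis using H_prod_gen[OF J] e_def by metis
qed

lemma Xbar_loc_coord_face:
  assumes J: "J \<subseteq> {..<r}"
  shows "Xbar_loc B (coord_face B J) = {z \<in> Z. \<forall>i\<in>J. z (f i) \<noteq> 0}"
proof (intro equalityI subsetI)
  fix z assume "z \<in> Xbar_loc B (coord_face B J)"
  then obtain u where z: "z \<in> Z" and u: "u \<in> relint qscale (coord_face B J)" "u \<in> lat_E B" "z (monomial B u) \<noteq> 0"
    unfolding Xbar_loc_def by blast
  have pos: "\<forall>i\<in>J. 0 < u i" using u(1) unfolding relint_coord_face[OF J] by blast
  have "z (f i) \<noteq> 0" if i: "i \<in> J" for i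
  proof -
    have "z (monomial B u) = (\<Prod>i<r. z (f i) ^ nat \<lfloor>u i\<rfloor>)" unfolding monomial_def by (simp add: pt_prod[OF z] z)
    then have "z (f i) ^ nat \<lfloor>u i\<rfloor> \<noteq> 0" using u(3) J i by auto
    moreover have "u i \<in> \<int>" using u(2) unfolding lat_E_def by blast
    then obtain m where "u i = of_int m" by (rule Ints_cases)
    then have "nat \<lfloor>u i\<rfloor> > 0" using pos i by auto
    ultimately show ?thesis by auto
  qed
  then show "z \<in> {z \<in> Z. \<forall>i\<in>J. z (f i) \<noteq> 0}" using z by blast
next
  fix z assume z: "z \<in> {z \<in> Z. \<forall>i\<in>J. z (f i) \<noteq> 0}"
  define u :: "nat \<Rightarrow> rat" where "u i = (if i \<in> J then 1 else 0)" for i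
  have "u \<in> coord_face B J"
    unfolding coord_face_def orthant_def u_def using J by (auto split: if_splits)
  then have "u \<in> relint qscale (coord_face B J)"
    unfolding relint_coord_face[OF J] by (simp add: u_def)
  moreover have "u \<in> lat_E B" unfolding lat_E_def u_def using J by (auto split: if_splits)
  moreover have "z (monomial B u) \<noteq> 0"
    unfolding monomial_def u_def using z J by (auto simp: pt_prod)
  ultimately show "z \<in> Xbar_loc B (coord_face B J)" unfolding Xbar_loc_def using z by blast
qed

text \<open>The elements vanishing at \<open>z\<close> form a radical ideal that contains the
  generators outside \<open>nzset z\<close> but not the product of the others.\<close>

lemma F_face_nzset:
  assumes z: "z \<in> Z"
  shows "F_face B (coord_face B (nzset z))"
proof -
  let ?R = "ring_on (UNIV :: 'r set)"
  let ?S = "{f j | j. j < r \<and> basis_vec j \<notin> coord_face B (nzset z)}"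
  have cr: "cring ?R" by (rule cring_ring_on) auto
  interpret cring ?R by (rule cr)
  have id: "ideal {a. z a = 0} ?R"
  proof (rule idealI)
    show "ring ?R" by (rule ring_axioms)
    show "subgroup {a. z a = 0} (add_monoid ?R)"
    proof
      fix x assume "x \<in> {a. z a = 0}"
      moreover have "inv\<^bsub>add_monoid ?R\<^esub> x = - x"
        using minus_equality[of "- x" x] unfolding a_inv_def by simp
      ultimately show "inv\<^bsub>add_monoid ?R\<^esub> x \<in> {a. z a = 0}" using z by simp
    qed (use z in auto)
  qed (use z in auto)
  have "?S \<subseteq> {a. z a = 0}"
    using basis_vec_mem_coord_face[of _ B "nzset z"] unfolding nzset_def by auto
  then have "Idl\<^bsub>?R\<^esub> ?S \<subseteq> {a. z a = 0}" using id unfolding genideal_def by blast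
  then have "a ^ n \<in> Idl\<^bsub>?R\<^esub> ?S \<Longrightarrow> z a = 0" for a n using z by (auto dest!: subsetD)
  then have "radical (Idl\<^bsub>?R\<^esub> ?S) \<subseteq> {a. z a = 0}" unfolding radical_def by blast
  moreover have "z (\<Prod>i | i < r \<and> basis_vec i \<in> coord_face B (nzset z). f i) \<noteq> 0"
    unfolding pt_prod[OF z] using basis_vec_mem_coord_face[of _ B "nzset z"]
    by (subst prod_zero_iff) (auto simp: nzset_def)
  moreover have "face qscale (coord_face B (nzset z)) (orthant B)"
    unfolding face_orthant_iff using nzset_sub by blast
  ultimately show ?thesis unfolding F_face_def by blast
qed

text \<open>If \<open>nzset z\<close> is not relevant, its cone has a proper face containing the
  degrees over \<open>J\<close>. The functional \<open>u\<close> cutting it out corresponds to a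
  one-parameter subgroup, and \<open>z1\<close> is the limit of \<open>z\<close> under it:
  components of positive weight tend to 0, those of weight 0 stay. The last conclusion expresses
  that \<open>z1\<close> lies in the closure of the orbit of \<open>z\<close>.\<close>

lemma limit_point:
  assumes z: "z \<in> Z" and J: "relevant J" "J \<subseteq> nzset z" and nr: "\<not> relevant (nzset z)"
  shows "\<exists>z1\<in>Z. J \<subseteq> nzset z1 \<and> nzset z1 \<subset> nzset z \<and> (\<forall>a. (\<forall>d. z (cmp a d) = 0) \<longrightarrow> z1 a = 0)"
proof -
  have "\<not> relint s (cone_of s w J) \<subseteq> relint s (cone_of s w (nzset z))"
  proof
    assume "relint s (cone_of s w J) \<subseteq> relint s (cone_of s w (nzset z))"
    then have "ample (nzset z)" using J(1) nzset_sub unfolding relevant_iff ample_def by blast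
    then show False using nr F_face_nzset[OF z] relevant_iff by blast
  qed
  then obtain u where u: "Vector_Spaces.linear s (*) u" "\<forall>i\<in>nzset z. 0 \<le> u (w i)"
    "\<forall>i\<in>J. u (w i) = 0" "\<not> (\<forall>i\<in>nzset z. u (w i) = (0::rat))"
    using relint_cone_of_mono[OF V.vector_space_axioms nzset_finite J(2), of w] by metis
  interpret u: Vector_Spaces.linear s "(*)" u by (rule u)
  define \<kappa> :: "'v \<Rightarrow> 'k" where "\<kappa> d = (if u d = 0 then 1 else 0)" for d
  define z1 where "z1 a = (\<Sum>d\<in>supp a. \<kappa> d * z (cmp a d))" for a
  have nn: "u d \<ge> 0" if d: "d \<in> L" "a \<in> H d" "z a \<noteq> 0" for d a
  proof -
    have "z (cmp a d) \<noteq> 0" using cmp_homog[OF d(1,2)] d(3) by simp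
    then obtain n :: "nat \<Rightarrow> nat" where n: "d = (\<Sum>i\<in>nzset z. s (of_nat (n i)) (w i))"
      using nonvanishing_degree[OF z] by blast
    show ?thesis unfolding n u.sum u.scale using u(2) by (intro sum_nonneg mult_nonneg_nonneg) auto
  qed
  have z1: "z1 \<in> Z"
    unfolding z1_def
  proof (rule multiplicative_extension[OF z])
    show "\<kappa> 0 = 1" unfolding \<kappa>_def by (simp add: u.zero)
    fix d e a b assume de: "d \<in> L" "e \<in> L" "a \<in> H d" "b \<in> H e" "z (a * b) \<noteq> 0"
    then have "u d \<ge> 0" "u e \<ge> 0" using nn z by auto
    then show "\<kappa> (d + e) = \<kappa> d * \<kappa> e" unfolding \<kappa>_def by (auto simp: u.add)
  qed
  have z1h: "z1 a = \<kappa> d * z a" if d: "d \<in> L" "a \<in> H d" for d a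
  proof (cases "a = 0")
    case False
    have "supp a = {d}" unfolding supp_def using cmp_homog[OF d] False by auto
    then show ?thesis unfolding z1_def using cmp_homog[OF d, of d] by simp
  qed (use z z1 in simp)
  have z1f: "z1 (f i) = \<kappa> (w i) * z (f i)" if "i < r" for i
    using z1h gen_deg[OF that] by blast
  have "J \<subseteq> nzset z1"
    using J(2) u(3) z1f unfolding nzset_def \<kappa>_def by auto
  moreover have "nzset z1 \<subset> nzset z"
    using u(4) z1f unfolding nzset_def \<kappa>_def by fastforce
  moreover have "\<forall>a. (\<forall>d. z (cmp a d) = 0) \<longrightarrow> z1 a = 0" unfolding z1_def by simp
  ultimately show ?thesis using z1 by blast
qed

end

section \<open>Varieties\<close>

lemma openin_zariski_space:
  assumes "\<And>f g. f \<in> A \<Longrightarrow> g \<in> A \<Longrightarrow> f * g \<in> A"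
  shows "openin (top_of (zariski_space Y A)) U \<longleftrightarrow> zariski_open Y A U"
proof -
  have "istopology (zariski_open Y A)"
    by (rule istopology_zariski_open) (use assms in \<open>auto intro!: bexI[of _ "_ * _"]\<close>)
  then show ?thesis unfolding zariski_space_def by (simp add: topology_inverse')
qed

lemma poly_funs_const: "(\<lambda>_. c) \<in> poly_funs n" and poly_funs_coord: "i < n \<Longrightarrow> (\<lambda>a. a i) \<in> poly_funs n"
  and poly_funs_add: "g \<in> poly_funs n \<Longrightarrow> h \<in> poly_funs n \<Longrightarrow> g + h \<in> poly_funs n"
  and poly_funs_mult: "g \<in> poly_funs n \<Longrightarrow> h \<in> poly_funs n \<Longrightarrow> g * h \<in> poly_funs n"
  unfolding poly_funs_def by (auto intro: alg_gen.intros)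

lemma openin_zariski_poly:
  "openin (top_of (zariski_space Y (poly_funs n))) U \<longleftrightarrow> zariski_open Y (poly_funs n) U"
  by (rule openin_zariski_space[OF poly_funs_mult])

lemma zariski_open_whole: "zariski_open Y (poly_funs n) Y"
  unfolding zariski_open_def by (rule exI[of _ "{\<lambda>_. 1}"]) (auto intro: poly_funs_const)

lemma topspace_zariski_poly: "points (zariski_space Y (poly_funs n)) = Y"
proof (rule equalityI)
  show "points (zariski_space Y (poly_funs n)) \<subseteq> Y"
    unfolding topspace_def openin_zariski_poly zariski_open_def by auto
  show "Y \<subseteq> points (zariski_space Y (poly_funs n))"
    by (rule openin_subset) (simp add: openin_zariski_poly zariski_open_whole)
qed

lemma reg_zariski_poly: "f \<in> poly_funs n \<Longrightarrow> f \<in> reg (zariski_space Y (poly_funs n)) Y"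
proof -
  assume f: "f \<in> poly_funs n"
  have "\<exists>V a b. zariski_open Y (poly_funs n) V \<and> x \<in> V \<and> V \<subseteq> Y \<and> a \<in> poly_funs n \<and> b \<in> poly_funs n \<and>
      (\<forall>y\<in>V. b y \<noteq> 0 \<and> f y = a y / b y)" if "x \<in> Y" for x
    using f that zariski_open_whole[of Y n] poly_funs_const[of 1 n]
    by (intro exI[of _ Y] exI[of _ f] exI[of _ "\<lambda>_. 1"]) simp
  then show ?thesis unfolding zariski_space_def by simp
qed

locale affine_chart =
  fixes S :: "('a, 'k::field) fspace" and n :: nat and Y :: "(nat \<Rightarrow> 'k) set" and \<phi> \<psi>
  assumes mor: "fs_morphism S (zariski_space Y (poly_funs n)) \<phi>"
    and mor': "fs_morphism (zariski_space Y (poly_funs n)) S \<psi>"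
    and inv: "x \<in> points S \<Longrightarrow> \<psi> (\<phi> x) = x" and inv': "y \<in> Y \<Longrightarrow> \<phi> (\<psi> y) = y"
    and Y_sub: "Y \<subseteq> affine_space n"
begin

lemma phi_mem: "x \<in> points S \<Longrightarrow> \<phi> x \<in> Y"
  using mor unfolding fs_morphism_def continuous_map_def topspace_zariski_poly by auto

lemma psi_mem: "y \<in> Y \<Longrightarrow> \<psi> y \<in> points S"
  using mor' unfolding fs_morphism_def continuous_map_def topspace_zariski_poly by auto

lemma open_preimage_psi: "openin (top_of S) U \<Longrightarrow> zariski_open Y (poly_funs n) {y \<in> Y. \<psi> y \<in> U}"
  using mor' unfolding fs_morphism_def continuous_map_def topspace_zariski_poly
    openin_zariski_poly by blast

lemma open_preimage_phi: "zariski_open Y (poly_funs n) V \<Longrightarrow> openin (top_of S) {x \<in> points S. \<phi> x \<in> V}"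
  using mor unfolding fs_morphism_def continuous_map_def topspace_zariski_poly
    openin_zariski_poly by blast

lemma reg_pull: 
  assumes "f \<in> poly_funs n"
  shows "f \<circ> \<phi> \<in> reg S (points S)"
proof -
  let ?Z = "zariski_space Y (poly_funs n)"
  have "openin (top_of ?Z) Y" using openin_topspace[of "top_of ?Z"] unfolding topspace_zariski_poly .
  then have "f \<circ> \<phi> \<in> reg S {x \<in> points S. \<phi> x \<in> Y}"
    using mor reg_zariski_poly[OF assms] unfolding fs_morphism_def by blast
  moreover have "{x \<in> points S. \<phi> x \<in> Y} = points S" using phi_mem by blast
  ultimately show ?thesis by simp
qed

lemma closed_cut_out:
  assumes "openin (top_of S) U" "x \<in> U"
  shows "\<exists>g\<in>reg S (points S). g x \<noteq> 0 \<and> (\<forall>y\<in>points S - U. g y = 0)"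
proof -
  obtain F where F: "F \<subseteq> poly_funs n" "{y \<in> Y. \<psi> y \<in> U} = {y \<in> Y. \<exists>f\<in>F. f y \<noteq> 0}"
    using open_preimage_psi[OF assms(1)] unfolding zariski_open_def by blast
  have x: "x \<in> points S" using assms openin_subset by blast
  have "\<phi> x \<in> {y \<in> Y. \<psi> y \<in> U}" using phi_mem[OF x] inv[OF x] assms(2) by simp
  then obtain f where f: "f \<in> F" "f (\<phi> x) \<noteq> 0" unfolding F(2) by blast
  have "f (\<phi> y) = 0" if y: "y \<in> points S - U" for y
  proof (rule ccontr)
    assume "f (\<phi> y) \<noteq> 0"
    then have "\<phi> y \<in> {y \<in> Y. \<psi> y \<in> U}" unfolding F(2) using f(1) phi_mem y by blast
    then show False using inv y by auto
  qed
  then show ?thesis using f reg_pull[of f] F(1) by (intro bexI[of _ "f \<circ> \<phi>"]) auto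
qed

lemma T1_points:
  assumes "x \<in> points S" "y \<in> points S" "x \<noteq> y"
  shows "\<exists>U. openin (top_of S) U \<and> x \<in> U \<and> y \<notin> U"
proof -
  have "\<phi> x \<noteq> \<phi> y" using inv assms by metis
  then obtain i where i: "\<phi> x i \<noteq> \<phi> y i" by blast
  have "i < n" using i phi_mem[OF assms(1)] phi_mem[OF assms(2)] Y_sub unfolding affine_space_def
    by (metis (mono_tags, lifting) linorder_not_less mem_Collect_eq subsetD)
  define f where "f = (\<lambda>a. a i) + (\<lambda>_. - \<phi> y i)"
  have f: "f \<in> poly_funs n" unfolding f_def by (intro poly_funs_add poly_funs_coord poly_funs_const \<open>i < n\<close>)
  have "zariski_open Y (poly_funs n) {v \<in> Y. f v \<noteq> 0}"
    unfolding zariski_open_def by (rule exI[of _ "{f}"]) (use f in auto)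
  from open_preimage_phi[OF this] show ?thesis
    using i assms phi_mem by (intro exI[of _ "{x \<in> points S. \<phi> x \<in> {v \<in> Y. f v \<noteq> 0}}"]) (auto simp: f_def)
qed

lemma reg_nonzero_nbhd:
  assumes U: "openin (top_of S) U" "x \<in> U" "g \<in> reg S U" "g x \<noteq> 0"
  shows "\<exists>V. openin (top_of S) V \<and> x \<in> V \<and> V \<subseteq> U \<and> (\<forall>y\<in>V. g y \<noteq> 0)"
proof -
  have x: "x \<in> points S" using U openin_subset by blast
  have "g \<circ> \<psi> \<in> reg (zariski_space Y (poly_funs n)) {y \<in> points (zariski_space Y (poly_funs n)). \<psi> y \<in> U}"
    using mor' U unfolding fs_morphism_def by blast
  then have g: "g \<circ> \<psi> \<in> reg (zariski_space Y (poly_funs n)) {y \<in> Y. \<psi> y \<in> U}"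
    unfolding topspace_zariski_poly .
  have "\<phi> x \<in> {y \<in> Y. \<psi> y \<in> U}" using phi_mem[OF x] inv[OF x] U(2) by simp
  moreover have "\<forall>x\<in>{y \<in> Y. \<psi> y \<in> U}. \<exists>V a b. zariski_open Y (poly_funs n) V \<and> x \<in> V \<and>
      V \<subseteq> {y \<in> Y. \<psi> y \<in> U} \<and> a \<in> poly_funs n \<and> b \<in> poly_funs n \<and> (\<forall>y\<in>V. b y \<noteq> 0 \<and> (g \<circ> \<psi>) y = a y / b y)"
    using g unfolding zariski_space_def by simp
  ultimately obtain V a b where V: "zariski_open Y (poly_funs n) V" "\<phi> x \<in> V" "V \<subseteq> {y \<in> Y. \<psi> y \<in> U}"
    "a \<in> poly_funs n" "b \<in> poly_funs n" "\<forall>y\<in>V. b y \<noteq> 0 \<and> (g \<circ> \<psi>) y = a y / b y"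
    by (drule_tac bspec) (assumption, elim exE conjE, rule that)
  obtain F where F: "F \<subseteq> poly_funs n" "V = {y \<in> Y. \<exists>f\<in>F. f y \<noteq> 0}" using V(1) unfolding zariski_open_def by blast
  define V' where "V' = {y \<in> V. a y \<noteq> 0}"
  have "V' = {y \<in> Y. \<exists>f\<in>(\<lambda>f. f * a) ` F. f y \<noteq> 0}" unfolding V'_def F(2) by auto
  then have V': "zariski_open Y (poly_funs n) V'"
    unfolding zariski_open_def using F(1) V(4) by (intro exI[of _ "(\<lambda>f. f * a) ` F"]) (auto intro: poly_funs_mult)
  have gx: "a (\<phi> x) \<noteq> 0" using V(2,6) inv[OF x] U(4) by auto
  have nz: "g y \<noteq> 0 \<and> y \<in> U" if y: "y \<in> points S" "\<phi> y \<in> V'" for y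
  proof -
    have "\<phi> y \<in> V" "a (\<phi> y) \<noteq> 0" using y(2) unfolding V'_def by auto
    then have "(g \<circ> \<psi>) (\<phi> y) \<noteq> 0" "\<psi> (\<phi> y) \<in> U" using V(3,6) by auto
    then show ?thesis using inv[OF y(1)] by simp
  qed
  show ?thesis
    using open_preimage_phi[OF V'] x V(2) gx nz
    by (intro exI[of _ "{y \<in> points S. \<phi> y \<in> V'}"]) (auto simp: V'_def)
qed

end

text \<open>The vanishing ideals of \<open>C1\<close> and \<open>C2\<close> have no common zero, so
  1 is a sum of an element of each; the summand from the ideal of \<open>C1\<close> is the
  function.\<close>

lemma affine_separation:
  fixes S :: "('a, 'k::{alg_closed_field, field_char_0}) fspace"
  assumes "affine_chart S n Y \<phi> \<psi>" and Y: "I \<subseteq> poly_funs n" "Y = {a \<in> affine_space n. \<forall>f\<in>I. f a = 0}"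
    and C: "openin (top_of S) (points S - C1)" "openin (top_of S) (points S - C2)" "C1 \<inter> C2 = {}"
    "C1 \<subseteq> points S" "C2 \<subseteq> points S"
  shows "\<exists>g\<in>reg S (points S). (\<forall>x\<in>C1. g x = 0) \<and> (\<forall>x\<in>C2. g x = 1)"
proof -
  interpret affine_chart S n Y \<phi> \<psi> by fact
  define J where "J C = {f \<in> poly_funs n. \<forall>x\<in>C. f (\<phi> x) = 0}" for C
  define K where "K = {f + g | f g. f \<in> J C1 \<and> g \<in> J C2}"
  have Jadd: "f + g \<in> J C" if "f \<in> J C" "g \<in> J C" for f g C
    using that poly_funs_add unfolding J_def by auto
  have Jmult: "f * g \<in> J C" if "f \<in> poly_funs n" "g \<in> J C" for f g C
    using that poly_funs_mult unfolding J_def by auto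
  have J0: "0 \<in> J C" for C using poly_funs_const[of 0 n] unfolding J_def zero_fun_def by auto
  have sub: "subalgebra (\<lambda>c _. c) (poly_funs n :: ((nat \<Rightarrow> 'k) \<Rightarrow> 'k) set)"
    unfolding poly_funs_def by (rule subalgebra_alg_gen[OF structure_map_const])
  have "subalgebra.ideal_on (poly_funs n) K"
    unfolding subalgebra.ideal_on_def[OF sub]
  proof (intro conjI ballI)
    show "K \<subseteq> poly_funs n" unfolding K_def J_def using poly_funs_add by auto
    show "0 \<in> K" unfolding K_def using J0 by (intro CollectI exI[of _ 0]) auto
  next
    fix a b assume "a \<in> K" "b \<in> K"
    then obtain f g f' g' where *: "f \<in> J C1" "g \<in> J C2" "f' \<in> J C1" "g' \<in> J C2" "a = f + g" "b = f' + g'"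
      unfolding K_def by auto
    then have "a + b = (f + f') + (g + g')" by (simp add: algebra_simps)
    then show "a + b \<in> K" unfolding K_def using Jadd * by blast
  next
    fix c a :: "(nat \<Rightarrow> 'k) \<Rightarrow> 'k" assume c: "c \<in> poly_funs n" and "a \<in> K"
    then obtain f g where *: "f \<in> J C1" "g \<in> J C2" "a = f + g" unfolding K_def by auto
    then have "c * a = c * f + c * g" by (simp add: algebra_simps)
    then show "c * a \<in> K" unfolding K_def using Jmult c * by blast
  qed
  moreover have "\<exists>f\<in>K. f a \<noteq> 0" if a: "a \<in> affine_space n" for a
  proof (rule ccontr)
    assume no: "\<not> (\<exists>f\<in>K. f a \<noteq> 0)"
    have van: "f a = 0" if "f \<in> J C1 \<or> f \<in> J C2" for f
    proof -
      have "f \<in> K" using that J0 unfolding K_def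
        by (auto intro: exI[of _ f] exI[of _ 0])
      then show ?thesis using no by blast
    qed
    have "f \<in> J C1" if "f \<in> I" for f
      using that Y phi_mem C(4) unfolding J_def by auto
    then have aY: "a \<in> Y" unfolding Y(2) using a van by blast
    \<comment> \<open>A closed set is cut out by its ideal, so a common zero of both ideals would
      give a common point of \<open>C1\<close> and \<open>C2\<close>.\<close>
    have mem: "\<psi> a \<in> C" if o: "openin (top_of S) (points S - C)" and v: "\<And>f. f \<in> J C \<Longrightarrow> f a = 0"
      and CS: "C \<subseteq> points S" for C
    proof (rule ccontr)
      assume "\<psi> a \<notin> C"
      obtain F where F: "F \<subseteq> poly_funs n" "{y \<in> Y. \<psi> y \<in> points S - C} = {y \<in> Y. \<exists>f\<in>F. f y \<noteq> 0}"
        using open_preimage_psi[OF o] unfolding zariski_open_def by blast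
      have "a \<in> {y \<in> Y. \<psi> y \<in> points S - C}" using aY psi_mem \<open>\<psi> a \<notin> C\<close> by auto
      then obtain f where f: "f \<in> F" "f a \<noteq> 0" unfolding F(2) by blast
      have "f (\<phi> x) = 0" if x: "x \<in> C" for x
      proof (rule ccontr)
        assume "f (\<phi> x) \<noteq> 0"
        then have "\<phi> x \<in> {y \<in> Y. \<psi> y \<in> points S - C}" unfolding F(2) using f(1) phi_mem x CS by blast
        then show False using inv x CS by auto
      qed
      then have "f \<in> J C" unfolding J_def using f(1) F(1) by auto
      then show False using v f(2) by blast
    qed
    have "\<psi> a \<in> C1" by (rule mem[OF C(1) _ C(4)]) (use van in blast)
    moreover have "\<psi> a \<in> C2" by (rule mem[OF C(2) _ C(5)]) (use van in blast)
    ultimately show False using C(3) by blast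
  qed
  ultimately have "1 \<in> K" by (rule weak_nullstellensatz)
  then obtain f g where fg: "f \<in> J C1" "g \<in> J C2" "1 = f + g" unfolding K_def by auto
  have "f (\<phi> x) = 1" if "x \<in> C2" for x
  proof -
    have "f (\<phi> x) + g (\<phi> x) = 1" using fun_cong[OF fg(3), of "\<phi> x"] by simp
    then show ?thesis using fg(2) that unfolding J_def by simp
  qed
  then show ?thesis using fg(1) reg_pull[of f] unfolding J_def
    by (intro bexI[of _ "f \<circ> \<phi>"]) auto
qed

lemma fs_affine_chart:
  assumes "fs_affine S"
  obtains n I \<phi> \<psi> where "I \<subseteq> poly_funs n"
    "affine_chart S n {a \<in> affine_space n. \<forall>f\<in>I. f a = 0} \<phi> \<psi>"
proof -
  obtain n I where I: "I \<subseteq> poly_funs n"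
    "fs_isomorphic S (zariski_space {a \<in> affine_space n. \<forall>f\<in>I. f a = 0} (poly_funs n))"
    using assms unfolding fs_affine_def by blast
  then obtain \<phi> \<psi> where "fs_morphism S (zariski_space {a \<in> affine_space n. \<forall>f\<in>I. f a = 0} (poly_funs n)) \<phi>"
    "fs_morphism (zariski_space {a \<in> affine_space n. \<forall>f\<in>I. f a = 0} (poly_funs n)) S \<psi>"
    "\<forall>x\<in>points S. \<psi> (\<phi> x) = x" "\<forall>y\<in>{a \<in> affine_space n. \<forall>f\<in>I. f a = 0}. \<phi> (\<psi> y) = y"
    unfolding fs_isomorphic_def topspace_zariski_poly by blast
  then have "affine_chart S n {a \<in> affine_space n. \<forall>f\<in>I. f a = 0} \<phi> \<psi>"
    by unfold_locales auto
  then show thesis using that I(1) by blast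
qed

lemma points_open_subspace: "openin (top_of S) U \<Longrightarrow> points (open_subspace S U) = U"
  unfolding open_subspace_def using openin_subset by fastforce

lemma openin_open_subspace:
  assumes "openin (top_of S) U"
  shows "openin (top_of (open_subspace S U)) V \<longleftrightarrow> openin (top_of S) V \<and> V \<subseteq> U"
  unfolding open_subspace_def using openin_open_subtopology[OF assms] by simp

lemma reg_open_subspace [simp]: "reg (open_subspace S U) = reg S"
  unfolding open_subspace_def by simp

section \<open>Topology of a variety\<close>

locale variety_facts =
  fixes X :: "('x, 'k::{alg_closed_field, field_char_0}) fspace"
  assumes var: "variety X"
begin

lemma sheaf: "function_sheaf X" and irr: "irreducible_subspace (top_of X) (points X)"
  using var unfolding variety_def by auto

lemma reg_const: "openin (top_of X) U \<Longrightarrow> (\<lambda>_. c) \<in> reg X U"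
  and reg_add: "openin (top_of X) U \<Longrightarrow> g \<in> reg X U \<Longrightarrow> h \<in> reg X U \<Longrightarrow> g + h \<in> reg X U"
  and reg_mult: "openin (top_of X) U \<Longrightarrow> g \<in> reg X U \<Longrightarrow> h \<in> reg X U \<Longrightarrow> g * h \<in> reg X U"
  and reg_restrict: "openin (top_of X) U \<Longrightarrow> openin (top_of X) V \<Longrightarrow> V \<subseteq> U \<Longrightarrow> g \<in> reg X U \<Longrightarrow> g \<in> reg X V"
proof -
  note at = sheaf[unfolded function_sheaf_def, THEN spec, THEN mp]
  note at3 = conjunct2[OF conjunct2[OF at]]
  show "openin (top_of X) U \<Longrightarrow> (\<lambda>_. c) \<in> reg X U"
    by (rule conjunct1[OF at, rule_format])
  show "openin (top_of X) U \<Longrightarrow> g \<in> reg X U \<Longrightarrow> h \<in> reg X U \<Longrightarrow> g + h \<in> reg X U"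
    by (rule conjunct1[OF conjunct2[OF at], rule_format, THEN conjunct1])
  show "openin (top_of X) U \<Longrightarrow> g \<in> reg X U \<Longrightarrow> h \<in> reg X U \<Longrightarrow> g * h \<in> reg X U"
    by (rule conjunct1[OF conjunct2[OF at], rule_format, THEN conjunct2])
  show "openin (top_of X) U \<Longrightarrow> openin (top_of X) V \<Longrightarrow> V \<subseteq> U \<Longrightarrow> g \<in> reg X U \<Longrightarrow> g \<in> reg X V"
    by (rule conjunct1[OF conjunct2[OF at3], rule_format])
qed

lemma affine_nbhd:
  assumes "x \<in> points X"
  obtains U where "openin (top_of X) U" "x \<in> U" "fs_affine (open_subspace X U)"
  using assms var unfolding variety_def by blast

text \<open>On an affine chart a regular function is locally a quotient of polynomials, whose
  numerator has an open nonvanishing locus. The sheaf axioms alone do not give this.\<close>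

lemma reg_nonzero_open:
  assumes "openin (top_of X) U" "g \<in> reg X U"
  shows "openin (top_of X) {x \<in> U. g x \<noteq> 0}"
proof (subst openin_subopen, intro ballI)
  fix x assume x: "x \<in> {x \<in> U. g x \<noteq> 0}"
  then have "x \<in> points X" using assms openin_subset by blast
  then obtain U' where U': "openin (top_of X) U'" "x \<in> U'" "fs_affine (open_subspace X U')"
    by (rule affine_nbhd)
  obtain n I \<phi> \<psi> where "I \<subseteq> poly_funs n"
    and ch: "affine_chart (open_subspace X U') n {a \<in> affine_space n. \<forall>f\<in>I. f a = 0} \<phi> \<psi>"
    by (rule fs_affine_chart[OF U'(3)])
  from ch interpret affine_chart "open_subspace X U'" n "{a \<in> affine_space n. \<forall>f\<in>I. f a = 0}" \<phi> \<psi> .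
  have o: "openin (top_of X) (U \<inter> U')" using assms(1) U'(1) by (rule openin_Int)
  then have "openin (top_of (open_subspace X U')) (U \<inter> U')" unfolding openin_open_subspace[OF U'(1)] by simp
  moreover have "g \<in> reg (open_subspace X U') (U \<inter> U')"
    using reg_restrict[OF assms(1) o _ assms(2)] by simp
  ultimately obtain V where "openin (top_of (open_subspace X U')) V" "x \<in> V" "V \<subseteq> U \<inter> U'" "\<forall>y\<in>V. g y \<noteq> 0"
    using reg_nonzero_nbhd[of "U \<inter> U'" x g] x U'(2) by blast
  then show "\<exists>V. openin (top_of X) V \<and> x \<in> V \<and> V \<subseteq> {x \<in> U. g x \<noteq> 0}"
    unfolding openin_open_subspace[OF U'(1)] by blast
qed

lemma affine_cut_out:
  assumes U: "openin (top_of X) U" "fs_affine (open_subspace X U)"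
    and V: "openin (top_of X) V" "x \<in> U" "x \<in> V"
  shows "\<exists>g\<in>reg X U. g x \<noteq> 0 \<and> (\<forall>y\<in>U - V. g y = 0)"
proof -
  obtain n I \<phi> \<psi> where "I \<subseteq> poly_funs n"
    and ch: "affine_chart (open_subspace X U) n {a \<in> affine_space n. \<forall>f\<in>I. f a = 0} \<phi> \<psi>"
    by (rule fs_affine_chart[OF U(2)])
  from ch interpret affine_chart "open_subspace X U" n "{a \<in> affine_space n. \<forall>f\<in>I. f a = 0}" \<phi> \<psi> .
  have "openin (top_of (open_subspace X U)) (U \<inter> V)"
    unfolding openin_open_subspace[OF U(1)] using U V openin_Int by blast
  from closed_cut_out[OF this, of x] V show ?thesis
    unfolding points_open_subspace[OF U(1)] by auto
qed

lemma T1: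
  assumes "x \<in> points X" "y \<in> points X" "x \<noteq> y"
  shows "\<exists>U. openin (top_of X) U \<and> x \<in> U \<and> y \<notin> U"
proof -
  obtain U where U: "openin (top_of X) U" "x \<in> U" "fs_affine (open_subspace X U)"
    by (rule affine_nbhd[OF assms(1)])
  show ?thesis
  proof (cases "y \<in> U")
    case True
    obtain n I \<phi> \<psi> where "I \<subseteq> poly_funs n"
      and ch: "affine_chart (open_subspace X U) n {a \<in> affine_space n. \<forall>f\<in>I. f a = 0} \<phi> \<psi>"
      by (rule fs_affine_chart[OF U(3)])
    from ch interpret affine_chart "open_subspace X U" n "{a \<in> affine_space n. \<forall>f\<in>I. f a = 0}" \<phi> \<psi> .
    from T1_points[of x y] True U assms(3) show ?thesis
      unfolding points_open_subspace[OF U(1)] openin_open_subspace[OF U(1)] by blast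
  qed (use U in blast)
qed

lemma open_meets:
  assumes "openin (top_of X) U" "openin (top_of X) V" "U \<noteq> {}" "V \<noteq> {}"
  shows "U \<inter> V \<noteq> {}"
proof
  assume e: "U \<inter> V = {}"
  have UV: "U \<subseteq> points X" "V \<subseteq> points X" using assms openin_subset by auto
  have "closedin (top_of X) (points X - U)" "closedin (top_of X) (points X - V)" using assms by auto
  moreover have "points X \<subseteq> (points X - U) \<union> (points X - V)" using e by blast
  ultimately have "points X \<subseteq> points X - U \<or> points X \<subseteq> points X - V"
    using irr unfolding irreducible_subspace_def by blast
  then show False using UV assms by blast
qed

end

context bunched
begin

section \<open>Regular functions on invariant open sets\<close>

definition inv_open :: "('r \<Rightarrow> 'k) set \<Rightarrow> bool" where
  "inv_open W \<longleftrightarrow> openin (top_of (Xbar B)) W \<and> W \<noteq> {} \<and> (\<forall>\<chi>\<in>torus B. \<forall>z\<in>W. act \<chi> z \<in> W)"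

lemma inv_open_sub: "inv_open W \<Longrightarrow> W \<subseteq> Z"
  unfolding inv_open_def openin_Xbar by auto

lemma open_basic:
  assumes "openin (top_of (Xbar B)) W" "z \<in> W"
  shows "z \<in> Z \<and> (\<exists>c. z c \<noteq> 0 \<and> (\<forall>y\<in>Z. y c \<noteq> 0 \<longrightarrow> y \<in> W))"
  using assms unfolding openin_Xbar by blast

lemma vanish_on_open:
  assumes "openin (top_of (Xbar B)) W" "W \<noteq> {}" "\<And>z. z \<in> W \<Longrightarrow> z a = 0"
  shows "a = 0"
proof -
  obtain z0 where "z0 \<in> W" using assms(2) by blast
  then obtain c where c: "z0 \<in> Z" "z0 c \<noteq> 0" "\<forall>y\<in>Z. y c \<noteq> 0 \<longrightarrow> y \<in> W" using open_basic[OF assms(1)] by blast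
  then have "c \<noteq> 0" using pt_0 by blast
  then show ?thesis by (rule vanish_open) (use c assms(3) in blast)
qed

text \<open>Local fractions agree in the fraction field, because principal open sets are dense. If
  a/b is their common value in lowest terms, then \<open>b\<close> divides every local denominator
  and so vanishes nowhere on \<open>W\<close>.\<close>

lemma reg_fraction:
  assumes W: "openin (top_of (Xbar B)) W" "W \<noteq> {}" and h: "h \<in> reg (Xbar B) W"
  shows "\<exists>a b. \<forall>z\<in>W. z b \<noteq> 0 \<and> h z = z a / z b"
proof -
  obtain z0 where z0: "z0 \<in> W" using W by blast
  have loc: "\<exists>a b c. y c \<noteq> 0 \<and> y b \<noteq> 0 \<and> y \<in> Z \<and> (\<forall>z\<in>Z. z c \<noteq> 0 \<longrightarrow> z b \<noteq> 0 \<and> h z = z a / z b)" if y: "y \<in> W" for y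
  proof -
    obtain V a b where V: "openin (top_of (Xbar B)) V" "y \<in> V" "\<forall>z\<in>V. z b \<noteq> 0 \<and> h z = z a / z b"
      using h[unfolded reg_Xbar, rule_format, OF y] by (elim exE conjE) (rule that)
    obtain c where "y \<in> Z" "y c \<noteq> 0" "\<forall>z\<in>Z. z c \<noteq> 0 \<longrightarrow> z \<in> V" using open_basic[OF V(1,2)] by blast
    then show ?thesis using V(2,3) by (intro exI[of _ a] exI[of _ b] exI[of _ c]) simp
  qed
  obtain a0 b0 c0 where 0: "z0 c0 \<noteq> 0" "z0 b0 \<noteq> 0" "z0 \<in> Z"
    "\<forall>z\<in>Z. z c0 \<noteq> 0 \<longrightarrow> z b0 \<noteq> 0 \<and> h z = z a0 / z b0" using loc[OF z0] by (elim exE conjE) (rule that)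
  have n0: "c0 \<noteq> 0" "b0 \<noteq> 0" using 0 pt_0 by auto
  obtain g a b where ab: "a0 = g * a" "b0 = g * b" "g \<noteq> 0" "\<not> (\<exists>q. prime_elem q \<and> q dvd a \<and> q dvd b)"
    using coprime_fraction[OF n0(2), of a0] by (elim exE conjE) (rule that)
  have b0: "b \<noteq> 0" using ab(2) n0(2) by auto
  have "y b \<noteq> 0 \<and> h y = y a / y b" if y: "y \<in> W" for y
  proof -
    obtain a1 b1 c1 where 1: "y c1 \<noteq> 0" "y b1 \<noteq> 0" "y \<in> Z"
      "\<forall>z\<in>Z. z c1 \<noteq> 0 \<longrightarrow> z b1 \<noteq> 0 \<and> h z = z a1 / z b1" using loc[OF y] by (elim exE conjE) (rule that)
    have "c1 \<noteq> 0" using 1 pt_0 by auto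
    then have "c0 * c1 \<noteq> 0" using n0 by simp
    then have "a0 * b1 - a1 * b0 = 0"
    proof (rule vanish_open)
      fix z assume z: "z \<in> Z" "z (c0 * c1) \<noteq> 0"
      then have "z b0 \<noteq> 0" "h z = z a0 / z b0" "z b1 \<noteq> 0" "h z = z a1 / z b1" using 0(4) 1(4) by auto
      then show "z (a0 * b1 - a1 * b0) = 0" using z(1) by (simp add: field_simps)
    qed
    then have "g * (a * b1) = g * (a1 * b)" unfolding ab by (simp add: algebra_simps)
    then have eq: "a * b1 = a1 * b" using ab(3) by simp
    then have "b dvd a * b1" by simp
    then have "b dvd b1" by (rule coprime_dvd[OF b0 ab(4)])
    then have yb: "y b \<noteq> 0" using pt_dvd[OF 1(3), of b b1] 1(2) by auto
    have "y a * y b1 = y a1 * y b" using arg_cong[OF eq, of y] 1(3) by simp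
    moreover have "h y = y a1 / y b1" using 1(4)[rule_format, OF 1(3,1)] by simp
    ultimately show ?thesis using yb 1(2) by (simp add: frac_eq_eq)
  qed
  then show ?thesis by (intro exI[of _ a] exI[of _ b] ballI)
qed

lemma act_inverse:
  assumes "\<chi> \<in> torus B" "z \<in> Z"
  shows "(\<lambda>d. inverse (\<chi> d)) \<in> torus B" "act (\<lambda>d. inverse (\<chi> d)) (act \<chi> z) = z"
proof -
  show t: "(\<lambda>d. inverse (\<chi> d)) \<in> torus B" using assms(1) unfolding torus_def by auto
  show "act (\<lambda>d. inverse (\<chi> d)) (act \<chi> z) = z"
  proof
    fix a
    have "act (\<lambda>d. inverse (\<chi> d)) (act \<chi> z) a = (\<Sum>d\<in>supp a. inverse (\<chi> d) * act \<chi> z (cmp a d))"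
      by (rule act_eq[OF t act_mem[OF assms]])
    also have "\<dots> = (\<Sum>d\<in>supp a. z (cmp a d))"
    proof (intro sum.cong refl)
      fix d assume d: "d \<in> supp a"
      have "act \<chi> z (cmp a d) = \<chi> d * z (cmp a d)"
        by (rule act_homog[OF assms supp_lat[OF d] cmp_mem[OF d]])
      then show "inverse (\<chi> d) * act \<chi> z (cmp a d) = z (cmp a d)"
        using torus_nonzero[OF assms(1) supp_lat[OF d]] by simp
    qed
    also have "\<dots> = z a" using cmp_props(4)[of a] pt_sum[OF assms(2), of "cmp a" "supp a"] by simp
    finally show "act (\<lambda>d. inverse (\<chi> d)) (act \<chi> z) a = z a" .
  qed
qed

lemma mem_dvd_prod_list: "q \<in> set qs \<Longrightarrow> q dvd (prod_list qs :: 'r)"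
  by (induction qs) auto

text \<open>The zeros of \<open>b\<close> lie outside \<open>W\<close>, where some nonzero
  homogeneous \<open>g\<close> vanishes. Hence every prime factor of \<open>b\<close> divides
  \<open>g\<close> and is itself homogeneous.\<close>

lemma denominator_homog:
  assumes W: "inv_open W" and b: "\<And>z. z \<in> W \<Longrightarrow> z b \<noteq> 0"
  shows "\<exists>e\<in>L. b \<in> H e"
proof -
  have o: "openin (top_of (Xbar B)) W" "W \<noteq> {}" using W unfolding inv_open_def by auto
  then obtain z0 where z0: "z0 \<in> W" by blast
  have z0Z: "z0 \<in> Z" using z0 W inv_open_sub by blast
  obtain a where a: "z0 a \<noteq> 0" "\<forall>y\<in>Z. y a \<noteq> 0 \<longrightarrow> y \<in> W" using open_basic[OF o(1) z0] by blast
  have "z0 a = (\<Sum>d\<in>supp a. z0 (cmp a d))"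
    using cmp_props(4)[of a] pt_sum[OF z0Z, of "cmp a" "supp a"] by simp
  then obtain d where d: "d \<in> supp a" "z0 (cmp a d) \<noteq> 0" using a(1) sum.not_neutral_contains_not_neutral by metis
  define g where "g = cmp a d"
  have g: "d \<in> L" "g \<in> H d" "g \<noteq> 0" unfolding g_def using supp_lat cmp_mem d z0Z by auto
  \<comment> \<open>Off \<open>W\<close> the element \<open>a\<close> vanishes; since
    \<open>W\<close> is invariant, it vanishes along the whole orbit of \<open>y\<close>, and
    therefore so does each of its components at \<open>y\<close>.\<close>
  have gv: "y g = 0" if y: "y \<in> Z" "y \<notin> W" for y
    unfolding g_def
  proof (rule orbit_vanish[OF y(1)])
    fix \<chi> assume \<chi>: "\<chi> \<in> torus B"
    have "act \<chi> y \<notin> W"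
    proof
      assume "act \<chi> y \<in> W"
      then have "act (\<lambda>d. inverse (\<chi> d)) (act \<chi> y) \<in> W"
        using W act_inverse(1)[OF \<chi> y(1)] unfolding inv_open_def by blast
      then show False using act_inverse(2)[OF \<chi> y(1)] y(2) by simp
    qed
    then show "act \<chi> y a = 0" using a(2) act_mem[OF \<chi> y(1)] by blast
  qed
  have b0: "b \<noteq> 0" using b[OF z0] pt_0[OF z0Z] by auto
  obtain u qs where uq: "u dvd 1" "\<forall>q\<in>set qs. prime_elem q" "b = u * prod_list qs" using prime_list[OF b0] by blast
  have hq: "\<exists>e\<in>L. q \<in> H e" if q: "q \<in> set qs" for q
  proof -
    have pq: "prime_elem q" using uq(2) q by blast
    have qb: "q dvd b" unfolding uq(3) using q by (intro dvd_mult mem_dvd_prod_list)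
    have "\<not> q dvd 1" using pq by (simp add: prime_elem_def)
    then have "q dvd g"
    proof (rule vanish_on_prime[OF pq])
      fix y assume "y \<in> Z" "y q = 0"
      then show "y g = 0" using gv b pt_dvd[of y, OF _ qb] by blast
    qed
    then show ?thesis using dvd_homog g by blast
  qed
  have "\<exists>e\<in>L. u * prod_list qs \<in> H e" using hq
  proof (induction qs)
    case Nil
    then show ?case using dvd_homog[OF uq(1) lat_0 H_1] by simp
  next
    case (Cons q qs)
    then obtain e where "e \<in> L" "u * prod_list qs \<in> H e" by auto
    moreover obtain e' where "e' \<in> L" "q \<in> H e'" using Cons.prems[of q] by auto
    ultimately have "q * (u * prod_list qs) \<in> H (e' + e)" "e' + e \<in> L" using H_mult lat_add by blast+
    then show ?case by (auto simp: mult_ac)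
  qed
  then show ?thesis unfolding uq(3) .
qed

text \<open>Invariance of a/b makes \<open>a\<close> scale like \<open>b\<close> along each orbit;
  by the independence of characters all its components outside degree \<open>e\<close> vanish on
  \<open>W\<close>.\<close>

lemma invariant_fraction:
  assumes W: "inv_open W" and b: "e \<in> L" "b \<in> H e" "\<And>z. z \<in> W \<Longrightarrow> z b \<noteq> 0"
    and inv: "\<And>\<chi> z. \<chi> \<in> torus B \<Longrightarrow> z \<in> W \<Longrightarrow> act \<chi> z a / act \<chi> z b = z a / z b"
  shows "a \<in> H e"
proof -
  have o: "openin (top_of (Xbar B)) W" "W \<noteq> {}" using W unfolding inv_open_def by auto
  have "cmp a d = 0" if "d \<noteq> e" for d
  proof (cases "d \<in> supp a")
    case True
    have "z (cmp a d) = 0" if z: "z \<in> W" for z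
    proof -
      have zZ: "z \<in> Z" using z W inv_open_sub by blast
      let ?I = "insert e (supp a)"
      have "\<forall>d\<in>?I. z (cmp a d) - (if d = e then z a else 0) = 0"
      proof (rule characters_independent)
        show "finite ?I" "?I \<subseteq> L" using cmp_props(1,2) b(1) by auto
        fix \<chi> assume \<chi>: "\<chi> \<in> torus B"
        have "act \<chi> z b = \<chi> e * z b" by (rule act_homog[OF \<chi> zZ b(1,2)])
        then have "act \<chi> z a = \<chi> e * z a"
          using inv[OF \<chi> z] b(3)[OF z] torus_nonzero[OF \<chi> b(1)] by (simp add: field_simps)
        moreover have "act \<chi> z a = (\<Sum>d\<in>?I. \<chi> d * z (cmp a d))"
          by (rule act_eq_on[OF \<chi> zZ]) (use cmp_props(1) in auto)
        moreover have "(\<Sum>d\<in>?I. \<chi> d * (if d = e then z a else 0)) = \<chi> e * z a"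
          using cmp_props(1)[of a] by (simp add: if_distrib[of "\<lambda>x. _ * x"] cong: if_cong)
        ultimately show "(\<Sum>d\<in>?I. \<chi> d * (z (cmp a d) - (if d = e then z a else 0))) = 0"
          unfolding right_diff_distrib sum_subtractf by simp
      qed
      then show ?thesis using True \<open>d \<noteq> e\<close> by auto
    qed
    then show ?thesis by (rule vanish_on_open[OF o])
  qed (simp add: cmp_outside)
  then have "supp a \<subseteq> {e}" unfolding supp_def by auto
  then have "(\<Sum>d\<in>{e}. cmp a d) = a" by (intro sum_cmp) auto
  then show ?thesis unfolding H_cmp_iff[OF b(1)] by simp
qed

lemma invariant_regular:
  assumes W: "inv_open W" and h: "h \<in> reg (Xbar B) W"
    and inv: "\<And>\<chi> z. \<chi> \<in> torus B \<Longrightarrow> z \<in> W \<Longrightarrow> h (act \<chi> z) = h z"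
  shows "\<exists>e\<in>L. \<exists>a\<in>H e. \<exists>b\<in>H e. \<forall>z\<in>W. z b \<noteq> 0 \<and> h z = z a / z b"
proof -
  have o: "openin (top_of (Xbar B)) W" "W \<noteq> {}" using W unfolding inv_open_def by auto
  obtain a b where ab: "\<forall>z\<in>W. z b \<noteq> 0 \<and> h z = z a / z b" using reg_fraction[OF o h] by blast
  obtain e where e: "e \<in> L" "b \<in> H e" using denominator_homog[OF W, of b] ab by blast
  have "a \<in> H e"
  proof (rule invariant_fraction[OF W e])
    fix \<chi> z assume *: "\<chi> \<in> torus B" "z \<in> W"
    then have "act \<chi> z \<in> W" using W unfolding inv_open_def by blast
    then show "act \<chi> z a / act \<chi> z b = z a / z b" using ab inv[OF *] * by metis
  qed (use ab in blast)
  then show ?thesis using e ab by blast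
qed

lemma fraction_regular:
  assumes "openin (top_of (Xbar B)) W" "\<And>z. z \<in> W \<Longrightarrow> z b \<noteq> 0"
  shows "(\<lambda>z. z a / z b) \<in> reg (Xbar B) W"
  unfolding reg_Xbar using assms by blast

lemma fraction_invariant:
  assumes "\<chi> \<in> torus B" "z \<in> Z" "e \<in> L" "a \<in> H e" "b \<in> H e"
  shows "act \<chi> z a / act \<chi> z b = z a / z b"
  using act_homog[OF assms(1-3)] assms(4,5) torus_nonzero[OF assms(1,3)] by simp

end

section \<open>The good quotient\<close>

context affine_chart
begin

text \<open>A regular function is only locally known to be a quotient a/b. Multiplied by
  \<open>b\<close> and by a polynomial \<open>c\<close> that vanishes wherever this representation
  fails, it becomes a polynomial everywhere. In \<open>p_surj\<close> this puts a multiple of an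
  invariant function into an ideal of polynomials.\<close>

lemma polynomial_multiple:
  assumes g: "g \<in> reg S (points S)" and x: "x \<in> points S" "g x \<noteq> 0"
  shows "\<exists>f\<in>poly_funs n. \<exists>v\<in>poly_funs n. f (\<phi> x) \<noteq> 0 \<and> (\<forall>y\<in>points S. f (\<phi> y) = v (\<phi> y) * g y)"
proof -
  have "g \<circ> \<psi> \<in> reg (zariski_space Y (poly_funs n)) {y \<in> points (zariski_space Y (poly_funs n)). \<psi> y \<in> points S}"
    using mor' g unfolding fs_morphism_def by blast
  moreover have "{y \<in> points (zariski_space Y (poly_funs n)). \<psi> y \<in> points S} = Y"
    unfolding topspace_zariski_poly using psi_mem by blast
  ultimately have "g \<circ> \<psi> \<in> reg (zariski_space Y (poly_funs n)) Y" by (simp only:)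
  then have "\<forall>y\<in>Y. \<exists>V a b. zariski_open Y (poly_funs n) V \<and> y \<in> V \<and>
      V \<subseteq> Y \<and> a \<in> poly_funs n \<and> b \<in> poly_funs n \<and> (\<forall>y\<in>V. b y \<noteq> 0 \<and> (g \<circ> \<psi>) y = a y / b y)"
    unfolding zariski_space_def by simp
  from bspec[OF this phi_mem[OF x(1)]] obtain V a b where V: "zariski_open Y (poly_funs n) V" "\<phi> x \<in> V"
    "a \<in> poly_funs n" "b \<in> poly_funs n" "\<forall>y\<in>V. b y \<noteq> 0 \<and> (g \<circ> \<psi>) y = a y / b y"
    by (elim exE conjE) (rule that)
  obtain F where F: "F \<subseteq> poly_funs n" "V = {y \<in> Y. \<exists>f\<in>F. f y \<noteq> 0}" using V(1) unfolding zariski_open_def by blast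
  obtain c where c: "c \<in> F" "c (\<phi> x) \<noteq> 0" using V(2) unfolding F(2) by blast
  have cp: "c \<in> poly_funs n" using c(1) F(1) by blast
  have "a (\<phi> x) \<noteq> 0" using bspec[OF V(5,2)] inv[OF x(1)] x(2) by auto
  then have "(a * c) (\<phi> x) \<noteq> 0" using c(2) by simp
  moreover have "(a * c) (\<phi> y) = (c * b) (\<phi> y) * g y" if y: "y \<in> points S" for y
  proof (cases "c (\<phi> y) = 0")
    case False
    then have "\<phi> y \<in> V" unfolding F(2) using c(1) phi_mem[OF y] by blast
    then show ?thesis using V(5) inv[OF y] by auto
  qed simp
  ultimately show ?thesis using poly_funs_mult[OF V(3) cp] poly_funs_mult[OF cp V(4)] by blast
qed

end

context bunched
begin

text \<open>Every relevant index set contains a minimal one, so the covering collection may be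
  replaced by all relevant sets.\<close>

lemma Xhat_points_iff: "z \<in> Xhat_points B \<longleftrightarrow> z \<in> Z \<and> (\<exists>J. relevant J \<and> J \<subseteq> nzset z)"
proof
  assume "z \<in> Xhat_points B"
  then obtain \<gamma> where \<gamma>: "\<gamma> \<in> cov B" "z \<in> Xbar_loc B \<gamma>" unfolding Xhat_points_def by blast
  then have "\<gamma> \<in> rlv B" unfolding cov_def by blast
  then obtain J where J: "relevant J" "\<gamma> = coord_face B J" unfolding rlv_eq by blast
  have "z \<in> Z \<and> J \<subseteq> nzset z"
    using \<gamma>(2) relevant_sub[OF J(1)] unfolding J(2) Xbar_loc_coord_face[OF relevant_sub[OF J(1)]] nzset_def by auto
  then show "z \<in> Z \<and> (\<exists>J. relevant J \<and> J \<subseteq> nzset z)" using J(1) by blast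
next
  assume "z \<in> Z \<and> (\<exists>J. relevant J \<and> J \<subseteq> nzset z)"
  then have z: "z \<in> Z" and ex: "\<exists>J. relevant J \<and> J \<subseteq> nzset z" by auto
  define P where "P J \<longleftrightarrow> relevant J \<and> J \<subseteq> nzset z" for J
  obtain J0 where "P J0" using ex unfolding P_def by blast
  then obtain J where J: "P J" and min: "\<And>J'. P J' \<Longrightarrow> card J \<le> card J'"
    using ex_has_least_nat[of P J0 card] by blast
  have rJ: "relevant J" "J \<subseteq> nzset z" using J unfolding P_def by auto
  have "coord_face B J \<in> cov B"
    unfolding cov_def
  proof (intro CollectI conjI notI)
    show "coord_face B J \<in> rlv B" using rJ(1) unfolding relevant_def by blast
    assume "\<exists>\<gamma>1\<in>rlv B. \<gamma>1 \<subset> coord_face B J"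
    then obtain \<gamma>1 where g1: "\<gamma>1 \<in> rlv B" "\<gamma>1 \<subset> coord_face B J" by (elim bexE)
    obtain J1 where J1: "relevant J1" "\<gamma>1 = coord_face B J1" using g1(1) unfolding rlv_eq by blast
    then have "J1 \<subset> J"
      using coord_face_mono_iff[OF relevant_sub[OF J1(1)], of J] g1(2) by blast
    then have "card J1 < card J" using relevant_finite[OF rJ(1)] psubset_card_mono by blast
    moreover have "P J1" using J1(1) \<open>J1 \<subset> J\<close> rJ(2) unfolding P_def by blast
    ultimately show False using min by fastforce
  qed
  moreover have "z \<in> Xbar_loc B (coord_face B J)"
    unfolding Xbar_loc_coord_face[OF relevant_sub[OF rJ(1)]] using z rJ(2) unfolding nzset_def by blast
  ultimately show "z \<in> Xhat_points B" unfolding Xhat_points_def by blast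
qed

lemma sub_nzset_iff: "z \<in> Z \<Longrightarrow> J \<subseteq> {..<r} \<Longrightarrow> J \<subseteq> nzset z \<longleftrightarrow> z (\<Prod>i\<in>J. f i) \<noteq> 0"
proof -
  assume z: "z \<in> Z" and J: "J \<subseteq> {..<r}"
  have "finite J" using J finite_subset by blast
  then show ?thesis using J unfolding pt_prod[OF z] nzset_def by (auto simp: prod_zero_iff)
qed

lemma sub_nzset_open: "J \<subseteq> {..<r} \<Longrightarrow> openin (top_of (Xbar B)) {z \<in> Z. J \<subseteq> nzset z}"
  unfolding openin_Xbar using sub_nzset_iff by (intro exI[of _ "{\<Prod>i\<in>J. f i}"]) auto

lemma Xhat_open: "openin (top_of (Xbar B)) (Xhat_points B)"
proof -
  have "Xhat_points B = \<Union>((\<lambda>J. {z \<in> Z. J \<subseteq> nzset z}) ` {J. relevant J})"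
    using Xhat_points_iff by blast
  moreover have "openin (top_of (Xbar B)) (\<Union>((\<lambda>J. {z \<in> Z. J \<subseteq> nzset z}) ` {J. relevant J}))"
    using sub_nzset_open relevant_sub by (intro openin_Union) blast
  ultimately show ?thesis by simp
qed

lemma nzset_act: "\<chi> \<in> torus B \<Longrightarrow> z \<in> Z \<Longrightarrow> nzset (act \<chi> z) = nzset z"
proof -
  assume \<chi>: "\<chi> \<in> torus B" and z: "z \<in> Z"
  have "act \<chi> z (f i) = 0 \<longleftrightarrow> z (f i) = 0" if "i < r" for i
    using act_homog[OF \<chi> z, of "w i" "f i"] gen_deg[OF that] torus_nonzero[OF \<chi>, of "w i"] by auto
  then show ?thesis unfolding nzset_def by blast
qed

lemma openin_Xhat: "openin (top_of (Xhat B)) V \<longleftrightarrow> openin (top_of (Xbar B)) V \<and> V \<subseteq> Xhat_points B"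
  unfolding Xhat_def by (rule openin_open_subspace[OF Xhat_open])

lemma points_Xhat: "points (Xhat B) = Xhat_points B"
  unfolding Xhat_def by (rule points_open_subspace[OF Xhat_open])

lemma reg_Xhat [simp]: "reg (Xhat B) = reg (Xbar B)"
  unfolding Xhat_def by simp

end

locale good_quot = bunched B for B :: "('k::{alg_closed_field, field_char_0}, 'r::idom, 'v::ab_group_add) bunch_data" +
  fixes X :: "('x, 'k) fspace" and p :: "('r \<Rightarrow> 'k) \<Rightarrow> 'x"
  assumes gq: "good_quotient B X p"
begin

sublocale X: variety_facts X
  by standard (use gq in \<open>simp add: good_quotient_def\<close>)

definition pre :: "'x set \<Rightarrow> ('r \<Rightarrow> 'k) set" where "pre U = {z \<in> Xhat_points B. p z \<in> U}"

lemma p_morphism: "fs_morphism (Xhat B) X p"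
  using gq unfolding good_quotient_def affine_morphism_def by simp

lemma p_act: "\<chi> \<in> torus B \<Longrightarrow> z \<in> Xhat_points B \<Longrightarrow> p (act \<chi> z) = p z"
  using gq unfolding good_quotient_def by simp

lemma p_mem: "z \<in> Xhat_points B \<Longrightarrow> p z \<in> points X"
  using p_morphism unfolding fs_morphism_def continuous_map_def points_Xhat by auto

lemma pre_sub: "pre U \<subseteq> Xhat_points B" "pre U \<subseteq> Z"
  unfolding pre_def using Xhat_points_iff by auto

lemma pre_mono: "U \<subseteq> V \<Longrightarrow> pre U \<subseteq> pre V"
  unfolding pre_def by blast

lemma pre_open: "openin (top_of X) U \<Longrightarrow> openin (top_of (Xbar B)) (pre U)"
proof -
  assume "openin (top_of X) U"
  then have "openin (top_of (Xhat B)) {z \<in> points (Xhat B). p z \<in> U}"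
    using p_morphism unfolding fs_morphism_def continuous_map_def by simp
  then show ?thesis unfolding openin_Xhat points_Xhat pre_def by simp
qed

lemma act_Xhat: "\<chi> \<in> torus B \<Longrightarrow> z \<in> Xhat_points B \<Longrightarrow> act \<chi> z \<in> Xhat_points B"
  unfolding Xhat_points_iff using act_mem nzset_act by auto

lemma pre_inv: "openin (top_of X) U \<Longrightarrow> z \<in> pre U \<Longrightarrow> inv_open (pre U)"
  unfolding inv_open_def using pre_open act_Xhat p_act by (auto simp: pre_def)

lemma quotient_functions:
  assumes "openin (top_of X) U"
  shows "g \<in> reg (Xbar B) (pre U) \<and> (\<forall>\<chi>\<in>torus B. \<forall>z\<in>pre U. g (act \<chi> z) = g z) \<longleftrightarrow>
    (\<exists>h\<in>reg X U. \<forall>z\<in>pre U. g z = h (p z))"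
  using gq assms unfolding good_quotient_def Let_def pre_def[symmetric] reg_Xhat by blast

lemma pull_fraction:
  assumes U: "openin (top_of X) U" "z0 \<in> pre U" and h: "h \<in> reg X U"
  shows "\<exists>e\<in>L. \<exists>a\<in>H e. \<exists>b\<in>H e. \<forall>z\<in>pre U. z b \<noteq> 0 \<and> h (p z) = z a / z b"
proof -
  have "(\<lambda>z. h (p z)) \<in> reg (Xbar B) (pre U) \<and> (\<forall>\<chi>\<in>torus B. \<forall>z\<in>pre U. h (p (act \<chi> z)) = h (p z))"
    unfolding quotient_functions[OF U(1), of "\<lambda>z. h (p z)"] using h by (intro bexI[of _ h]) auto
  then show ?thesis
    using invariant_regular[OF pre_inv[OF U], of "\<lambda>z. h (p z)"] by simp
qed

lemma push_fraction:
  assumes U: "openin (top_of X) U" and e: "e \<in> L" "a \<in> H e" "b \<in> H e"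
    and nz: "\<And>z. z \<in> pre U \<Longrightarrow> z b \<noteq> 0"
  shows "\<exists>h\<in>reg X U. \<forall>z\<in>pre U. h (p z) = z a / z b"
proof -
  have "(\<lambda>z. z a / z b) \<in> reg (Xbar B) (pre U)"
    by (rule fraction_regular[OF pre_open[OF U] nz])
  moreover have "\<forall>\<chi>\<in>torus B. \<forall>z\<in>pre U. act \<chi> z a / act \<chi> z b = z a / z b"
    using fraction_invariant[OF _ _ e] pre_sub(2)[of U] by (intro ballI) auto
  ultimately obtain h where "h \<in> reg X U" "\<forall>z\<in>pre U. z a / z b = h (p z)"
    using quotient_functions[OF U, of "\<lambda>z. z a / z b"] by blast
  then show ?thesis by (intro bexI[of _ h]) auto
qed

lemma separation:
  assumes U: "openin (top_of X) U" "fs_affine (open_subspace X U)"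
    and C: "openin (top_of (Xbar B)) (pre U - C1)" "openin (top_of (Xbar B)) (pre U - C2)" "C1 \<inter> C2 = {}"
    "C1 \<subseteq> pre U" "C2 \<subseteq> pre U"
  shows "\<exists>g\<in>reg (Xbar B) (pre U). (\<forall>z\<in>C1. g z = 0) \<and> (\<forall>z\<in>C2. g z = 1)"
proof -
  let ?S = "open_subspace (Xhat B) (pre U)"
  have o: "openin (top_of (Xhat B)) (pre U)" unfolding openin_Xhat using pre_open[OF U(1)] pre_sub by simp
  have "fs_affine (open_subspace (Xhat B) {z \<in> points (Xhat B). p z \<in> U})"
    using gq U unfolding good_quotient_def affine_morphism_def by blast
  then have aff: "fs_affine ?S" unfolding points_Xhat pre_def .
  have pS: "points ?S = pre U" by (rule points_open_subspace[OF o])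
  have oS: "openin (top_of ?S) V \<longleftrightarrow> openin (top_of (Xbar B)) V \<and> V \<subseteq> pre U" for V
    unfolding openin_open_subspace[OF o] openin_Xhat using pre_sub(1)[of U] by blast
  obtain n I \<phi> \<psi> where I: "I \<subseteq> poly_funs n"
    and ch: "affine_chart ?S n {a \<in> affine_space n. \<forall>f\<in>I. f a = 0} \<phi> \<psi>"
    by (rule fs_affine_chart[OF aff])
  have "\<exists>g\<in>reg ?S (points ?S). (\<forall>x\<in>C1. g x = 0) \<and> (\<forall>x\<in>C2. g x = 1)"
    by (rule affine_separation[OF ch I refl]) (use C in \<open>simp_all add: pS oS\<close>)
  then show ?thesis unfolding pS by simp
qed

text \<open>The injectivity clause of \<open>good_quotient\<close>. It replaces the surjectivity of
  \<open>p\<close> until \<open>p_surj\<close> is available.\<close>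

lemma density:
  assumes "openin (top_of X) U" "h1 \<in> reg X U" "h2 \<in> reg X U" "\<And>z. z \<in> pre U \<Longrightarrow> h1 (p z) = h2 (p z)" "x \<in> U"
  shows "h1 x = h2 x"
  using gq[unfolded good_quotient_def Let_def, THEN conjunct2, THEN conjunct2, THEN conjunct2, THEN spec,
      THEN mp, OF assms(1), THEN conjunct2] assms(2-)
  unfolding pre_def by simp

lemma regular_iff_fraction:
  assumes "openin (top_of (Xbar B)) W" "W \<noteq> {}"
  shows "g \<in> reg (Xbar B) W \<longleftrightarrow> (\<exists>a b. \<forall>z\<in>W. z b \<noteq> 0 \<and> g z = z a / z b)"
proof
  assume "\<exists>a b. \<forall>z\<in>W. z b \<noteq> 0 \<and> g z = z a / z b"
  then obtain a b where ab: "\<forall>z\<in>W. z b \<noteq> 0 \<and> g z = z a / z b" by (elim exE)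
  show "g \<in> reg (Xbar B) W"
    unfolding reg_Xbar using assms(1) ab by (intro ballI exI[of _ W] exI[of _ a] exI[of _ b]) simp
qed (rule reg_fraction[OF assms])

lemma cmp_mult_homog:
  assumes "e \<in> L" "b \<in> H e" "d \<in> L"
  shows "cmp (a * b) (d + e) = cmp a d * b"
proof -
  have "a * b = (\<Sum>x\<in>supp a. cmp a x * b)"
    by (subst (1) cmp_props(4)[of a]) (rule sum_distrib_right)
  then have "cmp (a * b) (d + e) = (\<Sum>x\<in>supp a. cmp (cmp a x * b) (d + e))" by (simp only: cmp_sum)
  also have "\<dots> = (\<Sum>x\<in>supp a. if x = d then cmp a d * b else 0)"
  proof (intro sum.cong refl)
    fix x assume x: "x \<in> supp a"
    show "cmp (cmp a x * b) (d + e) = (if x = d then cmp a d * b else 0)"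
      using cmp_homog[OF lat_add[OF supp_lat[OF x] assms(1)] H_mult[OF supp_lat[OF x] assms(1) cmp_mem[OF x] assms(2)], of "d + e"]
      by auto
  qed
  also have "\<dots> = cmp a d * b" using cmp_props(1)[of a] cmp_outside[of d a] by simp
  finally show ?thesis .
qed

text \<open>\<open>k\<close> is the invariant part of the regular function \<open>g\<close> on the preimage of \<open>U\<close>.\<close>

definition reynolds :: "'x set \<Rightarrow> (('r \<Rightarrow> 'k) \<Rightarrow> 'k) \<Rightarrow> ('x \<Rightarrow> 'k) \<Rightarrow> bool" where
  "reynolds U g k \<longleftrightarrow> k \<in> reg X U \<and> (\<exists>e\<in>L. \<exists>b\<in>H e. \<exists>a. \<forall>z\<in>pre U.
     z b \<noteq> 0 \<and> g z = z a / z b \<and> k (p z) = z (cmp a e) / z b)"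

context
  fixes U z0 assumes U: "openin (top_of X) U" "z0 \<in> pre U"
begin

lemma reynolds_exists:
  assumes "g \<in> reg (Xbar B) (pre U)"
  shows "\<exists>k. reynolds U g k"
proof -
  have ne: "pre U \<noteq> {}" using U(2) by blast
  obtain a b where ab: "\<forall>z\<in>pre U. z b \<noteq> 0 \<and> g z = z a / z b"
    using assms unfolding regular_iff_fraction[OF pre_open[OF U(1)] ne] by (elim exE)
  obtain e where e: "e \<in> L" "b \<in> H e" using denominator_homog[OF pre_inv[OF U], of b] ab by blast
  obtain k where k: "k \<in> reg X U" "\<forall>z\<in>pre U. k (p z) = z (cmp a e) / z b"
    using push_fraction[OF U(1) e(1) cmp_props(3)[OF e(1)] e(2)] ab by blast
  then have "reynolds U g k" unfolding reynolds_def using ab e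
    by (intro conjI bexI[of _ e] bexI[of _ b] exI[of _ a]) simp_all
  then show ?thesis by blast
qed

text \<open>Equal fractions become equal elements of R after cross multiplication, and comparing
  components of degree \<open>e + e'\<close> gives equality of the invariant parts on the image of
  \<open>p\<close>; \<open>density\<close> extends it to \<open>U\<close>.\<close>

lemma reynolds_unique:
  assumes "reynolds U g k" "reynolds U g' k'" and eq: "\<And>z. z \<in> pre U \<Longrightarrow> g z = g' z" and x: "x \<in> U"
  shows "k x = k' x"
proof -
  obtain e b a where 1: "k \<in> reg X U" "e \<in> L" "b \<in> H e"
    "\<forall>z\<in>pre U. z b \<noteq> 0 \<and> g z = z a / z b \<and> k (p z) = z (cmp a e) / z b"
    using assms(1) unfolding reynolds_def by blast
  obtain e' b' a' where 2: "k' \<in> reg X U" "e' \<in> L" "b' \<in> H e'"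
    "\<forall>z\<in>pre U. z b' \<noteq> 0 \<and> g' z = z a' / z b' \<and> k' (p z) = z (cmp a' e') / z b'"
    using assms(2) unfolding reynolds_def by blast
  have "a * b' - a' * b = 0"
  proof (rule vanish_on_open[OF pre_open[OF U(1)]])
    show "pre U \<noteq> {}" using U(2) by blast
    fix z assume z: "z \<in> pre U"
    then have zZ: "z \<in> Z" using pre_sub by blast
    have "z a / z b = z a' / z b'" using 1(4) 2(4) eq z by metis
    then show "z (a * b' - a' * b) = 0" using 1(4) 2(4) z zZ by (simp add: frac_eq_eq)
  qed
  then have "cmp (a * b') (e + e') = cmp (a' * b) (e' + e)" by (simp add: add.commute)
  then have eq: "cmp a e * b' = cmp a' e' * b"
    unfolding cmp_mult_homog[OF 2(2,3) 1(2)] cmp_mult_homog[OF 1(2,3) 2(2)] .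
  show ?thesis
  proof (rule density[OF U(1) 1(1) 2(1) _ x])
    fix z assume z: "z \<in> pre U"
    then have zZ: "z \<in> Z" using pre_sub by blast
    have "z (cmp a e) * z b' = z (cmp a' e') * z b" using arg_cong[OF eq, of z] zZ by simp
    then show "k (p z) = k' (p z)" using 1(4) 2(4) z by (simp add: frac_eq_eq)
  qed
qed

lemma reynolds_add:
  assumes "reynolds U g k" "reynolds U g' k'"
  shows "reynolds U (\<lambda>z. g z + g' z) (k + k')"
proof -
  obtain e b a where 1: "k \<in> reg X U" "e \<in> L" "b \<in> H e"
    "\<forall>z\<in>pre U. z b \<noteq> 0 \<and> g z = z a / z b \<and> k (p z) = z (cmp a e) / z b"
    using assms(1) unfolding reynolds_def by blast
  obtain e' b' a' where 2: "k' \<in> reg X U" "e' \<in> L" "b' \<in> H e'"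
    "\<forall>z\<in>pre U. z b' \<noteq> 0 \<and> g' z = z a' / z b' \<and> k' (p z) = z (cmp a' e') / z b'"
    using assms(2) unfolding reynolds_def by blast
  have c: "cmp (a * b' + a' * b) (e + e') = cmp a e * b' + cmp a' e' * b"
    unfolding cmp_add cmp_mult_homog[OF 2(2,3) 1(2)] using cmp_mult_homog[OF 1(2,3) 2(2), of a']
    by (simp add: add.commute)
  have "\<forall>z\<in>pre U. z (b * b') \<noteq> 0 \<and> g z + g' z = z (a * b' + a' * b) / z (b * b') \<and>
      (k + k') (p z) = z (cmp (a * b' + a' * b) (e + e')) / z (b * b')"
  proof
    fix z assume z: "z \<in> pre U"
    then have zZ: "z \<in> Z" using pre_sub by blast
    show "z (b * b') \<noteq> 0 \<and> g z + g' z = z (a * b' + a' * b) / z (b * b') \<and>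
      (k + k') (p z) = z (cmp (a * b' + a' * b) (e + e')) / z (b * b')"
      unfolding c using bspec[OF 1(4) z] bspec[OF 2(4) z] zZ by (simp add: add_frac_eq)
  qed
  then show ?thesis unfolding reynolds_def
    using X.reg_add[OF U(1) 1(1) 2(1)] lat_add[OF 1(2) 2(2)] H_mult[OF 1(2) 2(2) 1(3) 2(3)]
    by (intro conjI bexI[of _ "e + e'"] bexI[of _ "b * b'"] exI[of _ "a * b' + a' * b"]) simp_all
qed

text \<open>Linearity over the invariants: multiplication by a homogeneous element shifts degrees
  and commutes with taking components.\<close>

lemma reynolds_mult:
  assumes "reynolds U g k" "h \<in> reg X U"
  shows "reynolds U (\<lambda>z. g z * h (p z)) (k * h)"
proof -
  obtain e b a where 1: "k \<in> reg X U" "e \<in> L" "b \<in> H e"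
    "\<forall>z\<in>pre U. z b \<noteq> 0 \<and> g z = z a / z b \<and> k (p z) = z (cmp a e) / z b"
    using assms(1) unfolding reynolds_def by blast
  obtain e' a' b' where 2: "e' \<in> L" "a' \<in> H e'" "b' \<in> H e'" "\<forall>z\<in>pre U. z b' \<noteq> 0 \<and> h (p z) = z a' / z b'"
    using pull_fraction[OF U assms(2)] by blast
  have c: "cmp (a * a') (e + e') = cmp a e * a'" by (rule cmp_mult_homog[OF 2(1,2) 1(2)])
  have "\<forall>z\<in>pre U. z (b * b') \<noteq> 0 \<and> g z * h (p z) = z (a * a') / z (b * b') \<and>
      (k * h) (p z) = z (cmp (a * a') (e + e')) / z (b * b')"
  proof
    fix z assume z: "z \<in> pre U"
    then have zZ: "z \<in> Z" using pre_sub by blast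
    show "z (b * b') \<noteq> 0 \<and> g z * h (p z) = z (a * a') / z (b * b') \<and>
      (k * h) (p z) = z (cmp (a * a') (e + e')) / z (b * b')"
      unfolding c using bspec[OF 1(4) z] bspec[OF 2(4) z] zZ by simp
  qed
  then show ?thesis unfolding reynolds_def
    using X.reg_mult[OF U(1) 1(1) assms(2)] lat_add[OF 1(2) 2(1)] H_mult[OF 1(2) 2(1) 1(3) 2(3)]
    by (intro conjI bexI[of _ "e + e'"] bexI[of _ "b * b'"] exI[of _ "a * a'"]) simp_all
qed

lemma reynolds_const: "reynolds U (\<lambda>_. c) (\<lambda>_. c)"
proof -
  have "z 1 \<noteq> 0 \<and> c = z (\<iota> c) / z 1 \<and> c = z (cmp (\<iota> c) 0) / z 1" if "z \<in> pre U" for z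
  proof -
    have "z \<in> Z" using that pre_sub by blast
    then show ?thesis using cmp_homog[OF lat_0 H_emb_0[of c], of 0] by simp
  qed
  then show ?thesis unfolding reynolds_def using X.reg_const[OF U(1)] H_1 lat_0
    by (intro conjI bexI[of _ 0] bexI[of _ 1] exI[of _ "\<iota> c"]) simp_all
qed

end

text \<open>The fibre over \<open>y\<close> is nonempty: the regular functions on the preimage \<open>W\<close> of an affine
  neighbourhood all of whose multiples have an invariant part vanishing at \<open>y\<close> form a proper ideal,
  and every common zero of that ideal is mapped to \<open>y\<close>.\<close>

lemma p_surj:
  assumes y: "y \<in> points X"
  shows "\<exists>z\<in>Xhat_points B. p z = y"
proof -
  obtain U where U: "openin (top_of X) U" "y \<in> U" "fs_affine (open_subspace X U)"
    by (rule X.affine_nbhd[OF y])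
  let ?W = "pre U"
  \<comment> \<open>Otherwise the constants 0 and 1 would have the same pullback.\<close>
  have "?W \<noteq> {}"
  proof
    assume "?W = {}"
    then have "z \<in> pre U \<Longrightarrow> (\<lambda>_. 0) (p z) = ((\<lambda>_. 1) (p z) :: 'k)" for z by blast
    from density[OF U(1) X.reg_const[OF U(1), of 0] X.reg_const[OF U(1), of 1] this U(2)]
    show False by simp
  qed
  then obtain z0 where z0: "z0 \<in> ?W" by blast
  have ne: "?W \<noteq> {}" using z0 by blast
  note RU = U(1) z0
  have oW: "openin (top_of (Xbar B)) ?W" by (rule pre_open[OF U(1)])
  let ?S = "open_subspace (Xhat B) ?W"
  have o: "openin (top_of (Xhat B)) ?W" unfolding openin_Xhat using oW pre_sub by simp
  have "fs_affine (open_subspace (Xhat B) {z \<in> points (Xhat B). p z \<in> U})"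
    using gq U unfolding good_quotient_def affine_morphism_def by blast
  then have aff: "fs_affine ?S" unfolding points_Xhat pre_def .
  have pS: "points ?S = ?W" by (rule points_open_subspace[OF o])
  have regS: "reg ?S = reg (Xbar B)" by simp
  obtain n I \<phi> \<psi> where I: "I \<subseteq> poly_funs n"
    and ch: "affine_chart ?S n {a \<in> affine_space n. \<forall>f\<in>I. f a = 0} \<phi> \<psi>"
    by (rule fs_affine_chart[OF aff])
  let ?Y = "{a \<in> affine_space n. \<forall>f\<in>I. f a = 0}"
  interpret C: affine_chart ?S n ?Y \<phi> \<psi> by (rule ch)
  have reg_times: "(\<lambda>z. g z * h z) \<in> reg (Xbar B) ?W" if g: "g \<in> reg (Xbar B) ?W" and h: "h \<in> reg (Xbar B) ?W" for g h
  proof -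
    obtain a b where ab: "\<forall>z\<in>?W. z b \<noteq> 0 \<and> g z = z a / z b"
      using g unfolding regular_iff_fraction[OF oW ne] by (elim exE)
    obtain a' b' where ab': "\<forall>z\<in>?W. z b' \<noteq> 0 \<and> h z = z a' / z b'"
      using h unfolding regular_iff_fraction[OF oW ne] by (elim exE)
    have "\<forall>z\<in>?W. z (b * b') \<noteq> 0 \<and> g z * h z = z (a * a') / z (b * b')"
    proof
      fix z assume z: "z \<in> ?W"
      then have "z \<in> Z" using pre_sub by blast
      then show "z (b * b') \<noteq> 0 \<and> g z * h z = z (a * a') / z (b * b')"
        using bspec[OF ab z] bspec[OF ab' z] by simp
    qed
    then show ?thesis unfolding regular_iff_fraction[OF oW ne]
      by (intro exI[of _ "a * a'"] exI[of _ "b * b'"])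
  qed
  have pull: "(\<lambda>z. f (\<phi> z)) \<in> reg (Xbar B) ?W" if "f \<in> poly_funs n" for f
    using C.reg_pull[OF that] unfolding pS regS comp_def .
  \<comment> \<open>Testing all multiples \<open>c\<close> of the pullback makes \<open>K\<close> an
    ideal. It is proper because the invariant part of 1 is 1.\<close>
  define K where "K = {f \<in> poly_funs n. \<forall>c\<in>reg (Xbar B) ?W. \<forall>k. reynolds U (\<lambda>z. c z * f (\<phi> z)) k \<longrightarrow> k y = 0}"
  have sub: "subalgebra (\<lambda>c _. c) (poly_funs n :: ((nat \<Rightarrow> 'k) \<Rightarrow> 'k) set)"
    unfolding poly_funs_def by (rule subalgebra_alg_gen[OF structure_map_const])
  have zeroK: "f \<in> K" if f: "f \<in> poly_funs n" "\<And>z. z \<in> ?W \<Longrightarrow> f (\<phi> z) = 0" for f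
    unfolding K_def
  proof (intro CollectI conjI ballI allI impI)
    fix c k assume "reynolds U (\<lambda>z. c z * f (\<phi> z)) k"
    from reynolds_unique[OF RU this reynolds_const[OF RU, of 0] _ U(2)] show "k y = 0"
      using f(2) by simp
  qed (rule f(1))
  have KD: "k y = 0" if "f \<in> K" "c \<in> reg (Xbar B) ?W" "reynolds U (\<lambda>z. c z * f (\<phi> z)) k" for f c k
    using that unfolding K_def by blast
  have "subalgebra.ideal_on (poly_funs n) K"
    unfolding subalgebra.ideal_on_def[OF sub]
  proof (intro conjI ballI)
    show "K \<subseteq> poly_funs n" unfolding K_def by blast
    have "(0 :: (nat \<Rightarrow> 'k) \<Rightarrow> 'k) \<in> poly_funs n" using poly_funs_const[of 0 n] unfolding zero_fun_def .
    then show "0 \<in> K" by (rule zeroK) (rule zero_fun_apply)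
  next
    fix f g :: "(nat \<Rightarrow> 'k) \<Rightarrow> 'k" assume f: "f \<in> K" and g: "g \<in> K"
    show "f + g \<in> K"
      unfolding K_def
    proof (intro CollectI conjI ballI allI impI)
      show "f + g \<in> poly_funs n" using f g poly_funs_add unfolding K_def by blast
      fix c k assume c: "c \<in> reg (Xbar B) ?W" and k: "reynolds U (\<lambda>z. c z * (f + g) (\<phi> z)) k"
      have fp: "f \<in> poly_funs n" "g \<in> poly_funs n"
        using f g unfolding K_def by simp_all
      obtain k1 where k1: "reynolds U (\<lambda>z. c z * f (\<phi> z)) k1"
        using reynolds_exists[OF RU reg_times[OF c pull[OF fp(1)]]] by blast
      obtain k2 where k2: "reynolds U (\<lambda>z. c z * g (\<phi> z)) k2"
        using reynolds_exists[OF RU reg_times[OF c pull[OF fp(2)]]] by blast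
      have "k y = (k1 + k2) y"
        by (rule reynolds_unique[OF RU k reynolds_add[OF RU k1 k2] _ U(2)]) (simp add: algebra_simps)
      moreover have "k1 y = 0" "k2 y = 0" using KD[OF f c k1] KD[OF g c k2] .
      ultimately show "k y = 0" by simp
    qed
  next
    fix g f :: "(nat \<Rightarrow> 'k) \<Rightarrow> 'k" assume g: "g \<in> poly_funs n" and f: "f \<in> K"
    show "g * f \<in> K"
      unfolding K_def
    proof (intro CollectI conjI ballI allI impI)
      show "g * f \<in> poly_funs n" using f g poly_funs_mult unfolding K_def by blast
      fix c k assume c: "c \<in> reg (Xbar B) ?W" and k: "reynolds U (\<lambda>z. c z * (g * f) (\<phi> z)) k"
      have "(\<lambda>z. c z * (g * f) (\<phi> z)) = (\<lambda>z. (c z * g (\<phi> z)) * f (\<phi> z))" by (simp add: mult.assoc)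
      with k have "reynolds U (\<lambda>z. (c z * g (\<phi> z)) * f (\<phi> z)) k" by simp
      then show "k y = 0" by (rule KD[OF f reg_times[OF c pull[OF g]]])
    qed
  qed
  moreover have "1 \<notin> K"
  proof
    assume "1 \<in> K"
    from KD[OF this pull[OF poly_funs_const[of 1 n]], of "\<lambda>_. 1"] reynolds_const[OF RU, of 1]
    show False by simp
  qed
  ultimately obtain a where a: "a \<in> affine_space n" "\<And>f. f \<in> K \<Longrightarrow> f a = 0"
    using weak_nullstellensatz[of n K] by blast
  have "f \<in> K" if "f \<in> I" for f
    by (rule zeroK) (use that I C.phi_mem in \<open>auto simp: pS\<close>)
  then have aY: "a \<in> ?Y" using a by blast
  define z where "z = \<psi> a"
  have zW: "z \<in> ?W" using C.psi_mem[OF aY] unfolding z_def pS .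
  have pza: "\<phi> z = a" unfolding z_def by (rule C.inv'[OF aY])
  have "p z = y"
  proof (rule ccontr)
    assume "p z \<noteq> y"
    have pzU: "p z \<in> U" using zW unfolding pre_def by blast
    then have "p z \<in> points X" using openin_subset[OF U(1)] by blast
    then obtain V where V: "openin (top_of X) V" "p z \<in> V" "y \<notin> V" using X.T1[OF _ y \<open>p z \<noteq> y\<close>] by blast
    \<comment> \<open>\<open>h\<close> vanishes at \<open>y\<close> but not at \<open>p z\<close>. A
      polynomial multiple of its pullback lies in \<open>K\<close>, since invariant parts are linear
      over invariants, although it does not vanish at \<open>a\<close>.\<close>
    obtain h where h: "h \<in> reg X U" "h (p z) \<noteq> 0" "\<forall>x\<in>U - V. h x = 0"
      using X.affine_cut_out[OF U(1,3) V(1) pzU V(2)] by blast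
    have hy: "h y = 0" using h(3) U(2) V(3) by blast
    have "(\<lambda>z. h (p z)) \<in> reg (Xbar B) ?W"
      using quotient_functions[OF U(1), of "\<lambda>z. h (p z)"] h(1) by blast
    then obtain f v where fv: "f \<in> poly_funs n" "v \<in> poly_funs n" "f (\<phi> z) \<noteq> 0"
      "\<forall>x\<in>?W. f (\<phi> x) = v (\<phi> x) * h (p x)"
      using C.polynomial_multiple[of "\<lambda>z. h (p z)" z] zW h(2) unfolding pS regS by blast
    have "f \<in> K"
      unfolding K_def
    proof (intro CollectI conjI ballI allI impI)
      fix c k assume c: "c \<in> reg (Xbar B) ?W" and k: "reynolds U (\<lambda>z. c z * f (\<phi> z)) k"
      obtain k1 where k1: "reynolds U (\<lambda>z. c z * v (\<phi> z)) k1"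
        using reynolds_exists[OF RU reg_times[OF c pull[OF fv(2)]]] by blast
      have "k y = (k1 * h) y"
        by (rule reynolds_unique[OF RU k reynolds_mult[OF RU k1 h(1)] _ U(2)]) (use fv(4) in simp)
      then show "k y = 0" using hy by simp
    qed (rule fv(1))
    then show False using a(2) fv(3) pza by simp
  qed
  then show ?thesis using zW pre_sub(1) by blast
qed

lemma pre_surj: "x \<in> points X \<Longrightarrow> x \<in> U \<Longrightarrow> \<exists>z\<in>pre U. p z = x"
  using p_surj[of x] unfolding pre_def by blast

text \<open>The closure of the orbit of \<open>z\<close> stays in the locus of a relevant face that contains \<open>z\<close>,
  since on each chart of another relevant face this locus is the nonvanishing set of an invariant.\<close>

lemma saturated_nbhd:
  assumes J: "relevant J" and z: "z \<in> Z" "J \<subseteq> nzset z"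
  shows "\<exists>U. openin (top_of X) U \<and> p z \<in> U \<and> (\<forall>y\<in>pre U. J \<subseteq> nzset y)"
proof -
  have zh: "z \<in> Xhat_points B" unfolding Xhat_points_iff using assms by blast
  obtain U where U: "openin (top_of X) U" "p z \<in> U" "fs_affine (open_subspace X U)"
    by (rule X.affine_nbhd[OF p_mem[OF zh]])
  let ?W = "pre U"
  have zW: "z \<in> ?W" using zh U(2) unfolding pre_def by blast
  have oW: "openin (top_of (Xbar B)) ?W" by (rule pre_open[OF U(1)])
  have WZ: "?W \<subseteq> Z" by (rule pre_sub)
  \<comment> \<open>\<open>C1\<close> contains the orbit of \<open>z\<close> and is cut out by
    homogeneous elements; it stands in for the orbit closure inside the chart.\<close>
  define C1 where "C1 = {y \<in> ?W. \<forall>d\<in>L. \<forall>a\<in>H d. z a = 0 \<longrightarrow> y a = 0}"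
  define C2 where "C2 = {y \<in> ?W. \<not> J \<subseteq> nzset y}"
  have "openin (top_of (Xbar B)) {y \<in> Z. \<exists>a\<in>{a. \<exists>d\<in>L. a \<in> H d \<and> z a = 0}. y a \<noteq> 0}"
    unfolding openin_Xbar by blast
  then have "openin (top_of (Xbar B)) (?W \<inter> {y \<in> Z. \<exists>a\<in>{a. \<exists>d\<in>L. a \<in> H d \<and> z a = 0}. y a \<noteq> 0})"
    by (rule openin_Int[OF oW])
  moreover have "?W \<inter> {y \<in> Z. \<exists>a\<in>{a. \<exists>d\<in>L. a \<in> H d \<and> z a = 0}. y a \<noteq> 0} = ?W - C1"
    unfolding C1_def using WZ by blast
  ultimately have o1: "openin (top_of (Xbar B)) (?W - C1)" by simp
  have "openin (top_of (Xbar B)) (?W \<inter> {y \<in> Z. J \<subseteq> nzset y})"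
    by (rule openin_Int[OF oW sub_nzset_open[OF relevant_sub[OF J]]])
  moreover have "?W \<inter> {y \<in> Z. J \<subseteq> nzset y} = ?W - C2" unfolding C2_def using WZ by blast
  ultimately have o2: "openin (top_of (Xbar B)) (?W - C2)" by simp
  \<comment> \<open>For a point \<open>y\<close> of both sets, compare monomials \<open>P\<close>
    over \<open>J\<close> and \<open>Q\<close> over a relevant subset \<open>J2\<close> of
    \<open>nzset y\<close> of equal degree. The homogeneous element \<open>a\<close> vanishes at
    \<open>z\<close>, hence at \<open>y\<close>, and then \<open>y Q \<noteq> 0\<close> forces
    \<open>y P \<noteq> 0\<close>.\<close>
  have disj: "C2 \<inter> C1 = {}"
  proof (rule ccontr)
    assume "C2 \<inter> C1 \<noteq> {}"
    then obtain y where y: "y \<in> ?W" "\<not> J \<subseteq> nzset y"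
      and y0: "\<And>d a. d \<in> L \<Longrightarrow> a \<in> H d \<Longrightarrow> z a = 0 \<Longrightarrow> y a = 0"
      unfolding C1_def C2_def by blast
    have yZ: "y \<in> Z" using y WZ by blast
    obtain J2 where J2: "relevant J2" "J2 \<subseteq> nzset y" using y(1) pre_sub(1) Xhat_points_iff by blast
    obtain n n' where n: "\<forall>i\<in>J. 0 < n i" "\<forall>i\<in>J2. 0 < n' i"
      "(\<Sum>i\<in>J. s (of_nat (n i)) (w i)) = (\<Sum>i\<in>J2. s (of_nat (n' i)) (w i))"
      using ample_meet[of J J2] J J2(1) unfolding relevant_iff by blast
    define d where "d = (\<Sum>i\<in>J. s (of_nat (n i)) (w i))"
    define P where "P = (\<Prod>i\<in>J. f i ^ n i)"
    define Q where "Q = (\<Prod>i\<in>J2. f i ^ n' i)"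
    have d: "d \<in> L" "P \<in> H d" unfolding d_def P_def by (rule H_prod_gen[OF relevant_sub[OF J]])+
    have Q: "Q \<in> H d" unfolding d_def n(3) Q_def by (rule H_prod_gen[OF relevant_sub[OF J2(1)]])
    define a where "a = \<iota> (z P) * Q - \<iota> (z Q) * P"
    have aH: "a \<in> H d" unfolding a_def by (intro H_diff H_emb d Q)
    have "z a = 0" unfolding a_def using z(1) by simp
    then have "y a = 0" using y0[OF d(1) aH] by blast
    then have eq: "z P * y Q = z Q * y P" unfolding a_def using yZ by simp
    have finJ: "finite J" "finite J2" using J J2(1) relevant_finite by auto
    have "z P \<noteq> 0" unfolding P_def pt_prod[OF z(1)] using z finJ by (auto simp: nzset_def)
    moreover have "y Q \<noteq> 0" unfolding Q_def pt_prod[OF yZ] using J2 yZ finJ by (auto simp: nzset_def)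
    ultimately have "y P \<noteq> 0" using eq by auto
    then have "y (f i) \<noteq> 0" if "i \<in> J" for i
      using that finJ n(1) yZ unfolding P_def pt_prod[OF yZ] by (auto simp: prod_zero_iff)
    then show False using y(2) relevant_sub[OF J] unfolding nzset_def by blast
  qed
  have sub: "C2 \<subseteq> ?W" "C1 \<subseteq> ?W" unfolding C1_def C2_def by auto
  obtain g where g: "g \<in> reg (Xbar B) ?W" "\<forall>y\<in>C2. g y = 0" "\<forall>y\<in>C1. g y = 1"
    using separation[OF U(1,3) o2 o1 disj sub] by blast
  have Wne: "?W \<noteq> {}" using zW by blast
  obtain a b where ab: "\<forall>y\<in>?W. y b \<noteq> 0 \<and> g y = y a / y b" using reg_fraction[OF oW Wne g(1)] by blast
  obtain e where e: "e \<in> L" "b \<in> H e" using denominator_homog[OF pre_inv[OF U(1) zW], of b] ab by blast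
  have actW: "act \<chi> y \<in> ?W" if "\<chi> \<in> torus B" "y \<in> ?W" for \<chi> y
    using pre_inv[OF U(1) zW] that unfolding inv_open_def by blast
  have ce: "cmp a e \<in> H e" by (rule cmp_props(3)[OF e(1)])
  \<comment> \<open>The invariant part of the separating function \<open>g\<close>. It keeps the
    values that \<open>g\<close> takes constantly along orbits: 1 over \<open>z\<close> and 0 over
    the invariant set \<open>C2\<close>.\<close>
  obtain h where h: "h \<in> reg X U" "\<forall>y\<in>?W. h (p y) = y (cmp a e) / y b"
    using push_fraction[OF U(1) e(1) ce e(2)] ab by blast
  have hz: "h (p z) = 1"
  proof -
    have "z (cmp (a - b) e) = 0"
    proof (rule orbit_vanish[OF z(1)])
      fix \<chi> assume \<chi>: "\<chi> \<in> torus B"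
      have "act \<chi> z \<in> C1"
        unfolding C1_def using actW[OF \<chi> zW] act_homog[OF \<chi> z(1)] by auto
      then have "g (act \<chi> z) = 1" using g(3) by blast
      then have "act \<chi> z a = act \<chi> z b" using ab actW[OF \<chi> zW] by (metis divide_eq_1_iff)
      then show "act \<chi> z (a - b) = 0" using act_mem[OF \<chi> z(1)] by simp
    qed
    then have "z (cmp a e) = z b" unfolding cmp_diff using cmp_homog[OF e, of e] z(1) by simp
    then show ?thesis using h(2) ab zW by simp
  qed
  have hC2: "h (p y) = 0" if y: "y \<in> C2" for y
  proof -
    have yW: "y \<in> ?W" using y sub by blast
    then have yZ: "y \<in> Z" using WZ by blast
    have "y (cmp a e) = 0"
    proof (rule orbit_vanish[OF yZ])
      fix \<chi> assume \<chi>: "\<chi> \<in> torus B"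
      have "act \<chi> y \<in> C2"
        using y actW[OF \<chi> yW] nzset_act[OF \<chi> yZ] unfolding C2_def by simp
      then have "g (act \<chi> y) = 0" using g(2) by blast
      then show "act \<chi> y a = 0" using ab actW[OF \<chi> yW] by (metis divide_eq_0_iff)
    qed
    then show ?thesis using h(2) yW by simp
  qed
  define U' where "U' = {x \<in> U. h x \<noteq> 0}"
  have "openin (top_of X) U'" unfolding U'_def by (rule X.reg_nonzero_open[OF U(1) h(1)])
  moreover have "p z \<in> U'" unfolding U'_def using hz U(2) by simp
  moreover have "J \<subseteq> nzset y" if y: "y \<in> pre U'" for y
  proof (rule ccontr)
    assume "\<not> J \<subseteq> nzset y"
    then have "y \<in> C2" using y unfolding C2_def pre_def U'_def by blast
    then show False using hC2 y unfolding pre_def U'_def by blast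
  qed
  ultimately show ?thesis by blast
qed

section \<open>Loci of relevant faces in the quotient\<close>

definition loc :: "nat set \<Rightarrow> 'x set" where "loc J = p ` {z \<in> Z. J \<subseteq> nzset z}"

lemma X_loc_eq: "relevant J \<Longrightarrow> X_loc B p (coord_face B J) = loc J"
proof -
  assume "relevant J"
  then have J: "J \<subseteq> {..<r}" by (rule relevant_sub)
  have "{z \<in> Z. \<forall>i\<in>J. z (f i) \<noteq> 0} = {z \<in> Z. J \<subseteq> nzset z}" using J unfolding nzset_def by blast
  then show ?thesis unfolding X_loc_def loc_def Xbar_loc_coord_face[OF J] by simp
qed

text \<open>Saturation follows from \<open>saturated_nbhd\<close>, whose neighbourhood depends only
  on the image point. Openness needs \<open>p_surj\<close>: each point of that neighbourhood has a
  preimage, which then lies in the locus of \<open>J\<close>.\<close>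

lemma loc_props:
  assumes J: "relevant J"
  shows loc_open: "openin (top_of X) (loc J)" and pre_loc: "pre (loc J) = {z \<in> Z. J \<subseteq> nzset z}"
proof -
  have main: "J \<subseteq> nzset y" if y: "y \<in> Xhat_points B" "p y \<in> loc J" for y
  proof -
    obtain z where z: "z \<in> Z" "J \<subseteq> nzset z" "p y = p z" using y(2) unfolding loc_def by blast
    obtain U where "openin (top_of X) U" "p z \<in> U" "\<forall>y\<in>pre U. J \<subseteq> nzset y"
      using saturated_nbhd[OF J z(1,2)] by blast
    then show ?thesis using y(1) z(3) unfolding pre_def by simp
  qed
  show "pre (loc J) = {z \<in> Z. J \<subseteq> nzset z}"
  proof (intro equalityI subsetI)
    fix y assume "y \<in> pre (loc J)"
    then show "y \<in> {z \<in> Z. J \<subseteq> nzset z}" using main pre_sub(2) unfolding pre_def by blast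
  next
    fix y assume "y \<in> {z \<in> Z. J \<subseteq> nzset z}"
    then show "y \<in> pre (loc J)" unfolding pre_def loc_def Xhat_points_iff using J by blast
  qed
  show "openin (top_of X) (loc J)"
  proof (subst openin_subopen, intro ballI)
    fix x assume "x \<in> loc J"
    then obtain z where z: "z \<in> Z" "J \<subseteq> nzset z" "x = p z" unfolding loc_def by blast
    have zh: "z \<in> Xhat_points B" unfolding Xhat_points_iff using J z by blast
    obtain U where U: "openin (top_of X) U" "p z \<in> U" "\<forall>y\<in>pre U. J \<subseteq> nzset y"
      using saturated_nbhd[OF J z(1,2)] by blast
    have "U \<subseteq> loc J"
    proof
      fix y assume y: "y \<in> U"
      then have "y \<in> points X" using openin_subset[OF U(1)] by blast
      then obtain z' where "z' \<in> pre U" "p z' = y" using pre_surj y by blast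
      then show "y \<in> loc J" using U(3) pre_sub(2) unfolding loc_def by blast
    qed
    then show "\<exists>T. openin (top_of X) T \<and> x \<in> T \<and> T \<subseteq> loc J" using U(1,2) z(3) by blast
  qed
qed

text \<open>The fraction \<open>b * N / P\<close> is invariant and has the same zeros as
  \<open>b\<close> on the locus of \<open>nzset z0\<close>, where the monomials \<open>P\<close> and
  \<open>N\<close> are units.\<close>

lemma nonvanishing_nbhd:
  assumes J: "relevant (nzset z0)" and z0: "z0 \<in> Z" and e: "e \<in> L" "b \<in> H e" "z0 b \<noteq> 0"
  shows "\<exists>U. openin (top_of X) U \<and> p z0 \<in> U \<and> U \<subseteq> loc (nzset z0) \<and> (\<forall>z\<in>pre U. z b \<noteq> 0)"
proof -
  let ?J = "nzset z0"
  have zl: "z0 \<in> pre (loc ?J)" unfolding pre_loc[OF J] using z0 by simp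
  obtain e1 n m where e1: "e1 \<in> L" "(\<Prod>i\<in>?J. f i ^ n i) \<in> H (e + e1)" "(\<Prod>i\<in>?J. f i ^ m i) \<in> H e1"
    using monomial_fraction[OF nzset_sub nonvanishing_weight[OF z0 e]] by blast
  define P where "P = (\<Prod>i\<in>?J. f i ^ n i)"
  define N where "N = (\<Prod>i\<in>?J. f i ^ m i)"
  have nz: "z P \<noteq> 0" "z N \<noteq> 0" if "z \<in> pre (loc ?J)" for z
  proof -
    have "z \<in> Z" "?J \<subseteq> nzset z" using that unfolding pre_loc[OF J] by auto
    then show "z P \<noteq> 0" "z N \<noteq> 0" unfolding P_def N_def by (auto simp: pt_prod nzset_def)
  qed
  have bN: "b * N \<in> H (e + e1)" unfolding N_def by (rule H_mult[OF e(1) e1(1) e(2) e1(3)])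
  have PH: "P \<in> H (e + e1)" unfolding P_def by (rule e1(2))
  obtain h where h: "h \<in> reg X (loc ?J)" "\<forall>z\<in>pre (loc ?J). h (p z) = z (b * N) / z P"
    using push_fraction[OF loc_open[OF J] lat_add[OF e(1) e1(1)] bN PH] nz(1) by blast
  define U where "U = {x \<in> loc ?J. h x \<noteq> 0}"
  have "openin (top_of X) U" unfolding U_def by (rule X.reg_nonzero_open[OF loc_open[OF J] h(1)])
  moreover have "p z0 \<in> U" unfolding U_def using h(2) zl nz[OF zl] e(3) z0 by (auto simp: pre_def)
  moreover have "z b \<noteq> 0" if z: "z \<in> pre U" for z
  proof -
    have zl: "z \<in> pre (loc ?J)" "h (p z) \<noteq> 0" using z unfolding U_def pre_def by auto
    then have "z (b * N) \<noteq> 0" using h(2) by auto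
    moreover have "z \<in> Z" using z pre_sub by blast
    ultimately show ?thesis by auto
  qed
  ultimately show ?thesis unfolding U_def by blast
qed

text \<open>Take a point of the fibre in the locus of \<open>J\<close> with the fewest nonvanishing
  generators. Their index set is relevant, for otherwise \<open>limit_point\<close> leads to a
  smaller one in the same fibre; and it is not larger than \<open>J\<close>, because
  \<open>x\<close> would then lie in the locus of a larger relevant face, which the stratum
  excludes.\<close>

lemma special_point:
  assumes J: "relevant J" and x: "x \<in> stratum B p (coord_face B J)"
  shows "\<exists>z\<in>Z. p z = x \<and> nzset z = J"
proof -
  have xl: "x \<in> loc J" using x unfolding stratum_def X_loc_eq[OF J] by blast
  define P where "P z \<longleftrightarrow> z \<in> Z \<and> J \<subseteq> nzset z \<and> p z = x" for z
  obtain z1 where "P z1" using xl unfolding loc_def P_def by blast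
  then obtain z where z: "P z" and min: "\<And>y. P y \<Longrightarrow> card (nzset z) \<le> card (nzset y)"
    using ex_has_least_nat[of P z1 "\<lambda>z. card (nzset z)"] by blast
  have zp: "z \<in> Z" "J \<subseteq> nzset z" "p z = x" using z unfolding P_def by auto
  have zh: "z \<in> Xhat_points B" unfolding Xhat_points_iff using zp J by blast
  have rel: "relevant (nzset z)"
  proof (rule ccontr)
    assume "\<not> relevant (nzset z)"
    then obtain z1 where z1: "z1 \<in> Z" "J \<subseteq> nzset z1" "nzset z1 \<subset> nzset z"
      "\<forall>a. (\<forall>d. z (cmp a d) = 0) \<longrightarrow> z1 a = 0" using limit_point[OF zp(1) J zp(2)] by blast
    have z1h: "z1 \<in> Xhat_points B" unfolding Xhat_points_iff using z1 J by blast
    \<comment> \<open>Every neighbourhood of \<open>z1\<close> contains a translate of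
      \<open>z\<close>, because a function nonzero at \<open>z1\<close> has a component that is
      nonzero at \<open>z\<close>. As \<open>X\<close> is T1, the images agree.\<close>
    have "p z1 = p z"
    proof (rule ccontr)
      assume "p z1 \<noteq> p z"
      then obtain U where U: "openin (top_of X) U" "p z1 \<in> U" "p z \<notin> U"
        using X.T1[OF p_mem[OF z1h] p_mem[OF zh]] by blast
      have "z1 \<in> pre U" using z1h U(2) unfolding pre_def by blast
      then obtain c where c: "z1 c \<noteq> 0" "\<forall>y\<in>Z. y c \<noteq> 0 \<longrightarrow> y \<in> pre U" using open_basic[OF pre_open[OF U(1)]] by blast
      then obtain d where "z (cmp c d) \<noteq> 0" using z1(4) by blast
      then obtain \<chi> where \<chi>: "\<chi> \<in> torus B" "act \<chi> z c \<noteq> 0" using orbit_vanish[OF zp(1), of c d] by blast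
      then have "act \<chi> z \<in> pre U" using c(2) act_mem[OF \<chi>(1) zp(1)] by blast
      then have "p (act \<chi> z) \<in> U" unfolding pre_def by blast
      then show False using p_act[OF \<chi>(1) zh] U(3) by simp
    qed
    then have "P z1" unfolding P_def using z1 zp by simp
    then have "card (nzset z) \<le> card (nzset z1)" by (rule min)
    moreover have "card (nzset z1) < card (nzset z)" using z1(3) by (intro psubset_card_mono) simp_all
    ultimately show False by simp
  qed
  have "nzset z = J"
  proof (rule ccontr)
    assume ne: "nzset z \<noteq> J"
    let ?\<gamma>1 = "coord_face B (nzset z)"
    have J_sub: "J \<subseteq> {..<r}" by (rule relevant_sub[OF J])
    have "?\<gamma>1 \<in> rlv B" using rel unfolding relevant_def by blast
    moreover have "face qscale (coord_face B J) ?\<gamma>1"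
    proof -
      have "face qscale (coord_face B J) (orthant B)" unfolding face_orthant_iff using J_sub by blast
      then obtain u where u: "Vector_Spaces.linear qscale (*) u" "\<forall>x\<in>orthant B. 0 \<le> u x"
        "coord_face B J = {x \<in> orthant B. u x = 0}" unfolding face_def by blast
      have "coord_face B J \<subseteq> ?\<gamma>1" unfolding coord_face_mono_iff[OF J_sub] by (rule zp(2))
      moreover have "?\<gamma>1 \<subseteq> orthant B" unfolding coord_face_def by blast
      ultimately have "coord_face B J = {x \<in> ?\<gamma>1. u x = 0}" "\<forall>x\<in>?\<gamma>1. 0 \<le> u x" using u(2,3) by blast+
      then show ?thesis unfolding face_def using u(1) by blast
    qed
    moreover have "coord_face B J \<noteq> ?\<gamma>1"
      using coord_face_mono_iff[OF nzset_sub, of z J] ne zp(2) by blast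
    moreover have "x \<in> X_loc B p ?\<gamma>1" unfolding X_loc_eq[OF rel] loc_def using zp by blast
    ultimately show False using x unfolding stratum_def by blast
  qed
  then show ?thesis using zp by blast
qed

end

section \<open>The local ring of a point of the quotient\<close>

lemma domain_iso:
  assumes "domain R" "cring S" and h: "h \<in> ring_iso R S"
  shows "domain S"
proof -
  interpret R: domain R by fact
  interpret S: cring S by fact
  have hom: "h \<in> ring_hom R S" and bij: "bij_betw h (carrier R) (carrier S)"
    using h unfolding ring_iso_def by auto
  interpret h: ring_hom_cring R S h by unfold_locales (rule hom)
  have inj: "h a = h b \<longleftrightarrow> a = b" if "a \<in> carrier R" "b \<in> carrier R" for a b
    using bij that unfolding bij_betw_def inj_on_def by blast
  show ?thesis
  proof (rule domainI)
    show "cring S" by fact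
    show "\<one>\<^bsub>S\<^esub> \<noteq> \<zero>\<^bsub>S\<^esub>" using inj[of "\<one>\<^bsub>R\<^esub>" "\<zero>\<^bsub>R\<^esub>"] by simp
    fix a b assume ab: "a \<otimes>\<^bsub>S\<^esub> b = \<zero>\<^bsub>S\<^esub>" "a \<in> carrier S" "b \<in> carrier S"
    obtain a' b' where *: "a' \<in> carrier R" "b' \<in> carrier R" "a = h a'" "b = h b'"
      using bij ab(2,3) unfolding bij_betw_def by blast
    then have "h (a' \<otimes>\<^bsub>R\<^esub> b') = h \<zero>\<^bsub>R\<^esub>" using ab(1) by simp
    then have "a' \<otimes>\<^bsub>R\<^esub> b' = \<zero>\<^bsub>R\<^esub>" using inj * by blast
    then have "a' = \<zero>\<^bsub>R\<^esub> \<or> b' = \<zero>\<^bsub>R\<^esub>" using R.integral * by blast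
    then show "a = \<zero>\<^bsub>S\<^esub> \<or> b = \<zero>\<^bsub>S\<^esub>" using * by auto
  qed
qed

lemma integrally_closed_iso:
  assumes ic: "integrally_closed S" and R: "cring R" and h: "h \<in> ring_iso R S"
  shows "integrally_closed R"
proof -
  interpret R: cring R by fact
  interpret S: domain S using ic unfolding integrally_closed_def by blast
  have hom: "h \<in> ring_hom R S" and bij: "bij_betw h (carrier R) (carrier S)"
    using h unfolding ring_iso_def by auto
  interpret h: ring_hom_cring R S h by unfold_locales (rule hom)
  have "inv_into (carrier R) h \<in> ring_iso S R" by (rule ring_iso_set_sym[OF R.ring_axioms h])
  then have dR: "domain R" by (rule domain_iso[OF S.domain_axioms R])
  have inj: "h a = h b \<Longrightarrow> a = b" if "a \<in> carrier R" "b \<in> carrier R" for a b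
    using bij that unfolding bij_betw_def inj_on_def by blast
  have hpow: "h (a [^]\<^bsub>R\<^esub> (n::nat)) = h a [^]\<^bsub>S\<^esub> n" if "a \<in> carrier R" for a n
    using that by (induction n) auto
  show ?thesis
    unfolding integrally_closed_def
  proof (intro conjI ballI allI impI)
    show "domain R" by (rule dR)
    fix a b and n :: nat and c
    assume a: "a \<in> carrier R" and b: "b \<in> carrier R - {\<zero>\<^bsub>R\<^esub>}" and c: "c \<in> {..<n} \<rightarrow> carrier R"
      and eq: "a [^]\<^bsub>R\<^esub> n \<oplus>\<^bsub>R\<^esub> (\<Oplus>\<^bsub>R\<^esub>i\<in>{..<n}. c i \<otimes>\<^bsub>R\<^esub> a [^]\<^bsub>R\<^esub> i \<otimes>\<^bsub>R\<^esub> b [^]\<^bsub>R\<^esub> (n - i)) = \<zero>\<^bsub>R\<^esub>"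
    have cm: "(\<lambda>i. c i \<otimes>\<^bsub>R\<^esub> a [^]\<^bsub>R\<^esub> i \<otimes>\<^bsub>R\<^esub> b [^]\<^bsub>R\<^esub> (n - i)) \<in> {..<n} \<rightarrow> carrier R"
      using a b c by auto
    have "h (\<Oplus>\<^bsub>R\<^esub>i\<in>{..<n}. c i \<otimes>\<^bsub>R\<^esub> a [^]\<^bsub>R\<^esub> i \<otimes>\<^bsub>R\<^esub> b [^]\<^bsub>R\<^esub> (n - i)) =
        (\<Oplus>\<^bsub>S\<^esub>i\<in>{..<n}. h (c i \<otimes>\<^bsub>R\<^esub> a [^]\<^bsub>R\<^esub> i \<otimes>\<^bsub>R\<^esub> b [^]\<^bsub>R\<^esub> (n - i)))"
      using h.hom_finsum[OF cm] by (simp add: comp_def)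
    also have "\<dots> = (\<Oplus>\<^bsub>S\<^esub>i\<in>{..<n}. (h \<circ> c) i \<otimes>\<^bsub>S\<^esub> h a [^]\<^bsub>S\<^esub> i \<otimes>\<^bsub>S\<^esub> h b [^]\<^bsub>S\<^esub> (n - i))"
    proof (rule S.finsum_cong'[OF refl])
      show "(\<lambda>i. (h \<circ> c) i \<otimes>\<^bsub>S\<^esub> h a [^]\<^bsub>S\<^esub> i \<otimes>\<^bsub>S\<^esub> h b [^]\<^bsub>S\<^esub> (n - i)) \<in> {..<n} \<rightarrow> carrier S"
        using a b c by (auto simp: Pi_iff)
      fix i assume "i \<in> {..<n}"
      then have "c i \<in> carrier R" using c by auto
      then show "h (c i \<otimes>\<^bsub>R\<^esub> a [^]\<^bsub>R\<^esub> i \<otimes>\<^bsub>R\<^esub> b [^]\<^bsub>R\<^esub> (n - i)) =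
          (h \<circ> c) i \<otimes>\<^bsub>S\<^esub> h a [^]\<^bsub>S\<^esub> i \<otimes>\<^bsub>S\<^esub> h b [^]\<^bsub>S\<^esub> (n - i)"
        using a b by (simp add: hpow)
    qed
    finally have hs: "h (\<Oplus>\<^bsub>R\<^esub>i\<in>{..<n}. c i \<otimes>\<^bsub>R\<^esub> a [^]\<^bsub>R\<^esub> i \<otimes>\<^bsub>R\<^esub> b [^]\<^bsub>R\<^esub> (n - i)) =
        (\<Oplus>\<^bsub>S\<^esub>i\<in>{..<n}. (h \<circ> c) i \<otimes>\<^bsub>S\<^esub> h a [^]\<^bsub>S\<^esub> i \<otimes>\<^bsub>S\<^esub> h b [^]\<^bsub>S\<^esub> (n - i))" .
    have "h a [^]\<^bsub>S\<^esub> n \<oplus>\<^bsub>S\<^esub> (\<Oplus>\<^bsub>S\<^esub>i\<in>{..<n}. (h \<circ> c) i \<otimes>\<^bsub>S\<^esub> h a [^]\<^bsub>S\<^esub> i \<otimes>\<^bsub>S\<^esub> h b [^]\<^bsub>S\<^esub> (n - i)) = \<zero>\<^bsub>S\<^esub>"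
      using arg_cong[OF eq, of h] a R.finsum_closed[OF cm] by (simp add: hs hpow)
    moreover have "h a \<in> carrier S" using a by simp
    moreover have "h b \<in> carrier S - {\<zero>\<^bsub>S\<^esub>}" using b inj[of b "\<zero>\<^bsub>R\<^esub>"] by auto
    moreover have "h \<circ> c \<in> {..<n} \<rightarrow> carrier S" using c by (auto simp: Pi_iff)
    ultimately have "h b divides\<^bsub>S\<^esub> h a" using ic unfolding integrally_closed_def by blast
    then obtain y where y: "y \<in> carrier S" "h a = h b \<otimes>\<^bsub>S\<^esub> y" unfolding factor_def by blast
    obtain y' where y': "y' \<in> carrier R" "y = h y'" using bij y(1) unfolding bij_betw_def by blast
    have "a = b \<otimes>\<^bsub>R\<^esub> y'" by (rule inj) (use y y' a b in auto)
    then show "b divides\<^bsub>R\<^esub> a" unfolding factor_def using y'(1) by blast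
  qed
qed

lemma ring_on_nat_pow: "a [^]\<^bsub>ring_on A\<^esub> (n::nat) = (a :: 'a::comm_ring_1) ^ n"
  by (induction n) (simp_all add: nat_pow_def mult.commute)

lemma ring_on_finsum:
  assumes "cring (ring_on A)" "finite I" "g \<in> I \<rightarrow> A"
  shows "(\<Oplus>\<^bsub>ring_on A\<^esub>i\<in>I. g i) = (\<Sum>i\<in>I. g i :: 'a::comm_ring_1)"
proof -
  interpret cring "ring_on A" by fact
  show ?thesis using assms(2,3)
    by (induction I) (auto simp: Pi_iff)
qed

abbreviation Frac :: "'a::idom \<Rightarrow> 'a \<Rightarrow> 'a fract" where "Frac \<equiv> Fraction_Field.Fract"

lemma Frac_eq_0_iff: "b \<noteq> 0 \<Longrightarrow> Frac a b = 0 \<longleftrightarrow> a = 0"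
  by (simp add: Fraction_Field.Zero_fract_def Fraction_Field.eq_fract)

lemma Frac_power: "Frac a b ^ n = Frac (a ^ n) (b ^ n)"
  by (induction n) (simp_all add: Fraction_Field.One_fract_def)

lemma Frac_sum: "(\<Sum>i\<in>I. Frac (g i) 1) = Frac (\<Sum>i\<in>I. g i) 1"
  by (induction I rule: infinite_finite_induct) (simp_all add: Fraction_Field.Zero_fract_def)

lemma prime_product_unit:
  fixes A :: "'a::idom set"
  assumes "u \<in> A" "v \<in> A" "1 \<in> A" "u * v = 1"
  shows "prime_product (ring_on A) u"
proof -
  have "u \<noteq> 0" "v \<noteq> 0" using assms(4) by auto
  then have "1 divides\<^bsub>mult_of (ring_on A)\<^esub> u" "u divides\<^bsub>mult_of (ring_on A)\<^esub> 1"
    unfolding factor_def using assms by (auto simp: mult_of_def intro: bexI[of _ v])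
  then show ?thesis unfolding prime_product_def by (intro exI[of _ "[]"]) (simp add: associated_def)
qed

lemma prime_product_mult:
  fixes A :: "'a::idom set"
  assumes "Divisibility.prime (mult_of (ring_on A)) q" "q \<in> A" "q \<noteq> 0" "prime_product (ring_on A) a"
  shows "prime_product (ring_on A) (q * a)"
proof -
  obtain ps where ps: "set ps \<subseteq> carrier (mult_of (ring_on A))" "\<forall>p\<in>set ps. Divisibility.prime (mult_of (ring_on A)) p"
    "foldr (*) ps 1 \<sim>\<^bsub>mult_of (ring_on A)\<^esub> a" using assms(4) unfolding prime_product_def by auto
  have "foldr (*) (q # ps) 1 \<sim>\<^bsub>mult_of (ring_on A)\<^esub> q * a"
    using ps(3) assms(3) unfolding associated_def factor_def by (auto simp: mult_of_def mult.assoc)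
  then show ?thesis unfolding prime_product_def using ps assms(1-3)
    by (intro exI[of _ "q # ps"]) (auto simp: mult_of_def)
qed

context bunched
begin

text \<open>A degree with a nonzero element survives at some point, hence is an integral combination
  of the \<open>w i\<close>; by the faithful grading such degrees generate the lattice.\<close>

lemma lat_eq_weights: "L = weights {..<r}"
proof (rule equalityI)
  show "weights {..<r} \<subseteq> L" by (rule weights_sub_lat) simp
  have gen: "d \<in> weights {..<r}" if d: "d \<in> L" "H d \<noteq> {0}" for d
  proof -
    obtain a where a: "a \<in> H d" "a \<noteq> 0" using d H0[OF d(1)] by blast
    obtain z where z: "z \<in> Z" "z a \<noteq> 0" using exists_pt_nonzero[OF a(2)] by blast
    have "d \<in> weights (nzset z)" by (rule nonvanishing_weight[OF z(1) d(1) a(1) z(2)])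
    then obtain c :: "nat \<Rightarrow> int" where c: "d = (\<Sum>i\<in>nzset z. s (of_int (c i)) (w i))" unfolding weights_def by blast
    have "d = (\<Sum>i<r. s (of_int (if i \<in> nzset z then c i else 0)) (w i))"
      unfolding c using nzset_sub[of z] by (intro sum.mono_neutral_cong_left) auto
    then show ?thesis unfolding weights_def
      by (intro CollectI exI[of _ "\<lambda>i. if i \<in> nzset z then c i else 0"]) simp
  qed
  show "L \<subseteq> weights {..<r}"
  proof
    fix d assume "d \<in> L"
    then have "d \<in> int_span s {d \<in> L. H d \<noteq> {0}}" using faithful by simp
    then obtain F c where F: "finite F" "F \<subseteq> {d \<in> L. H d \<noteq> {0}}" "d = (\<Sum>x\<in>F. s (of_int (c x)) x)"
      unfolding int_span_def by blast
    have "(\<Sum>x\<in>F. s (of_int (c x)) x) \<in> weights {..<r}" using F(1,2)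
    proof (induction F)
      case (insert x F)
      then show ?case using gen by (auto intro!: weights_add weights_scale)
    qed (simp add: weights_0)
    then show "d \<in> weights {..<r}" unfolding F(3) .
  qed
qed

lemma weights_eq_lat_iff:
  assumes "J \<subseteq> {..<r}"
  shows "weights J = L \<longleftrightarrow> (\<forall>i<r. w i \<in> weights J)"
proof
  assume "weights J = L"
  then show "\<forall>i<r. w i \<in> weights J" using gen_deg by blast
next
  assume g: "\<forall>i<r. w i \<in> weights J"
  have "(\<Sum>i\<in>I. s (of_int (c i)) (w i)) \<in> weights J" if "finite I" "I \<subseteq> {..<r}" for I and c :: "nat \<Rightarrow> int"
    using that g by (induction I) (auto intro!: weights_add weights_scale simp: weights_0)
  then have "weights {..<r} \<subseteq> weights J" unfolding weights_def[of "{..<r}"] by auto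
  then show "weights J = L" using lat_eq_weights weights_sub_lat[OF assms] by blast
qed

lemma prime_power_split:
  assumes q: "prime_elem q" and a: "a \<noteq> (0::'r)"
  shows "\<exists>m h. a = q ^ m * h \<and> \<not> q dvd h"
  using ufd a
proof (induction a rule: prime_factor_induct)
  case (unit u)
  have "\<not> q dvd u" using q unit dvd_trans[of q u 1] by (auto simp: prime_elem_def)
  then show ?case by (intro exI[of _ 0] exI[of _ u]) simp
next
  case (prime p b)
  then obtain m h where mh: "b = q ^ m * h" "\<not> q dvd h" by blast
  show ?case
  proof (cases "q dvd p")
    case True
    obtain c where c: "p = q * c" using True by (rule dvdE)
    have "p dvd q" by (rule prime_elem_assoc[OF q prime.hyps(1) True])
    then obtain c' where c': "q = p * c'" by (rule dvdE)
    have "q * (c * c') = q * 1" using c c' by (simp add: mult.assoc[symmetric])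
    then have "c * c' = 1" using q by (simp only: mult_cancel_left) (simp add: prime_elem_def)
    then have "c dvd 1" by (metis dvd_triv_left)
    then have "\<not> q dvd c" using q dvd_trans[of q c 1] by (auto simp: prime_elem_def)
    then have "\<not> q dvd c * h" using mh(2) q by (simp add: prime_elem_dvd_mult_iff)
    then show ?thesis using mh(1) c by (intro exI[of _ "Suc m"] exI[of _ "c * h"]) (simp add: mult_ac)
  next
    case False
    then have "\<not> q dvd p * h" using mh(2) q by (simp add: prime_elem_dvd_mult_iff)
    then show ?thesis using mh(1) by (intro exI[of _ m] exI[of _ "p * h"]) (simp add: mult_ac)
  qed
qed

end

text \<open>By \<open>special_point\<close> every point of a stratum is of this kind, with
  \<open>nzset z0\<close> the index set of the face.\<close>

locale quot_point = good_quot B X p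
  for B :: "('k::{alg_closed_field, field_char_0}, 'r::idom, 'v::ab_group_add) bunch_data"
    and X :: "('x, 'k) fspace" and p :: "('r \<Rightarrow> 'k) \<Rightarrow> 'x" +
  fixes z0 :: "'r \<Rightarrow> 'k"
  assumes z0: "z0 \<in> Z" and rel: "relevant (nzset z0)"
begin

abbreviation "J \<equiv> nzset z0"
abbreviation "x \<equiv> p z0"

text \<open>The degree 0 part of the localization of R at the homogeneous elements not vanishing at
  \<open>z0\<close>, taken inside the fraction field; \<open>local_ring_iso\<close> identifies it
  with the local ring at \<open>x\<close>.\<close>

definition A :: "'r fract set" where
  "A = {q. \<exists>e\<in>L. \<exists>a\<in>H e. \<exists>b\<in>H e. z0 b \<noteq> 0 \<and> q = Frac a b}"

lemma A_mem: "e \<in> L \<Longrightarrow> a \<in> H e \<Longrightarrow> b \<in> H e \<Longrightarrow> z0 b \<noteq> 0 \<Longrightarrow> Frac a b \<in> A"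
  unfolding A_def by blast

lemma nz: "z0 b \<noteq> 0 \<Longrightarrow> b \<noteq> 0"
  using z0 by auto

lemma A_cases:
  assumes "q \<in> A"
  obtains e a b where "e \<in> L" "a \<in> H e" "b \<in> H e" "z0 b \<noteq> 0" "b \<noteq> 0" "q = Frac a b"
proof -
  from assms obtain e a b where *: "e \<in> L" "a \<in> H e" "b \<in> H e" "z0 b \<noteq> 0" "q = Frac a b"
    unfolding A_def by blast
  show thesis by (rule that[OF *(1-4) nz[OF *(4)] *(5)])
qed

lemma A_0: "0 \<in> A" and A_1: "1 \<in> A"
  using A_mem[OF lat_0 H0[OF lat_0] H_1] A_mem[OF lat_0 H_1 H_1] z0
  by (simp_all add: Fraction_Field.Zero_fract_def Fraction_Field.One_fract_def)

lemma A_add: "q \<in> A \<Longrightarrow> q' \<in> A \<Longrightarrow> q + q' \<in> A"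
proof (elim A_cases)
  fix e a b e' a' b'
  assume *: "e \<in> L" "a \<in> H e" "b \<in> H e" "z0 b \<noteq> 0" "b \<noteq> 0" "q = Frac a b"
    "e' \<in> L" "a' \<in> H e'" "b' \<in> H e'" "z0 b' \<noteq> 0" "b' \<noteq> 0" "q' = Frac a' b'"
  have "a' * b \<in> H (e + e')" using H_mult[OF *(7,1,8,3)] by (simp add: add.commute)
  then have "a * b' + a' * b \<in> H (e + e')"
    by (rule H_add[OF lat_add[OF *(1,7)] H_mult[OF *(1,7,2,9)]])
  then have "Frac (a * b' + a' * b) (b * b') \<in> A"
    using * z0 by (intro A_mem[of "e + e'"] lat_add H_mult) auto
  then show "q + q' \<in> A" using * by simp
qed

lemma A_mult: "q \<in> A \<Longrightarrow> q' \<in> A \<Longrightarrow> q * q' \<in> A"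
proof (elim A_cases)
  fix e a b e' a' b'
  assume *: "e \<in> L" "a \<in> H e" "b \<in> H e" "z0 b \<noteq> 0" "b \<noteq> 0" "q = Frac a b"
    "e' \<in> L" "a' \<in> H e'" "b' \<in> H e'" "z0 b' \<noteq> 0" "b' \<noteq> 0" "q' = Frac a' b'"
  have "Frac (a * a') (b * b') \<in> A"
    using * z0 by (intro A_mem[of "e + e'"] lat_add H_mult) auto
  then show "q * q' \<in> A" using * by simp
qed

lemma A_neg: "q \<in> A \<Longrightarrow> - q \<in> A"
  by (elim A_cases) (auto intro!: A_mem H_neg)

lemma A_power: "q \<in> A \<Longrightarrow> q ^ n \<in> A"
  by (induction n) (auto intro: A_1 A_mult)

lemma cring_A: "cring (ring_on A)"
  by (rule cring_ring_on) (intro A_0 A_1 A_add A_neg A_mult; assumption)+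

lemma domain_A: "domain (ring_on A)"
  by (rule domainI[OF cring_A]) auto

text \<open>A relation, since a fraction has many homogeneous representations; existence and
  uniqueness of \<open>q\<close> then give the map \<open>\<Psi>\<close>.\<close>

definition germ :: "('x \<Rightarrow> 'k) \<Rightarrow> 'r fract \<Rightarrow> bool" where
  "germ h q \<longleftrightarrow> (\<exists>e\<in>L. \<exists>a\<in>H e. \<exists>b\<in>H e. q = Frac a b \<and> z0 b \<noteq> 0 \<and> (\<exists>U. openin (top_of X) U \<and> x \<in> U \<and>
     U \<subseteq> loc J \<and> h \<in> reg X U \<and> (\<forall>z\<in>pre U. z b \<noteq> 0 \<and> h (p z) = z a / z b)))"

lemma germE:
  assumes "germ h q"
  obtains e a b U where "e \<in> L" "a \<in> H e" "b \<in> H e" "q = Frac a b" "z0 b \<noteq> 0" "b \<noteq> 0" "openin (top_of X) U" "x \<in> U"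
    "U \<subseteq> loc J" "h \<in> reg X U" "\<forall>z\<in>pre U. z b \<noteq> 0 \<and> h (p z) = z a / z b"
proof -
  from assms obtain e a b U where *: "e \<in> L" "a \<in> H e" "b \<in> H e" "q = Frac a b" "z0 b \<noteq> 0" "openin (top_of X) U" "x \<in> U"
    "U \<subseteq> loc J" "h \<in> reg X U" "\<forall>z\<in>pre U. z b \<noteq> 0 \<and> h (p z) = z a / z b" unfolding germ_def by blast
  show thesis by (rule that[OF *(1-5) nz[OF *(5)] *(6-10)])
qed

lemma germ_A: "germ h q \<Longrightarrow> q \<in> A"
  by (elim germE) (simp add: A_mem)

lemma x_loc: "x \<in> loc J" and x_points: "x \<in> points X"
proof -
  show "x \<in> loc J" unfolding loc_def using z0 by blast
  then show "x \<in> points X" using openin_subset[OF loc_open[OF rel]] by blast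
qed

lemma z0_Xhat: "z0 \<in> Xhat_points B"
  unfolding Xhat_points_iff using z0 rel by blast

lemma z0_pre: "x \<in> U \<Longrightarrow> z0 \<in> pre U"
  unfolding pre_def using z0_Xhat by blast

lemma shrink:
  assumes "e \<in> L" "b \<in> H e" "z0 b \<noteq> 0" "openin (top_of X) V" "x \<in> V"
  shows "\<exists>U. openin (top_of X) U \<and> x \<in> U \<and> U \<subseteq> V \<and> U \<subseteq> loc J \<and> (\<forall>z\<in>pre U. z b \<noteq> 0)"
proof -
  obtain U where U: "openin (top_of X) U" "x \<in> U" "U \<subseteq> loc J" "\<forall>z\<in>pre U. z b \<noteq> 0"
    using nonvanishing_nbhd[OF rel z0 assms(1-3)] by blast
  have "\<forall>z\<in>pre (U \<inter> V). z b \<noteq> 0" using U(4) pre_mono[of "U \<inter> V" U] by blast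
  then show ?thesis using U assms(4,5) by (intro exI[of _ "U \<inter> V"]) auto
qed

lemma germ_exists:
  assumes "h \<in> regular_near X x"
  shows "\<exists>q. germ h q"
proof -
  obtain U0 where U0: "openin (top_of X) U0" "x \<in> U0" "h \<in> reg X U0" using assms unfolding regular_near_def by blast
  define U where "U = U0 \<inter> loc J"
  have U: "openin (top_of X) U" "x \<in> U" "U \<subseteq> loc J" unfolding U_def using U0 loc_open[OF rel] x_loc by auto
  have hU: "h \<in> reg X U" by (rule X.reg_restrict[OF U0(1) U(1) _ U0(3)]) (simp add: U_def)
  obtain e a b where *: "e \<in> L" "a \<in> H e" "b \<in> H e" "\<forall>z\<in>pre U. z b \<noteq> 0 \<and> h (p z) = z a / z b"
    using pull_fraction[OF U(1) z0_pre[OF U(2)] hU] by blast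
  have "z0 b \<noteq> 0" using *(4) z0_pre[OF U(2)] by blast
  then have "germ h (Frac a b)" unfolding germ_def using * U hU by blast
  then show ?thesis by blast
qed

lemma germ_regular: "germ h q \<Longrightarrow> h \<in> regular_near X x"
  unfolding regular_near_def by (elim germE) blast

lemma germ_surj:
  assumes "q \<in> A"
  shows "\<exists>h. germ h q"
proof -
  obtain e a b where *: "e \<in> L" "a \<in> H e" "b \<in> H e" "z0 b \<noteq> 0" "b \<noteq> 0" "q = Frac a b" by (rule A_cases[OF assms])
  obtain U where U: "openin (top_of X) U" "x \<in> U" "U \<subseteq> loc J" "\<forall>z\<in>pre U. z b \<noteq> 0"
    using nonvanishing_nbhd[OF rel z0 *(1,3,4)] by blast
  obtain h where "h \<in> reg X U" "\<forall>z\<in>pre U. h (p z) = z a / z b"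
    using push_fraction[OF U(1) *(1-3)] U(4) by blast
  then have "germ h q" unfolding germ_def using * U by blast
  then show ?thesis by blast
qed

lemma pre_nonempty_dense:
  assumes "openin (top_of X) U" "x \<in> U" "\<And>z. z \<in> pre U \<Longrightarrow> z a = 0"
  shows "a = 0"
  by (rule vanish_on_open[OF pre_open[OF assms(1)] _ assms(3)]) (use z0_pre[OF assms(2)] in blast)

lemma germ_unique_near:
  assumes "germ h q" "germ h' q'" "openin (top_of X) V" "x \<in> V" "\<And>y. y \<in> V \<Longrightarrow> h y = h' y"
  shows "q = q'"
proof -
  obtain e a b U where 1: "e \<in> L" "a \<in> H e" "b \<in> H e" "q = Frac a b" "z0 b \<noteq> 0" "b \<noteq> 0" "openin (top_of X) U" "x \<in> U"
    "U \<subseteq> loc J" "h \<in> reg X U" "\<forall>z\<in>pre U. z b \<noteq> 0 \<and> h (p z) = z a / z b" by (rule germE[OF assms(1)])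
  obtain e' a' b' U' where 2: "e' \<in> L" "a' \<in> H e'" "b' \<in> H e'" "q' = Frac a' b'" "z0 b' \<noteq> 0" "b' \<noteq> 0" "openin (top_of X) U'" "x \<in> U'"
    "U' \<subseteq> loc J" "h' \<in> reg X U'" "\<forall>z\<in>pre U'. z b' \<noteq> 0 \<and> h' (p z) = z a' / z b'" by (rule germE[OF assms(2)])
  have "a * b' - a' * b = 0"
  proof (rule pre_nonempty_dense[of "U \<inter> U' \<inter> V"])
    show "openin (top_of X) (U \<inter> U' \<inter> V)" "x \<in> U \<inter> U' \<inter> V"
      using 1(7,8) 2(7,8) assms(3,4) by auto
    fix z assume "z \<in> pre (U \<inter> U' \<inter> V)"
    then have z: "z \<in> pre U" "z \<in> pre U'" "p z \<in> V" "z \<in> Z" using pre_sub unfolding pre_def by auto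
    have "z a / z b = z a' / z b'" using bspec[OF 1(11) z(1)] bspec[OF 2(11) z(2)] assms(5)[OF z(3)] by simp
    then show "z (a * b' - a' * b) = 0" using bspec[OF 1(11) z(1)] bspec[OF 2(11) z(2)] z(4) by (simp add: frac_eq_eq)
  qed
  then show ?thesis using 1(4,6) 2(4,6) by (simp add: Fraction_Field.eq_fract)
qed

lemma germ_unique: "germ h q \<Longrightarrow> germ h q' \<Longrightarrow> q = q'"
  using germ_unique_near[of h q h q' "points X"] x_points by auto

lemma germ_ops:
  assumes "germ h q" "germ h' q'"
  shows germ_add: "germ (h + h') (q + q')" and germ_mult: "germ (h * h') (q * q')"
proof -
  obtain e a b U where 1: "e \<in> L" "a \<in> H e" "b \<in> H e" "q = Frac a b" "z0 b \<noteq> 0" "b \<noteq> 0" "openin (top_of X) U" "x \<in> U"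
    "U \<subseteq> loc J" "h \<in> reg X U" "\<forall>z\<in>pre U. z b \<noteq> 0 \<and> h (p z) = z a / z b" by (rule germE[OF assms(1)])
  obtain e' a' b' U' where 2: "e' \<in> L" "a' \<in> H e'" "b' \<in> H e'" "q' = Frac a' b'" "z0 b' \<noteq> 0" "b' \<noteq> 0" "openin (top_of X) U'" "x \<in> U'"
    "U' \<subseteq> loc J" "h' \<in> reg X U'" "\<forall>z\<in>pre U'. z b' \<noteq> 0 \<and> h' (p z) = z a' / z b'" by (rule germE[OF assms(2)])
  let ?U = "U \<inter> U'"
  have U: "openin (top_of X) ?U" "x \<in> ?U" "?U \<subseteq> loc J" using 1(7-9) 2(7-9) by auto
  have r: "h \<in> reg X ?U" "h' \<in> reg X ?U"
    using X.reg_restrict[OF 1(7) U(1) _ 1(10)] X.reg_restrict[OF 2(7) U(1) _ 2(10)] by auto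
  have ee: "e + e' \<in> L" by (rule lat_add[OF 1(1) 2(1)])
  have "a' * b \<in> H (e + e')" using H_mult[OF 2(1) 1(1) 2(2) 1(3)] by (simp add: add.commute)
  then have n1: "a * b' + a' * b \<in> H (e + e')" by (rule H_add[OF ee H_mult[OF 1(1) 2(1) 1(2) 2(3)]])
  have n2: "a * a' \<in> H (e + e')" "b * b' \<in> H (e + e')" by (rule H_mult[OF 1(1) 2(1) 1(2) 2(2)], rule H_mult[OF 1(1) 2(1) 1(3) 2(3)])
  have q1: "q + q' = Frac (a * b' + a' * b) (b * b')" "q * q' = Frac (a * a') (b * b')"
    using 1(4,6) 2(4,6) by simp_all
  have zb: "z0 (b * b') \<noteq> 0" using 1(5) 2(5) z0 by simp
  have v: "z (b * b') \<noteq> 0" "(h + h') (p z) = z (a * b' + a' * b) / z (b * b')"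
    "(h * h') (p z) = z (a * a') / z (b * b')" if "z \<in> pre ?U" for z
  proof -
    have z: "z \<in> pre U" "z \<in> pre U'" "z \<in> Z" using that pre_sub unfolding pre_def by auto
    show "z (b * b') \<noteq> 0" "(h + h') (p z) = z (a * b' + a' * b) / z (b * b')"
      "(h * h') (p z) = z (a * a') / z (b * b')"
      using bspec[OF 1(11) z(1)] bspec[OF 2(11) z(2)] z(3) by (simp_all add: add_frac_eq)
  qed
  show "germ (h + h') (q + q')" unfolding germ_def
    using ee n1 n2(2) q1(1) zb U X.reg_add[OF U(1) r] v(1,2)
    by (intro bexI[of _ "e + e'"] bexI[of _ "a * b' + a' * b"] bexI[of _ "b * b'"] conjI exI[of _ ?U] ballI) simp_all
  show "germ (h * h') (q * q')" unfolding germ_def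
    using ee n2 q1(2) zb U X.reg_mult[OF U(1) r] v(1,3)
    by (intro bexI[of _ "e + e'"] bexI[of _ "a * a'"] bexI[of _ "b * b'"] conjI exI[of _ ?U] ballI) simp_all
qed

lemma germ_const: "germ (\<lambda>_. c) (Frac (\<iota> c) 1)"
proof -
  have "z 1 \<noteq> 0 \<and> c = z (\<iota> c) / z 1" if "z \<in> pre (loc J)" for z
  proof -
    have "z \<in> Z" using that pre_sub by blast
    then show ?thesis by simp
  qed
  then show ?thesis unfolding germ_def
    using lat_0 H_emb_0[of c] H_1 z0 loc_open[OF rel] x_loc X.reg_const[OF loc_open[OF rel]]
    by (intro bexI[of _ 0] bexI[of _ "\<iota> c"] bexI[of _ 1] conjI exI[of _ "loc J"] ballI) simp_all
qed

lemma germ_zero_iff: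
  assumes "germ h q"
  shows "q = 0 \<longleftrightarrow> h \<in> zero_near X x"
proof
  assume q0: "q = 0"
  obtain e a b U where 1: "e \<in> L" "a \<in> H e" "b \<in> H e" "q = Frac a b" "z0 b \<noteq> 0" "b \<noteq> 0" "openin (top_of X) U" "x \<in> U"
    "U \<subseteq> loc J" "h \<in> reg X U" "\<forall>z\<in>pre U. z b \<noteq> 0 \<and> h (p z) = z a / z b" by (rule germE[OF assms])
  have "a = 0" using q0 1(4,6) by (simp add: Frac_eq_0_iff)
  \<comment> \<open>The fraction only controls values on the image of \<open>p\<close>;
    \<open>p_surj\<close> makes this all of \<open>U\<close>.\<close>
  have "h y = 0" if y: "y \<in> U" for y
  proof -
    obtain z where z: "z \<in> pre U" "p z = y" using pre_surj y openin_subset[OF 1(7)] by blast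
    then have "z \<in> Z" using pre_sub by blast
    then show ?thesis using bspec[OF 1(11) z(1)] z(2) \<open>a = 0\<close> by simp
  qed
  then show "h \<in> zero_near X x" unfolding zero_near_def regular_near_def using 1(7,8,10) by blast
next
  assume "h \<in> zero_near X x"
  then obtain V where V: "openin (top_of X) V" "x \<in> V" "\<And>y. y \<in> V \<Longrightarrow> h y = 0" unfolding zero_near_def by blast
  have "q = Frac (\<iota> 0) 1" by (rule germ_unique_near[OF assms germ_const V(1,2)]) (simp add: V(3))
  then show "q = 0" by (simp add: Fraction_Field.Zero_fract_def)
qed

definition \<Psi> :: "('x \<Rightarrow> 'k) \<Rightarrow> 'r fract" where "\<Psi> h = (THE q. germ h q)"

lemma germ_Psi: "h \<in> regular_near X x \<Longrightarrow> germ h (\<Psi> h)"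
  using germ_exists[of h] germ_unique[of h] theI[of "germ h"] unfolding \<Psi>_def by metis

lemma Psi_eq: "germ h q \<Longrightarrow> \<Psi> h = q"
  using germ_Psi germ_regular germ_unique by blast

lemma cring_regular_near: "cring (ring_on (regular_near X x))"
proof (rule cring_ring_on)
  show "0 \<in> regular_near X x" using germ_regular[OF germ_const[of 0]] unfolding zero_fun_def .
  show "1 \<in> regular_near X x" using germ_regular[OF germ_const[of 1]] unfolding one_fun_def .
  show "a + b \<in> regular_near X x" if "a \<in> regular_near X x" "b \<in> regular_near X x" for a b
    using germ_regular[OF germ_add[OF germ_Psi germ_Psi]] that by blast
  show m: "a * b \<in> regular_near X x" if "a \<in> regular_near X x" "b \<in> regular_near X x" for a b
    using germ_regular[OF germ_mult[OF germ_Psi germ_Psi]] that by blast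
  show "- a \<in> regular_near X x" if "a \<in> regular_near X x" for a
  proof -
    have "(\<lambda>_. - 1) * a = - a" by (simp add: fun_eq_iff)
    then show ?thesis using m[OF germ_regular[OF germ_const[of "- 1"]] that] by simp
  qed
qed

lemma local_ring_iso: "\<exists>h. h \<in> ring_iso (local_ring X x) (ring_on A)"
proof -
  let ?R = "ring_on (regular_near X x)"
  have hom: "\<Psi> \<in> ring_hom ?R (ring_on A)"
  proof (rule ring_hom_memI)
    fix h assume "h \<in> carrier ?R"
    then show "\<Psi> h \<in> carrier (ring_on A)" using germ_A[OF germ_Psi] by simp
  next
    fix h h' assume "h \<in> carrier ?R" "h' \<in> carrier ?R"
    then have g: "germ h (\<Psi> h)" "germ h' (\<Psi> h')" using germ_Psi by auto
    show "\<Psi> (h \<otimes>\<^bsub>?R\<^esub> h') = \<Psi> h \<otimes>\<^bsub>ring_on A\<^esub> \<Psi> h'" using Psi_eq[OF germ_mult[OF g]] by simp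
    show "\<Psi> (h \<oplus>\<^bsub>?R\<^esub> h') = \<Psi> h \<oplus>\<^bsub>ring_on A\<^esub> \<Psi> h'" using Psi_eq[OF germ_add[OF g]] by simp
  next
    show "\<Psi> \<one>\<^bsub>?R\<^esub> = \<one>\<^bsub>ring_on A\<^esub>"
      using Psi_eq[OF germ_const[of 1]] by (simp add: one_fun_def Fraction_Field.One_fract_def)
  qed
  interpret R: cring ?R by (rule cring_regular_near)
  interpret S: cring "ring_on A" by (rule cring_A)
  interpret P: ring_hom_ring ?R "ring_on A" \<Psi> by (rule ring_hom_ringI2[OF R.ring_axioms S.ring_axioms hom])
  have ker: "a_kernel ?R (ring_on A) \<Psi> = zero_near X x"
  proof -
    have "h \<in> zero_near X x \<longleftrightarrow> h \<in> regular_near X x \<and> \<Psi> h = 0" for h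
      using germ_zero_iff[OF germ_Psi, of h] unfolding zero_near_def by blast
    then show ?thesis unfolding a_kernel_def kernel_def by auto
  qed
  have "\<Psi> ` carrier ?R = carrier (ring_on A)"
  proof (intro equalityI subsetI)
    fix q assume "q \<in> carrier (ring_on A)"
    then obtain h where h: "germ h q" using germ_surj by auto
    then show "q \<in> \<Psi> ` carrier ?R" using Psi_eq[OF h] germ_regular[OF h] by auto
  qed (use germ_A germ_Psi in auto)
  from P.FactRing_iso_set[OF this] show ?thesis unfolding ker local_ring_def[symmetric] by blast
qed

lemma cring_local_ring: "cring (local_ring X x)"
proof -
  let ?R = "ring_on (regular_near X x)"
  obtain h where h: "h \<in> ring_iso (local_ring X x) (ring_on A)" using local_ring_iso by blast
  interpret R: cring ?R by (rule cring_regular_near)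
  have "ideal (zero_near X x) ?R"
  proof (rule idealI)
    show "ring ?R" by (rule R.ring_axioms)
    show "subgroup (zero_near X x) (add_monoid ?R)"
    proof
      show "zero_near X x \<subseteq> carrier (add_monoid ?R)" unfolding zero_near_def by auto
      show "f \<otimes>\<^bsub>add_monoid ?R\<^esub> g \<in> zero_near X x" if "f \<in> zero_near X x" "g \<in> zero_near X x" for f g
      proof -
        have gf: "germ f 0" "germ g 0"
          using that germ_Psi[of f] germ_Psi[of g] germ_zero_iff[of f "\<Psi> f"] germ_zero_iff[of g "\<Psi> g"]
          unfolding zero_near_def by auto
        show ?thesis using germ_zero_iff[OF germ_add[OF gf]] by simp
      qed
      show "\<one>\<^bsub>add_monoid ?R\<^esub> \<in> zero_near X x"
        using germ_zero_iff[OF germ_const[of 0]] by (simp add: zero_fun_def Fraction_Field.Zero_fract_def)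
      show "inv\<^bsub>add_monoid ?R\<^esub> f \<in> zero_near X x" if f: "f \<in> zero_near X x" for f
      proof -
        have fr: "f \<in> regular_near X x" using f unfolding zero_near_def by blast
        have "\<ominus>\<^bsub>?R\<^esub> f \<oplus>\<^bsub>?R\<^esub> f = 0" using R.l_neg[of f] fr by simp
        then have "\<ominus>\<^bsub>?R\<^esub> f = - f" by (simp add: eq_neg_iff_add_eq_0)
        moreover have "- f \<in> zero_near X x"
        proof -
          have gf: "germ f 0" using f fr germ_Psi[of f] germ_zero_iff[of f "\<Psi> f"] by auto
          have "germ ((\<lambda>_. - 1) * f) (Frac (\<iota> (- 1)) 1 * 0)" by (rule germ_mult[OF germ_const gf])
          moreover have "(\<lambda>_. - 1) * f = - f" by (simp add: fun_eq_iff)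
          ultimately show ?thesis using germ_zero_iff[of "- f" 0] by simp
        qed
        ultimately show ?thesis unfolding a_inv_def by simp
      qed
    qed
    have *: "g * f \<in> zero_near X x" if "f \<in> zero_near X x" "g \<in> carrier ?R" for f g
    proof -
      have gf: "germ f 0" using that germ_Psi[of f] germ_zero_iff[of f "\<Psi> f"] unfolding zero_near_def by auto
      have "germ g (\<Psi> g)" using that germ_Psi by simp
      from germ_zero_iff[OF germ_mult[OF this gf]] show ?thesis by simp
    qed
    show "g \<otimes>\<^bsub>?R\<^esub> f \<in> zero_near X x" "f \<otimes>\<^bsub>?R\<^esub> g \<in> zero_near X x" if "f \<in> zero_near X x" "g \<in> carrier ?R" for f g
      using *[OF that] by (simp_all add: mult.commute)
  qed
  then show ?thesis unfolding local_ring_def by (rule ideal.quotient_is_cring[OF _ cring_regular_near])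
qed

lemma factorial_point_iff: "factorial_point X x \<longleftrightarrow> factorial_domain (ring_on A)"
proof -
  obtain h where h: "h \<in> ring_iso (local_ring X x) (ring_on A)" using local_ring_iso by blast
  have rl: "ring (local_ring X x)" using cring_local_ring by (rule cring.axioms(1))
  have g: "inv_into (carrier (local_ring X x)) h \<in> ring_iso (ring_on A) (local_ring X x)"
    by (rule ring_iso_set_sym[OF rl h])
  have "domain (local_ring X x)" by (rule domain_iso[OF domain_A cring_local_ring g])
  then show ?thesis unfolding factorial_point_def
    using factorial_domain_iso[OF _ domain_A h] factorial_domain_iso[OF _ _ g] by blast
qed

end

section \<open>Factorial points\<close>

context quot_point
begin

section \<open>Normality of the local ring\<close>

lemma prime_zero_factor:
  assumes "b \<noteq> 0" "z0 b = 0"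
  shows "\<exists>q. prime_elem q \<and> q dvd b \<and> z0 q = 0"
proof -
  obtain u qs where b: "u dvd 1" "\<forall>q\<in>set qs. prime_elem q" "b = u * prod_list qs"
    using prime_list[OF assms(1)] by blast
  have "prod_list (map z0 qs) = 0"
    using assms(2) pt_unit[OF z0 b(1)] unfolding b(3) by (simp add: z0 pt_prod_list[OF z0])
  then have "0 \<in> set (map z0 qs)" by (simp add: prod_list_zero_iff)
  then obtain q where q: "q \<in> set qs" "z0 q = 0" by auto
  have "q dvd b" unfolding b(3) using mem_dvd_prod_list[OF q(1)] by simp
  then show ?thesis using b(2) q by blast
qed

lemma not_dvd_nonzero: "z0 q = 0 \<Longrightarrow> z0 b \<noteq> 0 \<Longrightarrow> \<not> q dvd b"
  using pt_dvd[OF z0] by blast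

lemma common_denominator_A:
  assumes "c \<in> {..<n::nat} \<rightarrow> A"
  shows "\<exists>t u. z0 t \<noteq> 0 \<and> (\<forall>i<n. c i = Frac (u i) t)"
  using assms
proof (induction n)
  case 0
  show ?case by (intro exI[of _ 1]) (simp add: z0)
next
  case (Suc n)
  then have "c \<in> {..<n} \<rightarrow> A" by auto
  then obtain t u where tu: "z0 t \<noteq> 0" "\<forall>i<n. c i = Frac (u i) t" using Suc.IH by blast
  have "c n \<in> A" using Suc.prems by auto
  then obtain e a b where ab: "e \<in> L" "a \<in> H e" "b \<in> H e" "z0 b \<noteq> 0" "b \<noteq> 0" "c n = Frac a b" by (rule A_cases)
  have "c i = Frac (if i = n then a * t else u i * b) (t * b)" if "i < Suc n" for i
    using that tu(2) ab(5,6) nz[OF tu(1)] by (auto simp: less_Suc_eq Fraction_Field.eq_fract mult_ac)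
  then show ?case using tu(1) ab(4) z0
    by (intro exI[of _ "t * b"] exI[of _ "\<lambda>i. if i = n then a * t else u i * b"]) simp
qed

text \<open>Factors of homogeneous elements are homogeneous, so cancelling a common factor from a
  fraction of degree 0 leaves one of degree 0.\<close>

lemma homog_quotient:
  assumes "e \<in> L" "g * a \<in> H e" "g * b \<in> H e" "g * b \<noteq> 0" "z0 b \<noteq> 0"
  shows "Frac a b \<in> A"
proof -
  obtain d where d: "d \<in> L" "b \<in> H d" using dvd_homog[of b "g * b", OF _ assms(1,3,4)] by auto
  obtain d' where d': "d' \<in> L" "g \<in> H d'" using dvd_homog[of g "g * b", OF _ assms(1,3,4)] by auto
  have e: "e = d' + d" by (rule H_unique[OF assms(1) lat_add[OF d'(1) d(1)] assms(3) H_mult[OF d'(1) d(1) d'(2) d(2)] assms(4)])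
  have "a \<in> H d"
  proof (cases "a = 0")
    case False
    have ne: "g * a \<noteq> 0" using False assms(4) by auto
    obtain d'' where d'': "d'' \<in> L" "a \<in> H d''" using dvd_homog[of a "g * a", OF _ assms(1,2) ne] by auto
    have "e = d' + d''" by (rule H_unique[OF assms(1) lat_add[OF d'(1) d''(1)] assms(2) H_mult[OF d'(1) d''(1) d'(2) d''(2)] ne])
    then show ?thesis using e d'' by simp
  qed (use d in simp)
  then show ?thesis by (rule A_mem[OF d(1) _ d(2) assms(5)])
qed

text \<open>The rational root argument for the quotient a/b, written in lowest terms as P/Q: a prime
  factor of \<open>Q\<close> vanishing at \<open>z0\<close> would divide \<open>t * P ^ n\<close>,
  but it divides neither \<open>P\<close> nor \<open>t\<close>, which does not vanish at
  \<open>z0\<close>. Hence \<open>z0 Q \<noteq> 0\<close>.\<close>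

lemma integrally_closed_A: "integrally_closed (ring_on A)"
  unfolding integrally_closed_def
proof (intro conjI ballI allI impI)
  show "domain (ring_on A)" by (rule domain_A)
  fix a b and n :: nat and c
  assume a: "a \<in> carrier (ring_on A)" and b: "b \<in> carrier (ring_on A) - {\<zero>\<^bsub>ring_on A\<^esub>}"
    and c: "c \<in> {..<n} \<rightarrow> carrier (ring_on A)"
    and eq: "a [^]\<^bsub>ring_on A\<^esub> n \<oplus>\<^bsub>ring_on A\<^esub> (\<Oplus>\<^bsub>ring_on A\<^esub>i\<in>{..<n}. c i \<otimes>\<^bsub>ring_on A\<^esub> a [^]\<^bsub>ring_on A\<^esub> i
      \<otimes>\<^bsub>ring_on A\<^esub> b [^]\<^bsub>ring_on A\<^esub> (n - i)) = \<zero>\<^bsub>ring_on A\<^esub>"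
  have aA: "a \<in> A" and bA: "b \<in> A" "b \<noteq> 0" and cA: "c \<in> {..<n} \<rightarrow> A" using a b c by auto
  have "(\<lambda>i. c i * a ^ i * b ^ (n - i)) \<in> {..<n} \<rightarrow> A" using aA bA cA by (auto intro!: A_mult A_power)
  from ring_on_finsum[OF cring_A _ this] have eq': "a ^ n + (\<Sum>i<n. c i * a ^ i * b ^ (n - i)) = 0"
    using eq by (simp add: ring_on_nat_pow)
  obtain e a1 a2 where A1: "e \<in> L" "a1 \<in> H e" "a2 \<in> H e" "z0 a2 \<noteq> 0" "a2 \<noteq> 0" "a = Frac a1 a2" by (rule A_cases[OF aA])
  obtain e' b1 b2 where B1: "e' \<in> L" "b1 \<in> H e'" "b2 \<in> H e'" "z0 b2 \<noteq> 0" "b2 \<noteq> 0" "b = Frac b1 b2" by (rule A_cases[OF bA(1)])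
  have b10: "b1 \<noteq> 0" using bA(2) B1(5,6) by (simp add: Frac_eq_0_iff)
  have Q0: "a2 * b1 \<noteq> 0" using A1(5) b10 by simp
  obtain g P Q where PQ: "a1 * b2 = g * P" "a2 * b1 = g * Q" "g \<noteq> 0" "\<not> (\<exists>q. prime_elem q \<and> q dvd P \<and> q dvd Q)"
    using coprime_fraction[OF Q0, of "a1 * b2"] by (elim exE conjE) (rule that)
  have Qn: "Q \<noteq> 0" using PQ(2) Q0 by auto
  define y where "y = Frac P Q"
  have "a1 * (b2 * Q) = P * (a2 * b1)"
  proof -
    have "a1 * (b2 * Q) = (g * P) * Q" using PQ(1) by (simp add: mult.assoc[symmetric])
    also have "\<dots> = P * (g * Q)" by (simp add: mult_ac)
    finally show ?thesis using PQ(2) by simp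
  qed
  then have ay: "a = b * y" unfolding A1(6) B1(6) y_def using A1(5) B1(5) Qn
    by (simp add: Fraction_Field.eq_fract mult_ac)
  have "b ^ n * (y ^ n + (\<Sum>i<n. c i * y ^ i)) = a ^ n + (\<Sum>i<n. c i * a ^ i * b ^ (n - i))"
  proof -
    have "b ^ n * (c i * y ^ i) = c i * a ^ i * b ^ (n - i)" if "i < n" for i
    proof -
      have "b ^ n = b ^ i * b ^ (n - i)" using that by (simp add: power_add[symmetric])
      then show ?thesis unfolding ay by (simp add: power_mult_distrib mult_ac)
    qed
    then have "(\<Sum>i<n. b ^ n * (c i * y ^ i)) = (\<Sum>i<n. c i * a ^ i * b ^ (n - i))"
      by (intro sum.cong refl) simp
    moreover have "b ^ n * y ^ n = a ^ n" unfolding ay by (rule power_mult_distrib[symmetric])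
    ultimately show ?thesis by (simp add: distrib_left sum_distrib_left)
  qed
  then have yeq: "y ^ n + (\<Sum>i<n. c i * y ^ i) = 0" using eq' bA(2) by simp
  obtain t u where tu: "z0 t \<noteq> 0" "\<forall>i<n. c i = Frac (u i) t" using common_denominator_A[OF cA] by blast
  have t0: "t \<noteq> 0" by (rule nz[OF tu(1)])
  have "Frac (t * Q ^ n) 1 * (y ^ n + (\<Sum>i<n. c i * y ^ i)) = Frac (t * P ^ n + (\<Sum>i<n. u i * P ^ i * Q ^ (n - i))) 1"
  proof -
    have 1: "Frac (t * Q ^ n) 1 * y ^ n = Frac (t * P ^ n) 1"
      unfolding y_def Frac_power using Qn by (simp add: Fraction_Field.eq_fract mult_ac)
    have 2: "Frac (t * Q ^ n) 1 * (c i * y ^ i) = Frac (u i * P ^ i * Q ^ (n - i)) 1" if i: "i < n" for i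
    proof -
      have "Q ^ n = Q ^ i * Q ^ (n - i)" using i by (simp add: power_add[symmetric])
      then show ?thesis using tu(2) i t0 Qn unfolding y_def Frac_power
        by (simp add: Fraction_Field.eq_fract mult_ac)
    qed
    show ?thesis using 1 2 by (simp add: distrib_left sum_distrib_left Frac_sum)
  qed
  then have "Frac (t * P ^ n + (\<Sum>i<n. u i * P ^ i * Q ^ (n - i))) 1 = 0" using yeq by simp
  then have main: "t * P ^ n + (\<Sum>i<n. u i * P ^ i * Q ^ (n - i)) = 0" by (simp add: Frac_eq_0_iff)
  have "z0 Q \<noteq> 0"
  proof
    assume "z0 Q = 0"
    then obtain q where q: "prime_elem q" "q dvd Q" "z0 q = 0" using prime_zero_factor[OF Qn] by blast
    have "q dvd (\<Sum>i<n. u i * P ^ i * Q ^ (n - i))"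
    proof (rule dvd_sum)
      fix i assume "i \<in> {..<n}"
      then have "Q dvd Q ^ (n - i)" by (intro dvd_power) auto
      then show "q dvd u i * P ^ i * Q ^ (n - i)" using dvd_trans[OF q(2)] by (intro dvd_mult)
    qed
    moreover have "t * P ^ n = - (\<Sum>i<n. u i * P ^ i * Q ^ (n - i))" using main by (simp add: eq_neg_iff_add_eq_0)
    ultimately have "q dvd t * P ^ n" by simp
    then have "q dvd t \<or> q dvd P" using q(1) prime_elem_dvd_power by (auto simp: prime_elem_dvd_mult_iff)
    then show False using PQ(4) q not_dvd_nonzero[OF q(3) tu(1)] by blast
  qed
  then have "y \<in> A"
    unfolding y_def
  proof (rule homog_quotient[of "e + e'" g, rotated -1])
    show "e + e' \<in> L" by (rule lat_add[OF A1(1) B1(1)])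
    show "g * P \<in> H (e + e')" using H_mult[OF A1(1) B1(1) A1(2) B1(3)] PQ(1) by simp
    show "g * Q \<in> H (e + e')" using H_mult[OF A1(1) B1(1) A1(3) B1(2)] PQ(2) by simp
    show "g * Q \<noteq> 0" using PQ(3) Qn by simp
  qed
  then show "b divides\<^bsub>ring_on A\<^esub> a" unfolding factor_def using ay by auto
qed

lemma normal: "normal_point X x"
proof -
  obtain h where "h \<in> ring_iso (local_ring X x) (ring_on A)" using local_ring_iso by blast
  then show ?thesis unfolding normal_point_def
    by (rule integrally_closed_iso[OF integrally_closed_A cring_local_ring])
qed

section \<open>The prime ideal of the divisor of a generator\<close>

lemma key:
  assumes k: "k < r" "k \<notin> J" and d: "d \<in> L"
  obtains e P M n where "e \<in> L" "P \<in> H (d + e)" "M \<in> H e" "z0 M \<noteq> 0" "\<not> f k dvd P" "P \<noteq> 0"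
    "P = (\<Prod>i\<in>{..<r} - {k}. f i ^ n i)"
proof -
  obtain e n m where *: "e \<in> L" "(\<Prod>i\<in>{..<r} - {k}. f i ^ n i) \<in> H (d + e)" "(\<Prod>i\<in>J. f i ^ m i) \<in> H e"
    using key_fraction[OF rel k d] by blast
  have "z0 (\<Prod>i\<in>J. f i ^ m i) \<noteq> 0" unfolding pt_prod[OF z0] by (auto simp: z0 nzset_def)
  moreover have "\<not> f k dvd (\<Prod>i\<in>{..<r} - {k}. f i ^ n i)" by (rule gen_not_dvd_prod[OF k(1)]) simp
  moreover from this have "(\<Prod>i\<in>{..<r} - {k}. f i ^ n i) \<noteq> 0" by (metis dvd_0_right)
  ultimately show thesis using that[OF *(1-3)] by blast
qed

lemma gen_zero: "k < r \<Longrightarrow> k \<notin> J \<Longrightarrow> z0 (f k) = 0"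
  unfolding nzset_def by auto

text \<open>By \<open>key\<close> there is a numerator that is a monomial without
  \<open>f i\<close>. If \<open>q\<close> divides it, then \<open>q\<close> is associated to some
  \<open>f l\<close> with \<open>l\<close> outside \<open>J\<close>, and the numerator that
  \<open>key\<close> provides for \<open>l\<close> is not divisible by \<open>f l\<close>.\<close>

lemma no_common_prime:
  assumes d: "d \<in> L" and i: "i < r" "i \<notin> J" and q: "prime_elem q" "z0 q = 0"
    and all: "\<And>e P M. e \<in> L \<Longrightarrow> P \<in> H (d + e) \<Longrightarrow> M \<in> H e \<Longrightarrow> z0 M \<noteq> 0 \<Longrightarrow> P \<noteq> 0 \<Longrightarrow> q dvd P"
  shows False
proof -
  obtain e P M n where 1: "e \<in> L" "P \<in> H (d + e)" "M \<in> H e" "z0 M \<noteq> 0" "\<not> f i dvd P" "P \<noteq> 0"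
    "P = (\<Prod>j\<in>{..<r} - {i}. f j ^ n j)" by (rule key[OF i d])
  have "q dvd P" by (rule all[OF 1(1-4,6)])
  then obtain l where l: "l \<in> {..<r} - {i}" "q dvd f l" "f l dvd q"
    using prime_dvd_gen_prod[OF q(1), of n "{..<r} - {i}"] unfolding 1(7) by blast
  have "z0 (f l) = 0" by (rule pt_dvd[OF z0 l(2) q(2)])
  then have lJ: "l < r" "l \<notin> J" using l(1) unfolding nzset_def by auto
  obtain e' P' M' n' where 2: "e' \<in> L" "P' \<in> H (d + e')" "M' \<in> H e'" "z0 M' \<noteq> 0" "\<not> f l dvd P'" "P' \<noteq> 0"
    "P' = (\<Prod>j\<in>{..<r} - {l}. f j ^ n' j)" by (rule key[OF lJ d])
  have "q dvd P'" by (rule all[OF 2(1-4,6)])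
  then show False using 2(5) l(3) dvd_trans by blast
qed

text \<open>The prime ideal of \<open>A\<close> that belongs to the divisor of \<open>f i\<close>;
  \<open>D_iff\<close> shows that membership does not depend on the chosen fraction.\<close>

definition D :: "nat \<Rightarrow> 'r fract set" where
  "D i = {q. \<exists>e\<in>L. \<exists>a\<in>H e. \<exists>b\<in>H e. z0 b \<noteq> 0 \<and> f i dvd a \<and> q = Frac a b}"

lemma D_sub: "D i \<subseteq> A"
  unfolding D_def A_def by blast

lemma D_mem: "e \<in> L \<Longrightarrow> a \<in> H e \<Longrightarrow> b \<in> H e \<Longrightarrow> z0 b \<noteq> 0 \<Longrightarrow> f i dvd a \<Longrightarrow> Frac a b \<in> D i"
  unfolding D_def by blast

lemma D_iff:
  assumes i: "i < r" "i \<notin> J" and ab: "e \<in> L" "a \<in> H e" "b \<in> H e" "z0 b \<noteq> 0"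
  shows "Frac a b \<in> D i \<longleftrightarrow> f i dvd a"
proof
  assume "Frac a b \<in> D i"
  then obtain e' a' b' where *: "e' \<in> L" "a' \<in> H e'" "b' \<in> H e'" "z0 b' \<noteq> 0" "f i dvd a'" "Frac a b = Frac a' b'"
    unfolding D_def by blast
  then have "a * b' = a' * b" using nz[OF *(4)] nz[OF ab(4)] by (simp add: Fraction_Field.eq_fract)
  then have "f i dvd a * b'" using *(5) by simp
  then show "f i dvd a" using gen_prime[OF i(1)] not_dvd_nonzero[OF gen_zero[OF i] *(4)]
    by (simp add: prime_elem_dvd_mult_iff)
qed (use ab in \<open>auto simp: D_def\<close>)

text \<open>A valuation argument by hand. Let \<open>d\<close> be the degree of
  \<open>f i ^ m\<close>, the exact power of \<open>f i\<close> in the numerator of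
  \<open>\<pi>\<close>. Fractions of degrees \<open>- d\<close> and \<open>d\<close> from
  \<open>key\<close> give \<open>\<gamma> * \<pi> = \<alpha> * \<beta>\<close> with
  \<open>\<beta>\<close> and \<open>\<gamma>\<close> outside \<open>D i\<close>, so
  \<open>\<alpha>\<close>, the corrected power of \<open>f i\<close>, lies in \<open>I\<close>. It
  divides \<open>\<gamma> * c ^ m\<close> for every \<open>c\<close> in \<open>D i\<close>. The two
  applications are the principal ideal of a prime element and the ideal of a closed set containing
  the divisor.\<close>

lemma height_one:
  assumes i: "i < r" "i \<notin> J" and sub: "I \<subseteq> D i" and ne: "\<pi> \<in> I" "\<pi> \<noteq> 0"
    and ideal: "\<And>c a. c \<in> A \<Longrightarrow> a \<in> I \<Longrightarrow> c * a \<in> I"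
    and prime: "\<And>a b. a \<in> A \<Longrightarrow> b \<in> A \<Longrightarrow> a * b \<in> I \<Longrightarrow> a \<in> I \<or> b \<in> I"
  shows "D i \<subseteq> I"
proof
  have wi: "w i \<in> L" "f i \<in> H (w i)" using gen_deg[OF i(1)] by auto
  have fp: "prime_elem (f i)" by (rule gen_prime[OF i(1)])
  obtain e0 a0 b0 where 0: "e0 \<in> L" "a0 \<in> H e0" "b0 \<in> H e0" "z0 b0 \<noteq> 0" "b0 \<noteq> 0" "\<pi> = Frac a0 b0"
    by (rule A_cases[of \<pi>]) (use ne sub D_sub in blast)
  have a00: "a0 \<noteq> 0" using ne(2) 0(5,6) by (simp add: Frac_eq_0_iff)
  obtain m h where mh: "a0 = f i ^ m * h" "\<not> f i dvd h" using prime_power_split[OF fp a00] by blast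
  define d where "d = s (of_nat m) (w i)"
  have d: "d \<in> L" "f i ^ m \<in> H d" unfolding d_def by (rule lat_scale_of_nat[OF wi(1)], rule H_power[OF wi])
  obtain \<delta> where \<delta>: "\<delta> \<in> L" "h \<in> H \<delta>" using dvd_homog[of h a0, OF _ 0(1,2) a00] unfolding mh(1) by auto
  have e0: "e0 = d + \<delta>"
    by (rule H_unique[OF 0(1) lat_add[OF d(1) \<delta>(1)] 0(2) _ a00]) (use H_mult[OF d(1) \<delta>(1) d(2) \<delta>(2)] mh(1) in simp)
  obtain e1 P1 M1 n1 where 1: "e1 \<in> L" "P1 \<in> H (- d + e1)" "M1 \<in> H e1" "z0 M1 \<noteq> 0" "\<not> f i dvd P1" "P1 \<noteq> 0"
    "P1 = (\<Prod>j\<in>{..<r} - {i}. f j ^ n1 j)" by (rule key[OF i lat_neg[OF d(1)]])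
  obtain e2 P2 M2 n2 where 2: "e2 \<in> L" "P2 \<in> H (d + e2)" "M2 \<in> H e2" "z0 M2 \<noteq> 0" "\<not> f i dvd P2" "P2 \<noteq> 0"
    "P2 = (\<Prod>j\<in>{..<r} - {i}. f j ^ n2 j)" by (rule key[OF i d(1)])
  have L1: "- d + e1 \<in> L" and L2: "d + e2 \<in> L"
    by (rule lat_add[OF lat_neg[OF d(1)] 1(1)], rule lat_add[OF d(1) 2(1)])
  have M0: "M1 \<noteq> 0" "M2 \<noteq> 0" using nz 1(4) 2(4) by auto
  define \<alpha> where "\<alpha> = Frac (f i ^ m * P1) M1"
  define \<beta> where "\<beta> = Frac (h * P2) (b0 * M2)"
  define \<gamma> where "\<gamma> = Frac (P1 * P2) (M1 * M2)"
  have "f i ^ m * P1 \<in> H e1" using H_mult[OF d(1) L1 d(2) 1(2)] by simp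
  then have \<alpha>A: "\<alpha> \<in> A" unfolding \<alpha>_def by (rule A_mem[OF 1(1) _ 1(3,4)])
  have \<beta>h: "e0 + e2 \<in> L" "h * P2 \<in> H (e0 + e2)" "b0 * M2 \<in> H (e0 + e2)" "z0 (b0 * M2) \<noteq> 0"
    using lat_add[OF 0(1) 2(1)] H_mult[OF \<delta>(1) L2 \<delta>(2) 2(2)] H_mult[OF 0(1) 2(1) 0(3) 2(3)] 0(4) 2(4)
    by (auto simp: e0 z0 algebra_simps)
  have \<beta>A: "\<beta> \<in> A" unfolding \<beta>_def by (rule A_mem[OF \<beta>h])
  have \<gamma>h: "e1 + e2 \<in> L" "P1 * P2 \<in> H (e1 + e2)" "M1 * M2 \<in> H (e1 + e2)" "z0 (M1 * M2) \<noteq> 0"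
    using lat_add[OF 1(1) 2(1)] H_mult[OF L1 L2 1(2) 2(2)] H_mult[OF 1(1) 2(1) 1(3) 2(3)] 1(4) 2(4)
    by (auto simp: z0 algebra_simps)
  have \<gamma>A: "\<gamma> \<in> A" unfolding \<gamma>_def by (rule A_mem[OF \<gamma>h])
  have \<gamma>n: "\<gamma> \<notin> I"
  proof
    assume "\<gamma> \<in> I"
    then have "f i dvd P1 * P2" using sub D_iff[OF i \<gamma>h] unfolding \<gamma>_def by blast
    then show False using 1(5) 2(5) fp by (simp add: prime_elem_dvd_mult_iff)
  qed
  have "\<gamma> * \<pi> = \<alpha> * \<beta>" unfolding \<alpha>_def \<beta>_def \<gamma>_def 0(6) mh(1) using M0 0(5)
    by (simp add: mult_ac)
  then have "\<alpha> * \<beta> \<in> I" using ideal[OF \<gamma>A ne(1)] by simp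
  moreover have "\<beta> \<notin> I"
  proof
    assume "\<beta> \<in> I"
    then have "f i dvd h * P2" using sub D_iff[OF i \<beta>h] unfolding \<beta>_def by blast
    then show False using mh(2) 2(5) fp by (simp add: prime_elem_dvd_mult_iff)
  qed
  ultimately have \<alpha>I: "\<alpha> \<in> I" using prime[OF \<alpha>A \<beta>A] by blast
  have one: "1 \<notin> I"
  proof
    assume "1 \<in> I"
    then have "Frac 1 1 \<in> D i" using sub by (auto simp: Fraction_Field.One_fract_def)
    then have "f i dvd 1" using D_iff[OF i lat_0 H_1 H_1] z0 by simp
    then show False using fp by (simp add: prime_elem_def)
  qed
  fix c assume "c \<in> D i"
  then obtain e b' b where c: "e \<in> L" "b' \<in> H e" "b \<in> H e" "z0 b \<noteq> 0" "f i dvd b'" "c = Frac b' b" unfolding D_def by blast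
  have cA: "c \<in> A" unfolding c(6) by (rule A_mem[OF c(1-4)])
  show "c \<in> I"
  proof (cases "b' = 0")
    case True
    then have "c = 0 * \<pi>" unfolding c(6) by (simp add: Fraction_Field.fract_collapse)
    then show ?thesis using ideal[OF A_0 ne(1)] by simp
  next
    case False
    obtain g where g: "b' = f i * g" using c(5) by (rule dvdE)
    obtain \<eta> where \<eta>: "\<eta> \<in> L" "g \<in> H \<eta>" using dvd_homog[of g b', OF _ c(1,2) False] unfolding g by auto
    have e: "e = w i + \<eta>"
      by (rule H_unique[OF c(1) lat_add[OF wi(1) \<eta>(1)] c(2) _ False]) (use H_mult[OF wi(1) \<eta>(1) wi(2) \<eta>(2)] g in simp)
    let ?E = "s (of_nat m) e"
    have gm: "g ^ m * P2 \<in> H (?E + e2)"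
      using H_mult[OF lat_scale_of_nat[OF \<eta>(1)] L2 H_power[OF \<eta>] 2(2), of m]
      unfolding e d_def by (simp add: V.scale_right_distrib algebra_simps)
    have bm: "b ^ m * M2 \<in> H (?E + e2)"
      by (rule H_mult[OF lat_scale_of_nat[OF c(1)] 2(1) H_power[OF c(1,3)] 2(3)])
    have "Frac (g ^ m * P2) (b ^ m * M2) \<in> A"
      by (rule A_mem[OF lat_add[OF lat_scale_of_nat[OF c(1)] 2(1)] gm bm]) (use c(4) 2(4) z0 in simp)
    then have "Frac (g ^ m * P2) (b ^ m * M2) * \<alpha> \<in> I" using \<alpha>I by (rule ideal)
    moreover have "Frac (g ^ m * P2) (b ^ m * M2) * \<alpha> = \<gamma> * c ^ m"
      unfolding \<alpha>_def \<gamma>_def c(6) g Frac_power by (simp add: power_mult_distrib mult_ac)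
    ultimately have "\<gamma> * c ^ m \<in> I" by simp
    then have "c ^ m \<in> I" using prime[OF \<gamma>A A_power[OF cA]] \<gamma>n by blast
    then show ?thesis
    proof (induction m)
      case (Suc m)
      then show ?case using prime[OF cA A_power[OF cA], of m] by auto
    qed (use one in simp)
  qed
qed

text \<open>A fraction of degree \<open>- w i\<close> brings \<open>f i\<close> to degree 0.\<close>

lemma D_nonzero:
  assumes i: "i < r" "i \<notin> J"
  shows "\<exists>q\<in>D i. q \<noteq> 0"
proof -
  have wi: "w i \<in> L" "f i \<in> H (w i)" using gen_deg[OF i(1)] by auto
  obtain e P M n where 1: "e \<in> L" "P \<in> H (- w i + e)" "M \<in> H e" "z0 M \<noteq> 0" "\<not> f i dvd P" "P \<noteq> 0"
    "P = (\<Prod>j\<in>{..<r} - {i}. f j ^ n j)" by (rule key[OF i lat_neg[OF wi(1)]])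
  have "f i * P \<in> H e" using H_mult[OF wi(1) lat_add[OF lat_neg[OF wi(1)] 1(1)] wi(2) 1(2)] by simp
  then have "Frac (f i * P) M \<in> D i" by (rule D_mem[OF 1(1) _ 1(3,4)]) simp
  moreover have "Frac (f i * P) M \<noteq> 0" using 1(6) gen_nonzero[OF i(1)] nz[OF 1(4)] by (simp add: Frac_eq_0_iff)
  ultimately show ?thesis by blast
qed

lemma D_prime:
  assumes i: "i < r" "i \<notin> J" and ab: "a \<in> A" "b \<in> A" "a * b \<in> D i"
  shows "a \<in> D i \<or> b \<in> D i"
proof -
  obtain e a1 a2 where A1: "e \<in> L" "a1 \<in> H e" "a2 \<in> H e" "z0 a2 \<noteq> 0" "a2 \<noteq> 0" "a = Frac a1 a2" by (rule A_cases[OF ab(1)])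
  obtain e' b1 b2 where B1: "e' \<in> L" "b1 \<in> H e'" "b2 \<in> H e'" "z0 b2 \<noteq> 0" "b2 \<noteq> 0" "b = Frac b1 b2" by (rule A_cases[OF ab(2)])
  have "Frac (a1 * b1) (a2 * b2) \<in> D i" using ab(3) A1(6) B1(6) by simp
  moreover have "Frac (a1 * b1) (a2 * b2) \<in> D i \<longleftrightarrow> f i dvd a1 * b1"
    by (rule D_iff[OF i lat_add[OF A1(1) B1(1)] H_mult[OF A1(1) B1(1) A1(2) B1(2)] H_mult[OF A1(1) B1(1) A1(3) B1(3)]])
      (use A1(4) B1(4) z0 in simp)
  ultimately have "f i dvd a1 \<or> f i dvd b1" using gen_prime[OF i(1)] by (simp add: prime_elem_dvd_mult_iff)
  then show ?thesis using D_iff[OF i A1(1-4)] D_iff[OF i B1(1-4)] A1(6) B1(6) by auto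
qed

lemma D_ideal:
  assumes i: "i < r" "i \<notin> J" and ab: "a \<in> A" "b \<in> D i"
  shows "a * b \<in> D i"
proof -
  obtain e a1 a2 where A1: "e \<in> L" "a1 \<in> H e" "a2 \<in> H e" "z0 a2 \<noteq> 0" "a2 \<noteq> 0" "a = Frac a1 a2" by (rule A_cases[OF ab(1)])
  obtain e' b1 b2 where B1: "e' \<in> L" "b1 \<in> H e'" "b2 \<in> H e'" "z0 b2 \<noteq> 0" "f i dvd b1" "b = Frac b1 b2"
    using ab(2) unfolding D_def by blast
  have "Frac (a1 * b1) (a2 * b2) \<in> D i \<longleftrightarrow> f i dvd a1 * b1"
    by (rule D_iff[OF i lat_add[OF A1(1) B1(1)] H_mult[OF A1(1) B1(1) A1(2) B1(2)] H_mult[OF A1(1) B1(1) A1(3) B1(3)]])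
      (use A1(4) B1(4) z0 in simp)
  then show ?thesis using B1(5) A1(6) B1(6) by simp
qed

lemma degree_difference:
  assumes "e \<in> L" "b \<in> H e" "z0 b \<noteq> 0" "d \<in> L" "a \<in> H d" "z0 a \<noteq> 0"
  shows "e - d \<in> weights J"
  by (rule weights_diff[OF nonvanishing_weight[OF z0 assms(1-3)] nonvanishing_weight[OF z0 assms(4-6)]])

text \<open>A prime element \<open>\<pi>\<close> of \<open>A\<close> lying in \<open>D i\<close>
  generates \<open>D i\<close> by \<open>height_one\<close>. Its numerator is
  \<open>f i * g\<close>; the point is that \<open>g\<close> does not vanish at \<open>z0\<close>,
  so that \<open>w i\<close> is a difference of degrees of elements not vanishing there.\<close>

lemma factorial_imp_weights:
  assumes fd: "factorial_domain (ring_on A)"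
  shows "weights J = L"
  unfolding weights_eq_lat_iff[OF nzset_sub]
proof (intro allI impI)
  fix i assume ir: "i < r"
  show "w i \<in> weights J"
  proof (cases "i \<in> J")
    case False
    have i: "i < r" "i \<notin> J" using ir False by auto
    have wi: "w i \<in> L" "f i \<in> H (w i)" using gen_deg[OF i(1)] by auto
    let ?M = "mult_of (ring_on A)"
    \<comment> \<open>Any nonzero element of \<open>D i\<close> has a prime factor in
      \<open>D i\<close>, because \<open>D i\<close> is prime and does not contain 1.\<close>
    obtain c where c: "c \<in> D i" "c \<noteq> 0" using D_nonzero[OF i] by blast
    then have "c \<in> carrier ?M" using D_sub by (auto simp: mult_of_def)
    then have "prime_product (ring_on A) c" using fd unfolding factorial_domain_iff_prime_product by blast
    then obtain ps where ps: "set ps \<subseteq> carrier ?M" "\<forall>q\<in>set ps. Divisibility.prime ?M q"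
      "foldr (*) ps 1 \<sim>\<^bsub>?M\<^esub> c" unfolding prime_product_def by auto
    obtain y where y: "y \<in> A" "foldr (*) ps 1 = c * y"
      using ps(3) unfolding associated_def factor_def by (auto simp: mult_of_def)
    have "foldr (*) ps 1 \<in> D i" using D_ideal[OF i y(1) c(1)] y(2) by (simp add: mult.commute)
    moreover have "1 \<notin> D i"
    proof
      assume "1 \<in> D i"
      then have "f i dvd 1" using D_iff[OF i lat_0 H_1 H_1] z0 by (simp add: Fraction_Field.One_fract_def)
      then show False using gen_prime[OF i(1)] by (simp add: prime_elem_def)
    qed
    moreover have "foldr (*) ps 1 \<in> A \<and> (foldr (*) ps 1 \<in> D i \<longrightarrow> 1 \<in> D i \<or> (\<exists>q\<in>set ps. q \<in> D i))"
      using ps(1)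
    proof (induction ps)
      case (Cons q ps)
      then have "q \<in> A" by (auto simp: mult_of_def)
      then show ?case using Cons D_prime[OF i \<open>q \<in> A\<close>, of "foldr (*) ps 1"] by (auto intro: A_mult)
    qed (simp add: A_1)
    ultimately obtain \<pi> where \<pi>: "\<pi> \<in> set ps" "\<pi> \<in> D i" by blast
    have pA: "\<pi> \<in> A" "\<pi> \<noteq> 0" and pp: "Divisibility.prime ?M \<pi>" using \<pi>(1) ps(1,2) by (auto simp: mult_of_def)
    define I where "I = {\<pi> * a | a. a \<in> A}"
    have DI: "D i \<subseteq> I"
    proof (rule height_one[OF i _ _ pA(2)])
      show "I \<subseteq> D i" unfolding I_def using D_ideal[OF i _ \<pi>(2)] by (auto simp: mult.commute)
      show "\<pi> \<in> I" unfolding I_def using A_1 by (intro CollectI exI[of _ 1]) simp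
      show "a * b \<in> I" if "a \<in> A" "b \<in> I" for a b
      proof -
        obtain b' where b': "b = \<pi> * b'" "b' \<in> A" using \<open>b \<in> I\<close> unfolding I_def by blast
        have "a * b = \<pi> * (a * b')" unfolding b'(1) by (simp add: mult_ac)
        moreover have "a * b' \<in> A" by (rule A_mult[OF \<open>a \<in> A\<close> b'(2)])
        ultimately show ?thesis unfolding I_def by blast
      qed
      show "a \<in> I \<or> b \<in> I" if ab: "a \<in> A" "b \<in> A" "a * b \<in> I" for a b
      proof (cases "a = 0 \<or> b = 0")
        case True
        have "0 \<in> I" unfolding I_def using A_0 by (intro CollectI exI[of _ 0]) simp
        then show ?thesis using True by auto
      next
        case False
        obtain y where "y \<in> A" "a * b = \<pi> * y" using ab(3) unfolding I_def by blast
        moreover from this have "y \<noteq> 0" using False by auto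
        ultimately have "\<pi> divides\<^bsub>?M\<^esub> a \<otimes>\<^bsub>?M\<^esub> b" unfolding factor_def by (auto simp: mult_of_def)
        then have "\<pi> divides\<^bsub>?M\<^esub> a \<or> \<pi> divides\<^bsub>?M\<^esub> b"
          using pp ab False unfolding Divisibility.prime_def by (auto simp: mult_of_def)
        then show ?thesis unfolding factor_def I_def by (auto simp: mult_of_def)
      qed
    qed
    obtain e a b where ab: "e \<in> L" "a \<in> H e" "b \<in> H e" "z0 b \<noteq> 0" "f i dvd a" "\<pi> = Frac a b"
      using \<pi>(2) unfolding D_def by blast
    have b0: "b \<noteq> 0" by (rule nz[OF ab(4)])
    have a0: "a \<noteq> 0" using pA(2) ab(6) b0 by (simp add: Frac_eq_0_iff)
    obtain g where g: "a = f i * g" using ab(5) by (rule dvdE)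
    obtain \<eta> where \<eta>: "\<eta> \<in> L" "g \<in> H \<eta>" using dvd_homog[of g a, OF _ ab(1,2) a0] unfolding g by auto
    have e: "e = w i + \<eta>"
      by (rule H_unique[OF ab(1) lat_add[OF wi(1) \<eta>(1)] ab(2) _ a0]) (use H_mult[OF wi(1) \<eta>(1) wi(2) \<eta>(2)] g in simp)
    have g0: "g \<noteq> 0" using a0 g by auto
    have "z0 g \<noteq> 0"
    proof
      assume "z0 g = 0"
      then obtain q where q: "prime_elem q" "q dvd g" "z0 q = 0" using prime_zero_factor[OF g0] by blast
      \<comment> \<open>Each \<open>f i * P / M\<close> is a multiple of \<open>\<pi>\<close>, whose
        numerator is \<open>f i * g\<close>. So \<open>q\<close>, dividing \<open>g\<close>, would
        divide every such \<open>P\<close>.\<close>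
      show False
      proof (rule no_common_prime[OF lat_neg[OF wi(1)] i q(1,3)])
        fix e' P M assume P: "e' \<in> L" "P \<in> H (- w i + e')" "M \<in> H e'" "z0 M \<noteq> 0" "P \<noteq> 0"
        have "f i * P \<in> H e'" using H_mult[OF wi(1) lat_add[OF lat_neg[OF wi(1)] P(1)] wi(2) P(2)] by simp
        then have "Frac (f i * P) M \<in> D i" by (rule D_mem[OF P(1) _ P(3,4)]) simp
        then obtain y where y: "y \<in> A" "Frac (f i * P) M = \<pi> * y" using DI unfolding I_def by blast
        obtain d y1 y2 where Y: "d \<in> L" "y1 \<in> H d" "y2 \<in> H d" "z0 y2 \<noteq> 0" "y2 \<noteq> 0" "y = Frac y1 y2" by (rule A_cases[OF y(1)])
        have "f i * P * (b * y2) = a * y1 * M"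
          using y(2) ab(6) Y(5,6) b0 nz[OF P(4)] by (simp add: Fraction_Field.eq_fract)
        then have "f i * (P * (b * y2)) = f i * (g * (y1 * M))" unfolding g by (simp add: mult_ac)
        then have "P * (b * y2) = g * (y1 * M)" using gen_nonzero[OF i(1)] by simp
        then have "q dvd P * (b * y2)" using q(2) by simp
        moreover have "\<not> q dvd b * y2" by (rule not_dvd_nonzero[OF q(3)]) (use ab(4) Y(4) z0 in simp)
        ultimately show "q dvd P" using q(1) by (simp add: prime_elem_dvd_mult_iff)
      qed
    qed
    then have "e - \<eta> \<in> weights J" by (intro degree_difference[OF ab(1,3,4) \<eta>])
    then show ?thesis unfolding e by simp
  qed (simp add: weights_gen)
qed

text \<open>The factor \<open>N / P\<close>, built from elements not vanishing at \<open>z0\<close>,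
  shifts \<open>q\<close> to degree 0. A fraction whose numerator is divisible by \<open>q\<close>
  is a multiple of the result inside \<open>A\<close>, and denominators are not divisible by
  \<open>q\<close> because they do not vanish at \<open>z0\<close>.\<close>

lemma prime_of_homog_prime:
  assumes q: "prime_elem q" "z0 q = 0" "q \<in> H d" "d \<in> L" and NP: "N \<in> H e" "P \<in> H (d + e)" "e \<in> L" "z0 N \<noteq> 0" "z0 P \<noteq> 0"
  shows "Frac (q * N) P \<in> A" "Divisibility.prime (mult_of (ring_on A)) (Frac (q * N) P)"
proof -
  have de: "d + e \<in> L" by (rule lat_add[OF q(4) NP(3)])
  show mA: "Frac (q * N) P \<in> A" by (rule A_mem[OF de H_mult[OF q(4) NP(3) q(3) NP(1)] NP(2,5)])
  have N0: "N \<noteq> 0" "P \<noteq> 0" using nz NP(4,5) by auto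
  have q0: "q \<noteq> 0" using q(1) by (simp add: prime_elem_def)
  let ?\<pi> = "Frac (q * N) P"
  have div: "\<exists>y\<in>A. a = ?\<pi> * y" if a: "e' \<in> L" "a1 \<in> H e'" "a2 \<in> H e'" "z0 a2 \<noteq> 0" "a2 \<noteq> 0" "a = Frac a1 a2" "q dvd a1"
    for a a1 a2 e'
  proof (cases "a1 = 0")
    case True
    then have "a = ?\<pi> * 0" using a(6) by (simp add: Fraction_Field.fract_collapse)
    then show ?thesis using A_0 by blast
  next
    case False
    obtain g where g: "a1 = q * g" using a(7) by (rule dvdE)
    obtain \<eta> where \<eta>: "\<eta> \<in> L" "g \<in> H \<eta>" using dvd_homog[of g a1, OF _ a(1,2) False] unfolding g by auto
    have e': "e' = d + \<eta>"
      by (rule H_unique[OF a(1) lat_add[OF q(4) \<eta>(1)] a(2) _ False]) (use H_mult[OF q(4) \<eta>(1) q(3) \<eta>(2)] g in simp)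
    have 1: "g * P \<in> H (e' + e)" using H_mult[OF \<eta>(1) de \<eta>(2) NP(2)] unfolding e' by (simp add: algebra_simps)
    have 2: "a2 * N \<in> H (e' + e)" by (rule H_mult[OF a(1) NP(3) a(3) NP(1)])
    have "Frac (g * P) (a2 * N) \<in> A" by (rule A_mem[OF lat_add[OF a(1) NP(3)] 1 2]) (use a(4) NP(4) z0 in simp)
    moreover have "a = ?\<pi> * Frac (g * P) (a2 * N)"
      unfolding a(6) g using N0 a(5) by (simp add: Fraction_Field.eq_fract mult_ac)
    ultimately show ?thesis by blast
  qed
  show "Divisibility.prime (mult_of (ring_on A)) ?\<pi>"
    unfolding Divisibility.prime_def
  proof (intro conjI ballI impI)
    show "?\<pi> \<notin> Units (mult_of (ring_on A))"
    proof
      assume "?\<pi> \<in> Units (mult_of (ring_on A))"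
      then obtain y where y: "y \<in> A" "?\<pi> * y = 1" unfolding Units_def by (auto simp: mult_of_def)
      obtain e' c1 c2 where c: "e' \<in> L" "c1 \<in> H e'" "c2 \<in> H e'" "z0 c2 \<noteq> 0" "c2 \<noteq> 0" "y = Frac c1 c2" by (rule A_cases[OF y(1)])
      have "q * N * c1 = P * c2"
        using y(2) c(5,6) N0 by (simp add: Fraction_Field.One_fract_def Fraction_Field.eq_fract)
      then have "q dvd P * c2" by (metis dvd_triv_left mult.assoc)
      moreover have "\<not> q dvd P * c2" by (rule not_dvd_nonzero[OF q(2)]) (use NP(5) c(4) z0 in simp)
      ultimately show False by blast
    qed
    fix a b assume ab: "a \<in> carrier (mult_of (ring_on A))" "b \<in> carrier (mult_of (ring_on A))"
      "?\<pi> divides\<^bsub>mult_of (ring_on A)\<^esub> a \<otimes>\<^bsub>mult_of (ring_on A)\<^esub> b"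
    have aA: "a \<in> A" "a \<noteq> 0" "b \<in> A" "b \<noteq> 0" using ab(1,2) by (auto simp: mult_of_def)
    obtain y where y: "y \<in> A" "a * b = ?\<pi> * y" using ab(3) unfolding factor_def by (auto simp: mult_of_def)
    obtain ea a1 a2 where A1: "ea \<in> L" "a1 \<in> H ea" "a2 \<in> H ea" "z0 a2 \<noteq> 0" "a2 \<noteq> 0" "a = Frac a1 a2" by (rule A_cases[OF aA(1)])
    obtain eb b1 b2 where B1: "eb \<in> L" "b1 \<in> H eb" "b2 \<in> H eb" "z0 b2 \<noteq> 0" "b2 \<noteq> 0" "b = Frac b1 b2" by (rule A_cases[OF aA(3)])
    obtain ey y1 y2 where Y: "ey \<in> L" "y1 \<in> H ey" "y2 \<in> H ey" "z0 y2 \<noteq> 0" "y2 \<noteq> 0" "y = Frac y1 y2" by (rule A_cases[OF y(1)])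
    have "a1 * b1 * (P * y2) = q * N * y1 * (a2 * b2)"
      using y(2) A1(5,6) B1(5,6) Y(5,6) N0 by (simp add: Fraction_Field.eq_fract)
    then have "q dvd a1 * b1 * (P * y2)" by (metis dvd_triv_left mult.assoc)
    moreover have "\<not> q dvd P * y2" by (rule not_dvd_nonzero[OF q(2)]) (use NP(5) Y(4) z0 in simp)
    ultimately have "q dvd a1 \<or> q dvd b1" using q(1) by (auto simp: prime_elem_dvd_mult_iff)
    then have "(\<exists>y\<in>A. a = ?\<pi> * y) \<or> (\<exists>y\<in>A. b = ?\<pi> * y)" using div[OF A1] div[OF B1] by blast
    then show "?\<pi> divides\<^bsub>mult_of (ring_on A)\<^esub> a \<or> ?\<pi> divides\<^bsub>mult_of (ring_on A)\<^esub> b"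
      unfolding factor_def using aA by (auto simp: mult_of_def)
  qed
qed

text \<open>Now every degree is that of a Laurent monomial over \<open>J\<close>, so
  \<open>prime_of_homog_prime\<close> applies to each prime factor of a numerator that vanishes at
  \<open>z0\<close>.\<close>

lemma weights_imp_factorial:
  assumes wL: "weights J = L"
  shows "factorial_domain (ring_on A)"
proof -
  \<comment> \<open>\<open>v\<close> collects the factors that do not vanish at \<open>z0\<close>,
    including the monomials introduced by splitting off a prime; the empty list leaves a unit of
    \<open>A\<close>.\<close>
  have main: "prime_product (ring_on A) (Frac (v * prod_list qs) b)"
    if "\<forall>q\<in>set qs. prime_elem q" "e \<in> L" "v * prod_list qs \<in> H e" "b \<in> H e" "z0 b \<noteq> 0" "z0 v \<noteq> 0" for v qs b e
    using that
  proof (induction qs arbitrary: v b e)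
    case Nil
    then have v: "v \<in> H e" by simp
    have "Frac v b * Frac b v = 1" using nz[OF Nil.prems(5)] nz[OF Nil.prems(6)]
      by (simp add: Fraction_Field.One_fract_def Fraction_Field.eq_fract mult.commute)
    then show ?case
      using prime_product_unit[OF A_mem[OF Nil.prems(2) v Nil.prems(4,5)] A_mem[OF Nil.prems(2,4) v Nil.prems(6)] A_1] by simp
  next
    case (Cons q qs)
    have q: "prime_elem q" and qs: "\<forall>q\<in>set qs. prime_elem q" using Cons.prems(1) by auto
    show ?case
    proof (cases "z0 q = 0")
      case False
      have "v * q * prod_list qs \<in> H e" using Cons.prems(3) by (simp add: mult.assoc)
      then have "prime_product (ring_on A) (Frac (v * q * prod_list qs) b)"
        using Cons.IH[OF qs Cons.prems(2) _ Cons.prems(4,5)] Cons.prems(6) False z0 by simp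
      then show ?thesis by (simp add: mult.assoc)
    next
      case True
      have q0: "\<forall>q\<in>set qs. q \<noteq> 0" "q \<noteq> 0" "v \<noteq> 0" using q qs nz[OF Cons.prems(6)] by (auto simp: prime_elem_def)
      then have ne: "v * prod_list (q # qs) \<noteq> 0" by (auto simp: prod_list_zero_iff)
      have qd: "q dvd v * prod_list (q # qs)" by simp
      obtain d where d: "d \<in> L" "q \<in> H d" using dvd_homog[OF qd Cons.prems(2,3) ne] by blast
      have md: "v * prod_list qs dvd v * prod_list (q # qs)" by (simp add: mult.left_commute)
      obtain \<eta> where \<eta>: "\<eta> \<in> L" "v * prod_list qs \<in> H \<eta>" using dvd_homog[OF md Cons.prems(2,3) ne] by blast
      have e: "e = d + \<eta>"
        by (rule H_unique[OF Cons.prems(2) lat_add[OF d(1) \<eta>(1)] Cons.prems(3) _ ne])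
          (use H_mult[OF d(1) \<eta>(1) d(2) \<eta>(2)] in \<open>simp add: mult_ac\<close>)
      obtain e1 n m where e1: "e1 \<in> L" "(\<Prod>i\<in>J. f i ^ n i) \<in> H (d + e1)" "(\<Prod>i\<in>J. f i ^ m i) \<in> H e1"
        using monomial_fraction[OF nzset_sub, of d z0] d(1) wL by blast
      define P where "P = (\<Prod>i\<in>J. f i ^ n i)"
      define N where "N = (\<Prod>i\<in>J. f i ^ m i)"
      have nzP: "z0 P \<noteq> 0" "z0 N \<noteq> 0" unfolding P_def N_def pt_prod[OF z0] by (auto simp: z0 nzset_def)
      have PN: "P \<in> H (d + e1)" "N \<in> H e1" using e1 unfolding P_def N_def by auto
      note pr = prime_of_homog_prime[OF q True d(2,1) PN(2,1) e1(1) nzP(2,1)]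
      have "v * P * prod_list qs \<in> H (e + e1)"
        using H_mult[OF \<eta>(1) lat_add[OF d(1) e1(1)] \<eta>(2) PN(1)] unfolding e by (simp add: algebra_simps)
      moreover have "b * N \<in> H (e + e1)" by (rule H_mult[OF Cons.prems(2) e1(1) Cons.prems(4) PN(2)])
      ultimately have IH: "prime_product (ring_on A) (Frac (v * P * prod_list qs) (b * N))"
        using Cons.IH[OF qs lat_add[OF Cons.prems(2) e1(1)]] Cons.prems(5,6) nzP z0 by simp
      have nb: "N \<noteq> 0" "P \<noteq> 0" "b \<noteq> 0" using nz nzP Cons.prems(5) by auto
      have "Frac (q * N) P \<noteq> 0" using nb q0(2) by (simp add: Frac_eq_0_iff)
      from prime_product_mult[OF pr(2,1) this IH]
      have "prime_product (ring_on A) (Frac (q * N) P * Frac (v * P * prod_list qs) (b * N))" .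
      moreover have "Frac (q * N) P * Frac (v * P * prod_list qs) (b * N) = Frac (v * prod_list (q # qs)) b"
        using nb by (simp add: Fraction_Field.eq_fract mult_ac)
      ultimately show ?thesis by simp
    qed
  qed
  have "prime_product (ring_on A) c" if "c \<in> carrier (mult_of (ring_on A))" for c
  proof -
    have c: "c \<in> A" "c \<noteq> 0" using that by (auto simp: mult_of_def)
    obtain e a b where ab: "e \<in> L" "a \<in> H e" "b \<in> H e" "z0 b \<noteq> 0" "b \<noteq> 0" "c = Frac a b" by (rule A_cases[OF c(1)])
    have "a \<noteq> 0" using c(2) ab(5,6) by (simp add: Frac_eq_0_iff)
    then obtain u qs where uq: "u dvd 1" "\<forall>q\<in>set qs. prime_elem q" "a = u * prod_list qs" using prime_list by blast
    show ?thesis unfolding ab(6) uq(3)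
      by (rule main[OF uq(2) ab(1) _ ab(3,4) pt_unit[OF z0 uq(1)]]) (use ab(2) uq(3) in simp)
  qed
  then show ?thesis unfolding factorial_domain_iff_prime_product using domain_A by blast
qed

lemma factorial_iff: "factorial_point X x \<longleftrightarrow> weights J = L"
  unfolding factorial_point_iff using factorial_imp_weights weights_imp_factorial by blast

end

section \<open>Q-factorial points\<close>

lemma irreducible_subspace_closure:
  assumes "irreducible_subspace \<tau> S"
  shows "irreducible_subspace \<tau> (\<tau> closure_of S)"
proof -
  have S: "S \<subseteq> topspace \<tau>" "S \<noteq> {}"
    and irr: "\<And>A B. closedin \<tau> A \<Longrightarrow> closedin \<tau> B \<Longrightarrow> S \<subseteq> A \<union> B \<Longrightarrow> S \<subseteq> A \<or> S \<subseteq> B"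
    using assms unfolding irreducible_subspace_def by blast+
  have sub: "S \<subseteq> \<tau> closure_of S" by (rule closure_of_subset[OF S(1)])
  show ?thesis
    unfolding irreducible_subspace_def
  proof (intro conjI allI impI)
    show "\<tau> closure_of S \<subseteq> topspace \<tau>" by (rule closure_of_subset_topspace)
    show "\<tau> closure_of S \<noteq> {}" using sub S(2) by blast
    fix A B assume AB: "closedin \<tau> A" "closedin \<tau> B" "\<tau> closure_of S \<subseteq> A \<union> B"
    then have "S \<subseteq> A \<or> S \<subseteq> B" using irr sub by blast
    then show "\<tau> closure_of S \<subseteq> A \<or> \<tau> closure_of S \<subseteq> B" using AB closure_of_minimal by blast
  qed
qed

lemma irreducible_subspace_open_meets:
  assumes "irreducible_subspace \<tau> S" "openin \<tau> U" "openin \<tau> V" "U \<inter> S \<noteq> {}" "V \<inter> S \<noteq> {}"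
  shows "U \<inter> V \<inter> S \<noteq> {}"
proof
  assume "U \<inter> V \<inter> S = {}"
  moreover have "S \<subseteq> topspace \<tau>" using assms(1) unfolding irreducible_subspace_def by blast
  ultimately have "S \<subseteq> (topspace \<tau> - U) \<union> (topspace \<tau> - V)" by blast
  then have "S \<subseteq> topspace \<tau> - U \<or> S \<subseteq> topspace \<tau> - V"
    using assms(1) openin_closedin_eq[of \<tau> U] openin_closedin_eq[of \<tau> V] assms(2,3)
    unfolding irreducible_subspace_def by blast
  then show False using assms(4,5) by blast
qed

lemma irreducible_subspace_finite_Union:
  assumes "finite F" "irreducible_subspace \<tau> S" "\<And>C. C \<in> F \<Longrightarrow> closedin \<tau> C" "S \<subseteq> \<Union>F"
  shows "\<exists>C\<in>F. S \<subseteq> C"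
  using assms
proof (induction F rule: finite_induct)
  case empty
  then show ?case unfolding irreducible_subspace_def by simp
next
  case (insert C F)
  have "closedin \<tau> (\<Union>F)" using insert(1,5) by (intro closedin_Union) auto
  moreover have "closedin \<tau> C" "S \<subseteq> C \<union> \<Union>F" using insert(5,6) by auto
  ultimately have "S \<subseteq> C \<or> S \<subseteq> \<Union>F" using insert(4) unfolding irreducible_subspace_def by blast
  then show ?case using insert(3,4,5) by blast
qed

text \<open>Unions of chains of irreducible sets are irreducible, so Zorn's lemma gives a maximal
  one through \<open>y\<close>; it is closed since its closure is irreducible too and stays in
  \<open>A\<close>.\<close>

lemma maximal_irreducible_closed:
  assumes A: "closedin \<tau> A" and y: "y \<in> A"
  obtains Z where "closedin \<tau> Z" "irreducible_subspace \<tau> Z" "y \<in> Z" "Z \<subseteq> A"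
    "\<And>Z'. irreducible_subspace \<tau> Z' \<Longrightarrow> Z \<subseteq> Z' \<Longrightarrow> Z' \<subseteq> A \<Longrightarrow> Z' = Z"
proof -
  define \<C> where "\<C> = {Z. irreducible_subspace \<tau> Z \<and> y \<in> Z \<and> Z \<subseteq> A}"
  have At: "A \<subseteq> topspace \<tau>" by (rule closedin_subset[OF A])
  have "irreducible_subspace \<tau> {y}" using y At unfolding irreducible_subspace_def by auto
  then have ne: "\<C> \<noteq> {}" unfolding \<C>_def using y by auto
  have "\<exists>M\<in>\<C>. \<forall>Z\<in>\<C>. M \<subseteq> Z \<longrightarrow> Z = M"
  proof (rule subset_Zorn_nonempty[OF ne])
    fix \<D> assume \<D>: "\<D> \<noteq> {}" "subset.chain \<C> \<D>"
    have sub: "\<D> \<subseteq> \<C>" and lin: "\<And>S T. S \<in> \<D> \<Longrightarrow> T \<in> \<D> \<Longrightarrow> S \<subseteq> T \<or> T \<subseteq> S"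
      using \<D>(2) unfolding subset_chain_def by blast+
    have irr: "S \<subseteq> C1 \<or> S \<subseteq> C2" if "S \<in> \<D>" "closedin \<tau> C1" "closedin \<tau> C2" "S \<subseteq> C1 \<union> C2" for S C1 C2
      using that sub unfolding \<C>_def irreducible_subspace_def by blast
    have "\<Union>\<D> \<subseteq> A" "y \<in> \<Union>\<D>" using sub \<D>(1) unfolding \<C>_def by auto
    moreover have "irreducible_subspace \<tau> (\<Union>\<D>)"
      unfolding irreducible_subspace_def
    proof (intro conjI allI impI)
      show "\<Union>\<D> \<subseteq> topspace \<tau>" "\<Union>\<D> \<noteq> {}" using calculation At by auto
      fix C1 C2 assume C: "closedin \<tau> C1" "closedin \<tau> C2" "\<Union>\<D> \<subseteq> C1 \<union> C2"
      show "\<Union>\<D> \<subseteq> C1 \<or> \<Union>\<D> \<subseteq> C2"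
      proof (rule ccontr)
        assume "\<not> ?thesis"
        then obtain S T where ST: "S \<in> \<D>" "T \<in> \<D>" "\<not> S \<subseteq> C1" "\<not> T \<subseteq> C2" by blast
        obtain R where R: "R \<in> \<D>" "S \<subseteq> R" "T \<subseteq> R" using lin[OF ST(1,2)] ST(1,2) by blast
        have "R \<subseteq> C1 \<union> C2" using R(1) C(3) by blast
        then show False using irr[OF R(1) C(1,2)] R(2,3) ST(3,4) by blast
      qed
    qed
    ultimately show "\<Union>\<D> \<in> \<C>" unfolding \<C>_def by blast
  qed
  then obtain M where M: "M \<in> \<C>" "\<And>Z. Z \<in> \<C> \<Longrightarrow> M \<subseteq> Z \<Longrightarrow> Z = M" by blast
  have M': "irreducible_subspace \<tau> M" "y \<in> M" "M \<subseteq> A" using M(1) unfolding \<C>_def by auto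
  have sub: "M \<subseteq> \<tau> closure_of M" by (rule closure_of_subset) (use M' At in blast)
  have "\<tau> closure_of M \<in> \<C>" unfolding \<C>_def
    using irreducible_subspace_closure[OF M'(1)] sub M'(2) closure_of_minimal[OF M'(3) A] by blast
  then have "\<tau> closure_of M = M" using M(2) sub by blast
  then have "closedin \<tau> M" using closedin_closure_of[of \<tau> M] by simp
  then show thesis
  proof (rule that[OF _ M'])
    fix Z' assume "irreducible_subspace \<tau> Z'" "M \<subseteq> Z'" "Z' \<subseteq> A"
    then have "Z' \<in> \<C>" unfolding \<C>_def using M'(2) by blast
    then show "Z' = M" using M(2) \<open>M \<subseteq> Z'\<close> by blast
  qed
qed

lemma (in variety_facts) reg_finite_prod:
  assumes U: "openin (top_of X) U" and "finite I" "\<And>q. q \<in> I \<Longrightarrow> h q \<in> reg X U"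
  shows "\<exists>g\<in>reg X U. \<forall>y\<in>U. g y = 0 \<longleftrightarrow> (\<exists>q\<in>I. h q y = 0)"
  using assms(2,3)
proof (induction I rule: finite_induct)
  case empty
  show ?case by (rule bexI[OF _ reg_const[OF U, of 1]]) simp
next
  case (insert q I)
  then obtain g where g: "g \<in> reg X U" "\<forall>y\<in>U. g y = 0 \<longleftrightarrow> (\<exists>q\<in>I. h q y = 0)" by blast
  have "h q * g \<in> reg X U" by (rule reg_mult[OF U]) (use insert(4) g in auto)
  moreover have "\<forall>y\<in>U. (h q * g) y = 0 \<longleftrightarrow> (\<exists>q'\<in>insert q I. h q' y = 0)" using g(2) by auto
  ultimately show ?case by blast
qed

context good_quot
begin

text \<open>If neither closed set contained the image, there would be \<open>c1\<close> and
  \<open>c2\<close> not divisible by \<open>q\<close> whose nonvanishing loci map outside the one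
  and the other. Their product is not divisible by \<open>q\<close>, so by the Nullstellensatz some
  zero of \<open>q\<close> maps outside both.\<close>

lemma irreducible_divisor_image:
  assumes q: "prime_elem q" and ne: "z1 \<in> Xhat_points B" "z1 q = 0"
  shows "irreducible_subspace (top_of X) (p ` {z \<in> Xhat_points B. z q = 0})"
  unfolding irreducible_subspace_def
proof (intro conjI allI impI)
  let ?S = "p ` {z \<in> Xhat_points B. z q = 0}"
  show "?S \<subseteq> points X" using p_mem by blast
  show "?S \<noteq> {}" using ne by blast
  fix C1 C2 assume C: "closedin (top_of X) C1" "closedin (top_of X) C2" "?S \<subseteq> C1 \<union> C2"
  have basic: "\<exists>c. \<not> q dvd c \<and> (\<forall>z\<in>Z. z c \<noteq> 0 \<longrightarrow> z \<in> Xhat_points B \<and> p z \<notin> C)"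
    if C: "closedin (top_of X) C" "\<not> ?S \<subseteq> C" for C
  proof -
    obtain z2 where z2: "z2 \<in> Xhat_points B" "z2 q = 0" "p z2 \<notin> C" using C(2) by blast
    have "openin (top_of X) (points X - C)" using C(1) by blast
    moreover have "z2 \<in> pre (points X - C)" using z2 p_mem unfolding pre_def by blast
    ultimately obtain c where c: "z2 \<in> Z" "z2 c \<noteq> 0" "\<forall>y\<in>Z. y c \<noteq> 0 \<longrightarrow> y \<in> pre (points X - C)"
      using open_basic[OF pre_open] by blast
    have "\<not> q dvd c" using pt_dvd[OF c(1)] z2(2) c(2) by blast
    then show ?thesis using c(3) unfolding pre_def by blast
  qed
  show "?S \<subseteq> C1 \<or> ?S \<subseteq> C2"
  proof (rule ccontr)
    assume n: "\<not> ?thesis"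
    obtain c1 where c1: "\<not> q dvd c1" "\<forall>z\<in>Z. z c1 \<noteq> 0 \<longrightarrow> z \<in> Xhat_points B \<and> p z \<notin> C1" using basic[OF C(1)] n by blast
    obtain c2 where c2: "\<not> q dvd c2" "\<forall>z\<in>Z. z c2 \<noteq> 0 \<longrightarrow> z \<in> Xhat_points B \<and> p z \<notin> C2" using basic[OF C(2)] n by blast
    have "\<not> q dvd c1 * c2" using q c1(1) c2(1) by (simp add: prime_elem_dvd_mult_iff)
    then obtain z where z: "z \<in> Z" "z q = 0" "z (c1 * c2) \<noteq> 0" using exists_pt_on_prime[OF q] by blast
    then have "z c1 \<noteq> 0" "z c2 \<noteq> 0" by auto
    then show False using c1(2) c2(2) C(3) z(1,2) by blast
  qed
qed

end

context quot_point
begin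

lemma germ_same:
  assumes "germ h q" "germ h' q"
  shows "\<exists>U. openin (top_of X) U \<and> x \<in> U \<and> (\<forall>y\<in>U. h y = h' y)"
proof -
  have "germ (h + (\<lambda>_. -1) * h') (q + Frac (\<iota> (-1)) 1 * q)"
    by (rule germ_add[OF assms(1) germ_mult[OF germ_const assms(2)]])
  moreover have "q + Frac (\<iota> (-1)) 1 * q = 0"
    by (simp add: R.str_neg Fraction_Field.One_fract_def[symmetric] flip: minus_fract)
  ultimately have "h + (\<lambda>_. -1) * h' \<in> zero_near X x" using germ_zero_iff by metis
  then obtain U where "openin (top_of X) U" "x \<in> U" "\<forall>y\<in>U. (h + (\<lambda>_. -1) * h') y = 0"
    unfolding zero_near_def by blast
  then show ?thesis by (intro exI[of _ U]) auto
qed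

lemma basic_nbhd:
  assumes "openin (top_of X) V" "x \<in> V"
  obtains c where "z0 c \<noteq> 0" "\<And>z. z \<in> Z \<Longrightarrow> z c \<noteq> 0 \<Longrightarrow> z \<in> pre V"
  using open_basic[OF pre_open[OF assms(1)] z0_pre[OF assms(2)]] by blast

section \<open>The divisor of a generator through x\<close>

definition S :: "nat \<Rightarrow> 'x set" where
  "S i = p ` {z \<in> Xhat_points B. z (f i) = 0}"

definition C :: "nat \<Rightarrow> 'x set" where
  "C i = top_of X closure_of S i"

context
  fixes i assumes i: "i < r" "i \<notin> J"
begin

lemma x_S: "x \<in> S i"
  unfolding S_def using z0_Xhat gen_zero[OF i] by blast

lemma S_sub: "S i \<subseteq> C i" "S i \<subseteq> points X"
proof -
  show *: "S i \<subseteq> points X" unfolding S_def using p_mem by blast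
  show "S i \<subseteq> C i" unfolding C_def by (rule closure_of_subset[OF *])
qed

lemma C_closed: "closedin (top_of X) (C i)"
  unfolding C_def by simp

lemma C_irreducible: "irreducible_subspace (top_of X) (C i)"
  unfolding C_def S_def
  by (rule irreducible_subspace_closure[OF irreducible_divisor_image[OF gen_prime[OF i(1)] z0_Xhat gen_zero[OF i]]])

lemma vanish_on_C:
  assumes "germ h q" "q \<in> D i"
  shows "\<exists>U. openin (top_of X) U \<and> x \<in> U \<and> (\<forall>y\<in>U \<inter> C i. h y = 0)"
proof -
  obtain e a b U where g: "e \<in> L" "a \<in> H e" "b \<in> H e" "q = Frac a b" "z0 b \<noteq> 0" "b \<noteq> 0"
    "openin (top_of X) U" "x \<in> U" "U \<subseteq> loc J" "h \<in> reg X U" "\<forall>z\<in>pre U. z b \<noteq> 0 \<and> h (p z) = z a / z b"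
    by (rule germE[OF assms(1)])
  have fa: "f i dvd a" using assms(2) unfolding g(4) D_iff[OF i g(1-3,5)] .
  have "{y \<in> U. h y \<noteq> 0} \<inter> S i = {}"
  proof (rule ccontr)
    assume "{y \<in> U. h y \<noteq> 0} \<inter> S i \<noteq> {}"
    then obtain z where z: "z \<in> Xhat_points B" "z (f i) = 0" "p z \<in> U" "h (p z) \<noteq> 0" unfolding S_def by blast
    then have zp: "z \<in> pre U" unfolding pre_def by blast
    then have "z \<in> Z" using pre_sub by blast
    from pt_dvd[OF this fa] have "z a = 0" using z(2) by blast
    then show False using g(11) zp z(4) by simp
  qed
  then have "{y \<in> U. h y \<noteq> 0} \<inter> C i = {}"
    unfolding C_def using openin_Int_closure_of_eq_empty[OF X.reg_nonzero_open[OF g(7,10)]] by blast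
  then show ?thesis using g(7,8) by blast
qed

text \<open>Together with \<open>vanish_on_C\<close> this makes \<open>D i\<close> the ideal of
  germs vanishing on the divisor. Divisibility by \<open>f i\<close> is tested at the zeros of
  \<open>f i\<close> where \<open>c\<close> does not vanish, all of which lie over the given
  neighbourhood.\<close>

lemma vanish_on_S:
  assumes "germ h q" and V: "openin (top_of X) V" "x \<in> V" and van: "\<And>y. y \<in> V \<Longrightarrow> y \<in> S i \<Longrightarrow> h y = 0"
  shows "q \<in> D i"
proof -
  obtain e a b U where g: "e \<in> L" "a \<in> H e" "b \<in> H e" "q = Frac a b" "z0 b \<noteq> 0" "b \<noteq> 0"
    "openin (top_of X) U" "x \<in> U" "U \<subseteq> loc J" "h \<in> reg X U" "\<forall>z\<in>pre U. z b \<noteq> 0 \<and> h (p z) = z a / z b"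
    by (rule germE[OF assms(1)])
  obtain c where c: "z0 c \<noteq> 0" "\<And>z. z \<in> Z \<Longrightarrow> z c \<noteq> 0 \<Longrightarrow> z \<in> pre (U \<inter> V)"
    by (rule basic_nbhd[OF openin_Int[OF g(7) V(1)]]) (use g(8) V(2) in auto)
  have "f i dvd a"
  proof (rule vanish_on_prime[OF gen_prime[OF i(1)] not_dvd_nonzero[OF gen_zero[OF i] c(1)]])
    fix z assume z: "z \<in> Z" "z (f i) = 0" "z c \<noteq> 0"
    have zU: "z \<in> Xhat_points B" "p z \<in> U" "p z \<in> V" using c(2)[OF z(1,3)] unfolding pre_def by auto
    then have "h (p z) = 0" using van z(2) unfolding S_def by blast
    moreover have "z b \<noteq> 0 \<and> h (p z) = z a / z b" by (rule bspec[OF g(11)]) (use zU in \<open>simp add: pre_def\<close>)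
    ultimately show "z a = 0" by simp
  qed
  then show ?thesis unfolding g(4) D_iff[OF i g(1-3,5)] .
qed

text \<open>A nonzero element of \<open>D i\<close> vanishes on \<open>C i\<close> near
  \<open>x\<close>.\<close>

lemma C_proper: "C i \<noteq> points X"
proof
  assume C: "C i = points X"
  obtain q where q: "q \<in> D i" "q \<noteq> 0" using D_nonzero[OF i] by blast
  obtain h where h: "germ h q" using germ_surj D_sub q(1) by blast
  obtain U where U: "openin (top_of X) U" "x \<in> U" "\<forall>y\<in>U \<inter> C i. h y = 0" using vanish_on_C[OF h q(1)] by blast
  have "\<forall>y\<in>U. h y = 0" using U(3) C openin_subset[OF U(1)] by blast
  then have "h \<in> zero_near X x" unfolding zero_near_def using U(1,2) germ_regular[OF h] by blast
  then show False using germ_zero_iff[OF h] q(2) by blast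
qed

lemma vanishing_function:
  assumes Z': "closedin (top_of X) Z'" and U: "openin (top_of X) U" "fs_affine (open_subspace X U)"
    and y: "y \<in> U" "y \<notin> Z'"
  shows "\<exists>g\<in>reg X U. g y \<noteq> 0 \<and> (\<forall>y\<in>U \<inter> Z'. g y = 0)"
proof -
  have "y \<in> points X - Z'" using y openin_subset[OF U(1)] by blast
  then obtain g where "g \<in> reg X U" "g y \<noteq> 0" "\<forall>y\<in>U - (points X - Z'). g y = 0"
    using X.affine_cut_out[OF U _ y(1)] Z' by blast
  then show ?thesis by blast
qed

text \<open>The germs at \<open>x\<close> that vanish on \<open>Z'\<close> form a prime
  \<open>I\<close> inside \<open>D i\<close>, nonzero because \<open>Z'\<close> is not all of
  \<open>X\<close>. By \<open>height_one\<close> it equals \<open>D i\<close>; yet if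
  \<open>Z'\<close> were larger than \<open>C i\<close>, some function near \<open>x\<close> would
  vanish on \<open>C i\<close> but not on \<open>Z'\<close>.\<close>

lemma C_maximal:
  assumes Z': "closedin (top_of X) Z'" "irreducible_subspace (top_of X) Z'" "C i \<subseteq> Z'" "Z' \<noteq> points X"
  shows "Z' \<subseteq> C i"
proof (rule ccontr)
  assume "\<not> Z' \<subseteq> C i"
  then obtain y0 where y0: "y0 \<in> Z'" "y0 \<notin> C i" by blast
  have xZ: "x \<in> Z'" using x_S S_sub(1) Z'(3) by blast
  have Zp: "Z' \<subseteq> points X" by (rule closedin_subset[OF Z'(1)])
  obtain U where U: "openin (top_of X) U" "x \<in> U" "fs_affine (open_subspace X U)" by (rule X.affine_nbhd[OF x_points])
  define I where "I = {q. \<exists>h V. germ h q \<and> openin (top_of X) V \<and> x \<in> V \<and> (\<forall>y\<in>V \<inter> Z'. h y = 0)}"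
  have I_near: "\<exists>V. openin (top_of X) V \<and> x \<in> V \<and> (\<forall>y\<in>V \<inter> Z'. h y = 0)" if q: "q \<in> I" and h: "germ h q" for h q
  proof -
    obtain h' V where V: "germ h' q" "openin (top_of X) V" "x \<in> V" "\<forall>y\<in>V \<inter> Z'. h' y = 0" using q unfolding I_def by blast
    obtain V' where V': "openin (top_of X) V'" "x \<in> V'" "\<forall>y\<in>V'. h y = h' y" using germ_same[OF h V(1)] by blast
    show ?thesis using V V' by (intro exI[of _ "V \<inter> V'"]) auto
  qed
  have sub: "I \<subseteq> D i"
  proof
    fix q assume "q \<in> I"
    then obtain h V where V: "germ h q" "openin (top_of X) V" "x \<in> V" "\<forall>y\<in>V \<inter> Z'. h y = 0" unfolding I_def by blast
    then show "q \<in> D i" using vanish_on_S[OF V(1-3)] S_sub(1) Z'(3) by blast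
  qed
  have "points X - Z' \<noteq> {}" using Z'(4) Zp by blast
  then have "U \<inter> (points X - Z') \<noteq> {}" using X.open_meets[OF U(1)] U(2) Z'(1) by blast
  then obtain y1 where y1: "y1 \<in> U" "y1 \<notin> Z'" by blast
  obtain g where g: "g \<in> reg X U" "g y1 \<noteq> 0" "\<forall>y\<in>U \<inter> Z'. g y = 0" using vanishing_function[OF Z'(1) U(1,3) y1] by blast
  obtain \<pi> where \<pi>: "germ g \<pi>" using germ_exists[of g] g(1) U(1,2) unfolding regular_near_def by blast
  have \<pi>I: "\<pi> \<in> I" unfolding I_def using \<pi> U(1,2) g(3) by blast
  have \<pi>0: "\<pi> \<noteq> 0"
  proof
    assume "\<pi> = 0"
    then have "g \<in> zero_near X x" using germ_zero_iff[OF \<pi>] by blast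
    then obtain V where V: "openin (top_of X) V" "x \<in> V" "\<forall>y\<in>V. g y = 0" unfolding zero_near_def by blast
    have "V \<inter> {y \<in> U. g y \<noteq> 0} \<noteq> {}"
      by (rule X.open_meets[OF V(1) X.reg_nonzero_open[OF U(1) g(1)]]) (use V(2) y1 g(2) in auto)
    then show False using V(3) by blast
  qed
  have DI: "D i \<subseteq> I"
  proof (rule height_one[OF i sub \<pi>I \<pi>0])
    fix c a assume ca: "c \<in> A" "a \<in> I"
    obtain hc where hc: "germ hc c" using germ_surj[OF ca(1)] by blast
    obtain ha V where V: "germ ha a" "openin (top_of X) V" "x \<in> V" "\<forall>y\<in>V \<inter> Z'. ha y = 0" using ca(2) unfolding I_def by blast
    show "c * a \<in> I" unfolding I_def
      using germ_mult[OF hc V(1)] V(2-4) by (intro CollectI exI[of _ "hc * ha"] exI[of _ V]) auto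
  next
    fix a b assume ab: "a \<in> A" "b \<in> A" "a * b \<in> I"
    obtain ha where ha: "germ ha a" using germ_surj[OF ab(1)] by blast
    obtain hb where hb: "germ hb b" using germ_surj[OF ab(2)] by blast
    obtain V where V: "openin (top_of X) V" "x \<in> V" "\<forall>y\<in>V \<inter> Z'. (ha * hb) y = 0"
      using I_near[OF ab(3) germ_mult[OF ha hb]] by blast
    obtain Va where Va: "openin (top_of X) Va" "x \<in> Va" "ha \<in> reg X Va" using germ_regular[OF ha] unfolding regular_near_def by blast
    obtain Vb where Vb: "openin (top_of X) Vb" "x \<in> Vb" "hb \<in> reg X Vb" using germ_regular[OF hb] unfolding regular_near_def by blast
    define W where "W = V \<inter> Va \<inter> Vb"
    have W: "openin (top_of X) W" "x \<in> W" unfolding W_def using V Va Vb by auto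
    have ra: "ha \<in> reg X W" by (rule X.reg_restrict[OF Va(1) W(1) _ Va(3)]) (auto simp: W_def)
    have rb: "hb \<in> reg X W" by (rule X.reg_restrict[OF Vb(1) W(1) _ Vb(3)]) (auto simp: W_def)
    note op = X.reg_nonzero_open[OF W(1) ra] X.reg_nonzero_open[OF W(1) rb]
    have "{y \<in> W. ha y \<noteq> 0} \<inter> {y \<in> W. hb y \<noteq> 0} \<inter> Z' = {}" using V(3) unfolding W_def by auto
    then have "{y \<in> W. ha y \<noteq> 0} \<inter> Z' = {} \<or> {y \<in> W. hb y \<noteq> 0} \<inter> Z' = {}"
      using irreducible_subspace_open_meets[OF Z'(2) op] by blast
    then show "a \<in> I \<or> b \<in> I"
    proof
      assume "{y \<in> W. ha y \<noteq> 0} \<inter> Z' = {}"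
      then have "a \<in> I" unfolding I_def using ha W by blast
      then show ?thesis ..
    next
      assume "{y \<in> W. hb y \<noteq> 0} \<inter> Z' = {}"
      then have "b \<in> I" unfolding I_def using hb W by blast
      then show ?thesis ..
    qed
  qed
  \<comment> \<open>\<open>y0\<close> may lie outside the chart \<open>U\<close>; irreducibility of
    \<open>Z'\<close> provides a replacement inside.\<close>
  have "U \<inter> (points X - C i) \<inter> Z' \<noteq> {}"
    by (rule irreducible_subspace_open_meets[OF Z'(2) U(1)]) (use C_closed U(2) xZ y0 Zp in auto)
  then obtain y2 where y2: "y2 \<in> U" "y2 \<notin> C i" "y2 \<in> Z'" by blast
  obtain g' where g': "g' \<in> reg X U" "g' y2 \<noteq> 0" "\<forall>y\<in>U \<inter> C i. g' y = 0" using vanishing_function[OF C_closed U(1,3) y2(1,2)] by blast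
  obtain q where q: "germ g' q" using germ_exists[of g'] g'(1) U(1,2) unfolding regular_near_def by blast
  have "q \<in> D i" by (rule vanish_on_S[OF q U(1,2)]) (use g'(3) S_sub(1) in blast)
  then obtain V where V: "openin (top_of X) V" "x \<in> V" "\<forall>y\<in>V \<inter> Z'. g' y = 0" using I_near[OF _ q] DI by blast
  have "V \<inter> {y \<in> U. g' y \<noteq> 0} \<inter> Z' \<noteq> {}"
    by (rule irreducible_subspace_open_meets[OF Z'(2) V(1) X.reg_nonzero_open[OF U(1) g'(1)]]) (use V(2) xZ y2 g'(2) in auto)
  then show False using V(3) by blast
qed

lemma codim_one_C: "codim_one X (C i)"
  unfolding codim_one_def irreducible_closed_def
proof (intro conjI allI impI C_closed)
  fix Z' assume Z': "(closedin (top_of X) Z' \<and> irreducible_subspace (top_of X) Z') \<and> Z' \<subseteq> C i \<and>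
    (\<forall>Z''. (closedin (top_of X) Z'' \<and> irreducible_subspace (top_of X) Z'') \<and> Z' \<subseteq> Z'' \<and> Z'' \<subseteq> C i \<longrightarrow> Z'' = Z')"
  then have eq: "Z' = C i" using C_closed C_irreducible by blast
  show "Z' \<noteq> points X" unfolding eq by (rule C_proper)
  show "\<not> (\<exists>Z''. (closedin (top_of X) Z'' \<and> irreducible_subspace (top_of X) Z'') \<and> Z' \<subset> Z'' \<and> Z'' \<subset> points X)"
    unfolding eq using C_maximal by blast
qed

text \<open>A prime \<open>\<pi>\<close> through \<open>z0\<close> dividing the cofactor
  \<open>h\<close> would make the local equation vanish over the zeros of \<open>\<pi>\<close>. Near
  \<open>x\<close> these would map into \<open>C i\<close>, so every element of \<open>D i\<close>
  would vanish there and \<open>\<pi>\<close> would divide the numerators of all fractions of degree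
  \<open>- w i\<close>, against \<open>no_common_prime\<close>.\<close>

lemma qfactorial_imp_multiple:
  assumes qf: "qfactorial_point X x"
  shows "\<exists>m::nat. m > 0 \<and> s (of_nat m) (w i) \<in> weights J"
proof -
  have wi: "w i \<in> L" "f i \<in> H (w i)" using gen_deg[OF i(1)] by auto
  have fp: "prime_elem (f i)" by (rule gen_prime[OF i(1)])
  obtain U0 g where U0: "openin (top_of X) U0" "x \<in> U0" "g \<in> reg X U0" "C i \<inter> U0 = {y \<in> U0. g y = 0}"
    using qf codim_one_C unfolding qfactorial_point_def by blast
  obtain q where q: "germ g q" using germ_exists[of g] U0 unfolding regular_near_def by blast
  have qD: "q \<in> D i" by (rule vanish_on_S[OF q U0(1,2)]) (use U0(4) S_sub(1) in blast)
  obtain e a b U where g: "e \<in> L" "a \<in> H e" "b \<in> H e" "q = Frac a b" "z0 b \<noteq> 0" "b \<noteq> 0"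
    "openin (top_of X) U" "x \<in> U" "U \<subseteq> loc J" "g \<in> reg X U" "\<forall>z\<in>pre U. z b \<noteq> 0 \<and> g (p z) = z a / z b"
    by (rule germE[OF q])
  have fa: "f i dvd a" using qD unfolding g(4) D_iff[OF i g(1-3,5)] .
  have "q \<noteq> 0"
  proof
    assume "q = 0"
    then have "g \<in> zero_near X x" using germ_zero_iff[OF q] by blast
    then obtain V where V: "openin (top_of X) V" "x \<in> V" "\<forall>y\<in>V. g y = 0" unfolding zero_near_def by blast
    have "points X - C i \<noteq> {}" using C_proper closedin_subset[OF C_closed] by blast
    then have "V \<inter> U0 \<inter> (points X - C i) \<noteq> {}"
      using X.open_meets[OF openin_Int[OF V(1) U0(1)]] V(2) U0(2) C_closed by blast
    then show False using V(3) U0(4) by blast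
  qed
  then have a0: "a \<noteq> 0" using g(4,6) by (auto simp: Frac_eq_0_iff)
  obtain m h where mh: "a = f i ^ m * h" "\<not> f i dvd h" using prime_power_split[OF fp a0] by blast
  have m: "m > 0" using fa mh by (cases m) auto
  define d where "d = s (of_nat m) (w i)"
  have d: "d \<in> L" "f i ^ m \<in> H d" unfolding d_def by (rule lat_scale_of_nat[OF wi(1)], rule H_power[OF wi])
  obtain \<delta> where \<delta>: "\<delta> \<in> L" "h \<in> H \<delta>" using dvd_homog[of h a, OF _ g(1,2) a0] unfolding mh(1) by auto
  have e: "e = d + \<delta>"
    by (rule H_unique[OF g(1) lat_add[OF d(1) \<delta>(1)] g(2) _ a0]) (use H_mult[OF d(1) \<delta>(1) d(2) \<delta>(2)] mh(1) in simp)
  have h0: "h \<noteq> 0" using a0 mh(1) by auto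
  have "z0 h \<noteq> 0"
  proof
    assume "z0 h = 0"
    then obtain \<pi> where \<pi>: "prime_elem \<pi>" "\<pi> dvd h" "z0 \<pi> = 0" using prime_zero_factor[OF h0] by blast
    show False
    proof (rule no_common_prime[OF lat_neg[OF wi(1)] i \<pi>(1,3)])
      fix e' P M assume P: "e' \<in> L" "P \<in> H (- w i + e')" "M \<in> H e'" "z0 M \<noteq> 0" "P \<noteq> 0"
      have fP: "f i * P \<in> H e'" using H_mult[OF wi(1) lat_add[OF lat_neg[OF wi(1)] P(1)] wi(2) P(2)] by simp
      have cD: "Frac (f i * P) M \<in> D i" by (rule D_mem[OF P(1) fP P(3,4)]) simp
      obtain V' hc where V': "openin (top_of X) V'" "x \<in> V'" "V' \<subseteq> loc J" "\<forall>z\<in>pre V'. z M \<noteq> 0"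
        and hc: "hc \<in> reg X V'" "\<forall>z\<in>pre V'. hc (p z) = z (f i * P) / z M"
      proof -
        obtain V' where V': "openin (top_of X) V'" "x \<in> V'" "V' \<subseteq> points X" "V' \<subseteq> loc J" "\<forall>z\<in>pre V'. z M \<noteq> 0"
          using shrink[OF P(1,3,4) openin_topspace x_points] by blast
        obtain hc where "hc \<in> reg X V'" "\<forall>z\<in>pre V'. hc (p z) = z (f i * P) / z M"
          using push_fraction[OF V'(1) P(1) fP P(3)] V'(5) by blast
        then show thesis using that V' by blast
      qed
      have "germ hc (Frac (f i * P) M)" unfolding germ_def
        using P(1,3,4) fP V' hc by blast
      then obtain V where V: "openin (top_of X) V" "x \<in> V" "\<forall>y\<in>V \<inter> C i. hc y = 0" using vanish_on_C cD by blast
      obtain c where c: "z0 c \<noteq> 0" "\<And>z. z \<in> Z \<Longrightarrow> z c \<noteq> 0 \<Longrightarrow> z \<in> pre (V \<inter> V' \<inter> (U \<inter> U0))"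
        by (rule basic_nbhd[OF openin_Int[OF openin_Int[OF V(1) V'(1)] openin_Int[OF g(7) U0(1)]]]) (use V(2) V'(2) g(8) U0(2) in auto)
      have "\<pi> dvd f i * P"
      proof (rule vanish_on_prime[OF \<pi>(1) not_dvd_nonzero[OF \<pi>(3) c(1)]])
        fix z assume z: "z \<in> Z" "z \<pi> = 0" "z c \<noteq> 0"
        have zU: "z \<in> Xhat_points B" "p z \<in> U" "p z \<in> U0" "p z \<in> V" "p z \<in> V'" using c(2)[OF z(1,3)] unfolding pre_def by auto
        have "z h = 0" by (rule pt_dvd[OF z(1) \<pi>(2) z(2)])
        then have "z a = 0" unfolding mh(1) using z(1) by simp
        moreover have "z b \<noteq> 0 \<and> g (p z) = z a / z b" by (rule bspec[OF g(11)]) (use zU in \<open>simp add: pre_def\<close>)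
        ultimately have "g (p z) = 0" by simp
        then have "p z \<in> C i" using U0(4) zU(3) by blast
        then have "hc (p z) = 0" using V(3) zU(4) by blast
        moreover have "z \<in> pre V'" using zU by (simp add: pre_def)
        ultimately show "z (f i * P) = 0" using hc(2) V'(4) by (metis divide_eq_0_iff)
      qed
      \<comment> \<open>A prime dividing both \<open>h\<close> and \<open>f i\<close> would be
        associated to \<open>f i\<close>, which does not divide \<open>h\<close>.\<close>
      moreover have "\<not> \<pi> dvd f i"
        using prime_elem_assoc[OF \<pi>(1) fp] dvd_trans[OF _ \<pi>(2)] mh(2) by blast
      ultimately show "\<pi> dvd P" using \<pi>(1) by (simp add: prime_elem_dvd_mult_iff)
    qed
  qed
  then have "e - \<delta> \<in> weights J" by (intro degree_difference[OF g(1,3,5) \<delta>])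
  then show ?thesis using m unfolding e d_def by auto
qed

end

end

context bunched
begin

section \<open>The lattice condition and the dimension condition\<close>

lemma weightsI: "d = (\<Sum>i\<in>J. s (of_int (c i)) (w i)) \<Longrightarrow> d \<in> weights J"
  unfolding weights_def by blast

text \<open>The product of the individual multipliers works for all \<open>w i\<close> at once, and
  these generate the lattice.\<close>

lemma common_multiple:
  assumes "\<forall>i<r. \<exists>m::nat. m > 0 \<and> s (of_nat m) (w i) \<in> weights J" "d \<in> L"
  shows "\<exists>m::nat. m > 0 \<and> s (of_nat m) d \<in> weights J"
proof -
  obtain m :: "nat \<Rightarrow> nat" where m: "\<And>i. i < r \<Longrightarrow> 0 < m i" "\<And>i. i < r \<Longrightarrow> s (of_nat (m i)) (w i) \<in> weights J"
    using assms(1) by metis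
  obtain c where c: "d = (\<Sum>i<r. s (of_int (c i)) (w i))" using assms(2) unfolding lat_eq_weights weights_def by blast
  define M where "M = (\<Prod>i<r. m i)"
  have term_mem: "s (of_nat M) (s (of_int (c i)) (w i)) \<in> weights J" if "i < r" for i
  proof -
    have "m i dvd M" unfolding M_def by (rule dvd_prodI) (use that in auto)
    then obtain k where k: "M = m i * k" by (rule dvdE)
    have "s (of_nat M) (s (of_int (c i)) (w i)) = s (of_int (int k * c i)) (s (of_nat (m i)) (w i))"
      unfolding k by (simp add: mult_ac)
    then show ?thesis using weights_scale[OF m(2)[OF that]] by metis
  qed
  have "(\<Sum>i\<in>I. s (of_nat M) (s (of_int (c i)) (w i))) \<in> weights J" if "I \<subseteq> {..<r}" for I
    using finite_subset[OF that finite_lessThan] that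
    by (induction I rule: finite_induct) (auto intro!: weights_add weights_0 term_mem simp del: V.scale_scale)
  then have "s (of_nat M) d \<in> weights J" unfolding c V.scale_sum_right by blast
  moreover have "M > 0" unfolding M_def using m(1) by (intro prod_pos) auto
  ultimately show ?thesis by blast
qed

lemma Qmap_span_coord_face:
  assumes J: "J \<subseteq> {..<r}"
  shows "Qmap B ` (module.span qscale (coord_face B J) \<inter> lat_E B) = weights J"
proof -
  interpret Q: vector_space qscale by (rule vector_space_qscale)
  have fin: "finite J" using J finite_subset by blast
  have span: "v i = 0" if "v \<in> Q.span (coord_face B J)" "i \<notin> J" for v i
  proof -
    have "Q.span (coord_face B J) \<subseteq> {v. v i = 0}"
      by (rule Q.span_minimal) (use that(2) in \<open>auto simp: coord_face_def qscale_def intro!: Q.subspaceI\<close>)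
    then show ?thesis using that(1) by blast
  qed
  show ?thesis
  proof (intro equalityI subsetI)
    fix d assume "d \<in> Qmap B ` (Q.span (coord_face B J) \<inter> lat_E B)"
    then obtain v where v: "v \<in> Q.span (coord_face B J)" "v \<in> lat_E B" "d = Qmap B v" by blast
    have d: "d = (\<Sum>i\<in>J. s (v i) (w i))" unfolding v(3) by (rule Qmap_eq_sum[OF J]) (use span[OF v(1)] in blast)
    have "v i = of_int \<lfloor>v i\<rfloor>" for i using v(2) unfolding lat_E_def by (auto elim: Ints_cases)
    then have "d = (\<Sum>i\<in>J. s (of_int \<lfloor>v i\<rfloor>) (w i))" unfolding d by (intro sum.cong) auto
    then show "d \<in> weights J" by (rule weightsI)
  next
    fix d assume "d \<in> weights J"
    then obtain c where c: "d = (\<Sum>i\<in>J. s (of_int (c i)) (w i))" unfolding weights_def by blast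
    define v :: "nat \<Rightarrow> rat" where "v i = (if i \<in> J then of_int (c i) else 0)" for i
    have "v = (\<Sum>i\<in>J. qscale (v i) (basis_vec i))" by (rule vec_eq_sum_basis[OF fin]) (auto simp: v_def split: if_splits)
    moreover have "(\<Sum>i\<in>J. qscale (v i) (basis_vec i)) \<in> Q.span (coord_face B J)"
      by (intro Q.span_sum Q.span_scale Q.span_base) (use J basis_vec_mem_coord_face in blast)
    ultimately have "v \<in> Q.span (coord_face B J)" by simp
    moreover have "v \<in> lat_E B" unfolding lat_E_def v_def using J by auto
    moreover have "Qmap B v = d" unfolding c
      using Qmap_eq_sum[OF J, of v] by (auto simp: v_def split: if_splits)
    ultimately show "d \<in> Qmap B ` (Q.span (coord_face B J) \<inter> lat_E B)" by blast
  qed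
qed

text \<open>Full dimension makes every \<open>w i\<close> a rational combination of the degrees over
  \<open>J\<close>, and clearing denominators turns a multiple of it into an integral one. For the
  converse, the lattice contains a basis of the space.\<close>

lemma dim_Qmap_coord_face:
  assumes J: "J \<subseteq> {..<r}"
  shows "vector_space.dim s (Qmap B ` coord_face B J) = vector_space.dim s UNIV \<longleftrightarrow>
    (\<forall>i<r. \<exists>m::nat. m > 0 \<and> s (of_nat m) (w i) \<in> weights J)"
proof -
  obtain E where E: "finite E" "\<not> V.dependent E" "V.span E = UNIV" "L = int_span s E"
    using latt unfolding lattice_in_def by blast
  interpret F: finite_dimensional_vector_space s E
    by unfold_locales (use E in auto)
  have fin: "finite J" using J finite_subset by blast
  let ?K = "cone_of s w J"
  have wK: "w j \<in> ?K" if "j \<in> J" for j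
  proof -
    have "(\<Sum>i\<in>J. s (if i = j then 1 else 0) (w i)) = (\<Sum>i\<in>J. if i = j then w i else 0)" by (rule sum.cong) auto
    then have "w j = (\<Sum>i\<in>J. s (if i = j then 1 else 0) (w i))" using fin that by simp
    then show ?thesis unfolding cone_of_def by (intro CollectI exI[of _ "\<lambda>i. if i = j then 1 else 0"]) auto
  qed
  have sub: "weights J \<subseteq> V.span ?K"
  proof
    fix d assume "d \<in> weights J"
    then obtain c where c: "d = (\<Sum>i\<in>J. s (of_int (c i)) (w i))" unfolding weights_def by blast
    show "d \<in> V.span ?K" unfolding c by (intro V.span_sum V.span_scale V.span_base wK)
  qed
  have "vector_space.dim s ?K = vector_space.dim s UNIV \<longleftrightarrow> V.span ?K = UNIV"
    using F.dim_eq_full[of ?K] unfolding F.dim_UNIV F.dimension_def .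
  also have "\<dots> \<longleftrightarrow> (\<forall>i<r. \<exists>m::nat. m > 0 \<and> s (of_nat m) (w i) \<in> weights J)"
  proof (intro iffI allI impI)
    fix i assume full: "V.span ?K = UNIV" and "i < r"
    have "V.span ?K \<subseteq> {\<Sum>j\<in>J. s (c j) (w j) | c. True}"
    proof (rule V.span_minimal)
      show "?K \<subseteq> {\<Sum>j\<in>J. s (c j) (w j) | c. True}" unfolding cone_of_def by blast
      show "V.subspace {\<Sum>j\<in>J. s (c j) (w j) | c. True}"
      proof (rule V.subspaceI)
        show "0 \<in> {\<Sum>j\<in>J. s (c j) (w j) | c. True}" by (intro CollectI exI[of _ "\<lambda>_. 0"]) simp
        show "a + b \<in> {\<Sum>j\<in>J. s (c j) (w j) | c. True}"
          if ab: "a \<in> {\<Sum>j\<in>J. s (c j) (w j) | c. True}" "b \<in> {\<Sum>j\<in>J. s (c j) (w j) | c. True}" for a b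
        proof -
          obtain c c' where "a = (\<Sum>j\<in>J. s (c j) (w j))" "b = (\<Sum>j\<in>J. s (c' j) (w j))" using ab by blast
          then have "a + b = (\<Sum>j\<in>J. s (c j + c' j) (w j))" by (simp add: V.scale_left_distrib sum.distrib)
          then show ?thesis by (intro CollectI exI[of _ "\<lambda>j. c j + c' j"]) simp
        qed
        show "s k a \<in> {\<Sum>j\<in>J. s (c j) (w j) | c. True}" if a: "a \<in> {\<Sum>j\<in>J. s (c j) (w j) | c. True}" for k a
        proof -
          obtain c where "a = (\<Sum>j\<in>J. s (c j) (w j))" using a by blast
          then have "s k a = (\<Sum>j\<in>J. s (k * c j) (w j))" by (simp add: V.scale_sum_right)
          then show ?thesis by (intro CollectI exI[of _ "\<lambda>j. k * c j"]) simp
        qed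
      qed
    qed
    then obtain c where c: "w i = (\<Sum>j\<in>J. s (c j) (w j))" using full by blast
    obtain N :: nat where N: "N > 0" "\<forall>j\<in>J. of_nat N * c j \<in> \<int>" using common_denominator[OF fin] by blast
    have "s (of_nat N) (w i) = (\<Sum>j\<in>J. s (of_nat N * c j) (w j))" unfolding c by (simp add: V.scale_sum_right)
    also have "\<dots> = (\<Sum>j\<in>J. s (of_int \<lfloor>of_nat N * c j\<rfloor>) (w j))" using N(2) by (intro sum.cong) (auto elim: Ints_cases)
    finally have "s (of_nat N) (w i) \<in> weights J" by (rule weightsI)
    then show "\<exists>m::nat. m > 0 \<and> s (of_nat m) (w i) \<in> weights J" using N(1) by blast
  next
    assume mult: "\<forall>i<r. \<exists>m::nat. m > 0 \<and> s (of_nat m) (w i) \<in> weights J"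
    have LK: "d \<in> V.span ?K" if d: "d \<in> L" for d
    proof -
      obtain m :: nat where m: "m > 0" "s (of_nat m) d \<in> weights J" using common_multiple[OF mult d] by blast
      have "s (1 / of_nat m) (s (of_nat m) d) \<in> V.span ?K" by (rule V.span_scale[OF subsetD[OF sub m(2)]])
      then show ?thesis using m(1) by simp
    qed
    have "E \<subseteq> L"
    proof
      fix x assume "x \<in> E"
      then show "x \<in> L" unfolding E(4) int_span_def
        by (intro CollectI exI[of _ "{x}"] exI[of _ "\<lambda>_. 1"]) simp
    qed
    then have "E \<subseteq> V.span ?K" using LK by (intro subsetI) blast
    then have "V.span E \<subseteq> V.span ?K" by (intro V.span_minimal V.subspace_span)
    then show "V.span ?K = UNIV" using E(3) by blast
  qed
  finally show ?thesis unfolding Qmap_coord_face[OF J] .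
qed

end

context quot_point
begin

text \<open>Some positive multiple of \<open>d\<close> is the degree of a Laurent monomial over
  \<open>J\<close>, a unit on the locus of \<open>J\<close>. Dividing the corresponding power of
  \<open>q\<close> by it gives degree 0 and leaves the zeros unchanged, so one equation serves all
  of \<open>loc J\<close>.\<close>

lemma divisor_equation:
  assumes mult: "\<forall>i<r. \<exists>m::nat. m > 0 \<and> s (of_nat m) (w i) \<in> weights J" and q: "d \<in> L" "q \<in> H d"
  shows "\<exists>h\<in>reg X (loc J). \<forall>z\<in>pre (loc J). h (p z) = 0 \<longleftrightarrow> z q = 0"
proof -
  obtain m :: nat where m: "m > 0" "s (of_nat m) d \<in> weights J" using common_multiple[OF mult q(1)] by blast
  define d' where "d' = s (of_nat m) d"
  have d': "d' \<in> L" "q ^ m \<in> H d'" unfolding d'_def by (rule lat_scale_of_nat[OF q(1)], rule H_power[OF q])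
  obtain e k l where e: "e \<in> L" "(\<Prod>i\<in>J. f i ^ k i) \<in> H (- d' + e)" "(\<Prod>i\<in>J. f i ^ l i) \<in> H e"
    using monomial_fraction[OF nzset_sub weights_neg[OF m(2)]] unfolding d'_def by blast
  have nz: "z (\<Prod>i\<in>J. f i ^ n i) \<noteq> 0" if "z \<in> pre (loc J)" for z and n :: "nat \<Rightarrow> nat"
  proof -
    have z: "z \<in> Z" "J \<subseteq> nzset z" using that unfolding pre_loc[OF rel] by auto
    then have "z (f i) \<noteq> 0" if "i \<in> J" for i using that unfolding nzset_def by blast
    then show ?thesis unfolding pt_prod[OF z(1)] using z(1) by simp
  qed
  have "q ^ m * (\<Prod>i\<in>J. f i ^ k i) \<in> H e"
    using H_mult[OF d'(1) lat_add[OF lat_neg[OF d'(1)] e(1)] d'(2) e(2)] by simp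
  then obtain h where h: "h \<in> reg X (loc J)"
    "\<forall>z\<in>pre (loc J). h (p z) = z (q ^ m * (\<Prod>i\<in>J. f i ^ k i)) / z (\<Prod>i\<in>J. f i ^ l i)"
    using push_fraction[OF loc_open[OF rel] e(1) _ e(3)] nz by blast
  have "h (p z) = 0 \<longleftrightarrow> z q = 0" if z: "z \<in> pre (loc J)" for z
  proof -
    have "z \<in> Z" using z pre_sub by blast
    then show ?thesis using bspec[OF h(2) z] nz[OF z] m(1) by simp
  qed
  then show ?thesis using h(1) by blast
qed

text \<open>Some nonzero \<open>g\<close> near \<open>x\<close> vanishes on \<open>A\<close>, and
  the prime factors of its numerator define finitely many closed sets \<open>Cq q\<close> that cover
  \<open>A\<close> near \<open>x\<close>. A component of \<open>A\<close> meeting the neighbourhood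
  lies in one of them and, having codimension one, equals it. So the product of the equations of
  those \<open>Cq q\<close> contained in \<open>A\<close> cuts out \<open>A\<close>.\<close>

lemma multiple_imp_qfactorial:
  assumes mult: "\<forall>i<r. \<exists>m::nat. m > 0 \<and> s (of_nat m) (w i) \<in> weights J"
  shows "qfactorial_point X x"
  unfolding qfactorial_point_def
proof (intro conjI allI impI normal)
  fix A assume cod: "codim_one X A"
  then have Acl: "closedin (top_of X) A" unfolding codim_one_def by blast
  have Ap: "A \<subseteq> points X" by (rule closedin_subset[OF Acl])
  have comp: "Z' \<noteq> points X \<and> \<not> (\<exists>Z''. irreducible_closed X Z'' \<and> Z' \<subset> Z'' \<and> Z'' \<subset> points X)"
    if "irreducible_closed X Z'" "Z' \<subseteq> A" "\<And>Z''. irreducible_closed X Z'' \<Longrightarrow> Z' \<subseteq> Z'' \<Longrightarrow> Z'' \<subseteq> A \<Longrightarrow> Z'' = Z'" for Z'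
    using cod that unfolding codim_one_def by blast
  show "\<exists>U. openin (top_of X) U \<and> x \<in> U \<and> (\<exists>g\<in>reg X U. A \<inter> U = {y \<in> U. g y = 0})"
  proof (cases "x \<in> A")
    case False
    have op: "openin (top_of X) (points X - A)" using Acl by blast
    show ?thesis
    proof (intro exI conjI bexI)
      show "openin (top_of X) (points X - A)" by (rule op)
      show "x \<in> points X - A" using False x_points by blast
      show "(\<lambda>_. 1) \<in> reg X (points X - A)" by (rule X.reg_const[OF op])
      show "A \<inter> (points X - A) = {y \<in> points X - A. (1::'k) = 0}" by auto
    qed
  next
    case True
    \<comment> \<open>Otherwise \<open>X\<close> itself would be a component of \<open>A\<close>,
      which \<open>codim_one\<close> excludes.\<close>
    have "A \<noteq> points X"
    proof
      assume A: "A = points X"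
      have "irreducible_closed X A" unfolding irreducible_closed_def A using X.irr by simp
      then show False using comp[of A] A unfolding irreducible_closed_def by blast
    qed
    then have "points X - A \<noteq> {}" using Ap by blast
    obtain U where U: "openin (top_of X) U" "x \<in> U" "fs_affine (open_subspace X U)" by (rule X.affine_nbhd[OF x_points])
    obtain y1 where y1: "y1 \<in> U" "y1 \<notin> A"
      using X.open_meets[OF U(1), of "points X - A"] U(2) Acl \<open>points X - A \<noteq> {}\<close> by blast
    then have "y1 \<in> points X - A" using openin_subset[OF U(1)] by blast
    then obtain g where g: "g \<in> reg X U" "g y1 \<noteq> 0" "\<forall>y\<in>U - (points X - A). g y = 0"
      using X.affine_cut_out[OF U(1,3) _ y1(1)] Acl by blast
    have gA: "g y = 0" if "y \<in> U" "y \<in> A" for y using g(3) that by blast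
    obtain q0 where q0: "germ g q0" using germ_exists[of g] g(1) U(1,2) unfolding regular_near_def by blast
    obtain e a b U1 where ab: "e \<in> L" "a \<in> H e" "b \<in> H e" "q0 = Frac a b" "z0 b \<noteq> 0" "b \<noteq> 0"
      "openin (top_of X) U1" "x \<in> U1" "U1 \<subseteq> loc J" "g \<in> reg X U1" "\<forall>z\<in>pre U1. z b \<noteq> 0 \<and> g (p z) = z a / z b"
      by (rule germE[OF q0])
    have "q0 \<noteq> 0"
    proof
      assume "q0 = 0"
      then have "g \<in> zero_near X x" using germ_zero_iff[OF q0] by blast
      then obtain V where V: "openin (top_of X) V" "x \<in> V" "\<forall>y\<in>V. g y = 0" unfolding zero_near_def by blast
      have "V \<inter> {y \<in> U. g y \<noteq> 0} \<noteq> {}"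
        by (rule X.open_meets[OF V(1) X.reg_nonzero_open[OF U(1) g(1)]]) (use V(2) y1 g(2) in auto)
      then show False using V(3) by blast
    qed
    then have a0: "a \<noteq> 0" using ab(4,6) by (auto simp: Frac_eq_0_iff)
    obtain u qs where uq: "u dvd 1" "\<forall>q\<in>set qs. prime_elem q" "a = u * prod_list qs" using prime_list[OF a0] by blast
    have "\<exists>h\<in>reg X (loc J). \<forall>z\<in>pre (loc J). h (p z) = 0 \<longleftrightarrow> z q = 0" if q: "q \<in> set qs" for q
    proof -
      have "q dvd a" unfolding uq(3) using mem_dvd_prod_list[OF q] by simp
      then obtain d where "d \<in> L" "q \<in> H d" using dvd_homog[OF _ ab(1,2) a0] by blast
      then show ?thesis by (rule divisor_equation[OF mult])
    qed
    then obtain h where h: "\<And>q. q \<in> set qs \<Longrightarrow> h q \<in> reg X (loc J)"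
      "\<And>q z. q \<in> set qs \<Longrightarrow> z \<in> pre (loc J) \<Longrightarrow> h q (p z) = 0 \<longleftrightarrow> z q = 0"
      by metis
    define Sq where "Sq q = p ` {z \<in> Xhat_points B. z q = 0}" for q
    define Cq where "Cq q = top_of X closure_of Sq q" for q
    have Sp: "Sq q \<subseteq> points X" for q unfolding Sq_def using p_mem by blast
    have SC: "Sq q \<subseteq> Cq q" for q unfolding Cq_def by (rule closure_of_subset[OF Sp])
    have S_h: "h q y = 0 \<longleftrightarrow> y \<in> Sq q" if q: "q \<in> set qs" and y: "y \<in> loc J" for q y
    proof
      have "y \<in> points X" using openin_subset[OF loc_open[OF rel]] y by blast
      then obtain z where z: "z \<in> pre (loc J)" "p z = y" using pre_surj y by blast
      assume "h q y = 0"
      then have "z q = 0" using h(2)[OF q z(1)] z(2) by simp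
      then show "y \<in> Sq q" unfolding Sq_def using z pre_sub by blast
    next
      assume "y \<in> Sq q"
      then obtain z where z: "z \<in> Xhat_points B" "z q = 0" "p z = y" unfolding Sq_def by blast
      then have "z \<in> pre (loc J)" using y unfolding pre_def by blast
      then show "h q y = 0" using h(2)[OF q] z by blast
    qed
    \<comment> \<open>On \<open>loc J\<close> the image \<open>Sq q\<close> is already closed, being
      the zero set of the regular function \<open>h q\<close>.\<close>
    have C_S: "y \<in> Sq q" if q: "q \<in> set qs" and y: "y \<in> loc J" "y \<in> Cq q" for q y
    proof (rule ccontr)
      assume "y \<notin> Sq q"
      then have "y \<in> {y \<in> loc J. h q y \<noteq> 0}" using S_h[OF q y(1)] y(1) by blast
      moreover have "{y \<in> loc J. h q y \<noteq> 0} \<inter> Sq q = {}" using S_h[OF q] by blast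
      then have "{y \<in> loc J. h q y \<noteq> 0} \<inter> Cq q = {}" unfolding Cq_def
        using openin_Int_closure_of_eq_empty[OF X.reg_nonzero_open[OF loc_open[OF rel] h(1)[OF q]]] by blast
      ultimately show False using y(2) by blast
    qed
    have C_proper: "Cq q \<noteq> points X" if q: "q \<in> set qs" for q
    proof
      assume C: "Cq q = points X"
      have "z q = 0" if z: "z \<in> pre (loc J)" for z
      proof -
        have "p z \<in> loc J" "p z \<in> Cq q" using z pre_sub p_mem C unfolding pre_def by auto
        then have "h q (p z) = 0" using C_S[OF q] S_h[OF q] by blast
        then show ?thesis using h(2)[OF q z] by blast
      qed
      then have "q = 0" by (rule pre_nonempty_dense[OF loc_open[OF rel] x_loc])
      then show False using uq(2) q by (auto simp: prime_elem_def)
    qed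
    define W where "W = U \<inter> U1"
    have W: "openin (top_of X) W" "x \<in> W" "W \<subseteq> loc J" unfolding W_def using U(1,2) ab(7-9) by auto
    have g_S: "\<exists>q\<in>set qs. y \<in> Sq q" if y: "y \<in> W" "g y = 0" for y
    proof -
      have "y \<in> points X" using openin_subset[OF W(1)] y(1) by blast
      then obtain z where z: "z \<in> pre U1" "p z = y" using pre_surj y(1) unfolding W_def by blast
      have zZ: "z \<in> Xhat_points B" "z \<in> Z" using z(1) pre_sub by auto
      have "z a = 0" using bspec[OF ab(11) z(1)] z(2) y(2) by auto
      then have "prod_list (map z qs) = 0" using pt_unit[OF zZ(2) uq(1)] unfolding uq(3) by (simp add: zZ(2) pt_prod_list[OF zZ(2)])
      then have "0 \<in> set (map z qs)" by (simp add: prod_list_zero_iff)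
      then obtain q where q: "q \<in> set qs" "z q = 0" by auto
      then show ?thesis unfolding Sq_def using z(2) zZ(1) by blast
    qed
    define Q where "Q = {q \<in> set qs. Cq q \<subseteq> A}"
    obtain g' where g': "g' \<in> reg X (loc J)" "\<forall>y\<in>loc J. g' y = 0 \<longleftrightarrow> (\<exists>q\<in>Q. h q y = 0)"
      using X.reg_finite_prod[OF loc_open[OF rel], of Q h] h(1) unfolding Q_def by auto
    have "\<exists>q\<in>Q. h q y = 0" if y: "y \<in> A" "y \<in> W" for y
    proof -
      obtain Z' where Z': "closedin (top_of X) Z'" "irreducible_subspace (top_of X) Z'" "y \<in> Z'" "Z' \<subseteq> A"
        "\<And>Z''. irreducible_subspace (top_of X) Z'' \<Longrightarrow> Z' \<subseteq> Z'' \<Longrightarrow> Z'' \<subseteq> A \<Longrightarrow> Z'' = Z'"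
        using maximal_irreducible_closed[OF Acl y(1)] by metis
      have Zc: "\<not> (\<exists>Z''. irreducible_closed X Z'' \<and> Z' \<subset> Z'' \<and> Z'' \<subset> points X)"
        using comp[of Z'] Z' unfolding irreducible_closed_def by blast
      \<comment> \<open>The closed complement of \<open>W\<close> joins the cover, since the sets
        \<open>Cq q\<close> are known to cover \<open>Z'\<close> only inside \<open>W\<close>; it
        does not contain \<open>Z'\<close>, because \<open>y\<close> lies in
        \<open>W\<close>.\<close>
      have "Z' \<subseteq> \<Union>(insert (points X - W) (Cq ` set qs))"
      proof
        fix y' assume y': "y' \<in> Z'"
        show "y' \<in> \<Union>(insert (points X - W) (Cq ` set qs))"
        proof (cases "y' \<in> W")
          case True
          then have "g y' = 0" using gA Z'(4) y' unfolding W_def by blast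
          then show ?thesis using g_S[OF True] SC by blast
        next
          case False
          then show ?thesis using closedin_subset[OF Z'(1)] y' by blast
        qed
      qed
      moreover have "closedin (top_of X) C'" if "C' \<in> insert (points X - W) (Cq ` set qs)" for C'
        using that W(1) unfolding Cq_def by auto
      ultimately have "\<exists>C'\<in>insert (points X - W) (Cq ` set qs). Z' \<subseteq> C'"
        by (intro irreducible_subspace_finite_Union[OF _ Z'(2)]) auto
      then obtain q where q: "q \<in> set qs" "Z' \<subseteq> Cq q" using Z'(3) y(2) by auto
      have "Sq q \<noteq> {}" using q(2) Z'(3) unfolding Cq_def by (metis closure_of_empty empty_iff subset_eq)
      then obtain z1 where "z1 \<in> Xhat_points B" "z1 q = 0" unfolding Sq_def by blast
      from irreducible_divisor_image[OF bspec[OF uq(2) q(1)] this]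
      have "irreducible_closed X (Cq q)" unfolding irreducible_closed_def Cq_def Sq_def
        by (simp add: irreducible_subspace_closure)
      moreover have "Cq q \<subset> points X" using C_proper[OF q(1)] closure_of_subset_topspace[of "top_of X" "Sq q"] unfolding Cq_def by blast
      ultimately have eq: "Cq q = Z'" using Zc q(2) by blast
      have yl: "y \<in> loc J" using W(3) y(2) by blast
      have "y \<in> Sq q" by (rule C_S[OF q(1) yl]) (use eq Z'(3) in blast)
      then have "h q y = 0" using S_h[OF q(1) yl] by blast
      moreover have "q \<in> Q" unfolding Q_def using q(1) eq Z'(4) by blast
      ultimately show ?thesis by blast
    qed
    moreover have "y \<in> A" if y: "y \<in> W" "q \<in> Q" "h q y = 0" for y q
    proof -
      have "q \<in> set qs" "Cq q \<subseteq> A" using y(2) unfolding Q_def by auto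
      then show ?thesis using S_h[of q y] SC[of q] y(1,3) W(3) by blast
    qed
    ultimately have "A \<inter> W = {y \<in> W. g' y = 0}" using g'(2) W(3) by blast
    moreover have "g' \<in> reg X W" by (rule X.reg_restrict[OF loc_open[OF rel] W(1,3) g'(1)])
    ultimately show ?thesis using W(1,2) by blast
  qed
qed

lemma qfactorial_iff:
  "qfactorial_point X x \<longleftrightarrow> (\<forall>i<r. \<exists>m::nat. m > 0 \<and> s (of_nat m) (w i) \<in> weights J)"
proof (intro iffI allI impI)
  fix i assume qf: "qfactorial_point X x" and i: "i < r"
  show "\<exists>m::nat. m > 0 \<and> s (of_nat m) (w i) \<in> weights J"
  proof (cases "i \<in> J")
    case True
    then show ?thesis using weights_gen[OF True] by (intro exI[of _ 1]) simp
  next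
    case False
    then show ?thesis by (rule qfactorial_imp_multiple[OF i _ qf])
  qed
qed (rule multiple_imp_qfactorial, blast)

end

theorem corollary5p4:
  fixes B :: "('k::{alg_closed_field, field_char_0}, 'r::idom, 'v::ab_group_add) bunch_data"
    and X :: "('x, 'k) fspace"
    and p :: "('r \<Rightarrow> 'k) \<Rightarrow> 'x"
    and \<gamma>0 :: "(nat \<Rightarrow> rat) set"
    and x :: 'x
  assumes "bunched_ring B"
    and "good_quotient B X p"
    and "\<gamma>0 \<in> rlv B"
    and "x \<in> stratum B p \<gamma>0"
  shows "(factorial_point X x \<longleftrightarrow> Qmap B ` (module.span qscale \<gamma>0 \<inter> lat_E B) = lat B) \<and>
         (qfactorial_point X x \<longleftrightarrow>
            vector_space.dim (scl B) (Qmap B ` \<gamma>0) = vector_space.dim (scl B) UNIV)"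
proof -
  interpret good_quot B X p
    by (intro good_quot.intro bunched.intro good_quot_axioms.intro assms)
  obtain J where J: "relevant J" "\<gamma>0 = coord_face B J" using assms(3) unfolding rlv_eq by blast
  obtain z0 where z0: "z0 \<in> alg_homs (emb B)" "p z0 = x" "nzset z0 = J"
    using special_point[OF J(1) assms(4)[unfolded J(2)]] by blast
  note z0x = z0(2,3)
  interpret quot_point B X p z0
    by (intro quot_point.intro quot_point_axioms.intro good_quot_axioms) (use z0 J(1) in auto)
  show ?thesis
    using factorial_iff qfactorial_iff relevant_sub[OF J(1)]
    unfolding J(2) z0x by (simp add: Qmap_span_coord_face dim_Qmap_coord_face)
qed

end
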